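(* Let $R$ be a commutative noetherian ring, $M$ a finitely generated $R$-module, and $\mathfrak{p}$ a prime ideal of $R$. Then there exists an element $s\in R\setminus\mathfrak{p}$ such that $sH_I^i(M)=0$ for all ideals $I$ of $R$ and all integers $i<\operatorname{grade}(I,R)-\operatorname{Rfd}_{R_\mathfrak{p}}M_\mathfrak{p}$.
   Context: $H_I^i(-)$ is the $i$-th local cohomology functor with support in $I$. $\operatorname{grade}(I,R)$ is the grade of the ideal $I$ (length of a maximal $R$-regular sequence in $I$), equal to $\infty$ if $I=R$; the zero module over a local ring has depth $\infty$. The large restricted flat dimension of a finitely generated module $N$ over a noetherian ring $S$ is $\operatorname{Rfd}_SN=\sup_{\mathfrak{q}\in\operatorname{Spec}S}\{\operatorname{depth}S_\mathfrak{q}-\operatorname{depth}N_\mathfrak{q}\}$; it is known to lie in $\mathbb{N}\cup\{-\infty\}$, and it equals $-\infty$ if and only if $N=0$. In particular $\operatorname{Rfd}_{R_\mathfrak{p}}M_\mathfrak{p}=\sup\{\operatorname{depth}R_\mathfrak{q}-\operatorname{depth}M_\mathfrak{q}\mid \mathfrak{q}\in\operatorname{Spec}R,\ \mathfrak{q}\subseteq\mathfrak{p}\}$. When $\operatorname{Rfd}_{R_\mathfrak{p}}M_\mathfrak{p}=-\infty$, the quantity $-(-\infty)$ is interpreted as $\infty$ (so the condition on $i$ is vacuous and all integers $i$ are allowed). *)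

theory Defs
  imports "HOL-Algebra.Ideal_Product" "HOL-Algebra.Ring_Divisibility" "HOL-Algebra.Module"
    "HOL-Library.Extended_Real"
begin

text \<open>
  A module in HOL-Algebra is a record that also carries the unused fields \<open>mult\<close> and \<open>one\<close>;
  they are left \<open>undefined\<close> in quotients and localizations of modules.
\<close>

section \<open>Modules\<close>

definition self_module :: "('r, 'x) ring_scheme \<Rightarrow> ('r, 'r) module" where
  "self_module R = \<lparr>carrier = carrier R, monoid.mult = monoid.mult R, one = \<one>\<^bsub>R\<^esub>,
     zero = \<zero>\<^bsub>R\<^esub>, add = add R, smult = monoid.mult R\<rparr>"

definition fin_gen_module :: "('r, 'x) ring_scheme \<Rightarrow> ('r, 'm, 'y) module_scheme \<Rightarrow> bool" where
  "fin_gen_module R M \<longleftrightarrow> module R M \<and>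
     (\<exists>A. finite A \<and> A \<subseteq> carrier M \<and>
        carrier M = {\<Oplus>\<^bsub>M\<^esub> a\<in>A. c a \<odot>\<^bsub>M\<^esub> a | c. c \<in> A \<rightarrow> carrier R})"

definition mod_hom ::
  "('r, 'x) ring_scheme \<Rightarrow> ('r, 'm, 'y) module_scheme \<Rightarrow> ('r, 'n, 'z) module_scheme \<Rightarrow> ('m \<Rightarrow> 'n) set"
where
  "mod_hom R M N = {f. f \<in> carrier M \<rightarrow> carrier N \<and>
     (\<forall>x\<in>carrier M. \<forall>y\<in>carrier M. f (x \<oplus>\<^bsub>M\<^esub> y) = f x \<oplus>\<^bsub>N\<^esub> f y) \<and>
     (\<forall>a\<in>carrier R. \<forall>x\<in>carrier M. f (a \<odot>\<^bsub>M\<^esub> x) = a \<odot>\<^bsub>N\<^esub> f x)}"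

definition quot_module :: "('r, 'm, 'y) module_scheme \<Rightarrow> 'm set \<Rightarrow> ('r, 'm set) module" where
  "quot_module M N = \<lparr>carrier = a_rcosets\<^bsub>M\<^esub> N, monoid.mult = undefined, one = undefined,
     zero = N, add = set_add M, smult = (\<lambda>a X. \<Union>x\<in>X. N +>\<^bsub>M\<^esub> (a \<odot>\<^bsub>M\<^esub> x))\<rparr>"


section \<open>Localization\<close>

text \<open>The equivalence relation on pairs (m, s), which stand for the fractions m/s.\<close>

definition frac_rel ::
  "('r, 'm, 'y) module_scheme \<Rightarrow> 'r set \<Rightarrow> (('m \<times> 'r) \<times> ('m \<times> 'r)) set" where
  "frac_rel M S = {((m, s), (n, t)). m \<in> carrier M \<and> n \<in> carrier M \<and> s \<in> S \<and> t \<in> S \<and>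
     (\<exists>u\<in>S. u \<odot>\<^bsub>M\<^esub> (t \<odot>\<^bsub>M\<^esub> m) = u \<odot>\<^bsub>M\<^esub> (s \<odot>\<^bsub>M\<^esub> n))}"

definition loc_frac :: "('r, 'm, 'y) module_scheme \<Rightarrow> 'r set \<Rightarrow> 'm \<Rightarrow> 'r \<Rightarrow> ('m \<times> 'r) set" where
  "loc_frac M S m s = frac_rel M S `` {(m, s)}"

definition loc_module ::
  "('r, 'x) ring_scheme \<Rightarrow> 'r set \<Rightarrow> ('r, 'm, 'y) module_scheme
    \<Rightarrow> (('r \<times> 'r) set, ('m \<times> 'r) set) module" where
  "loc_module R S M = \<lparr>
     carrier = (carrier M \<times> S) // frac_rel M S,
     monoid.mult = undefined, one = undefined,
     zero = loc_frac M S \<zero>\<^bsub>M\<^esub> \<one>\<^bsub>R\<^esub>,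
     add = (\<lambda>X Y. \<Union>(m, s)\<in>X. \<Union>(n, t)\<in>Y.
              loc_frac M S (t \<odot>\<^bsub>M\<^esub> m \<oplus>\<^bsub>M\<^esub> s \<odot>\<^bsub>M\<^esub> n) (s \<otimes>\<^bsub>R\<^esub> t)),
     smult = (\<lambda>A X. \<Union>(a, s)\<in>A. \<Union>(m, t)\<in>X. loc_frac M S (a \<odot>\<^bsub>M\<^esub> m) (s \<otimes>\<^bsub>R\<^esub> t))\<rparr>"

definition loc_ring :: "('r, 'x) ring_scheme \<Rightarrow> 'r set \<Rightarrow> ('r \<times> 'r) set ring" where
  "loc_ring R S = (let L = loc_module R S (self_module R) in
     \<lparr>carrier = carrier L, monoid.mult = smult L, one = loc_frac (self_module R) S \<one>\<^bsub>R\<^esub> \<one>\<^bsub>R\<^esub>,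
      zero = \<zero>\<^bsub>L\<^esub>, add = add L\<rparr>)"

abbreviation ring_at :: "('r, 'x) ring_scheme \<Rightarrow> 'r set \<Rightarrow> ('r \<times> 'r) set ring" where
  "ring_at R q \<equiv> loc_ring R (carrier R - q)"

abbreviation module_at ::
  "('r, 'x) ring_scheme \<Rightarrow> 'r set \<Rightarrow> ('r, 'm, 'y) module_scheme
    \<Rightarrow> (('r \<times> 'r) set, ('m \<times> 'r) set) module" where
  "module_at R q M \<equiv> loc_module R (carrier R - q) M"


section \<open>Regular sequences, grade, depth, large restricted flat dimension\<close>

text \<open>The submodule \<open>(x\<^sub>1, \<dots>, x\<^sub>n) M\<close> of \<open>M\<close>.\<close>

definition seq_smult ::
  "('r, 'm, 'y) module_scheme \<Rightarrow> 'r list \<Rightarrow> 'm set" where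
  "seq_smult M xs = {\<Oplus>\<^bsub>M\<^esub> j\<in>{..<length xs}. (xs ! j) \<odot>\<^bsub>M\<^esub> m j | m.
     m \<in> {..<length xs} \<rightarrow> carrier M}"

text \<open>Each entry is a nonzerodivisor on the quotient of \<open>M\<close> by the preceding ones, and
  \<open>M / (xs) M\<close> is nonzero.\<close>

definition regular_sequence ::
  "('r, 'x) ring_scheme \<Rightarrow> ('r, 'm, 'y) module_scheme \<Rightarrow> 'r list \<Rightarrow> bool" where
  "regular_sequence R M xs \<longleftrightarrow> set xs \<subseteq> carrier R \<and> seq_smult M xs \<noteq> carrier M \<and>
     (\<forall>k<length xs. \<forall>m\<in>carrier M.
        (xs ! k) \<odot>\<^bsub>M\<^esub> m \<in> seq_smult M (take k xs) \<longrightarrow> m \<in> seq_smult M (take k xs))"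

text \<open>For a finitely generated module \<open>M\<close> over a noetherian ring with \<open>I M \<noteq> M\<close>, all maximal
  \<open>M\<close>-regular sequences in \<open>I\<close> have the same finite length, which is the supremum below.\<close>

definition regular_length ::
  "'r set \<Rightarrow> ('r, 'x) ring_scheme \<Rightarrow> ('r, 'm, 'y) module_scheme \<Rightarrow> enat" where
  "regular_length I R M =
     (SUP xs\<in>{xs. regular_sequence R M xs \<and> set xs \<subseteq> I}. enat (length xs))"

definition grade :: "'r set \<Rightarrow> ('r, 'x) ring_scheme \<Rightarrow> enat" where
  "grade I R = (if I = carrier R then \<infinity> else regular_length I R (self_module R))"

text \<open>Only meant for local rings \<open>S\<close>, where the maximal ideal is unique.\<close>

definition depth :: "('s, 'x) ring_scheme \<Rightarrow> ('s, 'm, 'y) module_scheme \<Rightarrow> enat" where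
  "depth S N = (if carrier N = {\<zero>\<^bsub>N\<^esub>} then \<infinity>
     else regular_length (THE n. maximalideal n S) S N)"

text \<open>Over a noetherian ring the minuend below is finite, so \<open>\<infinity> - \<infinity>\<close> does not occur.
  The supremum is \<open>-\<infinity>\<close> if all differences are, that is, if \<open>N = 0\<close>.\<close>

definition Rfd :: "('s, 'x) ring_scheme \<Rightarrow> ('s, 'm, 'y) module_scheme \<Rightarrow> ereal" where
  "Rfd S N = (SUP q\<in>{q. primeideal q S}.
     ereal_of_enat (depth (ring_at S q) (self_module (ring_at S q)))
     - ereal_of_enat (depth (ring_at S q) (module_at S q N)))"


section \<open>Local cohomology\<close>

text \<open>HOL cannot quantify over types, so the extension property is required for test modules \<open>L\<close>
  whose carrier lies in the type \<open>'r\<close> of the ring elements. This includes \<open>R\<close> itself, so by Baer's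
  criterion it implies the extension property for test modules of every type.\<close>

definition injective_module ::
  "('r, 'x) ring_scheme \<Rightarrow> ('r, 'e, 'y) module_scheme \<Rightarrow> bool" where
  "injective_module R E \<longleftrightarrow> module R E \<and>
     (\<forall>(L :: ('r, 'r) module) N f.
        module R L \<and> submodule N R L \<and> f \<in> mod_hom R (L\<lparr>carrier := N\<rparr>) E \<longrightarrow>
        (\<exists>g\<in>mod_hom R L E. \<forall>x\<in>N. g x = f x))"

text \<open>Exactness of \<open>0 \<rightarrow> M \<rightarrow> E\<^sup>0 \<rightarrow> E\<^sup>1 \<rightarrow> \<dots>\<close>, with augmentation \<open>\<epsilon>\<close> and differentials
  \<open>d i : E i \<rightarrow> E (i + 1)\<close>. The complex is indexed by all integers, with \<open>E i = 0\<close> for \<open>i < 0\<close>.\<close>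

definition injective_resolution ::
  "('r, 'x) ring_scheme \<Rightarrow> ('r, 'm, 'y) module_scheme \<Rightarrow> (int \<Rightarrow> ('r, 'e) module)
    \<Rightarrow> (int \<Rightarrow> 'e \<Rightarrow> 'e) \<Rightarrow> ('m \<Rightarrow> 'e) \<Rightarrow> bool" where
  "injective_resolution R M E d \<epsilon> \<longleftrightarrow>
     (\<forall>i. injective_module R (E i)) \<and>
     (\<forall>i<0. carrier (E i) = {\<zero>\<^bsub>E i\<^esub>}) \<and>
     (\<forall>i. d i \<in> mod_hom R (E i) (E (i + 1))) \<and>
     \<epsilon> \<in> mod_hom R M (E 0) \<and> inj_on \<epsilon> (carrier M) \<and>
     \<epsilon> ` carrier M = a_kernel (E 0) (E 1) (d 0) \<and>
     (\<forall>i\<ge>0. d i ` carrier (E i) = a_kernel (E (i + 1)) (E (i + 2)) (d (i + 1)))"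

definition cohomology ::
  "(int \<Rightarrow> ('r, 'e) module) \<Rightarrow> (int \<Rightarrow> 'e \<Rightarrow> 'e) \<Rightarrow> int \<Rightarrow> ('r, 'e set) module" where
  "cohomology C d i =
     quot_module ((C i)\<lparr>carrier := a_kernel (C i) (C (i + 1)) (d i)\<rparr>)
       (d (i - 1) ` carrier (C (i - 1)))"

primrec ideal_power :: "('r, 'x) ring_scheme \<Rightarrow> 'r set \<Rightarrow> nat \<Rightarrow> 'r set" where
  "ideal_power R I 0 = carrier R"
| "ideal_power R I (Suc n) = ideal_prod R I (ideal_power R I n)"

definition torsion ::
  "('r, 'x) ring_scheme \<Rightarrow> 'r set \<Rightarrow> ('r, 'm) module \<Rightarrow> ('r, 'm) module" where
  "torsion R I M =
     M\<lparr>carrier := {x \<in> carrier M. \<exists>n. \<forall>a\<in>ideal_power R I n. a \<odot>\<^bsub>M\<^esub> x = \<zero>\<^bsub>M\<^esub>}\<rparr>"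

text \<open>\<open>H\<close> is an \<open>i\<close>-th local cohomology module of \<open>M\<close> with support in \<open>I\<close>, that is, the value at \<open>M\<close>
  of the \<open>i\<close>-th right derived functor of the \<open>I\<close>-torsion functor, computed from some injective
  resolution with terms in the type \<open>'e\<close>. Up to isomorphism \<open>H\<close> does not depend on the resolution.
  If \<open>R\<close> is noetherian, a module of cardinality at most \<open>\<kappa>\<close>, for \<open>\<kappa>\<close> infinite and at least the
  cardinality of \<open>R\<close>, embeds into an injective module of cardinality at most \<open>\<kappa>\<close>
  (iterate countably often the adjunction of extensions of homomorphisms from the ideals, all of
  which are finitely generated). So resolutions exist as soon as \<open>'e\<close> is large enough, for
  instance for \<open>'e = 'r \<times> 'm \<times> nat\<close>.\<close>

definition is_local_cohomology ::
  "('r, 'x) ring_scheme \<Rightarrow> 'r set \<Rightarrow> int \<Rightarrow> ('r, 'm, 'y) module_scheme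
    \<Rightarrow> ('r, 'e set) module \<Rightarrow> bool" where
  "is_local_cohomology R I i M H \<longleftrightarrow>
     (\<exists>E d \<epsilon>. injective_resolution R M E d \<epsilon> \<and> H = cohomology (\<lambda>j. torsion R I (E j)) d i)"

end

theory Submission
  imports Defs
begin

text \<open>
  Let \<open>P\<close> be a free resolution of \<open>R / I\<^sup>n\<close>. If \<open>s\<close> kills \<open>H\<^sup>i(Hom(P, M))\<close> for every \<open>n\<close>, then \<open>s\<close>
  kills \<open>H\<^sub>I\<^sup>i(M)\<close>: an \<open>I\<close>-torsion cocycle is killed by some \<open>I\<^sup>n\<close>, and dimension shifting along an
  injective resolution turns it into a class of \<open>H\<^sup>i(Hom(P, M))\<close> (\<open>kills_cocycles\<close>,
  \<open>torsion_cocycle_boundary\<close>). The only trace that \<open>I\<close> leaves on \<open>P\<close> is that \<open>H\<^sup>i(Hom(P, R)) = 0\<close> for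
  \<open>i < grade I\<close> (\<open>acyclic_below_resolution\<close>). So it suffices to find one \<open>s \<notin> p\<close> which kills
  \<open>H\<^sup>i(Hom(P, M))\<close> for every complex \<open>P\<close> of finite free modules in nonnegative degrees with
  \<open>H\<^sup>i(Hom(P, R)) = 0\<close> for \<open>i < g\<close>, every \<open>g\<close> and every \<open>i < g - r\<close>, where \<open>r\<close> bounds the differences
  \<open>depth R\<^sub>q - depth M\<^sub>q\<close> for the primes \<open>q \<subseteq> p\<close>. This is \<open>uniform_annihilator\<close>. The elements \<open>s\<close> with
  this property form an ideal \<open>c\<close>, and the statement is that \<open>c\<close> is not contained in \<open>p\<close>.

  Suppose it is, and let \<open>q \<subseteq> p\<close> be a minimal prime of \<open>c\<close>. Then for every \<open>x \<in> q\<close> some \<open>s x\<^sup>n\<close> with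
  \<open>s \<notin> q\<close> lies in \<open>c\<close>. Replacing \<open>P\<close> by the iterated mapping cone of powers of finitely many elements
  of \<open>q\<close> keeps the acyclicity, and an element \<open>s \<notin> q\<close> that works for the cone yields one that works
  for \<open>P\<close> (\<open>kills_of_cones\<close>). On the cone, powers of these elements with a fixed exponent kill the
  cohomology with any coefficients. This has the effect that a nonzerodivisor on \<open>N\<close> among them may
  be divided out at the cost of one degree: what kills \<open>H\<^sup>i\<^sup>-\<^sup>1\<close> with coefficients in \<open>N / x N\<close> kills,
  after raising to a fixed power, \<open>H\<^sup>i\<close> with coefficients in \<open>N\<close> (\<open>kills_nonzerodivisor\<close>).

  Localized at \<open>q\<close>, this reduces the module \<open>M\<close> in \<open>depth M\<^sub>q\<close> steps to a quotient
  \<open>M / U\<close> in degree \<open>i - depth M\<^sub>q\<close> (\<open>kills_near_regular_descent\<close>), and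
  \<open>i - depth M\<^sub>q < g - depth R\<^sub>q\<close>. A finitely generated module is, up to elements outside \<open>q\<close> and
  further nonzerodivisor steps, an iterated extension of copies of \<open>R / q\<close>
  (\<open>kills_transfer_module\<close>). It remains to treat \<open>R / q\<close> in degrees below \<open>g - depth R\<^sub>q\<close>. After
  dividing \<open>R\<close> by a maximal near-regular sequence in \<open>q\<close> there is a copy of \<open>R / q\<close> in a quotient
  \<open>R / b\<close> whose cohomology is killed in these degrees, and the quotient of \<open>R / b\<close> by this copy is
  handled by the lower degrees, so one can induct on the degree (\<open>kills_residue_step\<close>). The annihilator
  changes at each step of this induction, and \<open>g\<close> is arbitrary. Therefore the induction must have
  bounded length: the cohomology of \<open>R / q\<close> vanishes in all degrees below \<open>g - k\<close> for a
  constant \<open>k\<close> (\<open>kills_bounded_slack\<close>), so that \<open>k\<close> steps suffice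
  (\<open>kills_residue_uniform\<close>). This constant also shows that the grade of a proper ideal is finite.

  Regular sequences over \<open>R\<^sub>q\<close> are replaced by sequences in \<open>q\<close> which are regular modulo
  \<open>q\<close>-saturated submodules over \<open>R\<close> itself (\<open>near_regular\<close>). The comparison with depth over the
  iterated localization \<open>(R\<^sub>p)\<^sub>q\<close> is made once, for an abstract localization map
  (\<open>near_regular_depth_bound\<close>).
\<close>

section \<open>Cohomology of free complexes with values in a subquotient\<close>

text \<open>A complex of finite free modules is a pair: the finite set \<open>bas P j\<close> indexes the basis of the
  \<open>j\<close>-th module, and row \<open>k\<close> of the matrix \<open>mat P j\<close> expresses the image of the basis element
  \<open>k \<in> bas P (j + 1)\<close> in the basis \<open>bas P j\<close>. All complexes have the same type, so that one can
  quantify over them.\<close>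

type_synonym 'r based_complex = "(int \<Rightarrow> nat set) \<times> (int \<Rightarrow> nat \<Rightarrow> nat \<Rightarrow> 'r)"

definition bas :: "'r based_complex \<Rightarrow> int \<Rightarrow> nat set" where
  "bas P = fst P"

definition mat :: "'r based_complex \<Rightarrow> int \<Rightarrow> nat \<Rightarrow> nat \<Rightarrow> 'r" where
  "mat P = snd P"

definition free_complex ::
  "('r, 'x) ring_scheme \<Rightarrow> 'r based_complex \<Rightarrow> bool" where
  "free_complex R P \<longleftrightarrow> (\<forall>j. finite (bas P j)) \<and> (\<forall>j<0. bas P j = {}) \<and>
     (\<forall>j k l. mat P j k l \<in> carrier R) \<and>
     (\<forall>j. \<forall>k\<in>bas P (j + 1). \<forall>m\<in>bas P (j - 1).
        (\<Oplus>\<^bsub>R\<^esub> l\<in>bas P j. mat P j k l \<otimes>\<^bsub>R\<^esub> mat P (j - 1) l m) = \<zero>\<^bsub>R\<^esub>)"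

text \<open>The differential of \<open>Hom(P, M)\<close>; a cochain of degree \<open>j\<close> is a family of elements indexed by
  \<open>bas P j\<close>.\<close>

definition cob ::
  "('r, 'm, 'y) module_scheme \<Rightarrow> 'r based_complex \<Rightarrow> int
    \<Rightarrow> (nat \<Rightarrow> 'm) \<Rightarrow> nat \<Rightarrow> 'm" where
  "cob M P j z = (\<lambda>k. \<Oplus>\<^bsub>M\<^esub> l\<in>bas P j. mat P j k l \<odot>\<^bsub>M\<^esub> z l)"

text \<open>Multiplication by \<open>s\<close> is zero on \<open>H\<^sup>i(Hom(P, V / U))\<close>. Cochains with values in \<open>V / U\<close> are
  represented by cochains with values in \<open>V\<close>, and equations hold modulo \<open>U\<close>. In this way all
  coefficient modules that occur are subquotients of one module, and no quotient has to be formed.\<close>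

definition kills ::
  "('r, 'm, 'y) module_scheme \<Rightarrow> 'r based_complex \<Rightarrow> int \<Rightarrow> 'r
    \<Rightarrow> 'm set \<Rightarrow> 'm set \<Rightarrow> bool" where
  "kills M P i s U V \<longleftrightarrow>
     (\<forall>z. z \<in> bas P i \<rightarrow> V \<and> cob M P i z \<in> bas P (i + 1) \<rightarrow> U \<longrightarrow>
        (\<exists>w. w \<in> bas P (i - 1) \<rightarrow> V \<and>
           (\<forall>k\<in>bas P i. s \<odot>\<^bsub>M\<^esub> z k \<ominus>\<^bsub>M\<^esub> cob M P (i - 1) w k \<in> U)))"

lemma free_complexD:
  assumes "free_complex R P"
  shows "finite (bas P j)" "j < 0 \<Longrightarrow> bas P j = {}" "mat P j k l \<in> carrier R"
    "k \<in> bas P (j + 1) \<Longrightarrow> m \<in> bas P (j - 1) \<Longrightarrow>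
        (\<Oplus>\<^bsub>R\<^esub> l\<in>bas P j. mat P j k l \<otimes>\<^bsub>R\<^esub> mat P (j - 1) l m) = \<zero>\<^bsub>R\<^esub>"
  using assms unfolding free_complex_def by auto

lemma killsD:
  assumes "kills M P i s U V" "z \<in> bas P i \<rightarrow> V" "\<And>k. k \<in> bas P (i + 1) \<Longrightarrow> cob M P i z k \<in> U"
  obtains w where "w \<in> bas P (i - 1) \<rightarrow> V"
    "\<And>k. k \<in> bas P i \<Longrightarrow> s \<odot>\<^bsub>M\<^esub> z k \<ominus>\<^bsub>M\<^esub> cob M P (i - 1) w k \<in> U"
  using assms unfolding kills_def Pi_def by blast

lemma killsI:
  assumes "\<And>z. \<lbrakk>z \<in> bas P i \<rightarrow> V; \<And>k. k \<in> bas P (i + 1) \<Longrightarrow> cob M P i z k \<in> U\<rbrakk> \<Longrightarrow>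
        \<exists>w. w \<in> bas P (i - 1) \<rightarrow> V \<and>
           (\<forall>k\<in>bas P i. s \<odot>\<^bsub>M\<^esub> z k \<ominus>\<^bsub>M\<^esub> cob M P (i - 1) w k \<in> U)"
  shows "kills M P i s U V"
  using assms unfolding kills_def Pi_def by blast

lemma kills_bounds:
  assumes "kills M P i s U V" "z \<in> bas P i \<rightarrow> V" "\<forall>k\<in>bas P (i + 1). cob M P i z k \<in> U"
  shows "\<exists>w. w \<in> bas P (i - 1) \<rightarrow> V \<and>
    (\<forall>k\<in>bas P i. s \<odot>\<^bsub>M\<^esub> z k \<ominus>\<^bsub>M\<^esub> cob M P (i - 1) w k \<in> U)"
  using assms unfolding kills_def Pi_def by blast

context module
begin

lemma submoduleD:
  assumes "submodule U R M"
  shows "\<And>x. x \<in> U \<Longrightarrow> x \<in> carrier M" "\<zero>\<^bsub>M\<^esub> \<in> U" "\<And>x y. x \<in> U \<Longrightarrow> y \<in> U \<Longrightarrow> x \<oplus>\<^bsub>M\<^esub> y \<in> U"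
    "\<And>a x. a \<in> carrier R \<Longrightarrow> x \<in> U \<Longrightarrow> a \<odot>\<^bsub>M\<^esub> x \<in> U" "\<And>x. x \<in> U \<Longrightarrow> \<ominus>\<^bsub>M\<^esub> x \<in> U"
    "\<And>x y. x \<in> U \<Longrightarrow> y \<in> U \<Longrightarrow> x \<ominus>\<^bsub>M\<^esub> y \<in> U"
proof -
  note E = submoduleE[OF assms]
  show "\<And>x. x \<in> U \<Longrightarrow> x \<in> carrier M" using E(1) by auto
  show "\<zero>\<^bsub>M\<^esub> \<in> U" using subgroup.one_closed[OF submodule.axioms(1)[OF assms]] by simp
  show "\<And>x y. x \<in> U \<Longrightarrow> y \<in> U \<Longrightarrow> x \<oplus>\<^bsub>M\<^esub> y \<in> U" using E by auto
  show "\<And>a x. a \<in> carrier R \<Longrightarrow> x \<in> U \<Longrightarrow> a \<odot>\<^bsub>M\<^esub> x \<in> U" using E by auto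
  show "\<And>x. x \<in> U \<Longrightarrow> \<ominus>\<^bsub>M\<^esub> x \<in> U" using E by auto
  show "\<And>x y. x \<in> U \<Longrightarrow> y \<in> U \<Longrightarrow> x \<ominus>\<^bsub>M\<^esub> y \<in> U" using E by (auto simp: a_minus_def)
qed

lemma submodule_diff_cancel:
  assumes "submodule U R M" "x \<in> carrier M" "y \<in> carrier M" "x \<ominus>\<^bsub>M\<^esub> y \<in> U"
  shows "x \<in> U \<longleftrightarrow> y \<in> U"
proof
  assume "y \<in> U"
  then have "(x \<ominus>\<^bsub>M\<^esub> y) \<oplus>\<^bsub>M\<^esub> y \<in> U" using assms(4) by (intro submoduleD(3)[OF assms(1)])
  then show "x \<in> U" using assms by (simp add: a_minus_def M.a_assoc M.l_neg)
next
  assume "x \<in> U"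
  then have "x \<ominus>\<^bsub>M\<^esub> (x \<ominus>\<^bsub>M\<^esub> y) \<in> U" using assms(4) by (rule submoduleD(6)[OF assms(1)])
  moreover have "x \<ominus>\<^bsub>M\<^esub> (x \<ominus>\<^bsub>M\<^esub> y) = y"
    using assms by (simp add: a_minus_def M.minus_add M.minus_minus M.r_neg2)
  ultimately show "y \<in> U" by simp
qed

lemma submodule_diff_trans:
  assumes "submodule U R M" "x \<in> carrier M" "y \<in> carrier M" "z \<in> carrier M"
    "x \<ominus>\<^bsub>M\<^esub> y \<in> U" "y \<ominus>\<^bsub>M\<^esub> z \<in> U"
  shows "x \<ominus>\<^bsub>M\<^esub> z \<in> U"
proof -
  have "(x \<ominus>\<^bsub>M\<^esub> y) \<oplus>\<^bsub>M\<^esub> (y \<ominus>\<^bsub>M\<^esub> z) \<in> U" using assms(5,6) by (intro submoduleD(3)[OF assms(1)])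
  moreover have "(x \<ominus>\<^bsub>M\<^esub> y) \<oplus>\<^bsub>M\<^esub> (y \<ominus>\<^bsub>M\<^esub> z) = x \<ominus>\<^bsub>M\<^esub> z"
    using assms by (simp add: a_minus_def M.a_assoc M.r_neg1)
  ultimately show ?thesis by simp
qed

lemma submodule_finsum:
  assumes "submodule U R M" "finite A" "\<And>a. a \<in> A \<Longrightarrow> f a \<in> U"
  shows "(\<Oplus>\<^bsub>M\<^esub> a\<in>A. f a) \<in> U"
  using assms(2,3)
proof (induct A)
  case empty
  then show ?case using submoduleD[OF assms(1)] by simp
next
  case (insert x F)
  have "f \<in> F \<rightarrow> carrier M" "f x \<in> carrier M" using insert(4) submoduleD(1)[OF assms(1)] by auto
  then show ?case using insert submoduleD[OF assms(1)] by simp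
qed

lemma smult_minus_distr:
  "\<lbrakk>a \<in> carrier R; x \<in> carrier M; y \<in> carrier M\<rbrakk> \<Longrightarrow> a \<odot>\<^bsub>M\<^esub> (x \<ominus>\<^bsub>M\<^esub> y) = a \<odot>\<^bsub>M\<^esub> x \<ominus>\<^bsub>M\<^esub> a \<odot>\<^bsub>M\<^esub> y"
  by (simp add: a_minus_def smult_r_distr smult_r_minus)

lemma smult_finsum:
  assumes "finite A" "x \<in> carrier M" "f \<in> A \<rightarrow> carrier R"
  shows "(\<Oplus>\<^bsub>R\<^esub> a\<in>A. f a) \<odot>\<^bsub>M\<^esub> x = (\<Oplus>\<^bsub>M\<^esub> a\<in>A. f a \<odot>\<^bsub>M\<^esub> x)"
  using assms
proof (induct A)
  case (insert a F)
  have "(\<lambda>a. f a \<odot>\<^bsub>M\<^esub> x) \<in> F \<rightarrow> carrier M" "f \<in> F \<rightarrow> carrier R" "f a \<in> carrier R"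
    using insert by auto
  then show ?case using insert by (simp add: smult_l_distr)
qed simp

lemma finsum_swap:
  assumes "finite A" "finite B" "\<And>a b. a \<in> A \<Longrightarrow> b \<in> B \<Longrightarrow> f a b \<in> carrier M"
  shows "(\<Oplus>\<^bsub>M\<^esub> a\<in>A. \<Oplus>\<^bsub>M\<^esub> b\<in>B. f a b) = (\<Oplus>\<^bsub>M\<^esub> b\<in>B. \<Oplus>\<^bsub>M\<^esub> a\<in>A. f a b)"
  using assms(1,3)
proof (induct A)
  case empty
  then show ?case by (simp add: M.finsum_zero)
next
  case (insert a F)
  have [simp]: "f a \<in> B \<rightarrow> carrier M" "(\<lambda>a. \<Oplus>\<^bsub>M\<^esub> b\<in>B. f a b) \<in> F \<rightarrow> carrier M"
    "(\<lambda>b. \<Oplus>\<^bsub>M\<^esub> a\<in>F. f a b) \<in> B \<rightarrow> carrier M" "(\<Oplus>\<^bsub>M\<^esub>b\<in>B. f a b) \<in> carrier M"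
    using insert(4) by (auto intro!: M.finsum_closed)
  have "(\<Oplus>\<^bsub>M\<^esub> a\<in>insert a F. \<Oplus>\<^bsub>M\<^esub> b\<in>B. f a b) = (\<Oplus>\<^bsub>M\<^esub> b\<in>B. f a b) \<oplus>\<^bsub>M\<^esub> (\<Oplus>\<^bsub>M\<^esub> b\<in>B. \<Oplus>\<^bsub>M\<^esub> a\<in>F. f a b)"
    using insert by simp
  also have "\<dots> = (\<Oplus>\<^bsub>M\<^esub> b\<in>B. f a b \<oplus>\<^bsub>M\<^esub> (\<Oplus>\<^bsub>M\<^esub> a\<in>F. f a b))"
    by (simp add: M.finsum_addf)
  also have "\<dots> = (\<Oplus>\<^bsub>M\<^esub> b\<in>B. \<Oplus>\<^bsub>M\<^esub> a\<in>insert a F. f a b)"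
    by (intro M.finsum_cong') (use insert in \<open>auto simp: Pi_def intro!: M.finsum_closed M.add.m_closed\<close>)
  finally show ?case .
qed

context
  fixes P
  assumes P: "free_complex R P"
begin

lemma mat_closed [simp]: "mat P j k l \<in> carrier R" and finite_bas [simp]: "finite (bas P j)"
  using free_complexD[OF P] by auto

lemma cob_closed:
  assumes "z \<in> bas P j \<rightarrow> carrier M" shows "cob M P j z k \<in> carrier M"
  unfolding cob_def using assms by (intro M.finsum_closed) (auto simp: Pi_def)

lemma cob_submodule:
  assumes "submodule U R M" "z \<in> bas P j \<rightarrow> U" shows "cob M P j z k \<in> U"
  unfolding cob_def using assms submoduleD(4)[OF assms(1)]
  by (intro submodule_finsum) (auto simp: Pi_def)

lemma cob_add:
  assumes "z \<in> bas P j \<rightarrow> carrier M" "w \<in> bas P j \<rightarrow> carrier M"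
  shows "cob M P j (\<lambda>l. z l \<oplus>\<^bsub>M\<^esub> w l) k = cob M P j z k \<oplus>\<^bsub>M\<^esub> cob M P j w k"
proof -
  have "cob M P j (\<lambda>l. z l \<oplus>\<^bsub>M\<^esub> w l) k
      = (\<Oplus>\<^bsub>M\<^esub> l\<in>bas P j. mat P j k l \<odot>\<^bsub>M\<^esub> z l \<oplus>\<^bsub>M\<^esub> mat P j k l \<odot>\<^bsub>M\<^esub> w l)"
    unfolding cob_def using assms
    by (intro M.finsum_cong') (auto simp: Pi_def smult_r_distr)
  also have "\<dots> = cob M P j z k \<oplus>\<^bsub>M\<^esub> cob M P j w k"
    unfolding cob_def using assms by (intro M.finsum_addf) (auto simp: Pi_def)
  finally show ?thesis .
qed

lemma cob_smult:
  assumes "z \<in> bas P j \<rightarrow> carrier M" "a \<in> carrier R"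
  shows "cob M P j (\<lambda>l. a \<odot>\<^bsub>M\<^esub> z l) k = a \<odot>\<^bsub>M\<^esub> cob M P j z k"
proof -
  have "a \<odot>\<^bsub>M\<^esub> cob M P j z k = (\<Oplus>\<^bsub>M\<^esub> l\<in>bas P j. a \<odot>\<^bsub>M\<^esub> (mat P j k l \<odot>\<^bsub>M\<^esub> z l))"
    unfolding cob_def using assms by (intro finsum_smult_ldistr) (auto simp: Pi_def)
  also have "\<dots> = cob M P j (\<lambda>l. a \<odot>\<^bsub>M\<^esub> z l) k"
    unfolding cob_def using assms
    by (intro M.finsum_cong') (auto simp: Pi_def smult_assoc1[symmetric] R.m_comm)
  finally show ?thesis by simp
qed

lemma cob_cong:
  assumes "w \<in> bas P j \<rightarrow> carrier M" "\<And>l. l \<in> bas P j \<Longrightarrow> z l = w l"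
  shows "cob M P j z k = cob M P j w k"
  unfolding cob_def using assms by (intro M.finsum_cong') (auto simp: Pi_def)

lemma cob_neg:
  assumes "z \<in> bas P j \<rightarrow> carrier M"
  shows "cob M P j (\<lambda>l. \<ominus>\<^bsub>M\<^esub> z l) k = \<ominus>\<^bsub>M\<^esub> cob M P j z k"
proof -
  have "cob M P j (\<lambda>l. \<ominus>\<^bsub>M\<^esub> z l) k = cob M P j (\<lambda>l. (\<ominus> \<one>) \<odot>\<^bsub>M\<^esub> z l) k"
    using assms by (intro cob_cong) (auto simp: Pi_def smult_l_minus)
  also have "\<dots> = \<ominus>\<^bsub>M\<^esub> cob M P j z k"
    using assms by (simp add: cob_smult smult_l_minus cob_closed)
  finally show ?thesis .
qed

lemma cob_diff:
  assumes "z \<in> bas P j \<rightarrow> carrier M" "w \<in> bas P j \<rightarrow> carrier M"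
  shows "cob M P j (\<lambda>l. z l \<ominus>\<^bsub>M\<^esub> w l) k = cob M P j z k \<ominus>\<^bsub>M\<^esub> cob M P j w k"
  unfolding a_minus_def using assms
  by (subst cob_add) (auto simp: Pi_def cob_neg)

lemma cob_zero: "cob M P j (\<lambda>_. \<zero>\<^bsub>M\<^esub>) k = \<zero>\<^bsub>M\<^esub>"
  unfolding cob_def by (simp add: M.finsum_zero)

lemma cob_cob:
  assumes z: "z \<in> bas P (j - 1) \<rightarrow> carrier M" and k: "k \<in> bas P (j + 1)"
  shows "cob M P j (cob M P (j - 1) z) k = \<zero>\<^bsub>M\<^esub>"
proof -
  let ?D = "mat P"
  have "cob M P j (cob M P (j - 1) z) k
      = (\<Oplus>\<^bsub>M\<^esub> l\<in>bas P j. \<Oplus>\<^bsub>M\<^esub> m\<in>bas P (j - 1). (?D j k l \<otimes> ?D (j - 1) l m) \<odot>\<^bsub>M\<^esub> z m)"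
    unfolding cob_def
  proof (intro M.finsum_cong')
    fix l assume "l \<in> bas P j"
    have "?D j k l \<odot>\<^bsub>M\<^esub> (\<Oplus>\<^bsub>M\<^esub> m\<in>bas P (j - 1). ?D (j - 1) l m \<odot>\<^bsub>M\<^esub> z m)
       = (\<Oplus>\<^bsub>M\<^esub> m\<in>bas P (j - 1). ?D j k l \<odot>\<^bsub>M\<^esub> (?D (j - 1) l m \<odot>\<^bsub>M\<^esub> z m))"
      using z by (intro finsum_smult_ldistr) (auto simp: Pi_def)
    also have "\<dots> = (\<Oplus>\<^bsub>M\<^esub> m\<in>bas P (j - 1). (?D j k l \<otimes> ?D (j - 1) l m) \<odot>\<^bsub>M\<^esub> z m)"
      using z by (intro M.finsum_cong') (auto simp: Pi_def smult_assoc1)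
    finally show "?D j k l \<odot>\<^bsub>M\<^esub> (\<Oplus>\<^bsub>M\<^esub> m\<in>bas P (j - 1). ?D (j - 1) l m \<odot>\<^bsub>M\<^esub> z m)
       = (\<Oplus>\<^bsub>M\<^esub> m\<in>bas P (j - 1). (?D j k l \<otimes> ?D (j - 1) l m) \<odot>\<^bsub>M\<^esub> z m)" .
  qed (use z in \<open>auto simp: Pi_def intro!: M.finsum_closed\<close>)
  also have "\<dots> = (\<Oplus>\<^bsub>M\<^esub> m\<in>bas P (j - 1). \<Oplus>\<^bsub>M\<^esub> l\<in>bas P j. (?D j k l \<otimes> ?D (j - 1) l m) \<odot>\<^bsub>M\<^esub> z m)"
    using z by (intro finsum_swap) (auto simp: Pi_def)
  also have "\<dots> = (\<Oplus>\<^bsub>M\<^esub> m\<in>bas P (j - 1). \<zero>\<^bsub>M\<^esub>)"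
  proof (intro M.finsum_cong')
    fix m assume m: "m \<in> bas P (j - 1)"
    have "(\<Oplus>\<^bsub>M\<^esub> l\<in>bas P j. (?D j k l \<otimes> ?D (j - 1) l m) \<odot>\<^bsub>M\<^esub> z m)
       = (\<Oplus>l\<in>bas P j. ?D j k l \<otimes> ?D (j - 1) l m) \<odot>\<^bsub>M\<^esub> z m"
      using z m by (intro smult_finsum[symmetric]) (auto simp: Pi_def)
    also have "\<dots> = \<zero>\<^bsub>M\<^esub>" using free_complexD(4)[OF P k m] z m by (auto simp: Pi_def)
    finally show "(\<Oplus>\<^bsub>M\<^esub> l\<in>bas P j. (?D j k l \<otimes> ?D (j - 1) l m) \<odot>\<^bsub>M\<^esub> z m) = \<zero>\<^bsub>M\<^esub>" .
  qed auto
  finally show ?thesis by (simp add: M.finsum_zero)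
qed

lemma cob_cob':
  assumes z: "z \<in> bas P j \<rightarrow> carrier M" and k: "k \<in> bas P (j + 2)"
  shows "cob M P (j + 1) (cob M P j z) k = \<zero>\<^bsub>M\<^esub>"
  using cob_cob[of z "j + 1" k] assms by (simp add: add.assoc)

lemma cob_diff_submodule:
  assumes "submodule U R M" "z \<in> bas P j \<rightarrow> carrier M" "w \<in> bas P j \<rightarrow> carrier M"
    "\<And>l. l \<in> bas P j \<Longrightarrow> z l \<ominus>\<^bsub>M\<^esub> w l \<in> U"
  shows "cob M P j z k \<ominus>\<^bsub>M\<^esub> cob M P j w k \<in> U"
  using cob_submodule[OF assms(1), of "\<lambda>l. z l \<ominus>\<^bsub>M\<^esub> w l" j k] assms by (simp add: cob_diff)

text \<open>Multiplication by \<open>s\<close> factors through the zero module.\<close>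

lemma kills_annihilator:
  assumes "submodule U R M" "U \<subseteq> V" "V \<subseteq> carrier M" "s \<in> carrier R" "\<And>v. v \<in> V \<Longrightarrow> s \<odot>\<^bsub>M\<^esub> v \<in> U"
  shows "kills M P i s U V"
proof (rule killsI)
  fix z assume z: "z \<in> bas P i \<rightarrow> V"
  have "s \<odot>\<^bsub>M\<^esub> z k \<ominus>\<^bsub>M\<^esub> cob M P (i - 1) (\<lambda>_. \<zero>\<^bsub>M\<^esub>) k \<in> U" if "k \<in> bas P i" for k
  proof -
    have "z k \<in> V" using z that by auto
    then show ?thesis
      using assms submoduleD[OF assms(1)] by (auto simp: cob_zero)
  qed
  moreover have "(\<lambda>_. \<zero>\<^bsub>M\<^esub>) \<in> bas P (i - 1) \<rightarrow> V" using submoduleD(2)[OF assms(1)] assms(2) by auto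
  ultimately show "\<exists>w. w \<in> bas P (i - 1) \<rightarrow> V \<and>
           (\<forall>k\<in>bas P i. s \<odot>\<^bsub>M\<^esub> z k \<ominus>\<^bsub>M\<^esub> cob M P (i - 1) w k \<in> U)" by blast
qed

lemma kills_neg: "i < 0 \<Longrightarrow> kills M P i s U V"
  by (rule killsI) (use free_complexD(2)[OF P, of i] free_complexD(2)[OF P, of "i - 1"] in auto)

lemma kills_mult:
  assumes "submodule U R M" "submodule V R M" "s \<in> carrier R" "a \<in> carrier R" "kills M P i s U V"
  shows "kills M P i (a \<otimes> s) U V"
proof (rule killsI)
  fix z assume z: "z \<in> bas P i \<rightarrow> V" "\<And>k. k \<in> bas P (i + 1) \<Longrightarrow> cob M P i z k \<in> U"
  obtain w where w: "w \<in> bas P (i - 1) \<rightarrow> V"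
    "\<And>k. k \<in> bas P i \<Longrightarrow> s \<odot>\<^bsub>M\<^esub> z k \<ominus>\<^bsub>M\<^esub> cob M P (i - 1) w k \<in> U"
    using killsD[OF assms(5) z] by blast
  have V: "\<And>v. v \<in> V \<Longrightarrow> v \<in> carrier M" using submoduleD[OF assms(2)] by auto
  have wc: "w \<in> bas P (i - 1) \<rightarrow> carrier M" using w(1) V by auto
  have "(a \<otimes> s) \<odot>\<^bsub>M\<^esub> z k \<ominus>\<^bsub>M\<^esub> cob M P (i - 1) (\<lambda>l. a \<odot>\<^bsub>M\<^esub> w l) k \<in> U" if k: "k \<in> bas P i" for k
  proof -
    have "z k \<in> carrier M" using z(1) k V by auto
    then have "(a \<otimes> s) \<odot>\<^bsub>M\<^esub> z k \<ominus>\<^bsub>M\<^esub> cob M P (i - 1) (\<lambda>l. a \<odot>\<^bsub>M\<^esub> w l) k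
       = a \<odot>\<^bsub>M\<^esub> (s \<odot>\<^bsub>M\<^esub> z k \<ominus>\<^bsub>M\<^esub> cob M P (i - 1) w k)"
      using assms(3,4) wc by (simp add: cob_smult smult_minus_distr smult_assoc1 cob_closed)
    then show ?thesis using w(2)[OF k] submoduleD(4)[OF assms(1,4)] by simp
  qed
  moreover have "(\<lambda>l. a \<odot>\<^bsub>M\<^esub> w l) \<in> bas P (i - 1) \<rightarrow> V" using w(1) submoduleD(4)[OF assms(2,4)] by auto
  ultimately show "\<exists>w. w \<in> bas P (i - 1) \<rightarrow> V \<and>
       (\<forall>k\<in>bas P i. (a \<otimes> s) \<odot>\<^bsub>M\<^esub> z k \<ominus>\<^bsub>M\<^esub> cob M P (i - 1) w k \<in> U)" by blast
qed

lemma kills_add: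
  assumes "submodule U R M" "submodule V R M" "s \<in> carrier R" "a \<in> carrier R"
    "kills M P i s U V" "kills M P i a U V"
  shows "kills M P i (s \<oplus> a) U V"
proof (rule killsI)
  fix z assume z: "z \<in> bas P i \<rightarrow> V" "\<And>k. k \<in> bas P (i + 1) \<Longrightarrow> cob M P i z k \<in> U"
  obtain w where w: "w \<in> bas P (i - 1) \<rightarrow> V"
    "\<And>k. k \<in> bas P i \<Longrightarrow> s \<odot>\<^bsub>M\<^esub> z k \<ominus>\<^bsub>M\<^esub> cob M P (i - 1) w k \<in> U"
    using killsD[OF assms(5) z] by blast
  obtain v where v: "v \<in> bas P (i - 1) \<rightarrow> V"
    "\<And>k. k \<in> bas P i \<Longrightarrow> a \<odot>\<^bsub>M\<^esub> z k \<ominus>\<^bsub>M\<^esub> cob M P (i - 1) v k \<in> U"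
    using killsD[OF assms(6) z] by blast
  have V: "\<And>v. v \<in> V \<Longrightarrow> v \<in> carrier M" using submoduleD[OF assms(2)] by auto
  have wc: "w \<in> bas P (i - 1) \<rightarrow> carrier M" "v \<in> bas P (i - 1) \<rightarrow> carrier M" using w(1) v(1) V by auto
  have "(s \<oplus> a) \<odot>\<^bsub>M\<^esub> z k \<ominus>\<^bsub>M\<^esub> cob M P (i - 1) (\<lambda>l. w l \<oplus>\<^bsub>M\<^esub> v l) k \<in> U" if k: "k \<in> bas P i" for k
  proof -
    have "z k \<in> carrier M" using z(1) k V by auto
    then have "(s \<oplus> a) \<odot>\<^bsub>M\<^esub> z k \<ominus>\<^bsub>M\<^esub> cob M P (i - 1) (\<lambda>l. w l \<oplus>\<^bsub>M\<^esub> v l) k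
       = (s \<odot>\<^bsub>M\<^esub> z k \<ominus>\<^bsub>M\<^esub> cob M P (i - 1) w k) \<oplus>\<^bsub>M\<^esub> (a \<odot>\<^bsub>M\<^esub> z k \<ominus>\<^bsub>M\<^esub> cob M P (i - 1) v k)"
      using assms(3,4) wc
      by (simp add: cob_add smult_l_distr cob_closed a_minus_def M.minus_add M.a_ac)
    then show ?thesis using w(2)[OF k] v(2)[OF k] submoduleD(3)[OF assms(1)] by simp
  qed
  moreover have "(\<lambda>l. w l \<oplus>\<^bsub>M\<^esub> v l) \<in> bas P (i - 1) \<rightarrow> V"
    using w(1) v(1) submoduleD(3)[OF assms(2)] by auto
  ultimately show "\<exists>w. w \<in> bas P (i - 1) \<rightarrow> V \<and>
       (\<forall>k\<in>bas P i. (s \<oplus> a) \<odot>\<^bsub>M\<^esub> z k \<ominus>\<^bsub>M\<^esub> cob M P (i - 1) w k \<in> U)" by blast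
qed

text \<open>The next three lemmas come from the three consecutive triples in the long exact sequence of
  \<open>0 \<rightarrow> V / U \<rightarrow> W / U \<rightarrow> W / V \<rightarrow> 0\<close>: if the outer terms are killed by \<open>s\<close> and \<open>t\<close>, then the middle
  term is killed by \<open>s \<otimes> t\<close>.\<close>

lemma kills_extension:
  assumes U: "submodule U R M" and V: "submodule V R M" and W: "submodule W R M"
    and sub: "U \<subseteq> V" "V \<subseteq> W" and s: "s \<in> carrier R" "t \<in> carrier R"
    and k1: "kills M P i s U V" and k2: "kills M P i t V W"
  shows "kills M P i (s \<otimes> t) U W"
proof (rule killsI)
  fix z assume z: "z \<in> bas P i \<rightarrow> W" "\<And>k. k \<in> bas P (i + 1) \<Longrightarrow> cob M P i z k \<in> U"
  note UD = submoduleD[OF U] and VD = submoduleD[OF V] and WD = submoduleD[OF W]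
  obtain w where w: "w \<in> bas P (i - 1) \<rightarrow> W"
    "\<And>k. k \<in> bas P i \<Longrightarrow> t \<odot>\<^bsub>M\<^esub> z k \<ominus>\<^bsub>M\<^esub> cob M P (i - 1) w k \<in> V"
    using killsD[OF k2 z(1)] z(2) sub by blast
  have wc: "w \<in> bas P (i - 1) \<rightarrow> carrier M" "z \<in> bas P i \<rightarrow> carrier M" using w(1) z(1) WD(1) by auto
  define y where "y = (\<lambda>k. t \<odot>\<^bsub>M\<^esub> z k \<ominus>\<^bsub>M\<^esub> cob M P (i - 1) w k)"
  have "cob M P i y k \<in> U" if k: "k \<in> bas P (i + 1)" for k
  proof -
    have "cob M P i y k = t \<odot>\<^bsub>M\<^esub> cob M P i z k"
      unfolding y_def using wc s k
      by (subst cob_diff) (auto simp: cob_smult cob_cob cob_closed a_minus_def)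
    then show ?thesis using UD(4)[OF s(2) z(2)[OF k]] by simp
  qed
  then obtain v where v: "v \<in> bas P (i - 1) \<rightarrow> V"
    "\<And>k. k \<in> bas P i \<Longrightarrow> s \<odot>\<^bsub>M\<^esub> y k \<ominus>\<^bsub>M\<^esub> cob M P (i - 1) v k \<in> U"
    using killsD[OF k1, of y] w(2) unfolding y_def by blast
  have vc: "v \<in> bas P (i - 1) \<rightarrow> carrier M" using v(1) VD(1) by auto
  have "(s \<otimes> t) \<odot>\<^bsub>M\<^esub> z k \<ominus>\<^bsub>M\<^esub> cob M P (i - 1) (\<lambda>l. s \<odot>\<^bsub>M\<^esub> w l \<oplus>\<^bsub>M\<^esub> v l) k \<in> U" if k: "k \<in> bas P i" for k
  proof -
    have "z k \<in> carrier M" using wc k by auto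
    moreover have "cob M P (i - 1) (\<lambda>l. s \<odot>\<^bsub>M\<^esub> w l \<oplus>\<^bsub>M\<^esub> v l) k
      = s \<odot>\<^bsub>M\<^esub> cob M P (i - 1) w k \<oplus>\<^bsub>M\<^esub> cob M P (i - 1) v k"
      using wc vc s by (subst cob_add) (auto simp: cob_smult)
    ultimately have "(s \<otimes> t) \<odot>\<^bsub>M\<^esub> z k \<ominus>\<^bsub>M\<^esub> cob M P (i - 1) (\<lambda>l. s \<odot>\<^bsub>M\<^esub> w l \<oplus>\<^bsub>M\<^esub> v l) k
       = s \<odot>\<^bsub>M\<^esub> y k \<ominus>\<^bsub>M\<^esub> cob M P (i - 1) v k"
      unfolding y_def using s wc vc
      by (simp add: smult_r_distr smult_r_minus smult_assoc1 cob_closed a_minus_def M.minus_add M.a_ac)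
    then show ?thesis using v(2)[OF k] by simp
  qed
  moreover have "(\<lambda>l. s \<odot>\<^bsub>M\<^esub> w l \<oplus>\<^bsub>M\<^esub> v l) \<in> bas P (i - 1) \<rightarrow> W"
    using w(1) v(1) s sub by (auto intro!: WD(3,4) simp: Pi_def)
  ultimately show "\<exists>w. w \<in> bas P (i - 1) \<rightarrow> W \<and>
       (\<forall>k\<in>bas P i. (s \<otimes> t) \<odot>\<^bsub>M\<^esub> z k \<ominus>\<^bsub>M\<^esub> cob M P (i - 1) w k \<in> U)" by blast
qed

lemma kills_submodule:
  assumes U: "submodule U R M" and V: "submodule V R M" and W: "submodule W R M"
    and sub: "U \<subseteq> V" "V \<subseteq> W" and s: "s \<in> carrier R" "t \<in> carrier R"
    and k1: "kills M P (i - 1) s V W" and k2: "kills M P i t U W"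
  shows "kills M P i (s \<otimes> t) U V"
proof (rule killsI)
  fix z assume z: "z \<in> bas P i \<rightarrow> V" "\<And>k. k \<in> bas P (i + 1) \<Longrightarrow> cob M P i z k \<in> U"
  note UD = submoduleD[OF U] and VD = submoduleD[OF V] and WD = submoduleD[OF W]
  obtain w where w: "w \<in> bas P (i - 1) \<rightarrow> W"
    "\<And>k. k \<in> bas P i \<Longrightarrow> t \<odot>\<^bsub>M\<^esub> z k \<ominus>\<^bsub>M\<^esub> cob M P (i - 1) w k \<in> U"
    using killsD[OF k2, of z] z sub by blast
  have wc: "w \<in> bas P (i - 1) \<rightarrow> carrier M" "z \<in> bas P i \<rightarrow> carrier M" using w(1) z(1) WD(1) VD(1) by auto
  have "cob M P (i - 1) w k \<in> V" if "k \<in> bas P i" for k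
    using submodule_diff_cancel[OF V, of "t \<odot>\<^bsub>M\<^esub> z k" "cob M P (i - 1) w k"] w(2)[OF that] sub(1) z(1)
      wc that s VD(4) by (auto simp: cob_closed Pi_def subset_iff)
  then obtain v where v: "v \<in> bas P (i - 1 - 1) \<rightarrow> W"
    "\<And>k. k \<in> bas P (i - 1) \<Longrightarrow> s \<odot>\<^bsub>M\<^esub> w k \<ominus>\<^bsub>M\<^esub> cob M P (i - 1 - 1) v k \<in> V"
    using killsD[OF k1, of w] w(1) by (metis diff_add_cancel)
  have vc: "v \<in> bas P (i - 1 - 1) \<rightarrow> carrier M" using v(1) WD(1) by auto
  define y where "y = (\<lambda>k. s \<odot>\<^bsub>M\<^esub> w k \<ominus>\<^bsub>M\<^esub> cob M P (i - 1 - 1) v k)"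
  have "(s \<otimes> t) \<odot>\<^bsub>M\<^esub> z k \<ominus>\<^bsub>M\<^esub> cob M P (i - 1) y k \<in> U" if k: "k \<in> bas P i" for k
  proof -
    have "cob M P (i - 1) y k = s \<odot>\<^bsub>M\<^esub> cob M P (i - 1) w k"
      unfolding y_def using wc vc s k cob_cob[OF vc, of k]
      by (subst cob_diff) (auto simp: cob_smult cob_closed a_minus_def)
    moreover have "z k \<in> carrier M" using wc k by auto
    ultimately have "(s \<otimes> t) \<odot>\<^bsub>M\<^esub> z k \<ominus>\<^bsub>M\<^esub> cob M P (i - 1) y k
       = s \<odot>\<^bsub>M\<^esub> (t \<odot>\<^bsub>M\<^esub> z k \<ominus>\<^bsub>M\<^esub> cob M P (i - 1) w k)"
      using s wc by (simp add: smult_minus_distr smult_assoc1 cob_closed)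
    then show ?thesis using w(2)[OF k] UD(4) s by simp
  qed
  moreover have "y \<in> bas P (i - 1) \<rightarrow> V" using v(2) unfolding y_def by auto
  ultimately show "\<exists>w. w \<in> bas P (i - 1) \<rightarrow> V \<and>
       (\<forall>k\<in>bas P i. (s \<otimes> t) \<odot>\<^bsub>M\<^esub> z k \<ominus>\<^bsub>M\<^esub> cob M P (i - 1) w k \<in> U)" by blast
qed

lemma kills_quotient:
  assumes U: "submodule U R M" and V: "submodule V R M" and W: "submodule W R M"
    and sub: "U \<subseteq> V" "V \<subseteq> W" and s: "s \<in> carrier R" "t \<in> carrier R"
    and k1: "kills M P i s U W" and k2: "kills M P (i + 1) t U V"
  shows "kills M P i (s \<otimes> t) V W"
proof (rule killsI)
  fix z assume z: "z \<in> bas P i \<rightarrow> W" "\<And>k. k \<in> bas P (i + 1) \<Longrightarrow> cob M P i z k \<in> V"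
  note UD = submoduleD[OF U] and VD = submoduleD[OF V] and WD = submoduleD[OF W]
  have zc: "z \<in> bas P i \<rightarrow> carrier M" using z(1) WD(1) by auto
  obtain w where w: "w \<in> bas P i \<rightarrow> V"
    "\<And>k. k \<in> bas P (i + 1) \<Longrightarrow> t \<odot>\<^bsub>M\<^esub> cob M P i z k \<ominus>\<^bsub>M\<^esub> cob M P i w k \<in> U"
    using killsD[OF k2, of "cob M P i z"] z(2) cob_cob'[OF zc] UD(2) 
    by (auto simp: add.assoc)
  have wc: "w \<in> bas P i \<rightarrow> carrier M" using w(1) VD(1) by auto
  define y where "y = (\<lambda>k. t \<odot>\<^bsub>M\<^esub> z k \<ominus>\<^bsub>M\<^esub> w k)"
  have "cob M P i y k \<in> U" if k: "k \<in> bas P (i + 1)" for k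
  proof -
    have "cob M P i y k = t \<odot>\<^bsub>M\<^esub> cob M P i z k \<ominus>\<^bsub>M\<^esub> cob M P i w k"
      unfolding y_def using zc wc s by (subst cob_diff) (auto simp: cob_smult)
    then show ?thesis using w(2)[OF k] by simp
  qed
  moreover have "y \<in> bas P i \<rightarrow> W" unfolding y_def using z(1) w(1) sub s by (auto intro!: WD(4,6) simp: Pi_def)
  ultimately obtain v where v: "v \<in> bas P (i - 1) \<rightarrow> W"
    "\<And>k. k \<in> bas P i \<Longrightarrow> s \<odot>\<^bsub>M\<^esub> y k \<ominus>\<^bsub>M\<^esub> cob M P (i - 1) v k \<in> U"
    using killsD[OF k1, of y] by blast
  have vc: "v \<in> bas P (i - 1) \<rightarrow> carrier M" using v(1) WD(1) by auto
  have "(s \<otimes> t) \<odot>\<^bsub>M\<^esub> z k \<ominus>\<^bsub>M\<^esub> cob M P (i - 1) v k \<in> V" if k: "k \<in> bas P i" for k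
  proof -
    have zk: "z k \<in> carrier M" "w k \<in> carrier M" "w k \<in> V" using zc wc w(1) k by auto
    then have "(s \<odot>\<^bsub>M\<^esub> y k \<ominus>\<^bsub>M\<^esub> cob M P (i - 1) v k) \<oplus>\<^bsub>M\<^esub> s \<odot>\<^bsub>M\<^esub> w k
       = (s \<otimes> t) \<odot>\<^bsub>M\<^esub> z k \<ominus>\<^bsub>M\<^esub> cob M P (i - 1) v k"
      unfolding y_def using s vc
      by (simp add: smult_r_distr smult_r_minus smult_assoc1 cob_closed a_minus_def M.a_ac M.r_neg2 M.r_neg1)
    moreover have "(s \<odot>\<^bsub>M\<^esub> y k \<ominus>\<^bsub>M\<^esub> cob M P (i - 1) v k) \<oplus>\<^bsub>M\<^esub> s \<odot>\<^bsub>M\<^esub> w k \<in> V"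
      using v(2)[OF k] sub(1) VD(3,4) s zk by auto
    ultimately show ?thesis by simp
  qed
  then show "\<exists>w. w \<in> bas P (i - 1) \<rightarrow> W \<and>
       (\<forall>k\<in>bas P i. (s \<otimes> t) \<odot>\<^bsub>M\<^esub> z k \<ominus>\<^bsub>M\<^esub> cob M P (i - 1) w k \<in> V)" using v(1) by blast
qed

end

end

lemma self_module_simps [simp]:
  "carrier (self_module R) = carrier R" "\<zero>\<^bsub>self_module R\<^esub> = \<zero>\<^bsub>R\<^esub>"
  "add (self_module R) = add R" "smult (self_module R) = monoid.mult R"
  by (simp_all add: self_module_def)

lemma self_module_finsum [simp]: "finsum (self_module R) = finsum R"
  and self_module_a_inv [simp]: "a_inv (self_module R) = a_inv R"
  and self_module_a_minus [simp]: "a_minus (self_module R) = a_minus R"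
  by (auto simp: self_module_def finsum_def a_inv_def a_minus_def fun_eq_iff finprod_def m_inv_def)

lemma (in cring) self_module: "module R (self_module R)"
proof -
  have "abelian_group (self_module R)"
    by (rule abelian_groupI) (auto simp: a_ac intro: l_neg a_closed exI[of _ "\<ominus> x" for x])
  then show ?thesis
    by (intro moduleI) (auto simp: cring_axioms l_distr r_distr m_assoc)
qed

definition plus_mult :: "('r, 'm, 'y) module_scheme \<Rightarrow> 'm set \<Rightarrow> 'r \<Rightarrow> 'm set \<Rightarrow> 'm set" where
  "plus_mult M U y V = {u \<oplus>\<^bsub>M\<^esub> y \<odot>\<^bsub>M\<^esub> v | u v. u \<in> U \<and> v \<in> V}"

definition plus_gen ::
  "('r, 'x) ring_scheme \<Rightarrow> ('r, 'm, 'y) module_scheme \<Rightarrow> 'm set \<Rightarrow> 'm \<Rightarrow> 'm set" where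
  "plus_gen R M U m = {u \<oplus>\<^bsub>M\<^esub> a \<odot>\<^bsub>M\<^esub> m | u a. u \<in> U \<and> a \<in> carrier R}"

context module
begin

lemma smult_commute:
  "\<lbrakk>a \<in> carrier R; b \<in> carrier R; x \<in> carrier M\<rbrakk> \<Longrightarrow> a \<odot>\<^bsub>M\<^esub> (b \<odot>\<^bsub>M\<^esub> x) = b \<odot>\<^bsub>M\<^esub> (a \<odot>\<^bsub>M\<^esub> x)"
  by (simp add: smult_assoc1[symmetric] R.m_comm)

lemma hom_finsum_submodule:
  assumes N: "module R N" and V: "submodule V R M"
    and phi: "\<And>v. v \<in> V \<Longrightarrow> \<phi> v \<in> carrier N"
    and add: "\<And>x y. x \<in> V \<Longrightarrow> y \<in> V \<Longrightarrow> \<phi> (x \<oplus>\<^bsub>M\<^esub> y) = \<phi> x \<oplus>\<^bsub>N\<^esub> \<phi> y"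
    and fin: "finite A" and f: "f \<in> A \<rightarrow> V"
  shows "\<phi> (\<Oplus>\<^bsub>M\<^esub> a\<in>A. f a) = (\<Oplus>\<^bsub>N\<^esub> a\<in>A. \<phi> (f a))"
  using fin f
proof (induct A)
  case empty
  interpret N: module R N by fact
  have z: "\<zero>\<^bsub>M\<^esub> \<in> V" "\<zero>\<^bsub>M\<^esub> \<in> carrier M" using submoduleD[OF V] by auto
  have "\<phi> \<zero>\<^bsub>M\<^esub> = \<phi> \<zero>\<^bsub>M\<^esub> \<oplus>\<^bsub>N\<^esub> \<phi> \<zero>\<^bsub>M\<^esub>" using add[OF z(1) z(1)] by simp
  then show ?case using phi[OF z(1)] by simp
next
  case (insert x F)
  interpret N: module R N by fact
  have F: "f \<in> F \<rightarrow> V" "f x \<in> V" using insert by auto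
  have c: "f \<in> F \<rightarrow> carrier M" "f x \<in> carrier M" using F submoduleD(1)[OF V] by auto
  have "(\<Oplus>\<^bsub>M\<^esub> a\<in>F. f a) \<in> V" using F insert(1) by (intro submodule_finsum[OF V]) auto
  moreover have "(\<lambda>a. \<phi> (f a)) \<in> F \<rightarrow> carrier N" "\<phi> (f x) \<in> carrier N" using F phi by auto
  ultimately show ?case using insert F c add by simp
qed

lemma submodule_plus_mult:
  assumes U: "submodule U R M" and V: "submodule V R M" and y: "y \<in> carrier R"
  shows "submodule (plus_mult M U y V) R M" "U \<subseteq> plus_mult M U y V"
    "v \<in> V \<Longrightarrow> y \<odot>\<^bsub>M\<^esub> v \<in> plus_mult M U y V" "U \<subseteq> V \<Longrightarrow> plus_mult M U y V \<subseteq> V"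
proof -
  note UD = submoduleD[OF U] and VD = submoduleD[OF V]
  show "submodule (plus_mult M U y V) R M"
  proof (rule submoduleI)
    show "plus_mult M U y V \<subseteq> carrier M" using UD(1) VD(1) y by (auto simp: plus_mult_def)
    show "\<zero>\<^bsub>M\<^esub> \<in> plus_mult M U y V"
      unfolding plus_mult_def using UD(2) VD(2) y by (auto intro!: exI[of _ "\<zero>\<^bsub>M\<^esub>"])
    show "\<ominus>\<^bsub>M\<^esub> a \<in> plus_mult M U y V" if a: "a \<in> plus_mult M U y V" for a
    proof -
      obtain u v where "u \<in> U" "v \<in> V" "a = u \<oplus>\<^bsub>M\<^esub> y \<odot>\<^bsub>M\<^esub> v" using a by (auto simp: plus_mult_def)
      then have "\<ominus>\<^bsub>M\<^esub> a = \<ominus>\<^bsub>M\<^esub> u \<oplus>\<^bsub>M\<^esub> y \<odot>\<^bsub>M\<^esub> (\<ominus>\<^bsub>M\<^esub> v)" "\<ominus>\<^bsub>M\<^esub> u \<in> U" "\<ominus>\<^bsub>M\<^esub> v \<in> V"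
        using UD(1,5) VD(1,5) y by (simp_all add: smult_r_minus M.minus_add)
      then show ?thesis unfolding plus_mult_def by blast
    qed
    show "a \<oplus>\<^bsub>M\<^esub> b \<in> plus_mult M U y V"
      if a: "a \<in> plus_mult M U y V" and b: "b \<in> plus_mult M U y V" for a b
    proof -
      obtain u v where a: "u \<in> U" "v \<in> V" "a = u \<oplus>\<^bsub>M\<^esub> y \<odot>\<^bsub>M\<^esub> v" using a by (auto simp: plus_mult_def)
      obtain u' v' where b: "u' \<in> U" "v' \<in> V" "b = u' \<oplus>\<^bsub>M\<^esub> y \<odot>\<^bsub>M\<^esub> v'" using b by (auto simp: plus_mult_def)
      have "u \<in> carrier M" "u' \<in> carrier M" "v \<in> carrier M" "v' \<in> carrier M" using a b UD(1) VD(1) by auto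
      then have "a \<oplus>\<^bsub>M\<^esub> b = (u \<oplus>\<^bsub>M\<^esub> u') \<oplus>\<^bsub>M\<^esub> y \<odot>\<^bsub>M\<^esub> (v \<oplus>\<^bsub>M\<^esub> v')"
        using a b y by (simp add: smult_r_distr M.a_ac)
      then show ?thesis unfolding plus_mult_def using a b UD(3) VD(3) by blast
    qed
    show "a \<odot>\<^bsub>M\<^esub> x \<in> plus_mult M U y V" if a: "a \<in> carrier R" and x: "x \<in> plus_mult M U y V" for a x
    proof -
      obtain u v where x: "u \<in> U" "v \<in> V" "x = u \<oplus>\<^bsub>M\<^esub> y \<odot>\<^bsub>M\<^esub> v" using x by (auto simp: plus_mult_def)
      have c: "u \<in> carrier M" "v \<in> carrier M" using x UD(1) VD(1) by auto
      then have "a \<odot>\<^bsub>M\<^esub> x = a \<odot>\<^bsub>M\<^esub> u \<oplus>\<^bsub>M\<^esub> y \<odot>\<^bsub>M\<^esub> (a \<odot>\<^bsub>M\<^esub> v)"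
        using a x y by (simp add: smult_r_distr smult_assoc1[symmetric] R.m_comm)
      then show ?thesis unfolding plus_mult_def using a x UD(4) VD(4) by blast
    qed
  qed
  show "U \<subseteq> plus_mult M U y V"
  proof
    fix u assume u: "u \<in> U"
    then have "u = u \<oplus>\<^bsub>M\<^esub> y \<odot>\<^bsub>M\<^esub> \<zero>\<^bsub>M\<^esub>" using UD(1) y by simp
    then show "u \<in> plus_mult M U y V" unfolding plus_mult_def using u VD(2) by blast
  qed
  show "y \<odot>\<^bsub>M\<^esub> v \<in> plus_mult M U y V" if v: "v \<in> V"
  proof -
    have "y \<odot>\<^bsub>M\<^esub> v = \<zero>\<^bsub>M\<^esub> \<oplus>\<^bsub>M\<^esub> y \<odot>\<^bsub>M\<^esub> v" using v VD(1) y by simp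
    then show ?thesis unfolding plus_mult_def using v UD(2) by blast
  qed
  show "plus_mult M U y V \<subseteq> V" if "U \<subseteq> V"
    unfolding plus_mult_def using that y by (auto intro!: VD(3,4))
qed

lemma submodule_plus_gen:
  assumes U: "submodule U R M" and m: "m \<in> carrier M"
  shows "submodule (plus_gen R M U m) R M" "U \<subseteq> plus_gen R M U m"
    "a \<in> carrier R \<Longrightarrow> a \<odot>\<^bsub>M\<^esub> m \<in> plus_gen R M U m" "m \<in> plus_gen R M U m"
    "submodule V R M \<Longrightarrow> U \<subseteq> V \<Longrightarrow> m \<in> V \<Longrightarrow> plus_gen R M U m \<subseteq> V"
proof -
  note UD = submoduleD[OF U]
  show "submodule (plus_gen R M U m) R M"
  proof (rule submoduleI)
    show "plus_gen R M U m \<subseteq> carrier M" using UD(1) m by (auto simp: plus_gen_def)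
    show "\<zero>\<^bsub>M\<^esub> \<in> plus_gen R M U m"
      unfolding plus_gen_def using UD(2) m by (auto intro!: exI[of _ "\<zero>\<^bsub>M\<^esub>"] exI[of _ "\<zero>"])
    show "\<ominus>\<^bsub>M\<^esub> x \<in> plus_gen R M U m" if x: "x \<in> plus_gen R M U m" for x
    proof -
      obtain u a where "u \<in> U" "a \<in> carrier R" "x = u \<oplus>\<^bsub>M\<^esub> a \<odot>\<^bsub>M\<^esub> m" using x by (auto simp: plus_gen_def)
      then have "\<ominus>\<^bsub>M\<^esub> x = \<ominus>\<^bsub>M\<^esub> u \<oplus>\<^bsub>M\<^esub> (\<ominus> a) \<odot>\<^bsub>M\<^esub> m" "\<ominus>\<^bsub>M\<^esub> u \<in> U" "\<ominus> a \<in> carrier R"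
        using UD(1,5) m by (simp_all add: smult_l_minus M.minus_add)
      then show ?thesis unfolding plus_gen_def by blast
    qed
    show "x \<oplus>\<^bsub>M\<^esub> y \<in> plus_gen R M U m" if x: "x \<in> plus_gen R M U m" and y: "y \<in> plus_gen R M U m" for x y
    proof -
      obtain u a where x: "u \<in> U" "a \<in> carrier R" "x = u \<oplus>\<^bsub>M\<^esub> a \<odot>\<^bsub>M\<^esub> m" using x by (auto simp: plus_gen_def)
      obtain u' a' where y: "u' \<in> U" "a' \<in> carrier R" "y = u' \<oplus>\<^bsub>M\<^esub> a' \<odot>\<^bsub>M\<^esub> m" using y by (auto simp: plus_gen_def)
      have "u \<in> carrier M" "u' \<in> carrier M" using x y UD(1) by auto
      then have "x \<oplus>\<^bsub>M\<^esub> y = (u \<oplus>\<^bsub>M\<^esub> u') \<oplus>\<^bsub>M\<^esub> (a \<oplus> a') \<odot>\<^bsub>M\<^esub> m"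
        using x y m by (simp add: smult_l_distr M.a_ac)
      then show ?thesis unfolding plus_gen_def using x y UD(3) by blast
    qed
    show "b \<odot>\<^bsub>M\<^esub> x \<in> plus_gen R M U m" if b: "b \<in> carrier R" and x: "x \<in> plus_gen R M U m" for b x
    proof -
      obtain u a where x: "u \<in> U" "a \<in> carrier R" "x = u \<oplus>\<^bsub>M\<^esub> a \<odot>\<^bsub>M\<^esub> m" using x by (auto simp: plus_gen_def)
      then have "b \<odot>\<^bsub>M\<^esub> x = b \<odot>\<^bsub>M\<^esub> u \<oplus>\<^bsub>M\<^esub> (b \<otimes> a) \<odot>\<^bsub>M\<^esub> m"
        using b x m UD(1) by (simp add: smult_r_distr smult_assoc1)
      then show ?thesis unfolding plus_gen_def using b x UD(4) by blast
    qed
  qed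
  show "U \<subseteq> plus_gen R M U m"
  proof
    fix u assume u: "u \<in> U"
    then have "u = u \<oplus>\<^bsub>M\<^esub> \<zero> \<odot>\<^bsub>M\<^esub> m" using UD(1) m by simp
    then show "u \<in> plus_gen R M U m" unfolding plus_gen_def using u by blast
  qed
  show *: "a \<odot>\<^bsub>M\<^esub> m \<in> plus_gen R M U m" if a: "a \<in> carrier R" for a
  proof -
    have "a \<odot>\<^bsub>M\<^esub> m = \<zero>\<^bsub>M\<^esub> \<oplus>\<^bsub>M\<^esub> a \<odot>\<^bsub>M\<^esub> m" using a m by simp
    then show ?thesis unfolding plus_gen_def using a UD(2) by blast
  qed
  show "m \<in> plus_gen R M U m" using *[of \<one>] m by simp
  show "plus_gen R M U m \<subseteq> V" if V: "submodule V R M" "U \<subseteq> V" "m \<in> V"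
    unfolding plus_gen_def using V by (auto intro!: submoduleD(3,4)[OF V(1)])
qed

context
  fixes P
  assumes P: "free_complex R P"
begin

lemmas Pfacts = mat_closed[OF P] finite_bas[OF P]

lemma cob_hom:
  assumes N: "module R N" and V: "submodule V R M"
    and phi: "\<And>v. v \<in> V \<Longrightarrow> \<phi> v \<in> carrier N"
    and add: "\<And>x y. x \<in> V \<Longrightarrow> y \<in> V \<Longrightarrow> \<phi> (x \<oplus>\<^bsub>M\<^esub> y) = \<phi> x \<oplus>\<^bsub>N\<^esub> \<phi> y"
    and smult: "\<And>a x. a \<in> carrier R \<Longrightarrow> x \<in> V \<Longrightarrow> \<phi> (a \<odot>\<^bsub>M\<^esub> x) = a \<odot>\<^bsub>N\<^esub> \<phi> x"
    and z: "z \<in> bas P j \<rightarrow> V"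
  shows "\<phi> (cob M P j z k) = cob N P j (\<lambda>l. \<phi> (z l)) k"
proof -
  interpret N: module R N by fact
  have "\<phi> (cob M P j z k) = (\<Oplus>\<^bsub>N\<^esub> l\<in>bas P j. \<phi> (mat P j k l \<odot>\<^bsub>M\<^esub> z l))"
    unfolding cob_def using z Pfacts
    by (intro hom_finsum_submodule[OF N V phi add]) (auto simp: Pi_def intro!: submoduleD(4)[OF V])
  also have "\<dots> = cob N P j (\<lambda>l. \<phi> (z l)) k"
    unfolding cob_def using z Pfacts phi smult
    by (intro N.M.finsum_cong') (auto simp: Pi_def)
  finally show ?thesis .
qed

lemma
  assumes N: "module R N" and V: "submodule V R M" and U: "submodule U R M"
    and V': "submodule V' R N" and U': "submodule U' R N" and s: "s \<in> carrier R"
    and phi: "\<And>v. v \<in> V \<Longrightarrow> \<phi> v \<in> V'"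
    and add: "\<And>x y. x \<in> V \<Longrightarrow> y \<in> V \<Longrightarrow> \<phi> (x \<oplus>\<^bsub>M\<^esub> y) = \<phi> x \<oplus>\<^bsub>N\<^esub> \<phi> y"
    and smult: "\<And>a x. a \<in> carrier R \<Longrightarrow> x \<in> V \<Longrightarrow> \<phi> (a \<odot>\<^bsub>M\<^esub> x) = a \<odot>\<^bsub>N\<^esub> \<phi> x"
    and surj: "\<And>y. y \<in> V' \<Longrightarrow> \<exists>v\<in>V. y \<ominus>\<^bsub>N\<^esub> \<phi> v \<in> U'"
    and ker: "\<And>v. v \<in> V \<Longrightarrow> \<phi> v \<in> U' \<longleftrightarrow> v \<in> U"
  shows kills_iso: "kills M P i s U V \<Longrightarrow> kills N P i s U' V'"
    and kills_iso': "kills N P i s U' V' \<Longrightarrow> kills M P i s U V"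
proof -
  interpret N: module R N by fact
  note UD = submoduleD[OF U] and VD = submoduleD[OF V]
    and UD' = N.submoduleD[OF U'] and VD' = N.submoduleD[OF V']
  have phic: "\<And>v. v \<in> V \<Longrightarrow> \<phi> v \<in> carrier N" using phi VD'(1) by auto
  have hom: "\<phi> (cob M P j z k) = cob N P j (\<lambda>l. \<phi> (z l)) k" if "z \<in> bas P j \<rightarrow> V" for j z k
    using that by (intro cob_hom[OF N V]) (simp_all add: phic add smult)
  have diff: "\<phi> (x \<ominus>\<^bsub>M\<^esub> y) = \<phi> x \<ominus>\<^bsub>N\<^esub> \<phi> y" if "x \<in> V" "y \<in> V" for x y
  proof -
    have "\<phi> (x \<ominus>\<^bsub>M\<^esub> y) = \<phi> (x \<oplus>\<^bsub>M\<^esub> (\<ominus> \<one>) \<odot>\<^bsub>M\<^esub> y)"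
      using that VD(1) by (simp add: smult_l_minus a_minus_def)
    also have "\<dots> = \<phi> x \<oplus>\<^bsub>N\<^esub> (\<ominus> \<one>) \<odot>\<^bsub>N\<^esub> \<phi> y" using that add smult VD(4) by simp
    also have "\<dots> = \<phi> x \<ominus>\<^bsub>N\<^esub> \<phi> y" using that phic by (simp add: N.smult_l_minus a_minus_def)
    finally show ?thesis .
  qed
  have lift: "\<exists>z. z \<in> A \<rightarrow> V \<and> (\<forall>l\<in>A. z' l \<ominus>\<^bsub>N\<^esub> \<phi> (z l) \<in> U')" if "z' \<in> A \<rightarrow> V'" for z' and A :: "nat set"
  proof -
    have "\<forall>l\<in>A. \<exists>v. v \<in> V \<and> z' l \<ominus>\<^bsub>N\<^esub> \<phi> v \<in> U'" using surj that by blast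
    then obtain z where "\<forall>l\<in>A. z l \<in> V \<and> z' l \<ominus>\<^bsub>N\<^esub> \<phi> (z l) \<in> U'" by (rule bchoice[THEN exE])
    then show ?thesis by (intro exI[of _ z]) auto
  qed
  show "kills N P i s U' V'" if k: "kills M P i s U V"
  proof (rule killsI)
    fix z' assume z': "z' \<in> bas P i \<rightarrow> V'" "\<And>k. k \<in> bas P (i + 1) \<Longrightarrow> cob N P i z' k \<in> U'"
    obtain z where z: "z \<in> bas P i \<rightarrow> V" "\<forall>l\<in>bas P i. z' l \<ominus>\<^bsub>N\<^esub> \<phi> (z l) \<in> U'"
      using lift[OF z'(1)] by blast
    have c: "z' \<in> bas P i \<rightarrow> carrier N" "(\<lambda>l. \<phi> (z l)) \<in> bas P i \<rightarrow> carrier N" "z \<in> bas P i \<rightarrow> carrier M"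
      using z' z phic VD'(1) VD(1) by (auto simp: Pi_def)
    have "cob M P i z k \<in> U" if k: "k \<in> bas P (i + 1)" for k
    proof -
      have "cob N P i z' k \<ominus>\<^bsub>N\<^esub> cob N P i (\<lambda>l. \<phi> (z l)) k \<in> U'"
        using z by (intro N.cob_diff_submodule[OF P U' c(1,2)]) auto
      then have "cob N P i (\<lambda>l. \<phi> (z l)) k \<in> U'"
        using z'(2)[OF k] N.submodule_diff_cancel[OF U' N.cob_closed[OF P c(1)] N.cob_closed[OF P c(2)]] by simp
      then show ?thesis using hom[OF z(1)] ker[OF cob_submodule[OF P V z(1)]] by simp
    qed
    then obtain w where w: "w \<in> bas P (i - 1) \<rightarrow> V"
      "\<And>k. k \<in> bas P i \<Longrightarrow> s \<odot>\<^bsub>M\<^esub> z k \<ominus>\<^bsub>M\<^esub> cob M P (i - 1) w k \<in> U"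
      using killsD[OF k z(1)] by blast
    have "s \<odot>\<^bsub>N\<^esub> z' k \<ominus>\<^bsub>N\<^esub> cob N P (i - 1) (\<lambda>l. \<phi> (w l)) k \<in> U'" if k: "k \<in> bas P i" for k
    proof -
      have zk: "z k \<in> V" "z' k \<in> carrier N" "z' k \<ominus>\<^bsub>N\<^esub> \<phi> (z k) \<in> U'" using z k c by auto
      have wk: "cob M P (i - 1) w k \<in> V" by (rule cob_submodule[OF P V w(1)])
      have "\<phi> (s \<odot>\<^bsub>M\<^esub> z k \<ominus>\<^bsub>M\<^esub> cob M P (i - 1) w k) \<in> U'"
        using w(2)[OF k] ker[OF VD(6)[OF VD(4)[OF s zk(1)] wk]] by simp
      then have "s \<odot>\<^bsub>N\<^esub> \<phi> (z k) \<ominus>\<^bsub>N\<^esub> cob N P (i - 1) (\<lambda>l. \<phi> (w l)) k \<in> U'"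
        using diff VD(4) s zk wk hom[OF w(1)] smult by simp
      moreover have "s \<odot>\<^bsub>N\<^esub> z' k \<ominus>\<^bsub>N\<^esub> s \<odot>\<^bsub>N\<^esub> \<phi> (z k) \<in> U'"
        using UD'(4)[OF s zk(3)] s zk phic by (simp add: N.smult_minus_distr)
      moreover have "cob N P (i - 1) (\<lambda>l. \<phi> (w l)) k \<in> carrier N"
        using hom[OF w(1), of k] phic[OF wk] by simp
      ultimately show ?thesis
        using s zk phic by (auto intro: N.submodule_diff_trans[OF U', of _ "s \<odot>\<^bsub>N\<^esub> \<phi> (z k)"])
    qed
    moreover have "(\<lambda>l. \<phi> (w l)) \<in> bas P (i - 1) \<rightarrow> V'" using w(1) phi by auto
    ultimately show "\<exists>w. w \<in> bas P (i - 1) \<rightarrow> V' \<and>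
           (\<forall>k\<in>bas P i. s \<odot>\<^bsub>N\<^esub> z' k \<ominus>\<^bsub>N\<^esub> cob N P (i - 1) w k \<in> U')" by blast
  qed
  show "kills M P i s U V" if k: "kills N P i s U' V'"
  proof (rule killsI)
    fix z assume z: "z \<in> bas P i \<rightarrow> V" "\<And>k. k \<in> bas P (i + 1) \<Longrightarrow> cob M P i z k \<in> U"
    have "cob N P i (\<lambda>l. \<phi> (z l)) k \<in> U'" if "k \<in> bas P (i + 1)" for k
      using z(2)[OF that] hom[OF z(1)] ker[OF cob_submodule[OF P V z(1)]] by simp
    moreover have "(\<lambda>l. \<phi> (z l)) \<in> bas P i \<rightarrow> V'" using z(1) phi by auto
    ultimately obtain w' where w': "w' \<in> bas P (i - 1) \<rightarrow> V'"
      "\<And>k. k \<in> bas P i \<Longrightarrow> s \<odot>\<^bsub>N\<^esub> \<phi> (z k) \<ominus>\<^bsub>N\<^esub> cob N P (i - 1) w' k \<in> U'"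
      using killsD[OF k, of "\<lambda>l. \<phi> (z l)"] by blast
    obtain w where w: "w \<in> bas P (i - 1) \<rightarrow> V" "\<forall>l\<in>bas P (i - 1). w' l \<ominus>\<^bsub>N\<^esub> \<phi> (w l) \<in> U'"
      using lift[OF w'(1)] by blast
    have c: "w' \<in> bas P (i - 1) \<rightarrow> carrier N" "(\<lambda>l. \<phi> (w l)) \<in> bas P (i - 1) \<rightarrow> carrier N"
      using w' w phic VD'(1) by (auto simp: Pi_def)
    have "s \<odot>\<^bsub>M\<^esub> z k \<ominus>\<^bsub>M\<^esub> cob M P (i - 1) w k \<in> U" if k: "k \<in> bas P i" for k
    proof -
      have zk: "z k \<in> V" using z k by auto
      have wk: "cob M P (i - 1) w k \<in> V" by (rule cob_submodule[OF P V w(1)])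
      have "cob N P (i - 1) w' k \<ominus>\<^bsub>N\<^esub> cob N P (i - 1) (\<lambda>l. \<phi> (w l)) k \<in> U'"
        using w by (intro N.cob_diff_submodule[OF P U' c]) auto
      then have "s \<odot>\<^bsub>N\<^esub> \<phi> (z k) \<ominus>\<^bsub>N\<^esub> cob N P (i - 1) (\<lambda>l. \<phi> (w l)) k \<in> U'"
        using N.submodule_diff_trans[OF U' _ _ _ w'(2)[OF k]] N.cob_closed[OF P] c s phic[OF zk] by auto
      then have "\<phi> (s \<odot>\<^bsub>M\<^esub> z k \<ominus>\<^bsub>M\<^esub> cob M P (i - 1) w k) \<in> U'"
        using diff VD(4) s zk wk hom[OF w(1)] smult by simp
      then show ?thesis using ker[OF VD(6)[OF VD(4)[OF s zk] wk]] by simp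
    qed
    then show "\<exists>w. w \<in> bas P (i - 1) \<rightarrow> V \<and>
           (\<forall>k\<in>bas P i. s \<odot>\<^bsub>M\<^esub> z k \<ominus>\<^bsub>M\<^esub> cob M P (i - 1) w k \<in> U)" using w(1) by blast
  qed
qed

text \<open>If the class of \<open>z\<close> is killed by a nonzerodivisor \<open>y\<close> on \<open>V / U\<close>, it is the image of a class of
  degree \<open>i - 1\<close> under the connecting map of \<open>0 \<rightarrow> V / U \<rightarrow> V / U \<rightarrow> V / (U + y V) \<rightarrow> 0\<close>, where the
  first map is multiplication by \<open>y\<close>. The cochain \<open>w\<close> represents that class.\<close>

lemma nonzerodivisor_step:
  assumes U: "submodule U R M" and V: "submodule V R M" and sub: "U \<subseteq> V"
    and s: "s \<in> carrier R" and y: "y \<in> carrier R"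
    and nzd: "\<And>v. v \<in> V \<Longrightarrow> y \<odot>\<^bsub>M\<^esub> v \<in> U \<Longrightarrow> v \<in> U"
    and k1: "kills M P (i - 1) s (plus_mult M U y V) V"
    and z: "z \<in> bas P i \<rightarrow> V" and w: "w \<in> bas P (i - 1) \<rightarrow> V"
    and zw: "\<And>k. k \<in> bas P i \<Longrightarrow> y \<odot>\<^bsub>M\<^esub> z k \<ominus>\<^bsub>M\<^esub> cob M P (i - 1) w k \<in> U"
  shows "\<exists>v. v \<in> bas P (i - 1) \<rightarrow> V \<and> (\<forall>k\<in>bas P i. s \<odot>\<^bsub>M\<^esub> z k \<ominus>\<^bsub>M\<^esub> cob M P (i - 1) v k \<in> U)"
proof -
  let ?W = "plus_mult M U y V"
  note W = submodule_plus_mult[OF U V y]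
  note UD = submoduleD[OF U] and VD = submoduleD[OF V] and WD = submoduleD[OF W(1)]
  have c: "z \<in> bas P i \<rightarrow> carrier M" "w \<in> bas P (i - 1) \<rightarrow> carrier M" using z w VD(1) by auto
  have "cob M P (i - 1) w k \<in> ?W" if k: "k \<in> bas P i" for k
  proof -
    have zk: "z k \<in> V" "z k \<in> carrier M" using z c k by auto
    have "y \<odot>\<^bsub>M\<^esub> z k \<ominus>\<^bsub>M\<^esub> cob M P (i - 1) w k \<in> ?W" using zw[OF k] W(2) by auto
    then show ?thesis
      using submodule_diff_cancel[OF W(1), of "y \<odot>\<^bsub>M\<^esub> z k" "cob M P (i - 1) w k"] W(3)[OF zk(1)] zk y
        cob_closed[OF P c(2)] by simp
  qed
  then obtain u where u: "u \<in> bas P (i - 1 - 1) \<rightarrow> V"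
    "\<And>k. k \<in> bas P (i - 1) \<Longrightarrow> s \<odot>\<^bsub>M\<^esub> w k \<ominus>\<^bsub>M\<^esub> cob M P (i - 1 - 1) u k \<in> ?W"
    using killsD[OF k1 w] by auto
  have uc: "u \<in> bas P (i - 1 - 1) \<rightarrow> carrier M" using u VD(1) by auto
  have "\<forall>k\<in>bas P (i - 1). \<exists>v. v \<in> V \<and> (s \<odot>\<^bsub>M\<^esub> w k \<ominus>\<^bsub>M\<^esub> cob M P (i - 1 - 1) u k) \<ominus>\<^bsub>M\<^esub> y \<odot>\<^bsub>M\<^esub> v \<in> U"
  proof
    fix k assume k: "k \<in> bas P (i - 1)"
    obtain a v where av: "a \<in> U" "v \<in> V" "s \<odot>\<^bsub>M\<^esub> w k \<ominus>\<^bsub>M\<^esub> cob M P (i - 1 - 1) u k = a \<oplus>\<^bsub>M\<^esub> y \<odot>\<^bsub>M\<^esub> v"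
      using u(2)[OF k] unfolding plus_mult_def by blast
    have "(a \<oplus>\<^bsub>M\<^esub> y \<odot>\<^bsub>M\<^esub> v) \<ominus>\<^bsub>M\<^esub> y \<odot>\<^bsub>M\<^esub> v = a"
      using av(1,2) UD(1) VD(1) y by (simp add: a_minus_def M.a_assoc M.r_neg)
    then show "\<exists>v. v \<in> V \<and> (s \<odot>\<^bsub>M\<^esub> w k \<ominus>\<^bsub>M\<^esub> cob M P (i - 1 - 1) u k) \<ominus>\<^bsub>M\<^esub> y \<odot>\<^bsub>M\<^esub> v \<in> U"
      using av by auto
  qed
  then obtain v where v: "\<forall>k\<in>bas P (i - 1). v k \<in> V \<and>
      (s \<odot>\<^bsub>M\<^esub> w k \<ominus>\<^bsub>M\<^esub> cob M P (i - 1 - 1) u k) \<ominus>\<^bsub>M\<^esub> y \<odot>\<^bsub>M\<^esub> v k \<in> U"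
    by (rule bchoice[THEN exE])
  have vV: "v \<in> bas P (i - 1) \<rightarrow> V" "v \<in> bas P (i - 1) \<rightarrow> carrier M" using v VD(1) by auto
  have "s \<odot>\<^bsub>M\<^esub> z k \<ominus>\<^bsub>M\<^esub> cob M P (i - 1) v k \<in> U" if k: "k \<in> bas P i" for k
  proof -
    have zk: "z k \<in> V" "z k \<in> carrier M" using z c k by auto
    have "cob M P (i - 1) (\<lambda>l. s \<odot>\<^bsub>M\<^esub> w l \<ominus>\<^bsub>M\<^esub> cob M P (i - 1 - 1) u l) k
        \<ominus>\<^bsub>M\<^esub> cob M P (i - 1) (\<lambda>l. y \<odot>\<^bsub>M\<^esub> v l) k \<in> U"
      using v vV c s y uc by (intro cob_diff_submodule[OF P U]) (auto simp: Pi_def cob_closed[OF P])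
    also have "cob M P (i - 1) (\<lambda>l. s \<odot>\<^bsub>M\<^esub> w l \<ominus>\<^bsub>M\<^esub> cob M P (i - 1 - 1) u l) k
       = s \<odot>\<^bsub>M\<^esub> cob M P (i - 1) w k"
      using c s k uc cob_cob[OF P uc, of k]
      by (subst cob_diff[OF P]) (auto simp: cob_smult[OF P] cob_closed[OF P] a_minus_def)
    also have "cob M P (i - 1) (\<lambda>l. y \<odot>\<^bsub>M\<^esub> v l) k = y \<odot>\<^bsub>M\<^esub> cob M P (i - 1) v k"
      using vV y by (simp add: cob_smult[OF P])
    finally have 1: "s \<odot>\<^bsub>M\<^esub> cob M P (i - 1) w k \<ominus>\<^bsub>M\<^esub> y \<odot>\<^bsub>M\<^esub> cob M P (i - 1) v k \<in> U" .
    have "s \<odot>\<^bsub>M\<^esub> (y \<odot>\<^bsub>M\<^esub> z k) \<ominus>\<^bsub>M\<^esub> s \<odot>\<^bsub>M\<^esub> cob M P (i - 1) w k \<in> U"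
      using UD(4)[OF s zw[OF k]] s y zk cob_closed[OF P c(2)] by (simp add: smult_minus_distr)
    then have "s \<odot>\<^bsub>M\<^esub> (y \<odot>\<^bsub>M\<^esub> z k) \<ominus>\<^bsub>M\<^esub> y \<odot>\<^bsub>M\<^esub> cob M P (i - 1) v k \<in> U"
      using submodule_diff_trans[OF U _ _ _ _ 1] s y zk cob_closed[OF P c(2)] cob_closed[OF P vV(2)]
      by auto
    also have "s \<odot>\<^bsub>M\<^esub> (y \<odot>\<^bsub>M\<^esub> z k) \<ominus>\<^bsub>M\<^esub> y \<odot>\<^bsub>M\<^esub> cob M P (i - 1) v k
       = y \<odot>\<^bsub>M\<^esub> (s \<odot>\<^bsub>M\<^esub> z k \<ominus>\<^bsub>M\<^esub> cob M P (i - 1) v k)"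
      using s y zk cob_closed[OF P vV(2)]
      by (simp add: smult_minus_distr smult_assoc1[symmetric] R.m_comm)
    finally show ?thesis
      using nzd[OF VD(6)[OF VD(4)[OF s zk(1)] cob_submodule[OF P V vV(1)]]] by simp
  qed
  then show ?thesis using vV(1) by blast
qed

text \<open>A class killed by \<open>y\<^sup>n\<close> is brought to zero in \<open>n\<close> rounds: \<open>y\<^sup>n\<^sup>-\<^sup>1 z\<close> is killed by \<open>y\<close>, hence by
  \<open>s\<close>, so \<open>s z\<close> is killed by \<open>y\<^sup>n\<^sup>-\<^sup>1\<close>.\<close>

lemma kills_nonzerodivisor:
  assumes U: "submodule U R M" and V: "submodule V R M" and sub: "U \<subseteq> V"
    and s: "s \<in> carrier R" and y: "y \<in> carrier R"
    and nzd: "\<And>v. v \<in> V \<Longrightarrow> y \<odot>\<^bsub>M\<^esub> v \<in> U \<Longrightarrow> v \<in> U"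
    and k1: "kills M P (i - 1) s (plus_mult M U y V) V"
    and k2: "kills M P i (y [^] (n::nat)) U V"
  shows "kills M P i (s [^] n) U V"
proof -
  note UD = submoduleD[OF U] and VD = submoduleD[OF V]
  have *: "\<exists>v. v \<in> bas P (i - 1) \<rightarrow> V \<and> (\<forall>k\<in>bas P i. s [^] n \<odot>\<^bsub>M\<^esub> z k \<ominus>\<^bsub>M\<^esub> cob M P (i - 1) v k \<in> U)"
    if z: "z \<in> bas P i \<rightarrow> V" and w: "w \<in> bas P (i - 1) \<rightarrow> V"
      and zw: "\<And>k. k \<in> bas P i \<Longrightarrow> y [^] n \<odot>\<^bsub>M\<^esub> z k \<ominus>\<^bsub>M\<^esub> cob M P (i - 1) w k \<in> U" for z w and n :: nat
    using that
  proof (induct n arbitrary: z w)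
    case 0
    then show ?case by auto
  next
    case (Suc n)
    have zc: "z \<in> bas P i \<rightarrow> carrier M" using Suc(2) VD(1) by auto
    have "y \<odot>\<^bsub>M\<^esub> (y [^] n \<odot>\<^bsub>M\<^esub> z k) \<ominus>\<^bsub>M\<^esub> cob M P (i - 1) w k \<in> U" if "k \<in> bas P i" for k
    proof -
      have "z k \<in> carrier M" using zc that by auto
      then show ?thesis using Suc(4)[OF that] y by (simp add: smult_commute[of y] smult_assoc1)
    qed
    moreover have "(\<lambda>k. y [^] n \<odot>\<^bsub>M\<^esub> z k) \<in> bas P i \<rightarrow> V" using Suc(2) y VD(4) by (auto simp: Pi_def)
    ultimately obtain v where v: "v \<in> bas P (i - 1) \<rightarrow> V"
      "\<forall>k\<in>bas P i. s \<odot>\<^bsub>M\<^esub> (y [^] n \<odot>\<^bsub>M\<^esub> z k) \<ominus>\<^bsub>M\<^esub> cob M P (i - 1) v k \<in> U"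
      using nonzerodivisor_step[OF U V sub s y nzd k1, of "\<lambda>k. y [^] n \<odot>\<^bsub>M\<^esub> z k" w] Suc(3) by blast
    have "y [^] n \<odot>\<^bsub>M\<^esub> (s \<odot>\<^bsub>M\<^esub> z k) \<ominus>\<^bsub>M\<^esub> cob M P (i - 1) v k \<in> U" if "k \<in> bas P i" for k
    proof -
      have "z k \<in> carrier M" using zc that by auto
      then show ?thesis using v(2) that y s by (simp add: smult_commute[of "y [^] n" s])
    qed
    moreover have "(\<lambda>k. s \<odot>\<^bsub>M\<^esub> z k) \<in> bas P i \<rightarrow> V" using Suc(2) s VD(4) by (auto simp: Pi_def)
    ultimately obtain u where u: "u \<in> bas P (i - 1) \<rightarrow> V"
      "\<forall>k\<in>bas P i. s [^] n \<odot>\<^bsub>M\<^esub> (s \<odot>\<^bsub>M\<^esub> z k) \<ominus>\<^bsub>M\<^esub> cob M P (i - 1) u k \<in> U"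
      using Suc(1)[of "\<lambda>k. s \<odot>\<^bsub>M\<^esub> z k" v] v(1) by blast
    have "s [^] Suc n \<odot>\<^bsub>M\<^esub> z k \<ominus>\<^bsub>M\<^esub> cob M P (i - 1) u k \<in> U" if "k \<in> bas P i" for k
    proof -
      have "z k \<in> carrier M" using zc that by auto
      then show ?thesis using u(2) that s by (simp add: smult_assoc1)
    qed
    then show ?case using u(1) by blast
  qed
  show ?thesis
  proof (rule killsI)
    fix z assume z: "z \<in> bas P i \<rightarrow> V" "\<And>k. k \<in> bas P (i + 1) \<Longrightarrow> cob M P i z k \<in> U"
    then obtain w where w: "w \<in> bas P (i - 1) \<rightarrow> V"
      "\<And>k. k \<in> bas P i \<Longrightarrow> y [^] n \<odot>\<^bsub>M\<^esub> z k \<ominus>\<^bsub>M\<^esub> cob M P (i - 1) w k \<in> U"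
      using killsD[OF k2 z] by blast
    show "\<exists>v. v \<in> bas P (i - 1) \<rightarrow> V \<and>
       (\<forall>k\<in>bas P i. s [^] n \<odot>\<^bsub>M\<^esub> z k \<ominus>\<^bsub>M\<^esub> cob M P (i - 1) v k \<in> U)"
      by (rule *[OF z(1) w])
  qed
qed

end

end

section \<open>Mapping cones of scalars\<close>

text \<open>The mapping cone of multiplication by \<open>y\<close> on \<open>P\<close>, so that \<open>Hom(cone R y P, M)\<close> has the differential
  \<open>(z, w) \<mapsto> (d z, y z - d w)\<close>. Even indices belong to \<open>P\<close>, odd ones to the shifted copy.\<close>

definition cone ::
  "('r, 'x) ring_scheme \<Rightarrow> 'r \<Rightarrow> 'r based_complex
    \<Rightarrow> 'r based_complex" where
  "cone R y P = (\<lambda>j. (\<lambda>l. 2 * l) ` bas P j \<union> (\<lambda>l. 2 * l + 1) ` bas P (j - 1),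
     \<lambda>j k l. if even k then (if even l then mat P j (k div 2) (l div 2) else \<zero>\<^bsub>R\<^esub>)
       else if even l then (if k div 2 = l div 2 then y else \<zero>\<^bsub>R\<^esub>)
       else \<ominus>\<^bsub>R\<^esub> mat P (j - 1) (k div 2) (l div 2))"

primrec cones where
  "cones R [] P = P"
| "cones R (y # ys) P = cone R y (cones R ys P)"

lemma bas_cone: "bas (cone R y P) j = (\<lambda>l. 2 * l) ` bas P j \<union> (\<lambda>l. 2 * l + 1) ` bas P (j - 1)"
  by (simp add: cone_def bas_def)

lemma mat_cone:
  "mat (cone R y P) j (2 * k) (2 * l) = mat P j k l"
  "mat (cone R y P) j (2 * k) (Suc (2 * l)) = \<zero>\<^bsub>R\<^esub>"
  "mat (cone R y P) j (Suc (2 * k)) (2 * l) = (if k = l then y else \<zero>\<^bsub>R\<^esub>)"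
  "mat (cone R y P) j (Suc (2 * k)) (Suc (2 * l)) = \<ominus>\<^bsub>R\<^esub> mat P (j - 1) k l"
  by (simp_all add: cone_def mat_def)

lemma Pi_bas_cone:
  "z \<in> bas (cone R y P) j \<rightarrow> V \<longleftrightarrow>
     (\<lambda>l. z (2 * l)) \<in> bas P j \<rightarrow> V \<and> (\<lambda>l. z (Suc (2 * l))) \<in> bas P (j - 1) \<rightarrow> V"
  by (auto simp: bas_cone)

lemma finite_bas_cone: "free_complex R P \<Longrightarrow> finite (bas (cone R y P) j)"
  by (simp add: bas_cone free_complexD(1))

context module
begin

lemma finsum_bas_cone:
  assumes P: "free_complex R P" and f: "f \<in> bas (cone R y P) j \<rightarrow> carrier M"
  shows "(\<Oplus>\<^bsub>M\<^esub> l\<in>bas (cone R y P) j. f l)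
      = (\<Oplus>\<^bsub>M\<^esub> l\<in>bas P j. f (2 * l)) \<oplus>\<^bsub>M\<^esub> (\<Oplus>\<^bsub>M\<^esub> l\<in>bas P (j - 1). f (Suc (2 * l)))"
proof -
  note [simp] = finite_bas[OF P]
  have f': "(\<lambda>l. f (2 * l)) \<in> bas P j \<rightarrow> carrier M" "(\<lambda>l. f (Suc (2 * l))) \<in> bas P (j - 1) \<rightarrow> carrier M"
    using f by (auto simp: Pi_bas_cone)
  have "(\<Oplus>\<^bsub>M\<^esub> l\<in>bas (cone R y P) j. f l)
     = (\<Oplus>\<^bsub>M\<^esub> l\<in>(\<lambda>l. 2 * l) ` bas P j. f l) \<oplus>\<^bsub>M\<^esub> (\<Oplus>\<^bsub>M\<^esub> l\<in>(\<lambda>l. 2 * l + 1) ` bas P (j - 1). f l)"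
    unfolding bas_cone
  proof (rule M.finsum_Un_disjoint)
    show "(\<lambda>l. 2 * l) ` bas P j \<inter> (\<lambda>l. 2 * l + 1) ` bas P (j - 1) = {}"
      by (auto dest: arg_cong[of _ _ even])
  qed (use f in \<open>auto simp: bas_cone\<close>)
  also have "(\<Oplus>\<^bsub>M\<^esub> l\<in>(\<lambda>l. 2 * l) ` bas P j. f l) = (\<Oplus>\<^bsub>M\<^esub> l\<in>bas P j. f (2 * l))"
    using f'(1) by (intro M.finsum_reindex) (auto simp: inj_on_def)
  also have "(\<Oplus>\<^bsub>M\<^esub> l\<in>(\<lambda>l. 2 * l + 1) ` bas P (j - 1). f l) = (\<Oplus>\<^bsub>M\<^esub> l\<in>bas P (j - 1). f (2 * l + 1))"
    using f'(2) by (intro M.finsum_reindex) (auto simp: inj_on_def)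
  finally show ?thesis by simp
qed

lemma cob_cone_even:
  assumes P: "free_complex R P" and z: "z \<in> bas (cone R y P) j \<rightarrow> carrier M" and y: "y \<in> carrier R"
  shows "cob M (cone R y P) j z (2 * k) = cob M P j (\<lambda>l. z (2 * l)) k"
proof -
  note [simp] = finite_bas[OF P] mat_closed[OF P]
  have z': "(\<lambda>l. z (2 * l)) \<in> bas P j \<rightarrow> carrier M" "(\<lambda>l. z (Suc (2 * l))) \<in> bas P (j - 1) \<rightarrow> carrier M"
    using z by (auto simp: Pi_bas_cone)
  have "cob M (cone R y P) j z (2 * k) = (\<Oplus>\<^bsub>M\<^esub> l\<in>bas P j. mat (cone R y P) j (2 * k) (2 * l) \<odot>\<^bsub>M\<^esub> z (2 * l))
     \<oplus>\<^bsub>M\<^esub> (\<Oplus>\<^bsub>M\<^esub> l\<in>bas P (j - 1). mat (cone R y P) j (2 * k) (Suc (2 * l)) \<odot>\<^bsub>M\<^esub> z (Suc (2 * l)))"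
    unfolding cob_def using z' y by (intro finsum_bas_cone[OF P]) (auto simp: bas_cone mat_cone Pi_def)
  also have "(\<Oplus>\<^bsub>M\<^esub> l\<in>bas P (j - 1). mat (cone R y P) j (2 * k) (Suc (2 * l)) \<odot>\<^bsub>M\<^esub> z (Suc (2 * l)))
     = (\<Oplus>\<^bsub>M\<^esub> l\<in>bas P (j - 1). \<zero>\<^bsub>M\<^esub>)"
    using z' by (intro M.finsum_cong') (auto simp: mat_cone Pi_def)
  also have "(\<Oplus>\<^bsub>M\<^esub> l\<in>bas P j. mat (cone R y P) j (2 * k) (2 * l) \<odot>\<^bsub>M\<^esub> z (2 * l)) = cob M P j (\<lambda>l. z (2 * l)) k"
    by (simp add: mat_cone cob_def)
  finally show ?thesis using cob_closed[OF P z'(1)] by (simp add: M.finsum_zero)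
qed

lemma cob_cone_odd:
  assumes P: "free_complex R P" and z: "z \<in> bas (cone R y P) j \<rightarrow> carrier M" and y: "y \<in> carrier R"
    and k: "k \<in> bas P j"
  shows "cob M (cone R y P) j z (Suc (2 * k))
    = y \<odot>\<^bsub>M\<^esub> z (2 * k) \<ominus>\<^bsub>M\<^esub> cob M P (j - 1) (\<lambda>l. z (Suc (2 * l))) k"
proof -
  note [simp] = finite_bas[OF P] mat_closed[OF P]
  have z': "(\<lambda>l. z (2 * l)) \<in> bas P j \<rightarrow> carrier M" "(\<lambda>l. z (Suc (2 * l))) \<in> bas P (j - 1) \<rightarrow> carrier M"
    using z by (auto simp: Pi_bas_cone)
  have "cob M (cone R y P) j z (Suc (2 * k)) = (\<Oplus>\<^bsub>M\<^esub> l\<in>bas P j. mat (cone R y P) j (Suc (2 * k)) (2 * l) \<odot>\<^bsub>M\<^esub> z (2 * l))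
     \<oplus>\<^bsub>M\<^esub> (\<Oplus>\<^bsub>M\<^esub> l\<in>bas P (j - 1). mat (cone R y P) j (Suc (2 * k)) (Suc (2 * l)) \<odot>\<^bsub>M\<^esub> z (Suc (2 * l)))"
    unfolding cob_def using z' y by (intro finsum_bas_cone[OF P]) (auto simp: bas_cone mat_cone Pi_def)
  also have "(\<Oplus>\<^bsub>M\<^esub> l\<in>bas P (j - 1). mat (cone R y P) j (Suc (2 * k)) (Suc (2 * l)) \<odot>\<^bsub>M\<^esub> z (Suc (2 * l)))
     = (\<Oplus>\<^bsub>M\<^esub> l\<in>bas P (j - 1). mat P (j - 1) k l \<odot>\<^bsub>M\<^esub> (\<ominus>\<^bsub>M\<^esub> z (Suc (2 * l))))"
    using z' by (intro M.finsum_cong') (auto simp: mat_cone Pi_def smult_l_minus smult_r_minus)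
  also have "\<dots> = \<ominus>\<^bsub>M\<^esub> cob M P (j - 1) (\<lambda>l. z (Suc (2 * l))) k"
    using cob_neg[OF P z'(2), of k] by (simp add: cob_def)
  also have "(\<Oplus>\<^bsub>M\<^esub> l\<in>bas P j. mat (cone R y P) j (Suc (2 * k)) (2 * l) \<odot>\<^bsub>M\<^esub> z (2 * l))
     = (\<Oplus>\<^bsub>M\<^esub> l\<in>bas P j. if k = l then y \<odot>\<^bsub>M\<^esub> z (2 * l) else \<zero>\<^bsub>M\<^esub>)"
    using z' y by (intro M.finsum_cong') (auto simp: mat_cone Pi_def)
  also have "\<dots> = y \<odot>\<^bsub>M\<^esub> z (2 * k)"
    using z' y k by (intro M.finsum_singleton) auto
  finally show ?thesis by (simp add: a_minus_def)
qed

end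

lemma (in cring) free_complex_cone:
  assumes P: "free_complex R P" and y: "y \<in> carrier R"
  shows "free_complex R (cone R y P)"
proof -
  let ?C = "cone R y P"
  interpret S: module R "self_module R" by (rule self_module)
  note [simp] = S.mat_closed[OF P]
  have closed: "mat ?C j k l \<in> carrier R" for j k l
    using y by (simp add: cone_def mat_def[of "(_, _)"])
  have 0: "(\<Oplus>l\<in>bas ?C j. mat ?C j k l \<otimes> mat ?C (j - 1) l m) = \<zero>"
    if k: "k \<in> bas ?C (j + 1)" and m: "m \<in> bas ?C (j - 1)" for j k m
  proof -
    let ?z = "\<lambda>l. mat ?C (j - 1) l m"
    have z: "?z \<in> bas ?C j \<rightarrow> carrier (self_module R)" using closed by auto
    have eq: "(\<Oplus>l\<in>bas ?C j. mat ?C j k l \<otimes> mat ?C (j - 1) l m) = cob (self_module R) ?C j ?z k"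
      by (simp add: cob_def)
    consider (ee) k' m' where "k = 2 * k'" "m = 2 * m'" "k' \<in> bas P (j + 1)" "m' \<in> bas P (j - 1)"
      | (eo) k' m' where "k = 2 * k'" "m = Suc (2 * m')" "k' \<in> bas P (j + 1)"
      | (oe) k' m' where "k = Suc (2 * k')" "m = 2 * m'" "k' \<in> bas P j" "m' \<in> bas P (j - 1)"
      | (oo) k' m' where "k = Suc (2 * k')" "m = Suc (2 * m')" "k' \<in> bas P j" "m' \<in> bas P (j - 1 - 1)"
      using k m by (auto simp: bas_cone)
    then have "cob (self_module R) ?C j ?z k = \<zero>"
    proof cases
      case ee
      then have "cob (self_module R) ?C j ?z k = (\<Oplus>l\<in>bas P j. mat P j k' l \<otimes> mat P (j - 1) l m')"
        using S.cob_cone_even[OF P z y, of k'] by (simp add: mat_cone) (simp add: cob_def)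
      then show ?thesis using free_complexD(4)[OF P] ee by simp
    next
      case eo
      then show ?thesis
        using S.cob_cone_even[OF P z y, of k'] S.cob_zero[OF P] by (simp add: mat_cone)
    next
      case oe
      have "cob (self_module R) ?C j ?z k
        = y \<otimes> mat P (j - 1) k' m' \<ominus> cob (self_module R) P (j - 1) (\<lambda>l. if l = m' then y else \<zero>) k'"
        using S.cob_cone_odd[OF P z y oe(3)] oe by (simp add: mat_cone)
      also have "cob (self_module R) P (j - 1) (\<lambda>l. if l = m' then y else \<zero>) k'
        = (\<Oplus>l\<in>bas P (j - 1). if m' = l then mat P (j - 1) k' l \<otimes> y else \<zero>)"
        unfolding cob_def using y by (simp, intro finsum_cong') auto
      also have "\<dots> = mat P (j - 1) k' m' \<otimes> y"
        using y oe S.finite_bas[OF P] by (intro finsum_singleton) auto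
      finally show ?thesis using y by (simp add: m_comm a_minus_def r_neg)
    next
      case oo
      have "cob (self_module R) ?C j ?z k
        = y \<otimes> \<zero> \<ominus> cob (self_module R) P (j - 1) (\<lambda>l. \<ominus> mat P (j - 1 - 1) l m') k'"
        using S.cob_cone_odd[OF P z y oo(3)] oo by (simp add: mat_cone)
      also have "cob (self_module R) P (j - 1) (\<lambda>l. \<ominus> mat P (j - 1 - 1) l m') k'
        = \<ominus> (\<Oplus>l\<in>bas P (j - 1). mat P (j - 1) k' l \<otimes> mat P (j - 1 - 1) l m')"
        using S.cob_neg[OF P, of "\<lambda>l. mat P (j - 1 - 1) l m'" "j - 1" k'] by (simp add: cob_def)
      also have "\<dots> = \<zero>" using free_complexD(4)[OF P, of k' "j - 1" m'] oo by simp
      finally show ?thesis using y by (simp add: a_minus_def)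
    qed
    then show ?thesis using eq by simp
  qed
  show ?thesis
    unfolding free_complex_def
    using finite_bas_cone[OF P] closed 0 free_complexD(2)[OF P] by (auto simp: bas_cone)
qed

lemma (in cring) free_complex_cones:
  "free_complex R P \<Longrightarrow> set ys \<subseteq> carrier R \<Longrightarrow> free_complex R (cones R ys P)"
  by (induct ys) (auto intro: free_complex_cone)

definition interleave :: "(nat \<Rightarrow> 'm) \<Rightarrow> (nat \<Rightarrow> 'm) \<Rightarrow> nat \<Rightarrow> 'm" where
  "interleave z w k = (if even k then z (k div 2) else w (k div 2))"

lemma interleave_simps [simp]: "interleave z w (2 * k) = z k" "interleave z w (Suc (2 * k)) = w k"
  by (simp_all add: interleave_def)

context module
begin

context
  fixes P y
  assumes P: "free_complex R P" and y: "y \<in> carrier R"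
begin

text \<open>Multiplication by \<open>y\<close> is null-homotopic on the cone; the homotopy moves the odd component to the
  even one.\<close>

lemma kills_cone_self:
  assumes U: "submodule U R M" and V: "submodule V R M"
  shows "kills M (cone R y P) i y U V"
proof (rule killsI)
  let ?C = "cone R y P"
  fix z assume z: "z \<in> bas ?C i \<rightarrow> V" "\<And>k. k \<in> bas ?C (i + 1) \<Longrightarrow> cob M ?C i z k \<in> U"
  note UD = submoduleD[OF U] and VD = submoduleD[OF V]
  have zc: "z \<in> bas ?C i \<rightarrow> carrier M" using z(1) VD(1) by auto
  define w where "w = interleave (\<lambda>l. z (Suc (2 * l))) (\<lambda>_. \<zero>\<^bsub>M\<^esub>)"
  have w: "w \<in> bas ?C (i - 1) \<rightarrow> V"
    using z(1) VD(2) by (auto simp: w_def Pi_bas_cone)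
  then have wc: "w \<in> bas ?C (i - 1) \<rightarrow> carrier M" using VD(1) by auto
  have "y \<odot>\<^bsub>M\<^esub> z k \<ominus>\<^bsub>M\<^esub> cob M ?C (i - 1) w k \<in> U" if k: "k \<in> bas ?C i" for k
  proof -
    consider (e) k' where "k = 2 * k'" "k' \<in> bas P i" | (o) k' where "k = Suc (2 * k')" "k' \<in> bas P (i - 1)"
      using k by (auto simp: bas_cone)
    then show ?thesis
    proof cases
      case e
      have "cob M ?C i z (Suc (2 * k')) \<in> U" using z(2) e by (auto simp: bas_cone)
      then show ?thesis using e cob_cone_odd[OF P zc y e(2)] cob_cone_even[OF P wc y] by (simp add: w_def)
    next
      case o
      have "z k \<in> carrier M" using zc k by auto
      moreover have "cob M ?C (i - 1) w k = y \<odot>\<^bsub>M\<^esub> z k"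
        using cob_cone_odd[OF P wc y o(2)] o calculation y cob_zero[OF P] by (simp add: w_def a_minus_def)
      ultimately show ?thesis using y UD(2) by (simp add: a_minus_def M.r_neg)
    qed
  qed
  then show "\<exists>w. w \<in> bas ?C (i - 1) \<rightarrow> V \<and>
     (\<forall>k\<in>bas ?C i. y \<odot>\<^bsub>M\<^esub> z k \<ominus>\<^bsub>M\<^esub> cob M ?C (i - 1) w k \<in> U)" using w by blast
qed

text \<open>The cohomology of the cone is an extension of a submodule of \<open>H\<^sup>i\<close> by a quotient of \<open>H\<^sup>i\<^sup>-\<^sup>1\<close>, which
  is why \<open>a\<close> has to be squared.\<close>

lemma kills_cone:
  assumes U: "submodule U R M" and V: "submodule V R M" and a: "a \<in> carrier R"
    and k1: "kills M P i a U V" and k2: "kills M P (i - 1) a U V"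
  shows "kills M (cone R y P) i (a \<otimes> a) U V"
proof (rule killsI)
  let ?C = "cone R y P"
  fix z assume z: "z \<in> bas ?C i \<rightarrow> V" "\<And>k. k \<in> bas ?C (i + 1) \<Longrightarrow> cob M ?C i z k \<in> U"
  note UD = submoduleD[OF U] and VD = submoduleD[OF V]
  have zc: "z \<in> bas ?C i \<rightarrow> carrier M" using z(1) VD(1) by auto
  define z0 z1 where "z0 = (\<lambda>l. z (2 * l))" and "z1 = (\<lambda>l. z (Suc (2 * l)))"
  have z01: "z0 \<in> bas P i \<rightarrow> V" "z1 \<in> bas P (i - 1) \<rightarrow> V" using z(1) by (auto simp: Pi_bas_cone z0_def z1_def)
  have z01c: "z0 \<in> bas P i \<rightarrow> carrier M" "z1 \<in> bas P (i - 1) \<rightarrow> carrier M" using z01 VD(1) by auto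
  have "cob M P i z0 k \<in> U" if "k \<in> bas P (i + 1)" for k
    using z(2)[of "2 * k"] that cob_cone_even[OF P zc y, of k] by (auto simp: bas_cone z0_def)
  then obtain u where u: "u \<in> bas P (i - 1) \<rightarrow> V"
    "\<And>k. k \<in> bas P i \<Longrightarrow> a \<odot>\<^bsub>M\<^esub> z0 k \<ominus>\<^bsub>M\<^esub> cob M P (i - 1) u k \<in> U"
    using killsD[OF k1 z01(1)] by blast
  have uc: "u \<in> bas P (i - 1) \<rightarrow> carrier M" using u VD(1) by auto
  define t where "t = (\<lambda>k. a \<odot>\<^bsub>M\<^esub> z1 k \<ominus>\<^bsub>M\<^esub> y \<odot>\<^bsub>M\<^esub> u k)"
  have t: "t \<in> bas P (i - 1) \<rightarrow> V"
    unfolding t_def using z01 u a y by (auto simp: Pi_def intro!: VD(4,6))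
  have "cob M P (i - 1) t k \<in> U" if k: "k \<in> bas P i" for k
  proof -
    have zk: "z0 k \<in> carrier M" using z01c k by auto
    have 1: "y \<odot>\<^bsub>M\<^esub> z0 k \<ominus>\<^bsub>M\<^esub> cob M P (i - 1) z1 k \<in> U"
      using z(2)[of "Suc (2 * k)"] k cob_cone_odd[OF P zc y k] by (auto simp: bas_cone z0_def z1_def)
    have c: "cob M P (i - 1) z1 k \<in> carrier M" "cob M P (i - 1) u k \<in> carrier M"
      using cob_closed[OF P z01c(2)] cob_closed[OF P uc] by auto
    have "cob M P (i - 1) t k = a \<odot>\<^bsub>M\<^esub> cob M P (i - 1) z1 k \<ominus>\<^bsub>M\<^esub> y \<odot>\<^bsub>M\<^esub> cob M P (i - 1) u k"
      unfolding t_def using z01c uc a y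
      by (subst cob_diff[OF P]) (auto simp: cob_smult[OF P])
    also have "\<dots> = y \<odot>\<^bsub>M\<^esub> (a \<odot>\<^bsub>M\<^esub> z0 k \<ominus>\<^bsub>M\<^esub> cob M P (i - 1) u k)
       \<ominus>\<^bsub>M\<^esub> a \<odot>\<^bsub>M\<^esub> (y \<odot>\<^bsub>M\<^esub> z0 k \<ominus>\<^bsub>M\<^esub> cob M P (i - 1) z1 k)"
      using a y c zk
      by (simp add: smult_r_distr smult_r_minus smult_commute[of a y] a_minus_def M.minus_add
          M.minus_minus M.a_ac M.r_neg1 M.r_neg2)
    finally show ?thesis using UD(6)[OF UD(4)[OF y u(2)[OF k]] UD(4)[OF a 1]] by simp
  qed
  then obtain v where v: "v \<in> bas P (i - 1 - 1) \<rightarrow> V"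
    "\<And>k. k \<in> bas P (i - 1) \<Longrightarrow> a \<odot>\<^bsub>M\<^esub> t k \<ominus>\<^bsub>M\<^esub> cob M P (i - 1 - 1) v k \<in> U"
    using killsD[OF k2 t] by auto
  have vc: "v \<in> bas P (i - 1 - 1) \<rightarrow> carrier M" using v VD(1) by auto
  define w where "w = interleave (\<lambda>l. a \<odot>\<^bsub>M\<^esub> u l) (\<lambda>l. \<ominus>\<^bsub>M\<^esub> v l)"
  have w: "w \<in> bas ?C (i - 1) \<rightarrow> V"
    using u(1) v(1) a by (auto simp: w_def bas_cone Pi_def intro!: VD(4,5))
  then have wc: "w \<in> bas ?C (i - 1) \<rightarrow> carrier M" using VD(1) by auto
  have "(a \<otimes> a) \<odot>\<^bsub>M\<^esub> z k \<ominus>\<^bsub>M\<^esub> cob M ?C (i - 1) w k \<in> U" if k: "k \<in> bas ?C i" for k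
  proof -
    have zk: "z k \<in> carrier M" using zc k by auto
    consider (e) k' where "k = 2 * k'" "k' \<in> bas P i" | (o) k' where "k = Suc (2 * k')" "k' \<in> bas P (i - 1)"
      using k by (auto simp: bas_cone)
    then show ?thesis
    proof cases
      case e
      have "cob M ?C (i - 1) w k = a \<odot>\<^bsub>M\<^esub> cob M P (i - 1) u k'"
        using cob_cone_even[OF P wc y] e uc a by (simp add: w_def cob_smult[OF P])
      then have "(a \<otimes> a) \<odot>\<^bsub>M\<^esub> z k \<ominus>\<^bsub>M\<^esub> cob M ?C (i - 1) w k
         = a \<odot>\<^bsub>M\<^esub> (a \<odot>\<^bsub>M\<^esub> z0 k' \<ominus>\<^bsub>M\<^esub> cob M P (i - 1) u k')"
        using a zk e cob_closed[OF P uc] by (simp add: z0_def smult_assoc1 smult_minus_distr)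
      then show ?thesis using u(2)[OF e(2)] UD(4)[OF a] by simp
    next
      case o
      have c: "cob M P (i - 1 - 1) v k' \<in> carrier M" "u k' \<in> carrier M" using cob_closed[OF P vc] uc o by auto
      have "cob M ?C (i - 1) w k = y \<odot>\<^bsub>M\<^esub> (a \<odot>\<^bsub>M\<^esub> u k') \<ominus>\<^bsub>M\<^esub> cob M P (i - 1 - 1) (\<lambda>l. \<ominus>\<^bsub>M\<^esub> v l) k'"
        using cob_cone_odd[OF P wc y o(2)] o by (simp add: w_def)
      also have "\<dots> = y \<odot>\<^bsub>M\<^esub> (a \<odot>\<^bsub>M\<^esub> u k') \<oplus>\<^bsub>M\<^esub> cob M P (i - 1 - 1) v k'"
        using vc c by (simp only: cob_neg[OF P vc] a_minus_def M.minus_minus)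
      finally have "(a \<otimes> a) \<odot>\<^bsub>M\<^esub> z k \<ominus>\<^bsub>M\<^esub> cob M ?C (i - 1) w k
         = a \<odot>\<^bsub>M\<^esub> t k' \<ominus>\<^bsub>M\<^esub> cob M P (i - 1 - 1) v k'"
        using a y zk o c
        by (simp add: t_def z1_def smult_assoc1 smult_r_distr smult_r_minus smult_commute[of a y]
            a_minus_def M.minus_add M.a_ac)
      then show ?thesis using v(2)[OF o(2)] by simp
    qed
  qed
  then show "\<exists>w. w \<in> bas ?C (i - 1) \<rightarrow> V \<and>
     (\<forall>k\<in>bas ?C i. (a \<otimes> a) \<odot>\<^bsub>M\<^esub> z k \<ominus>\<^bsub>M\<^esub> cob M ?C (i - 1) w k \<in> U)" using w by blast
qed

text \<open>A cocycle \<open>z\<close> of \<open>P\<close> lifts to the cocycle \<open>(z, w)\<close> of the cone as soon as \<open>y z\<close> is the coboundary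
  of \<open>w\<close>.\<close>

lemma kills_of_cone_aux:
  assumes U: "submodule U R M" and V: "submodule V R M" and s: "s \<in> carrier R"
    and k: "kills M (cone R y P) i s U V"
    and z: "z \<in> bas P i \<rightarrow> V" "\<And>k. k \<in> bas P (i + 1) \<Longrightarrow> cob M P i z k \<in> U"
    and w: "w \<in> bas P (i - 1) \<rightarrow> V"
      "\<And>k. k \<in> bas P i \<Longrightarrow> y \<odot>\<^bsub>M\<^esub> z k \<ominus>\<^bsub>M\<^esub> cob M P (i - 1) w k \<in> U"
  shows "\<exists>v. v \<in> bas P (i - 1) \<rightarrow> V \<and> (\<forall>k\<in>bas P i. s \<odot>\<^bsub>M\<^esub> z k \<ominus>\<^bsub>M\<^esub> cob M P (i - 1) v k \<in> U)"
proof -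
  let ?C = "cone R y P"
  note VD = submoduleD[OF V]
  have zw: "interleave z w \<in> bas ?C i \<rightarrow> V" using z w by (auto simp: Pi_bas_cone)
  then have zwc: "interleave z w \<in> bas ?C i \<rightarrow> carrier M" using VD(1) by auto
  have "cob M ?C i (interleave z w) k \<in> U" if k: "k \<in> bas ?C (i + 1)" for k
  proof -
    consider (e) k' where "k = 2 * k'" "k' \<in> bas P (i + 1)" | (o) k' where "k = Suc (2 * k')" "k' \<in> bas P i"
      using k by (auto simp: bas_cone)
    then show ?thesis
    proof cases
      case e
      then show ?thesis using cob_cone_even[OF P zwc y] z(2)[OF e(2)] by simp
    next
      case o
      then show ?thesis using cob_cone_odd[OF P zwc y o(2)] w(2)[OF o(2)] by simp
    qed
  qed
  then obtain t where t: "t \<in> bas ?C (i - 1) \<rightarrow> V"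
    "\<And>k. k \<in> bas ?C i \<Longrightarrow> s \<odot>\<^bsub>M\<^esub> interleave z w k \<ominus>\<^bsub>M\<^esub> cob M ?C (i - 1) t k \<in> U"
    using killsD[OF k zw] by blast
  have tc: "t \<in> bas ?C (i - 1) \<rightarrow> carrier M" using t VD(1) by auto
  have "s \<odot>\<^bsub>M\<^esub> z k \<ominus>\<^bsub>M\<^esub> cob M P (i - 1) (\<lambda>l. t (2 * l)) k \<in> U" if k: "k \<in> bas P i" for k
    using t(2)[of "2 * k"] k cob_cone_even[OF P tc y, of k] by (auto simp: bas_cone)
  moreover have "(\<lambda>l. t (2 * l)) \<in> bas P (i - 1) \<rightarrow> V" using t(1) by (auto simp: Pi_bas_cone)
  ultimately show ?thesis by blast
qed

lemma kills_of_cone_annihilator: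
  assumes U: "submodule U R M" and V: "submodule V R M" and s: "s \<in> carrier R"
    and k: "kills M (cone R y P) i s U V" and ann: "\<And>v. v \<in> V \<Longrightarrow> y \<odot>\<^bsub>M\<^esub> v \<in> U"
  shows "kills M P i s U V"
proof (rule killsI)
  fix z assume z: "z \<in> bas P i \<rightarrow> V" "\<And>k. k \<in> bas P (i + 1) \<Longrightarrow> cob M P i z k \<in> U"
  show "\<exists>v. v \<in> bas P (i - 1) \<rightarrow> V \<and> (\<forall>k\<in>bas P i. s \<odot>\<^bsub>M\<^esub> z k \<ominus>\<^bsub>M\<^esub> cob M P (i - 1) v k \<in> U)"
  proof (rule kills_of_cone_aux[OF U V s k z])
    show "(\<lambda>_. \<zero>\<^bsub>M\<^esub>) \<in> bas P (i - 1) \<rightarrow> V" using submoduleD(2)[OF V] by auto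
    fix k assume "k \<in> bas P i"
    then have "y \<odot>\<^bsub>M\<^esub> z k \<in> U" using z(1) ann by auto
    then show "y \<odot>\<^bsub>M\<^esub> z k \<ominus>\<^bsub>M\<^esub> cob M P (i - 1) (\<lambda>_. \<zero>\<^bsub>M\<^esub>) k \<in> U"
      using submoduleD[OF U] by (auto simp: cob_zero[OF P])
  qed
qed

lemma kills_of_cone:
  assumes U: "submodule U R M" and V: "submodule V R M" and s: "s \<in> carrier R" and a: "a \<in> carrier R"
    and k: "kills M (cone R y P) i s U V" and k': "kills M P i (y \<otimes> a) U V"
  shows "kills M P i (s \<otimes> a) U V"
proof (rule killsI)
  note VD = submoduleD[OF V]
  fix z assume z: "z \<in> bas P i \<rightarrow> V" "\<And>k. k \<in> bas P (i + 1) \<Longrightarrow> cob M P i z k \<in> U"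
  have zc: "z \<in> bas P i \<rightarrow> carrier M" using z(1) VD(1) by auto
  obtain w where w: "w \<in> bas P (i - 1) \<rightarrow> V"
    "\<And>k. k \<in> bas P i \<Longrightarrow> (y \<otimes> a) \<odot>\<^bsub>M\<^esub> z k \<ominus>\<^bsub>M\<^esub> cob M P (i - 1) w k \<in> U"
    using killsD[OF k' z] by blast
  have "\<exists>v. v \<in> bas P (i - 1) \<rightarrow> V \<and>
     (\<forall>k\<in>bas P i. s \<odot>\<^bsub>M\<^esub> (a \<odot>\<^bsub>M\<^esub> z k) \<ominus>\<^bsub>M\<^esub> cob M P (i - 1) v k \<in> U)"
  proof (rule kills_of_cone_aux[OF U V s k _ _ w(1)])
    show "(\<lambda>k. a \<odot>\<^bsub>M\<^esub> z k) \<in> bas P i \<rightarrow> V" using z(1) VD(4)[OF a] by auto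
    show "cob M P i (\<lambda>k. a \<odot>\<^bsub>M\<^esub> z k) k \<in> U" if "k \<in> bas P (i + 1)" for k
      using submoduleD(4)[OF U a z(2)[OF that]] zc a by (simp add: cob_smult[OF P])
    show "y \<odot>\<^bsub>M\<^esub> (a \<odot>\<^bsub>M\<^esub> z k) \<ominus>\<^bsub>M\<^esub> cob M P (i - 1) w k \<in> U" if "k \<in> bas P i" for k
      using w(2)[OF that] zc that a y by (auto simp: smult_assoc1 Pi_def)
  qed
  then obtain v where v: "v \<in> bas P (i - 1) \<rightarrow> V"
     "\<forall>k\<in>bas P i. s \<odot>\<^bsub>M\<^esub> (a \<odot>\<^bsub>M\<^esub> z k) \<ominus>\<^bsub>M\<^esub> cob M P (i - 1) v k \<in> U" by blast
  have "(s \<otimes> a) \<odot>\<^bsub>M\<^esub> z k \<ominus>\<^bsub>M\<^esub> cob M P (i - 1) v k \<in> U" if "k \<in> bas P i" for k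
    using v(2) zc that a s by (auto simp: smult_assoc1 Pi_def)
  then show "\<exists>v. v \<in> bas P (i - 1) \<rightarrow> V \<and>
     (\<forall>k\<in>bas P i. (s \<otimes> a) \<odot>\<^bsub>M\<^esub> z k \<ominus>\<^bsub>M\<^esub> cob M P (i - 1) v k \<in> U)" using v(1) by blast
qed

end

text \<open>Vanishing below a degree passes to cones without any loss, since \<open>\<one>\<close> equals its square.\<close>

lemma kills_cones_one:
  assumes P: "free_complex R P" and ys: "set ys \<subseteq> carrier R"
    and U: "submodule U R M" and V: "submodule V R M"
    and k: "\<And>j. j < c \<Longrightarrow> kills M P j \<one> U V" and i: "i < c"
  shows "kills M (cones R ys P) i \<one> U V"
  using ys i
proof (induct ys arbitrary: i)
  case Nil
  then show ?case using k by simp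
next
  case (Cons y ys)
  then show ?case
    using kills_cone[OF free_complex_cones[OF P], of ys y U V \<one> i, OF _ _ U V] R.l_one by fastforce
qed

lemma kills_cones_mem:
  assumes P: "free_complex R P" and ys: "set ys \<subseteq> carrier R" and x: "x \<in> set ys"
    and U: "submodule U R M" and V: "submodule V R M"
  shows "kills M (cones R ys P) i (x [^] ((2::nat) ^ length ys)) U V"
  using ys x
proof (induct ys arbitrary: i)
  case (Cons y ys)
  have C: "free_complex R (cones R ys P)" using free_complex_cones[OF P] Cons by auto
  have xy: "x \<in> carrier R" "y \<in> carrier R" using Cons by auto
  have e: "x [^] ((2::nat) ^ length (y # ys)) = x [^] ((2::nat) ^ length ys) \<otimes> x [^] ((2::nat) ^ length ys)"
    using xy by (simp add: R.nat_pow_mult mult_2)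
  show ?case
  proof (cases "x \<in> set ys")
    case True
    then have "kills M (cones R ys P) j (x [^] ((2::nat) ^ length ys)) U V" for j using Cons by auto
    then show ?thesis unfolding e using kills_cone[OF C xy(2) U V] xy by simp
  next
    case False
    then have "x = y" using Cons by auto
    have "(1::nat) \<le> 2 ^ length (y # ys)" by simp
    then obtain n where n: "(2::nat) ^ length (y # ys) = Suc n" by (metis Suc_le_D One_nat_def)
    have "kills M (cones R (y # ys) P) i (x [^] n \<otimes> x) U V"
      using kills_mult[OF free_complex_cone[OF C xy(2)] U V, of x "x [^] n" i] xy
        kills_cone_self[OF C xy(2) U V] \<open>x = y\<close> by simp
    then show ?thesis unfolding n by simp
  qed
qed simp

lemma kills_of_cones_annihilator:
  assumes P: "free_complex R P" and ys: "set ys \<subseteq> carrier R"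
    and U: "submodule U R M" and V: "submodule V R M" and s: "s \<in> carrier R"
    and ann: "\<And>y v. y \<in> set ys \<Longrightarrow> v \<in> V \<Longrightarrow> y \<odot>\<^bsub>M\<^esub> v \<in> U"
    and k: "kills M (cones R ys P) i s U V"
  shows "kills M P i s U V"
  using ys ann k
proof (induct ys)
  case (Cons y ys)
  then show ?case
    using kills_of_cone_annihilator[OF free_complex_cones[OF P], of ys y U V s i] U V s by simp
qed simp

end

section \<open>Ideals of a noetherian ring\<close>

locale noetherian_cring = cring R + noetherian_ring R for R (structure)

definition colon :: "('r, 'x) ring_scheme \<Rightarrow> ('r, 'm, 'y) module_scheme \<Rightarrow> 'm set \<Rightarrow> 'm \<Rightarrow> 'r set" where
  "colon R M U m = {a \<in> carrier R. a \<odot>\<^bsub>M\<^esub> m \<in> U}"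

definition sat :: "('r, 'x) ring_scheme \<Rightarrow> ('r, 'm, 'y) module_scheme \<Rightarrow> 'r set \<Rightarrow> 'm set \<Rightarrow> 'm set" where
  "sat R M q U = {v \<in> carrier M. \<exists>f\<in>carrier R - q. f \<odot>\<^bsub>M\<^esub> v \<in> U}"

context cring
begin

lemma submodule_self_iff: "submodule J R (self_module R) \<longleftrightarrow> ideal J R"
proof
  interpret S: module R "self_module R" by (rule self_module)
  assume J: "submodule J R (self_module R)"
  show "ideal J R"
  proof (rule idealI[OF ring_axioms])
    show "subgroup J (add_monoid R)"
      using S.submoduleD[OF J] by (intro add.subgroupI) (auto simp: a_inv_def[symmetric])
    show "x \<otimes> a \<in> J" if "a \<in> J" "x \<in> carrier R" for a x
      using S.submoduleD(4)[OF J] that by simp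
    then show "a \<otimes> x \<in> J" if "a \<in> J" "x \<in> carrier R" for a x
      using S.submoduleD(1)[OF J] that m_comm[of a x] by simp
  qed
next
  interpret S: module R "self_module R" by (rule self_module)
  assume "ideal J R"
  then interpret ideal J R .
  show "submodule J R (self_module R)"
    by (rule S.submoduleI) (use a_subset I_l_closed in \<open>auto simp: a_closed\<close>)
qed

lemma colon_self [simp]: "colon R (self_module R) J a = {r \<in> carrier R. r \<otimes> a \<in> J}"
  by (simp add: colon_def)

lemma ideal_colon: "ideal J R \<Longrightarrow> a \<in> carrier R \<Longrightarrow> ideal (colon R (self_module R) J a) R"
proof -
  assume J: "ideal J R" and a: "a \<in> carrier R"
  interpret S: module R "self_module R" by (rule self_module)
  interpret ideal J R by fact
  show ?thesis
    unfolding submodule_self_iff[symmetric] using a I_l_closed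
    by (intro S.submoduleI) (auto simp: l_distr l_minus m_assoc a_closed)
qed

lemma ideal_plus_gen:
  assumes "ideal J R" "a \<in> carrier R"
  shows "ideal (plus_gen R (self_module R) J a) R" "J \<subseteq> plus_gen R (self_module R) J a"
    "a \<in> plus_gen R (self_module R) J a"
  using module.submodule_plus_gen[OF self_module, of J a] assms
  by (auto simp: submodule_self_iff)

lemma plus_mult_self: "a \<in> carrier R \<Longrightarrow> J \<subseteq> carrier R \<Longrightarrow>
    plus_mult (self_module R) J a (carrier R) = plus_gen R (self_module R) J a"
  unfolding plus_mult_def plus_gen_def by (auto, metis m_comm, metis m_comm)

end

context noetherian_cring
begin

lemma wf_ideal: "wf {(J', J). ideal J R \<and> ideal J' R \<and> J \<subset> J'}"
  unfolding wf_iff_no_infinite_down_chain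
proof
  assume "\<exists>f. \<forall>n. (f (Suc n), f n) \<in> {(J', J). ideal J R \<and> ideal J' R \<and> J \<subset> J'}"
  then obtain f where f: "(f (Suc n), f n) \<in> {(J', J). ideal J R \<and> ideal J' R \<and> J \<subset> J'}" for n
    by blast
  have lt: "f n \<subset> f (Suc n)" and id: "ideal (f n) R" for n using f[of n] by auto
  have mono: "f m \<subseteq> f n" if "m \<le> n" for m n using lift_Suc_mono_le[of f, OF _ that] lt by blast
  have "subset.chain {I. ideal I R} (range f)"
    unfolding subset_chain_def using id mono nat_le_linear by (auto simp del: subset_iff) blast
  then have "\<Union> (range f) \<in> range f" by (intro ideal_chain_is_trivial) auto
  then obtain m where "\<Union> (range f) = f m" by auto
  then show False using lt[of m] by blast
qed

lemma ideal_less_induct [consumes 1, case_names less]: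
  assumes "ideal I R"
    and "\<And>J. ideal J R \<Longrightarrow> (\<And>J'. ideal J' R \<Longrightarrow> J \<subset> J' \<Longrightarrow> \<Phi> J') \<Longrightarrow> \<Phi> J"
  shows "\<Phi> I"
  using assms(1)
proof (induct I rule: wf_induct_rule[OF wf_ideal])
  case (1 J)
  show ?case
  proof (rule assms(2)[OF 1(2)])
    fix J' assume "ideal J' R" "J \<subset> J'"
    then show "\<Phi> J'" using 1(1)[of J'] 1(2) by simp
  qed
qed

text \<open>A noetherian induction that replaces prime filtrations: if \<open>J\<close> is neither prime nor the whole ring,
  then \<open>a b \<in> J\<close> for some \<open>a, b \<notin> J\<close>, both \<open>J : a\<close> and \<open>J + R a\<close> are larger than \<open>J\<close>, and \<open>R / J\<close> is an
  extension of \<open>R / (J + R a)\<close> by \<open>R / (J : a)\<close>.\<close>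

lemma ideal_factor_induct [consumes 1, case_names carrier prime factor]:
  assumes I: "ideal I R"
    and carrier: "\<Phi> (carrier R)"
    and prime: "\<And>q. primeideal q R \<Longrightarrow> (\<And>J. ideal J R \<Longrightarrow> q \<subset> J \<Longrightarrow> \<Phi> J) \<Longrightarrow> \<Phi> q"
    and factor: "\<And>J a. \<lbrakk>ideal J R; a \<in> carrier R; \<Phi> (colon R (self_module R) J a);
        \<Phi> (plus_gen R (self_module R) J a)\<rbrakk> \<Longrightarrow> \<Phi> J"
  shows "\<Phi> I"
  using I
proof (induct I rule: ideal_less_induct)
  case (less J)
  interpret J: ideal J R by fact
  show ?case
  proof (cases "J = carrier R \<or> primeideal J R")
    case True
    then show ?thesis using carrier prime less by blast
  next
    case False
    then have "\<exists>a b. a \<in> carrier R \<and> b \<in> carrier R \<and> a \<otimes> b \<in> J \<and> a \<notin> J \<and> b \<notin> J"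
      using primeidealI[OF less(1) cring_axioms] by blast
    then obtain a b where ab: "a \<in> carrier R" "b \<in> carrier R" "a \<otimes> b \<in> J" "a \<notin> J" "b \<notin> J" by blast
    have "J \<subset> plus_gen R (self_module R) J a" using ideal_plus_gen[OF less(1) ab(1)] ab by blast
    moreover have "J \<subset> colon R (self_module R) J a"
      using ab J.I_r_closed J.a_subset m_comm by auto
    ultimately show ?thesis
      using factor[OF less(1) ab(1)] less(2) ideal_plus_gen[OF less(1) ab(1)] ideal_colon[OF less(1) ab(1)]
      by blast
  qed
qed

lemma ideal_gens:
  assumes "ideal I R"
  obtains xs where "set xs \<subseteq> I" "\<And>J. ideal J R \<Longrightarrow> set xs \<subseteq> J \<Longrightarrow> I \<subseteq> J"
proof -
  obtain A where A: "A \<subseteq> carrier R" "finite A" "I = Idl A" using finetely_gen[OF assms] by blast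
  obtain xs where "set xs = A" using finite_list[OF A(2)] by blast
  then show ?thesis using that[of xs] A genideal_self[OF A(1)] genideal_minimal by auto
qed

text \<open>A maximal element among the annihilators \<open>J : r\<close> which contain \<open>z\<close>, for \<open>r \<notin> J\<close>, is prime.\<close>

lemma associated_prime_exists:
  assumes J: "ideal J R" and z: "z \<in> carrier R" and r: "r \<in> carrier R" "r \<notin> J" "z \<otimes> r \<in> J"
  shows "\<exists>r\<in>carrier R. primeideal (colon R (self_module R) J r) R \<and> z \<in> colon R (self_module R) J r"
proof -
  let ?c = "colon R (self_module R) J"
  interpret J: ideal J R by fact
  have "\<forall>r\<in>carrier R. I = ?c r \<and> r \<notin> J \<and> z \<otimes> r \<in> J \<longrightarrow>
      (\<exists>r\<in>carrier R. primeideal (?c r) R \<and> z \<in> ?c r)" if "ideal I R" for I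
    using that
  proof (induct I rule: ideal_less_induct)
    case (less I)
    show ?case
    proof (intro ballI impI)
      fix r assume r: "r \<in> carrier R" and *: "I = ?c r \<and> r \<notin> J \<and> z \<otimes> r \<in> J"
      show "\<exists>r\<in>carrier R. primeideal (?c r) R \<and> z \<in> ?c r"
      proof (cases "\<exists>a\<in>carrier R. a \<otimes> r \<notin> J \<and> I \<noteq> ?c (a \<otimes> r)")
        case True
        then obtain a where a: "a \<in> carrier R" "a \<otimes> r \<notin> J" "I \<noteq> ?c (a \<otimes> r)" by blast
        have "x \<otimes> (a \<otimes> r) \<in> J" if "x \<in> carrier R" "x \<otimes> r \<in> J" for x
          using J.I_l_closed[OF that(2) a(1)] that a r by (simp add: m_lcomm)
        then have "I \<subset> ?c (a \<otimes> r)" "z \<otimes> (a \<otimes> r) \<in> J" using a * z by auto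
        then show ?thesis using less(2)[OF ideal_colon[OF J, of "a \<otimes> r"]] a r by blast
      next
        case no: False
        have "primeideal (?c r) R"
        proof (rule primeidealI[OF ideal_colon[OF J r] cring_axioms])
          have "\<one> \<notin> ?c r" using * r by simp
          then show "carrier R \<noteq> ?c r" by blast
          fix a b assume ab: "a \<in> carrier R" "b \<in> carrier R" "a \<otimes> b \<in> ?c r"
          show "a \<in> ?c r \<or> b \<in> ?c r"
          proof (cases "a \<otimes> r \<in> J")
            case False
            then have "I = ?c (a \<otimes> r)" using no ab(1) by blast
            moreover have "b \<in> ?c (a \<otimes> r)" using ab r by (simp add: m_assoc m_lcomm)
            ultimately show ?thesis using * by simp
          qed (use ab in simp)
        qed
        then show ?thesis using * r z by auto
      qed
    qed
  qed
  then show ?thesis using ideal_colon[OF J r(1)] r by blast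
qed

text \<open>The associated primes of an extension are among those of the two outer terms.\<close>

lemma finite_associated_primes:
  assumes "ideal J R"
  shows "finite {P. primeideal P R \<and> (\<exists>r\<in>carrier R. P = colon R (self_module R) J r)}" (is "finite (?A J)")
  using assms
proof (induct J rule: ideal_factor_induct)
  case carrier
  have "colon R (self_module R) (carrier R) r = carrier R" if "r \<in> carrier R" for r using that by auto
  then have "?A (carrier R) = {}" using primeideal.I_notcarr by blast
  then show ?case by (simp only: finite.emptyI)
next
  case (prime q)
  interpret q: primeideal q R by fact
  have "colon R (self_module R) q r = (if r \<in> q then carrier R else q)" if "r \<in> carrier R" for r
    using that q.I_prime[OF _ that] q.I_l_closed[of r] q.I_r_closed[OF _ that] q.a_subset by auto
  then have "?A q \<subseteq> {q}" using primeideal.I_notcarr by fastforce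
  then show ?case using finite_subset by blast
next
  case (factor J a)
  let ?K = "plus_gen R (self_module R) J a" and ?c = "\<lambda>J. colon R (self_module R) J"
  interpret J: ideal J R by fact
  have "?A J \<subseteq> ?A (?c J a) \<union> ?A ?K"
  proof
    fix P assume "P \<in> ?A J"
    then obtain r where P: "primeideal P R" and r: "r \<in> carrier R" "P = ?c J r" by blast
    interpret P: primeideal P R by fact
    have mem: "x \<in> P \<longleftrightarrow> x \<in> carrier R \<and> x \<otimes> r \<in> J" for x
      by (simp only: r(2) colon_self mem_Collect_eq)
    show "P \<in> ?A (?c J a) \<union> ?A ?K"
    proof (cases "\<exists>s\<in>carrier R. s \<otimes> r \<in> ?K \<and> s \<otimes> r \<notin> J")
      case True
      then obtain s where s: "s \<in> carrier R" "s \<otimes> r \<in> ?K" "s \<otimes> r \<notin> J" by blast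
      obtain j b where jb: "j \<in> J" "b \<in> carrier R" "s \<otimes> r = j \<oplus> b \<otimes> a"
        using s(2) by (auto simp: plus_gen_def)
      have jc: "j \<in> carrier R" using jb J.a_subset by auto
      have "x \<in> P \<longleftrightarrow> x \<in> ?c (?c J a) b" if x: "x \<in> carrier R" for x
      proof -
        have "s \<notin> P" using mem s(3) by blast
        then have "x \<in> P \<longleftrightarrow> x \<otimes> s \<in> P" using P.I_prime[OF x s(1)] P.I_r_closed[OF _ s(1)] by blast
        also have "\<dots> \<longleftrightarrow> x \<otimes> (s \<otimes> r) \<in> J" unfolding mem using r(1) x s(1) by (simp add: m_assoc)
        also have "x \<otimes> (s \<otimes> r) = x \<otimes> j \<oplus> x \<otimes> b \<otimes> a"
          using jb jc x factor(2) by (simp add: r_distr m_assoc)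
        also have "\<dots> \<in> J \<longleftrightarrow> x \<otimes> b \<otimes> a \<in> J"
        proof -
          have xj: "x \<otimes> j \<in> J" using J.I_l_closed[OF jb(1) x] .
          have c: "x \<otimes> j \<in> carrier R" "x \<otimes> b \<otimes> a \<in> carrier R" using x jb jc factor(2) by auto
          have "x \<otimes> b \<otimes> a \<in> J" if "x \<otimes> j \<oplus> x \<otimes> b \<otimes> a \<in> J"
            using J.a_closed[OF J.a_inv_closed[OF xj] that] c by (simp add: r_neg1)
          then show ?thesis using J.a_closed[OF xj] by blast
        qed
        finally show ?thesis using x jb by simp
      qed
      then have "P = ?c (?c J a) b" using P.a_subset by auto
      then show ?thesis using P jb(2) by blast
    next
      case False
      then have "x \<in> P \<longleftrightarrow> x \<in> ?c ?K r" for x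
        unfolding mem colon_self mem_Collect_eq using ideal_plus_gen(2)[OF factor(1,2)] by blast
      then have "P = ?c ?K r" by blast
      then show ?thesis using P r by blast
    qed
  qed
  then show ?case using factor(3,4) finite_subset by blast
qed

lemma prime_avoidance:
  assumes "finite S" and I: "ideal I R" and "\<And>P. P \<in> S \<Longrightarrow> primeideal P R" "\<And>P. P \<in> S \<Longrightarrow> \<not> I \<subseteq> P"
  shows "\<exists>x\<in>I. \<forall>P\<in>S. x \<notin> P"
  using assms(1,3,4)
proof (induct S rule: finite_psubset_induct)
  case (psubset S)
  interpret I: ideal I R by fact
  show ?case
  proof (cases "\<exists>P\<in>S. \<exists>Q\<in>S. Q \<noteq> P \<and> Q \<subseteq> P")
    case True
    then obtain P Q where PQ: "P \<in> S" "Q \<in> S" "Q \<noteq> P" "Q \<subseteq> P" by blast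
    have "\<exists>x\<in>I. \<forall>P\<in>S - {Q}. x \<notin> P"
      by (rule psubset(2)) (use PQ psubset(3,4) in auto)
    then show ?thesis using PQ by blast
  next
    case no: False
    show ?thesis
    proof (cases "S = {}")
      case True
      then show ?thesis using I.zero_closed by blast
    next
      case False
      then obtain P where P: "P \<in> S" by blast
      interpret P: primeideal P R using psubset(3) P by blast
      have "\<exists>y\<in>I. y \<notin> P \<and> (\<forall>Q\<in>T. y \<in> Q)" if "finite T" "T \<subseteq> S - {P}" for T
        using that
      proof (induct T)
        case empty
        then show ?case using psubset(4)[OF P] by auto
      next
        case (insert Q T)
        then obtain y where y: "y \<in> I" "y \<notin> P" "\<forall>Q\<in>T. y \<in> Q" by auto
        have Q: "Q \<in> S" "Q \<noteq> P" using insert by auto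
        then obtain x where x: "x \<in> Q" "x \<notin> P" using no P by blast
        interpret Q: primeideal Q R using psubset(3) Q by blast
        have c: "x \<in> carrier R" "y \<in> carrier R" using x y Q.a_subset I.a_subset by auto
        have "x \<otimes> y \<in> I" using I.I_l_closed y c by blast
        moreover have "x \<otimes> y \<notin> P" using P.I_prime c x y by blast
        moreover have "x \<otimes> y \<in> Q" using Q.I_r_closed x c by blast
        moreover have "x \<otimes> y \<in> Q'" if "Q' \<in> T" for Q'
        proof -
          interpret Q': primeideal Q' R using psubset(3) insert that by blast
          show ?thesis using Q'.I_l_closed y that c by blast
        qed
        ultimately show ?case by blast
      qed
      from this[of "S - {P}"] obtain y where y: "y \<in> I" "y \<notin> P" "\<forall>Q\<in>S - {P}. y \<in> Q"
        using psubset(1) by blast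
      have "\<exists>x\<in>I. \<forall>Q\<in>S - {P}. x \<notin> Q"
        by (rule psubset(2)) (use P psubset(3,4) in auto)
      then obtain x where x: "x \<in> I" "\<forall>Q\<in>S - {P}. x \<notin> Q" by blast
      have c: "x \<in> carrier R" "y \<in> carrier R" using x y I.a_subset by auto
      show ?thesis
      proof (cases "x \<in> P")
        case True
        have "x \<oplus> y \<notin> Q" if Q: "Q \<in> S" for Q
        proof
          assume xy: "x \<oplus> y \<in> Q"
          interpret Q: primeideal Q R using psubset(3) Q by blast
          show False
          proof (cases "Q = P")
            case True
            then have "(\<ominus> x) \<oplus> (x \<oplus> y) \<in> P" using xy \<open>x \<in> P\<close> P.a_closed P.a_inv_closed by blast
            then show False using y c by (simp add: r_neg1)
          next
            case False
            then have "(x \<oplus> y) \<oplus> (\<ominus> y) \<in> Q" using xy y Q Q.a_closed Q.a_inv_closed by blast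
            then show False using x Q False c by (simp add: a_assoc r_neg)
          qed
        qed
        moreover have "x \<oplus> y \<in> I" using x y I.a_closed by blast
        ultimately show ?thesis by blast
      qed (use x in blast)
    qed
  qed
qed

text \<open>The ideal \<open>I\<close> is covered by the finitely many associated primes of \<open>J\<close>, so it lies in one of them.\<close>

lemma zero_divisors_annihilated:
  assumes J: "ideal J R" and I: "ideal I R"
    and zd: "\<And>z. z \<in> I \<Longrightarrow> \<exists>r\<in>carrier R - J. z \<otimes> r \<in> J"
  shows "\<exists>r\<in>carrier R - J. \<forall>x\<in>I. x \<otimes> r \<in> J"
proof -
  let ?A = "{P. primeideal P R \<and> (\<exists>r\<in>carrier R. P = colon R (self_module R) J r)}"
  interpret I: ideal I R by fact
  have "\<exists>P\<in>?A. z \<in> P" if z: "z \<in> I" for z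
  proof -
    obtain r where r: "r \<in> carrier R" "r \<notin> J" "z \<otimes> r \<in> J" using zd[OF z] by blast
    have "z \<in> carrier R" using z I.a_subset by blast
    from associated_prime_exists[OF J this r] show ?thesis by blast
  qed
  then have "\<not> (\<exists>z\<in>I. \<forall>P\<in>?A. z \<notin> P)" by blast
  then obtain P where P: "P \<in> ?A" "I \<subseteq> P"
    using prime_avoidance[OF finite_associated_primes[OF J] I] by blast
  then obtain r where r: "r \<in> carrier R" "P = colon R (self_module R) J r" by blast
  interpret J: ideal J R by fact
  have "r \<notin> J"
  proof
    assume "r \<in> J"
    then have "P = carrier R" unfolding r(2) colon_self using J.I_l_closed by blast
    then show False using P primeideal.I_notcarr by blast
  qed
  moreover have "x \<otimes> r \<in> J" if "x \<in> I" for x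
    using P(2) that unfolding r(2) colon_self by blast
  ultimately show ?thesis using r(1) by blast
qed

text \<open>Products of elements, one from each prime, stand for the product of the primes.\<close>

lemma prime_product_in_ideal:
  assumes "ideal J R"
  shows "\<exists>qs. (\<forall>q\<in>set qs. primeideal q R \<and> J \<subseteq> q) \<and>
    (\<forall>ys. list_all2 (\<in>) ys qs \<longrightarrow> foldr (\<otimes>) ys \<one> \<in> J)"
  using assms
proof (induct J rule: ideal_factor_induct)
  case carrier
  then show ?case by (intro exI[of _ "[]"]) auto
next
  case (prime q)
  interpret q: primeideal q R by fact
  show ?case using prime q.a_subset by (intro exI[of _ "[q]"]) (auto simp: list_all2_Cons2 subset_iff)
next
  case (factor J a)
  let ?K = "plus_gen R (self_module R) J a" and ?C = "colon R (self_module R) J a"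
  interpret J: ideal J R by fact
  have CK: "ideal ?C R" "ideal ?K R" "J \<subseteq> ?K" "J \<subseteq> ?C"
    using ideal_colon ideal_plus_gen factor(1,2) J.I_r_closed J.a_subset by auto
  obtain qs1 where 1: "\<forall>q\<in>set qs1. primeideal q R \<and> ?C \<subseteq> q"
    "\<And>ys. list_all2 (\<in>) ys qs1 \<Longrightarrow> foldr (\<otimes>) ys \<one> \<in> ?C" using factor(3) by blast
  obtain qs2 where 2: "\<forall>q\<in>set qs2. primeideal q R \<and> ?K \<subseteq> q"
    "\<And>ys. list_all2 (\<in>) ys qs2 \<Longrightarrow> foldr (\<otimes>) ys \<one> \<in> ?K" using factor(4) by blast
  have "foldr (\<otimes>) ys \<one> \<in> J" if ys: "list_all2 (\<in>) ys (qs1 @ qs2)" for ys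
  proof -
    obtain ys1 ys2 where y: "ys = ys1 @ ys2" "list_all2 (\<in>) ys1 qs1" "list_all2 (\<in>) ys2 qs2"
      using ys by (auto simp: list_all2_append2)
    have sub: "set ys \<subseteq> carrier R" if "list_all2 (\<in>) ys qs" "\<forall>q\<in>set qs. primeideal q R" for ys qs
      using that
    proof (induct ys qs rule: list_all2_induct)
      case (Cons y ys q qs)
      then interpret q: primeideal q R by simp
      show ?case using Cons q.a_subset by auto
    qed simp
    have ys1: "set ys1 \<subseteq> carrier R" and ys2: "set ys2 \<subseteq> carrier R" using sub y 1(1) 2(1) by blast+
    have app: "foldr (\<otimes>) (us @ vs) \<one> = foldr (\<otimes>) us \<one> \<otimes> foldr (\<otimes>) vs \<one> \<and> foldr (\<otimes>) us \<one> \<in> carrier R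
        \<and> foldr (\<otimes>) vs \<one> \<in> carrier R"
      if us: "set us \<subseteq> carrier R" and vs: "set vs \<subseteq> carrier R" for us vs
    proof -
      have v: "foldr (\<otimes>) vs \<one> \<in> carrier R" using vs by (induct vs) auto
      have u: "foldr (\<otimes>) us \<one> \<in> carrier R" using us by (induct us) auto
      have "foldr (\<otimes>) (us @ vs) \<one> = foldr (\<otimes>) us \<one> \<otimes> foldr (\<otimes>) vs \<one>"
        using us
      proof (induct us)
        case (Cons u us)
        have "foldr (\<otimes>) us \<one> \<in> carrier R" using Cons(2) by (induct us) auto
        then show ?case using Cons v by (simp add: m_assoc)
      qed (use v in simp)
      then show ?thesis using u v by simp
    qed
    have A: "foldr (\<otimes>) ys \<one> = foldr (\<otimes>) ys1 \<one> \<otimes> foldr (\<otimes>) ys2 \<one>" "foldr (\<otimes>) ys1 \<one> \<in> carrier R"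
      using app[OF ys1 ys2] y(1) by auto
    obtain j b where jb: "j \<in> J" "b \<in> carrier R" "foldr (\<otimes>) ys2 \<one> = j \<oplus> b \<otimes> a"
      using 2(2)[OF y(3)] by (auto simp: plus_gen_def)
    have C: "foldr (\<otimes>) ys1 \<one> \<otimes> a \<in> J" using 1(2)[OF y(2)] by simp
    have "foldr (\<otimes>) ys \<one> = foldr (\<otimes>) ys1 \<one> \<otimes> j \<oplus> b \<otimes> (foldr (\<otimes>) ys1 \<one> \<otimes> a)"
      unfolding A(1) jb(3) using jb A(2) factor(2) J.a_subset by (auto simp: r_distr m_lcomm)
    then show ?thesis using J.a_closed J.I_l_closed jb(1,2) A(2) C by simp
  qed
  moreover have "\<forall>q\<in>set (qs1 @ qs2). primeideal q R \<and> J \<subseteq> q"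
  proof
    fix q assume "q \<in> set (qs1 @ qs2)"
    then consider "q \<in> set qs1" | "q \<in> set qs2" by auto
    then show "primeideal q R \<and> J \<subseteq> q"
      by cases (use 1(1) CK(4) 2(1) CK(3) in \<open>meson subset_trans\<close>)+
  qed
  ultimately show ?case by blast
qed

lemma foldr_mult_split:
  assumes q: "primeideal q R" and x: "x \<in> carrier R"
    and "set ys \<subseteq> carrier R" "\<And>y. y \<in> set ys \<Longrightarrow> y = x \<or> y \<notin> q"
  shows "\<exists>s\<in>carrier R - q. \<exists>n::nat. foldr (\<otimes>) ys \<one> = s \<otimes> x [^] n"
  using assms(3,4)
proof (induct ys)
  case Nil
  interpret q: primeideal q R by fact
  have "\<one> \<notin> q" using q.I_notcarr q.one_imp_carrier by blast
  then show ?case by (intro bexI[of _ \<one>] exI[of _ 0]) auto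
next
  case (Cons y ys)
  interpret q: primeideal q R by fact
  obtain s n where s: "s \<in> carrier R" "s \<notin> q" "foldr (\<otimes>) ys \<one> = s \<otimes> x [^] (n::nat)" using Cons by auto
  show ?case
  proof (cases "y = x")
    case True
    have "foldr (\<otimes>) (y # ys) \<one> = s \<otimes> x [^] Suc n"
      using s x True by (simp add: m_ac)
    then show ?thesis using s by blast
  next
    case False
    then have "y \<notin> q" "y \<in> carrier R" using Cons by auto
    then have "y \<otimes> s \<in> carrier R - q" "foldr (\<otimes>) (y # ys) \<one> = (y \<otimes> s) \<otimes> x [^] n"
      using s x q.I_prime by (auto simp: m_assoc)
    then show ?thesis by blast
  qed
qed

text \<open>The prime \<open>q\<close> is minimal among those that contain \<open>c\<close> and lie in \<open>p\<close>; the last property says that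
  \<open>q\<close> is the radical of \<open>c\<close> locally at \<open>q\<close>. It follows from a product of primes contained in \<open>c\<close>: the
  factors other than \<open>q\<close> contain elements outside \<open>q\<close>.\<close>

lemma minimal_prime_over:
  assumes c: "ideal c R" and p: "primeideal p R" and cp: "c \<subseteq> p"
  obtains q where "primeideal q R" "c \<subseteq> q" "q \<subseteq> p"
    "\<And>x. x \<in> q \<Longrightarrow> \<exists>s\<in>carrier R - q. \<exists>n::nat. s \<otimes> x [^] n \<in> c"
proof -
  obtain qs where qs: "\<And>q. q \<in> set qs \<Longrightarrow> primeideal q R" "\<And>q. q \<in> set qs \<Longrightarrow> c \<subseteq> q"
    "\<And>ys. list_all2 (\<in>) ys qs \<Longrightarrow> foldr (\<otimes>) ys \<one> \<in> c" using prime_product_in_ideal[OF c] by blast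
  have qc: "q \<subseteq> carrier R" if "q \<in> set qs" for q
    using qs(1)[OF that] by (simp add: primeideal_def ideal_def additive_subgroup.a_subset)
  have choose: "foldr (\<otimes>) (map f qs) \<one> \<in> c" if "\<And>q. q \<in> set qs \<Longrightarrow> f q \<in> q" for f
    using that by (intro qs(3)) (auto simp: list_all2_conv_all_nth)
  define A where "A = {q \<in> set qs. q \<subseteq> p}"
  have "A \<noteq> {}"
  proof
    assume "A = {}"
    then have "\<forall>q\<in>set qs. \<exists>y. y \<in> q \<and> y \<notin> p" by (auto simp: A_def)
    then obtain f where f: "\<forall>q\<in>set qs. f q \<in> q \<and> f q \<notin> p" by (rule bchoice[THEN exE])
    then have "foldr (\<otimes>) (map f qs) \<one> \<in> p" using choose cp by blast
    moreover have "\<exists>s\<in>carrier R - p. \<exists>n::nat. foldr (\<otimes>) (map f qs) \<one> = s \<otimes> \<one> [^] n"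
      using f qc by (intro foldr_mult_split[OF p]) auto
    ultimately show False by auto
  qed
  moreover have "finite A" by (simp add: A_def)
  ultimately obtain q where q: "q \<in> A" "\<And>q'. q' \<in> A \<Longrightarrow> q' \<subseteq> q \<Longrightarrow> q = q'"
    using finite_has_minimal[of A] by blast
  have qq: "q \<in> set qs" "q \<subseteq> p" using q(1) by (auto simp: A_def)
  show ?thesis
  proof (rule that[OF qs(1)[OF qq(1)] qs(2)[OF qq(1)] qq(2)])
    fix x assume x: "x \<in> q"
    have "\<forall>Q\<in>set qs. \<exists>y. y \<in> Q \<and> (y = x \<or> y \<notin> q)"
    proof
      fix Q assume Q: "Q \<in> set qs"
      show "\<exists>y. y \<in> Q \<and> (y = x \<or> y \<notin> q)"
      proof (cases "Q \<subseteq> q")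
        case True
        then have "Q = q" using q(2)[of Q] qq Q by (auto simp: A_def)
        then show ?thesis using x by blast
      qed blast
    qed
    then obtain f where f: "\<forall>Q\<in>set qs. f Q \<in> Q \<and> (f Q = x \<or> f Q \<notin> q)" by (rule bchoice[THEN exE])
    then have "foldr (\<otimes>) (map f qs) \<one> \<in> c" using choose by blast
    moreover have "\<exists>s\<in>carrier R - q. \<exists>n::nat. foldr (\<otimes>) (map f qs) \<one> = s \<otimes> x [^] n"
      using f qc x qq by (intro foldr_mult_split[OF qs(1)[OF qq(1)]]) auto
    ultimately show "\<exists>s\<in>carrier R - q. \<exists>n::nat. s \<otimes> x [^] n \<in> c" by metis
  qed
qed

end

section \<open>Finitely generated modules and saturation\<close>

sublocale cring \<subseteq> self: module R "self_module R"
  by (rule self_module)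

definition adjoin where
  "adjoin R M U ms = foldr (\<lambda>m V. plus_gen R M V m) ms U"

lemma adjoin_simps [simp]:
  "adjoin R M U [] = U" "adjoin R M U (m # ms) = plus_gen R M (adjoin R M U ms) m"
  by (simp_all add: adjoin_def)

text \<open>Generation is expressed by submodules rather than by linear combinations, because it is only used
  to identify submodules that contain the generators.\<close>

definition generates :: "('r, 'x) ring_scheme \<Rightarrow> ('r, 'm, 'y) module_scheme \<Rightarrow> 'm list \<Rightarrow> bool" where
  "generates R M ms \<longleftrightarrow> set ms \<subseteq> carrier M \<and>
     (\<forall>V. submodule V R M \<longrightarrow> set ms \<subseteq> V \<longrightarrow> V = carrier M)"

lemma fin_gen_module_generates:
  assumes "fin_gen_module R M"
  shows "\<exists>ms. generates R M ms"
proof -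
  obtain A where A: "finite A" "A \<subseteq> carrier M" "module R M"
    "carrier M = {\<Oplus>\<^bsub>M\<^esub> a\<in>A. c a \<odot>\<^bsub>M\<^esub> a | c. c \<in> A \<rightarrow> carrier R}"
    using assms unfolding fin_gen_module_def by blast
  interpret module R M by fact
  obtain ms where ms: "set ms = A" using finite_list[OF A(1)] by blast
  have "V = carrier M" if V: "submodule V R M" "A \<subseteq> V" for V
  proof
    show "V \<subseteq> carrier M" using submoduleD(1)[OF V(1)] by blast
    show "carrier M \<subseteq> V"
    proof
      fix x assume "x \<in> carrier M"
      then obtain c where "c \<in> A \<rightarrow> carrier R" "x = (\<Oplus>\<^bsub>M\<^esub> a\<in>A. c a \<odot>\<^bsub>M\<^esub> a)" using A(4) by blast
      then show "x \<in> V" using A(1) V(2)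
        by (auto intro!: submodule_finsum[OF V(1)] submoduleD(4)[OF V(1)])
    qed
  qed
  then show ?thesis using A(2) ms unfolding generates_def by blast
qed

context module
begin

lemma submodule_adjoin:
  assumes U: "submodule U R M" and ms: "set ms \<subseteq> carrier M"
  shows "submodule (adjoin R M U ms) R M" "U \<subseteq> adjoin R M U ms" "set ms \<subseteq> adjoin R M U ms"
proof -
  have "submodule (adjoin R M U ms) R M \<and> U \<subseteq> adjoin R M U ms \<and> set ms \<subseteq> adjoin R M U ms"
    using ms
  proof (induct ms)
    case (Cons m ms)
    then have IH: "submodule (adjoin R M U ms) R M" "U \<subseteq> adjoin R M U ms" "set ms \<subseteq> adjoin R M U ms"
      and m: "m \<in> carrier M" by auto
    from submodule_plus_gen[OF IH(1) m] IH show ?case by (auto simp del: subset_iff)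
  qed (use U in simp)
  then show "submodule (adjoin R M U ms) R M" "U \<subseteq> adjoin R M U ms" "set ms \<subseteq> adjoin R M U ms" by auto
qed

lemma adjoin_generates:
  assumes "submodule U R M" "generates R M ms"
  shows "adjoin R M U ms = carrier M"
  using submodule_adjoin[OF assms(1), of ms] assms(2) unfolding generates_def by blast

lemma submodule_zero: "submodule {\<zero>\<^bsub>M\<^esub>} R M"
  by (rule submoduleI) auto

lemma submodule_Int:
  assumes "submodule U R M" "submodule V R M"
  shows "submodule (U \<inter> V) R M"
  using submoduleD[OF assms(1)] submoduleD[OF assms(2)]
  by (intro submoduleI) auto

lemma ideal_colon_module:
  assumes U: "submodule U R M" and m: "m \<in> carrier M"
  shows "ideal (colon R M U m) R"
  unfolding submodule_self_iff[symmetric] colon_def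
proof (rule self.submoduleI)
  note UD = submoduleD[OF U]
  let ?C = "{a \<in> carrier R. a \<odot>\<^bsub>M\<^esub> m \<in> U}"
  show "?C \<subseteq> carrier (self_module R)" by auto
  show "\<zero>\<^bsub>self_module R\<^esub> \<in> ?C" using UD(2) m by simp
  show "\<ominus>\<^bsub>self_module R\<^esub> a \<in> ?C" if "a \<in> ?C" for a
    using that UD(5) m by (simp add: smult_l_minus)
  show "a \<oplus>\<^bsub>self_module R\<^esub> b \<in> ?C" if "a \<in> ?C" "b \<in> ?C" for a b
    using that UD(3) m by (simp add: smult_l_distr)
  show "a \<odot>\<^bsub>self_module R\<^esub> b \<in> ?C" if "a \<in> carrier R" "b \<in> ?C" for a b
    using that UD(4) m by (simp add: smult_assoc1)
qed

lemma submodule_image_closed: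
  assumes V: "submodule V R M" and "f \<in> carrier R"
  shows "submodule {v \<in> carrier M. f \<odot>\<^bsub>M\<^esub> v \<in> V} R M"
  using submoduleD[OF V] assms(2)
  by (intro submoduleI) (auto simp: smult_r_minus smult_r_distr smult_commute[of f])

text \<open>The cyclic module generated by \<open>m\<close> modulo \<open>U\<close> is \<open>R / (U : m)\<close>.\<close>

lemma kills_cyclic:
  assumes P: "free_complex R P" and U: "submodule U R M" and m: "m \<in> carrier M" and s: "s \<in> carrier R"
  shows "kills (self_module R) P i s (colon R M U m) (carrier R) \<longleftrightarrow> kills M P i s U (plus_gen R M U m)"
proof -
  note G = submodule_plus_gen[OF U m]
  have c: "submodule (colon R M U m) R (self_module R)" "submodule (carrier R) R (self_module R)"
    using ideal_colon_module[OF U m] oneideal by (auto simp: submodule_self_iff)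
  have surj: "\<exists>v\<in>carrier R. y \<ominus>\<^bsub>M\<^esub> v \<odot>\<^bsub>M\<^esub> m \<in> U" if y: "y \<in> plus_gen R M U m" for y
  proof -
    obtain u a where ua: "u \<in> U" "a \<in> carrier R" "y = u \<oplus>\<^bsub>M\<^esub> a \<odot>\<^bsub>M\<^esub> m" using y by (auto simp: plus_gen_def)
    have "u \<in> carrier M" using ua submoduleD(1)[OF U] by blast
    then have "y \<ominus>\<^bsub>M\<^esub> a \<odot>\<^bsub>M\<^esub> m = u" using ua m by (simp add: a_minus_def M.a_assoc M.r_neg)
    then show ?thesis using ua(1,2) by (intro bexI[of _ a]) simp_all
  qed
  note iso = self.kills_iso[OF P module_axioms c(2) c(1) G(1) U s, of "\<lambda>a. a \<odot>\<^bsub>M\<^esub> m"]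
    self.kills_iso'[OF P module_axioms c(2) c(1) G(1) U s, of "\<lambda>a. a \<odot>\<^bsub>M\<^esub> m"]
  show ?thesis
  proof
    show "kills M P i s U (plus_gen R M U m)" if "kills (self_module R) P i s (colon R M U m) (carrier R)"
      by (rule iso(1)) (use that m G(3) surj in \<open>auto simp: smult_l_distr smult_assoc1 colon_def\<close>)
    show "kills (self_module R) P i s (colon R M U m) (carrier R)" if "kills M P i s U (plus_gen R M U m)"
      by (rule iso(2)) (use that m G(3) surj in \<open>auto simp: smult_l_distr smult_assoc1 colon_def\<close>)
  qed
qed

text \<open>If \<open>y\<close> is a nonzerodivisor on \<open>V / U\<close>, then \<open>V / U\<close> is isomorphic to \<open>(U + y V) / U\<close>.\<close>

lemma kills_plus_mult:
  assumes P: "free_complex R P" and U: "submodule U R M" and V: "submodule V R M" and sub: "U \<subseteq> V"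
    and y: "y \<in> carrier R" and nzd: "\<And>v. v \<in> V \<Longrightarrow> y \<odot>\<^bsub>M\<^esub> v \<in> U \<Longrightarrow> v \<in> U"
    and s: "s \<in> carrier R" and k: "kills M P i s U V"
  shows "kills M P i s U (plus_mult M U y V)"
proof -
  note G = submodule_plus_mult[OF U V y]
  note VD = submoduleD[OF V] and UD = submoduleD[OF U]
  have surj: "\<exists>v\<in>V. x \<ominus>\<^bsub>M\<^esub> y \<odot>\<^bsub>M\<^esub> v \<in> U" if x: "x \<in> plus_mult M U y V" for x
  proof -
    obtain u v where uv: "u \<in> U" "v \<in> V" "x = u \<oplus>\<^bsub>M\<^esub> y \<odot>\<^bsub>M\<^esub> v" using x by (auto simp: plus_mult_def)
    have "u \<in> carrier M" "v \<in> carrier M" using uv UD(1) VD(1) by blast+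
    then have "x \<ominus>\<^bsub>M\<^esub> y \<odot>\<^bsub>M\<^esub> v = u" using uv y by (simp add: a_minus_def M.a_assoc M.r_neg)
    then show ?thesis using uv(1,2) by (intro bexI[of _ v]) simp_all
  qed
  show ?thesis
  proof (rule kills_iso[OF P module_axioms V U G(1) U s, of "\<lambda>v. y \<odot>\<^bsub>M\<^esub> v"])
    show "y \<odot>\<^bsub>M\<^esub> v \<in> U \<longleftrightarrow> v \<in> U" if "v \<in> V" for v using that nzd UD(4) y by blast
  qed (use surj G(3) k VD(1) y in \<open>auto simp: smult_r_distr smult_commute[of y]\<close>)
qed

end

context noetherian_cring
begin

text \<open>Submodules of noetherian modules are finitely generated. The induction is on the generators of the
  ambient module: the coefficients at the first generator form an ideal, and the rest lies in a module
  with fewer generators.\<close>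

lemma generates_submodule:
  assumes M: "module R M" and gen: "generates R M ms" and V: "submodule V R M"
  shows "\<exists>vs. set vs \<subseteq> V \<and> (\<forall>X. submodule X R M \<longrightarrow> set vs \<subseteq> X \<longrightarrow> V \<subseteq> X)"
proof -
  interpret M: module R M by fact
  have "\<forall>V. submodule V R M \<longrightarrow> V \<subseteq> adjoin R M {\<zero>\<^bsub>M\<^esub>} ns \<longrightarrow>
      (\<exists>vs. set vs \<subseteq> V \<and> (\<forall>X. submodule X R M \<longrightarrow> set vs \<subseteq> X \<longrightarrow> V \<subseteq> X))"
    if "set ns \<subseteq> carrier M" for ns
    using that
  proof (induct ns)
    case Nil
    show ?case
    proof (intro allI impI)
      fix V assume "submodule V R M" "V \<subseteq> adjoin R M {\<zero>\<^bsub>M\<^esub>} []"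
      then show "\<exists>vs. set vs \<subseteq> V \<and> (\<forall>X. submodule X R M \<longrightarrow> set vs \<subseteq> X \<longrightarrow> V \<subseteq> X)"
        using M.submoduleD(2) by (intro exI[of _ "[]"]) auto
    qed
  next
    case (Cons m ns)
    let ?W = "adjoin R M {\<zero>\<^bsub>M\<^esub>} ns"
    have m: "m \<in> carrier M" and ns: "set ns \<subseteq> carrier M" using Cons(2) by auto
    have W: "submodule ?W R M" by (rule M.submodule_adjoin(1)[OF M.submodule_zero ns])
    note WD = M.submoduleD[OF W]
    show ?case
    proof (intro allI impI)
      fix V assume V: "submodule V R M" and VW: "V \<subseteq> adjoin R M {\<zero>\<^bsub>M\<^esub>} (m # ns)"
      note VD = M.submoduleD[OF V]
      define J where "J = (\<lambda>X. {a \<in> carrier R. \<exists>w\<in>?W. w \<oplus>\<^bsub>M\<^esub> a \<odot>\<^bsub>M\<^esub> m \<in> X})"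
      have J: "ideal (J X) R" if X: "submodule X R M" for X
        unfolding submodule_self_iff[symmetric]
      proof (rule self.submoduleI)
        note XD = M.submoduleD[OF X]
        show "J X \<subseteq> carrier (self_module R)" by (auto simp: J_def)
        show "\<zero>\<^bsub>self_module R\<^esub> \<in> J X" unfolding J_def using WD(2) XD(2) m
          by (auto intro!: bexI[of _ "\<zero>\<^bsub>M\<^esub>"])
        have smult: "b \<otimes> a \<in> J X" if a: "a \<in> J X" and b: "b \<in> carrier R" for a b
        proof -
          obtain w where w: "w \<in> ?W" "w \<oplus>\<^bsub>M\<^esub> a \<odot>\<^bsub>M\<^esub> m \<in> X" "a \<in> carrier R" using a by (auto simp: J_def)
          have "b \<odot>\<^bsub>M\<^esub> (w \<oplus>\<^bsub>M\<^esub> a \<odot>\<^bsub>M\<^esub> m) = b \<odot>\<^bsub>M\<^esub> w \<oplus>\<^bsub>M\<^esub> (b \<otimes> a) \<odot>\<^bsub>M\<^esub> m"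
            using w(1,3) WD(1) b m by (simp add: M.smult_r_distr M.smult_assoc1)
          then have "b \<odot>\<^bsub>M\<^esub> w \<oplus>\<^bsub>M\<^esub> (b \<otimes> a) \<odot>\<^bsub>M\<^esub> m \<in> X" using XD(4)[OF b w(2)] by simp
          then show ?thesis unfolding J_def using WD(4)[OF b w(1)] b w(3) by auto
        qed
        then show "b \<odot>\<^bsub>self_module R\<^esub> a \<in> J X" if "b \<in> carrier R" "a \<in> J X" for a b using that by simp
        show "\<ominus>\<^bsub>self_module R\<^esub> a \<in> J X" if a: "a \<in> J X" for a
          using smult[OF a, of "\<ominus> \<one>"] a by (simp add: J_def l_minus)
        show "a \<oplus>\<^bsub>self_module R\<^esub> b \<in> J X" if "a \<in> J X" and "b \<in> J X" for a b
        proof -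
          obtain w where w: "w \<in> ?W" "w \<oplus>\<^bsub>M\<^esub> a \<odot>\<^bsub>M\<^esub> m \<in> X" "a \<in> carrier R"
            using \<open>a \<in> J X\<close> by (auto simp: J_def)
          obtain v where v: "v \<in> ?W" "v \<oplus>\<^bsub>M\<^esub> b \<odot>\<^bsub>M\<^esub> m \<in> X" "b \<in> carrier R"
            using \<open>b \<in> J X\<close> by (auto simp: J_def)
          have "(w \<oplus>\<^bsub>M\<^esub> a \<odot>\<^bsub>M\<^esub> m) \<oplus>\<^bsub>M\<^esub> (v \<oplus>\<^bsub>M\<^esub> b \<odot>\<^bsub>M\<^esub> m) = (w \<oplus>\<^bsub>M\<^esub> v) \<oplus>\<^bsub>M\<^esub> (a \<oplus> b) \<odot>\<^bsub>M\<^esub> m"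
            using w(1,3) v(1,3) WD(1) m by (simp add: M.smult_l_distr M.M.a_ac)
          then have "(w \<oplus>\<^bsub>M\<^esub> v) \<oplus>\<^bsub>M\<^esub> (a \<oplus> b) \<odot>\<^bsub>M\<^esub> m \<in> X" using XD(3)[OF w(2) v(2)] by simp
          then show ?thesis unfolding J_def using WD(3)[OF w(1) v(1)] w(3) v(3) by auto
        qed
      qed
      obtain as where as: "set as \<subseteq> J V" "\<And>I. ideal I R \<Longrightarrow> set as \<subseteq> I \<Longrightarrow> J V \<subseteq> I"
        using ideal_gens[OF J[OF V]] by blast
      have "\<forall>a\<in>set as. \<exists>w. w \<in> ?W \<and> w \<oplus>\<^bsub>M\<^esub> a \<odot>\<^bsub>M\<^esub> m \<in> V" using as(1) by (auto simp: J_def)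
      then obtain w where w: "\<forall>a\<in>set as. w a \<in> ?W \<and> w a \<oplus>\<^bsub>M\<^esub> a \<odot>\<^bsub>M\<^esub> m \<in> V"
        by (rule bchoice[THEN exE])
      have VWi: "submodule (V \<inter> ?W) R M" "V \<inter> ?W \<subseteq> ?W" using M.submodule_Int[OF V W] by auto
      obtain us where us: "set us \<subseteq> V \<inter> ?W" "\<And>X. submodule X R M \<Longrightarrow> set us \<subseteq> X \<Longrightarrow> V \<inter> ?W \<subseteq> X"
        using Cons(1)[OF ns] VWi by blast
      let ?vs = "us @ map (\<lambda>a. w a \<oplus>\<^bsub>M\<^esub> a \<odot>\<^bsub>M\<^esub> m) as"
      have "V \<subseteq> X" if X: "submodule X R M" and sub: "set ?vs \<subseteq> X" for X
      proof
        fix v assume v: "v \<in> V"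
        have "set as \<subseteq> J (X \<inter> V)"
        proof
          fix a assume a: "a \<in> set as"
          then have "w a \<oplus>\<^bsub>M\<^esub> a \<odot>\<^bsub>M\<^esub> m \<in> X \<inter> V" "w a \<in> ?W" "a \<in> carrier R"
            using w sub as(1) by (auto simp: J_def)
          then show "a \<in> J (X \<inter> V)" unfolding J_def by blast
        qed
        then have JV: "J V \<subseteq> J (X \<inter> V)" using as(2)[OF J[OF M.submodule_Int[OF X V]]] by blast
        obtain u a where ua: "u \<in> ?W" "a \<in> carrier R" "v = u \<oplus>\<^bsub>M\<^esub> a \<odot>\<^bsub>M\<^esub> m"
          using v VW by (auto simp: plus_gen_def)
        have "a \<in> J V" using ua v by (auto simp: J_def)
        then obtain u' where u': "u' \<in> ?W" "u' \<oplus>\<^bsub>M\<^esub> a \<odot>\<^bsub>M\<^esub> m \<in> X" "u' \<oplus>\<^bsub>M\<^esub> a \<odot>\<^bsub>M\<^esub> m \<in> V"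
          using JV by (auto simp: J_def)
        have c: "u \<in> carrier M" "u' \<in> carrier M" using ua u' WD(1) by blast+
        have d: "v \<ominus>\<^bsub>M\<^esub> (u' \<oplus>\<^bsub>M\<^esub> a \<odot>\<^bsub>M\<^esub> m) = u \<ominus>\<^bsub>M\<^esub> u'"
          using c ua(2,3) m by (simp add: a_minus_def M.M.minus_add M.M.a_ac M.M.r_neg M.M.r_neg1 M.M.r_neg2)
        have "v \<ominus>\<^bsub>M\<^esub> (u' \<oplus>\<^bsub>M\<^esub> a \<odot>\<^bsub>M\<^esub> m) \<in> V \<inter> ?W"
          using VD(6)[OF v u'(3)] WD(6)[OF ua(1) u'(1)] d by simp
        then have "v \<ominus>\<^bsub>M\<^esub> (u' \<oplus>\<^bsub>M\<^esub> a \<odot>\<^bsub>M\<^esub> m) \<in> X" using us(2)[OF X] sub by auto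
        then show "v \<in> X"
          using M.submodule_diff_cancel[OF X VD(1)[OF v] VD(1)[OF u'(3)]] u'(2) by simp
      qed
      moreover have "set ?vs \<subseteq> V" using us(1) w by auto
      ultimately show "\<exists>vs. set vs \<subseteq> V \<and> (\<forall>X. submodule X R M \<longrightarrow> set vs \<subseteq> X \<longrightarrow> V \<subseteq> X)" by blast
    qed
  qed
  moreover have "V \<subseteq> adjoin R M {\<zero>\<^bsub>M\<^esub>} ms" "set ms \<subseteq> carrier M"
    using M.adjoin_generates[OF M.submodule_zero gen] M.submoduleD(1)[OF V] gen
    by (auto simp: generates_def)
  ultimately show ?thesis using V by blast
qed

lemma generates_self: "generates R (self_module R) [\<one>]"
  unfolding generates_def
proof (intro conjI allI impI)
  fix V assume V: "submodule V R (self_module R)" "set [\<one>] \<subseteq> V"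
  then interpret ideal V R by (simp add: submodule_self_iff)
  show "V = carrier (self_module R)" using V(2) one_imp_carrier by simp
qed simp

end

context cring
begin

lemma prime_compl_mult:
  assumes "primeideal q R" "f \<in> carrier R - q" "g \<in> carrier R - q"
  shows "f \<otimes> g \<in> carrier R - q"
  using primeideal.I_prime[OF assms(1)] assms(2,3) by blast

lemma prime_compl_one: "primeideal q R \<Longrightarrow> \<one> \<in> carrier R - q"
  using primeideal.I_notcarr ideal.one_imp_carrier[OF primeideal.axioms(1)] by blast

lemma prime_compl_pow: "primeideal q R \<Longrightarrow> f \<in> carrier R - q \<Longrightarrow> f [^] (n::nat) \<in> carrier R - q"
  by (induct n) (use prime_compl_one prime_compl_mult in auto)

end

context module
begin

context
  fixes q assumes q: "primeideal q R"
begin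

lemma submodule_sat:
  assumes U: "submodule U R M"
  shows "submodule (sat R M q U) R M" "U \<subseteq> sat R M q U" "sat R M q U \<subseteq> carrier M"
proof -
  note UD = submoduleD[OF U]
  show "U \<subseteq> sat R M q U"
    using UD(1) prime_compl_one[OF q] by (auto simp: sat_def intro!: bexI[of _ \<one>])
  show "submodule (sat R M q U) R M"
  proof (rule submoduleI)
    show "sat R M q U \<subseteq> carrier M" by (auto simp: sat_def)
    show "\<zero>\<^bsub>M\<^esub> \<in> sat R M q U" using UD(2) \<open>U \<subseteq> sat R M q U\<close> by blast
    show "\<ominus>\<^bsub>M\<^esub> a \<in> sat R M q U" if "a \<in> sat R M q U" for a
      using that UD(5) by (auto simp: sat_def smult_r_minus)
    show "a \<odot>\<^bsub>M\<^esub> x \<in> sat R M q U" if "a \<in> carrier R" "x \<in> sat R M q U" for a x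
      using that UD(4)[OF that(1)] by (auto simp: sat_def smult_commute[of _ a])
    show "a \<oplus>\<^bsub>M\<^esub> b \<in> sat R M q U" if ab: "a \<in> sat R M q U" "b \<in> sat R M q U" for a b
    proof -
      obtain f g where fg: "f \<in> carrier R - q" "f \<odot>\<^bsub>M\<^esub> a \<in> U" "g \<in> carrier R - q" "g \<odot>\<^bsub>M\<^esub> b \<in> U"
        using ab by (auto simp: sat_def)
      have c: "a \<in> carrier M" "b \<in> carrier M" "f \<in> carrier R" "g \<in> carrier R" using ab fg by (auto simp: sat_def)
      have "(f \<otimes> g) \<odot>\<^bsub>M\<^esub> (a \<oplus>\<^bsub>M\<^esub> b) = g \<odot>\<^bsub>M\<^esub> (f \<odot>\<^bsub>M\<^esub> a) \<oplus>\<^bsub>M\<^esub> f \<odot>\<^bsub>M\<^esub> (g \<odot>\<^bsub>M\<^esub> b)"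
        using c by (simp add: smult_r_distr smult_assoc1 smult_commute[of f g a])
      then have "(f \<otimes> g) \<odot>\<^bsub>M\<^esub> (a \<oplus>\<^bsub>M\<^esub> b) \<in> U" using UD(3)[OF UD(4)[OF c(4) fg(2)] UD(4)[OF c(3) fg(4)]] by simp
      then show ?thesis using prime_compl_mult[OF q fg(1,3)] c unfolding sat_def by blast
    qed
  qed
  show "sat R M q U \<subseteq> carrier M" by (auto simp: sat_def)
qed

lemma sat_closed:
  assumes "v \<in> carrier M" "f \<in> carrier R - q" "f \<odot>\<^bsub>M\<^esub> v \<in> sat R M q U"
  shows "v \<in> sat R M q U"
proof -
  obtain g where g: "g \<in> carrier R - q" "g \<odot>\<^bsub>M\<^esub> (f \<odot>\<^bsub>M\<^esub> v) \<in> U" using assms(3) by (auto simp: sat_def)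
  then have "(g \<otimes> f) \<odot>\<^bsub>M\<^esub> v \<in> U" using assms by (simp add: smult_assoc1)
  then show ?thesis using prime_compl_mult[OF q g(1) assms(2)] assms(1) unfolding sat_def by blast
qed

text \<open>A finitely generated module that vanishes locally at \<open>q\<close> is killed by one element outside \<open>q\<close>.\<close>

lemma sat_annihilator:
  assumes N: "noetherian_ring R" and gen: "generates R M ms" and U: "submodule U R M"
  shows "\<exists>f\<in>carrier R - q. \<forall>v\<in>sat R M q U. f \<odot>\<^bsub>M\<^esub> v \<in> U"
proof -
  interpret N: noetherian_cring R
    using N cring_axioms by (simp add: noetherian_cring_def)
  obtain vs where vs: "set vs \<subseteq> sat R M q U"
    "\<And>X. submodule X R M \<Longrightarrow> set vs \<subseteq> X \<Longrightarrow> sat R M q U \<subseteq> X"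
    using N.generates_submodule[OF module_axioms gen submodule_sat(1)[OF U]] by blast
  have "\<exists>f\<in>carrier R - q. \<forall>v\<in>set ws. f \<odot>\<^bsub>M\<^esub> v \<in> U" if "set ws \<subseteq> sat R M q U" for ws
    using that
  proof (induct ws)
    case Nil
    then show ?case using prime_compl_one[OF q] by auto
  next
    case (Cons w ws)
    then obtain f where f: "f \<in> carrier R - q" "\<forall>v\<in>set ws. f \<odot>\<^bsub>M\<^esub> v \<in> U" by auto
    obtain g where g: "g \<in> carrier R - q" "g \<odot>\<^bsub>M\<^esub> w \<in> U" using Cons(2) by (auto simp: sat_def)
    have c: "f \<in> carrier R" "g \<in> carrier R" using f g by auto
    have "(f \<otimes> g) \<odot>\<^bsub>M\<^esub> v \<in> U" if v: "v \<in> set (w # ws)" for v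
    proof -
      have vc: "v \<in> carrier M" using v Cons(2) submodule_sat(3)[OF U] by blast
      show ?thesis
      proof (cases "v = w")
        case True
        then show ?thesis using submoduleD(4)[OF U c(1) g(2)] c vc by (simp add: smult_assoc1)
      next
        case False
        then have "f \<odot>\<^bsub>M\<^esub> v \<in> U" using v f by auto
        then show ?thesis using submoduleD(4)[OF U c(2)] c vc by (simp add: smult_assoc1 smult_commute[of f g])
      qed
    qed
    then show ?case using prime_compl_mult[OF q f(1) g(1)] by blast
  qed
  then obtain f where f: "f \<in> carrier R - q" "\<forall>v\<in>set vs. f \<odot>\<^bsub>M\<^esub> v \<in> U" using vs(1) by blast
  then have "sat R M q U \<subseteq> {v \<in> carrier M. f \<odot>\<^bsub>M\<^esub> v \<in> U}"
    using vs submodule_sat(3)[OF U] by (intro vs(2) submodule_image_closed[OF U]) auto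
  then show ?thesis using f(1) by blast
qed

end

end

section \<open>Near-regular sequences and residue domains\<close>

text \<open>The vanishing of \<open>H\<^sup>i(Hom(P, R))\<close> for \<open>i < g\<close>.\<close>

definition acyclic_below ::
  "('r, 'x) ring_scheme \<Rightarrow> 'r based_complex \<Rightarrow> int \<Rightarrow> bool" where
  "acyclic_below R P g \<longleftrightarrow> free_complex R P \<and>
     (\<forall>i<g. kills (self_module R) P i \<one>\<^bsub>R\<^esub> {\<zero>\<^bsub>R\<^esub>} (carrier R))"

text \<open>A sequence in \<open>q\<close> that becomes regular over \<open>R\<^sub>q\<close>: at every stage the submodule is replaced by its
  \<open>q\<close>-saturation, the preimage of its localization. The last argument is the resulting saturated
  submodule; it may be all of \<open>M\<close>, in which case the sequence can be continued by any element of \<open>q\<close>.\<close>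

inductive near_regular ::
  "('r, 'x) ring_scheme \<Rightarrow> ('r, 'm, 'y) module_scheme \<Rightarrow> 'r set \<Rightarrow> 'r list \<Rightarrow> 'm set \<Rightarrow> bool"
  for R M q where
  Nil: "near_regular R M q [] (sat R M q {\<zero>\<^bsub>M\<^esub>})"
| snoc: "near_regular R M q zs U \<Longrightarrow> z \<in> q \<Longrightarrow>
     (\<And>v. v \<in> carrier M \<Longrightarrow> z \<odot>\<^bsub>M\<^esub> v \<in> U \<Longrightarrow> v \<in> U) \<Longrightarrow>
     near_regular R M q (zs @ [z]) (sat R M q (plus_mult M U z (carrier M)))"

definition generating_list :: "('r, 'x) ring_scheme \<Rightarrow> 'r set \<Rightarrow> 'r list \<Rightarrow> bool" where
  "generating_list R q xs \<longleftrightarrow> set xs \<subseteq> q \<and> (\<forall>J. ideal J R \<longrightarrow> set xs \<subseteq> J \<longrightarrow> q \<subseteq> J)"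

text \<open>The \<open>n\<close>-th powers of the elements of \<open>X\<close> kill the cohomology of \<open>P\<close> with coefficients in any
  subquotient of \<open>M\<close>. Iterated cones have this property.\<close>

definition power_null ::
  "('r, 'x) ring_scheme \<Rightarrow> ('r, 'm, 'y) module_scheme \<Rightarrow> 'r based_complex
    \<Rightarrow> 'r set \<Rightarrow> nat \<Rightarrow> bool" where
  "power_null R M P X n \<longleftrightarrow> (\<forall>x\<in>X. \<forall>i U V. submodule U R M \<longrightarrow> submodule V R M \<longrightarrow>
     kills M P i (x [^]\<^bsub>R\<^esub> n) U V)"

text \<open>Annihilators of the cohomology with coefficients in \<open>R / q\<close> give annihilators for \<open>V / U\<close>. It
  matters that \<open>s\<close> and \<open>m\<close> do not depend on the complex, on \<open>e\<close> or on the bound \<open>c\<close> for the degrees.\<close>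

definition transfers ::
  "('r, 'x) ring_scheme \<Rightarrow> ('r, 'm, 'y) module_scheme \<Rightarrow> 'r set \<Rightarrow> 'r set \<Rightarrow> nat
    \<Rightarrow> 'm set \<Rightarrow> 'm set \<Rightarrow> 'r \<Rightarrow> nat \<Rightarrow> bool" where
  "transfers R M q X n U V s m \<longleftrightarrow> (\<forall>P c e. free_complex R P \<longrightarrow> power_null R (self_module R) P X n \<longrightarrow>
    e \<in> carrier R \<longrightarrow> (\<forall>i<c. kills (self_module R) P i e q (carrier R)) \<longrightarrow>
    (\<forall>i<c. kills M P i (s \<otimes>\<^bsub>R\<^esub> e [^]\<^bsub>R\<^esub> m) U V))"

lemma transfersD:
  "\<lbrakk>transfers R M q X n U V s m; free_complex R P; power_null R (self_module R) P X n;
    e \<in> carrier R; \<forall>i<c. kills (self_module R) P i e q (carrier R); i < c\<rbrakk>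
   \<Longrightarrow> kills M P i (s \<otimes>\<^bsub>R\<^esub> e [^]\<^bsub>R\<^esub> m) U V"
  unfolding transfers_def by blast

lemma transfersI:
  assumes "\<And>P c e i. \<lbrakk>free_complex R P; power_null R (self_module R) P X n;
    e \<in> carrier R; \<forall>i<c. kills (self_module R) P i e q (carrier R); i < c\<rbrakk>
   \<Longrightarrow> kills M P i (s \<otimes>\<^bsub>R\<^esub> e [^]\<^bsub>R\<^esub> m) U V"
  shows "transfers R M q X n U V s m"
  using assms unfolding transfers_def by blast

lemma (in module) near_regular_facts:
  assumes q: "primeideal q R" and "near_regular R M q zs U"
  shows "submodule U R M \<and> set zs \<subseteq> q \<and> (\<forall>v\<in>carrier M. \<forall>f\<in>carrier R - q. f \<odot>\<^bsub>M\<^esub> v \<in> U \<longrightarrow> v \<in> U)"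
  using assms(2)
proof induct
  case Nil
  then show ?case using submodule_sat(1)[OF q submodule_zero] sat_closed[OF q] by auto
next
  case (snoc zs U z)
  have "z \<in> carrier R" using q snoc(3) by (blast intro: ideal.Icarr primeideal.axioms(1))
  then have "submodule (plus_mult M U z (carrier M)) R M"
    using submodule_plus_mult(1) snoc carrier_is_submodule by blast
  then show ?case using submodule_sat(1)[OF q] sat_closed[OF q] snoc by auto
qed

lemma (in cring) submodule_self_simps:
  "submodule (carrier R) R (self_module R)" "submodule {\<zero>} R (self_module R)"
  using oneideal zeroideal by (auto simp: submodule_self_iff)

lemma (in cring) kills_ideal_nonzerodivisor:
  assumes P: "free_complex R P" and J: "ideal J R" and x: "x \<in> carrier R" and s: "s \<in> carrier R"
    and nzd: "\<And>v. v \<in> carrier R \<Longrightarrow> x \<otimes> v \<in> J \<Longrightarrow> v \<in> J"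
    and k: "kills (self_module R) P (i - 1) s (plus_gen R (self_module R) J x) (carrier R)"
      "kills (self_module R) P i (x [^] n) J (carrier R)"
  shows "kills (self_module R) P i (s [^] (n::nat)) J (carrier R)"
proof (rule self.kills_nonzerodivisor[OF P _ submodule_self_simps(1) _ s x])
  show sub: "J \<subseteq> carrier R" using J by (blast intro: ideal.Icarr)
  show "kills (self_module R) P (i - 1) s (plus_mult (self_module R) J x (carrier R)) (carrier R)"
    using k(1) plus_mult_self[OF x sub] by simp
qed (use J k(2) nzd in \<open>simp_all add: submodule_self_iff\<close>)

context noetherian_cring
begin

lemma generating_list_exists: "ideal I R \<Longrightarrow> \<exists>xs. generating_list R I xs"
  by (rule ideal_gens[of I]) (auto simp: generating_list_def)

text \<open>Each element of the sequence is a nonzerodivisor modulo the preceding saturated ideal, so dividing it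
  out costs one degree. Saturating costs a factor outside \<open>q\<close>.\<close>

lemma near_regular_kills:
  assumes q: "primeideal q R" and "near_regular R (self_module R) q zs b"
  shows "\<exists>f\<in>carrier R - q. \<forall>P g i. acyclic_below R P g \<longrightarrow> i + int (length zs) < g \<longrightarrow>
     kills (self_module R) P i f b (carrier R)"
  using assms(2)
proof induct
  case Nil
  let ?S = "sat R (self_module R) q {\<zero>\<^bsub>self_module R\<^esub>}"
  note S = self.submodule_sat[OF q self.submodule_zero]
  obtain f where f: "f \<in> carrier R - q" "\<forall>v\<in>?S. f \<otimes> v \<in> {\<zero>}"
    using self.sat_annihilator[OF q noetherian_ring_axioms generates_self self.submodule_zero] by auto
  have "kills (self_module R) P i f ?S (carrier R)" if P: "acyclic_below R P g" and i: "i < g" for P g i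
  proof -
    have PP: "free_complex R P" using P by (simp add: acyclic_below_def)
    have "kills (self_module R) P (i + 1) f {\<zero>} ?S"
      using f S by (intro self.kills_annihilator[OF PP]) (auto simp: submodule_self_simps)
    moreover have "kills (self_module R) P i \<one> {\<zero>} (carrier R)" using P i by (simp add: acyclic_below_def)
    ultimately have "kills (self_module R) P i (\<one> \<otimes> f) ?S (carrier R)"
      using f S by (intro self.kills_quotient[OF PP submodule_self_simps(2) S(1) submodule_self_simps(1)]) auto
    then show ?thesis using f by simp
  qed
  then show ?case using f(1) by (intro bexI[of _ f] allI impI) simp_all
next
  case (snoc zs U z)
  note U = self.near_regular_facts[OF q snoc(1)]
  have zR: "z \<in> carrier R" using q snoc(3) by (blast intro: ideal.Icarr primeideal.axioms(1))
  obtain f where f: "f \<in> carrier R - q" "\<And>P g i. acyclic_below R P g \<Longrightarrow> i + int (length zs) < g \<Longrightarrow>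
     kills (self_module R) P i f U (carrier R)" using snoc(2) by blast
  let ?W = "plus_mult (self_module R) U z (carrier R)"
  have Us: "submodule U R (self_module R)" "U \<subseteq> carrier R" using U self.submoduleD(1) by auto
  note W = self.submodule_plus_mult[OF Us(1) submodule_self_simps(1) zR]
  let ?S = "sat R (self_module R) q ?W"
  note S = self.submodule_sat[OF q W(1)]
  obtain f' where f': "f' \<in> carrier R - q" "\<forall>v\<in>?S. f' \<otimes> v \<in> ?W"
    using self.sat_annihilator[OF q noetherian_ring_axioms generates_self W(1)] by auto
  have "kills (self_module R) P i ((f \<otimes> f) \<otimes> f') ?S (carrier R)"
    if P: "acyclic_below R P g" and i: "i + int (length (zs @ [z])) < g" for P g i
  proof -
    have PP: "free_complex R P" using P by (simp add: acyclic_below_def)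
    have k1: "kills (self_module R) P (i + 1) f U ?W"
      using f(2)[OF P, of "i + 1"] i snoc(4) f(1) zR Us
      by (intro self.kills_plus_mult[OF PP Us(1) submodule_self_simps(1)]) auto
    have k2: "kills (self_module R) P i f U (carrier R)" using f(2)[OF P, of i] i by simp
    have k3: "kills (self_module R) P i (f \<otimes> f) ?W (carrier R)"
      using f k1 k2 W(2) W(4)[OF Us(2)]
      by (intro self.kills_quotient[OF PP Us(1) W(1) submodule_self_simps(1)]) auto
    have "kills (self_module R) P (i + 1) f' ?W ?S"
      using f' S by (intro self.kills_annihilator[OF PP W(1)]) auto
    then show ?thesis
      using f f' k3 S W(4)[OF Us(2)]
      by (intro self.kills_quotient[OF PP W(1) S(1) submodule_self_simps(1)]) auto
  qed
  moreover have "(f \<otimes> f) \<otimes> f' \<in> carrier R - q" by (rule prime_compl_mult[OF q prime_compl_mult[OF q f(1) f(1)] f'(1)])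
  ultimately show ?case by (intro bexI[of _ "(f \<otimes> f) \<otimes> f'"] allI impI) simp_all
qed

text \<open>A sequence that cannot be prolonged inside \<open>q\<close> exists by noetherian induction. Then \<open>q\<close> consists of
  zero divisors on \<open>R / b\<close>, so \<open>R / b\<close> contains a copy of \<open>R / q\<close>, generated by \<open>r\<close>.\<close>

lemma near_regular_maximal:
  assumes q: "primeideal q R"
  shows "\<exists>zs b r. near_regular R (self_module R) q zs b \<and> b \<noteq> carrier R \<and> r \<in> carrier R \<and>
    colon R (self_module R) b r = q"
proof -
  interpret q: primeideal q R by fact
  have sub: "sat R (self_module R) q J \<subseteq> q" if "J \<subseteq> q" for J
  proof
    fix v assume "v \<in> sat R (self_module R) q J"
    then obtain f where "v \<in> carrier R" "f \<in> carrier R - q" "f \<otimes> v \<in> J" by (auto simp: sat_def)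
    then show "v \<in> q" using q.I_prime[of f v] that by blast
  qed
  have 1: "\<one> \<notin> q" using prime_compl_one[OF q] by blast
  let ?ok = "\<lambda>b. b \<subseteq> q \<and> (\<exists>zs. near_regular R (self_module R) q zs b)"
  have main: "?ok b \<longrightarrow> (\<exists>b'. ?ok b' \<and> (\<forall>z\<in>q. \<exists>r\<in>carrier R - b'. z \<otimes> r \<in> b'))" if "ideal b R" for b
    using that
  proof (induct b rule: ideal_less_induct)
    case (less b)
    show ?case
    proof (rule impI, cases "\<forall>z\<in>q. \<exists>r\<in>carrier R - b. z \<otimes> r \<in> b")
      assume b: "?ok b" and "\<not> (\<forall>z\<in>q. \<exists>r\<in>carrier R - b. z \<otimes> r \<in> b)"
      then obtain z where z: "z \<in> q" "\<And>r. r \<in> carrier R \<Longrightarrow> z \<otimes> r \<in> b \<Longrightarrow> r \<in> b" by blast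
      obtain zs where zs: "near_regular R (self_module R) q zs b" using b by blast
      have zR: "z \<in> carrier R" using z q.a_subset by blast
      have sb: "submodule b R (self_module R)" using less(1) by (simp add: submodule_self_iff)
      let ?W = "plus_mult (self_module R) b z (carrier R)"
      note W = self.submodule_plus_mult[OF sb submodule_self_simps(1) zR]
      let ?S = "sat R (self_module R) q ?W"
      note S = self.submodule_sat[OF q W(1)]
      have nr: "near_regular R (self_module R) q (zs @ [z]) ?S"
        using near_regular.snoc[OF zs z(1)] z(2) by simp
      have "?W \<subseteq> q" unfolding plus_mult_def using b z(1) q.I_r_closed q.a_closed by auto
      then have "?S \<subseteq> q" by (rule sub)
      moreover have "b \<subset> ?S"
      proof -
        have "z \<notin> b" using z(2)[of \<one>] zR b 1 by auto
        moreover have "z \<in> ?S" using W(3)[of \<one>] S(2) zR by auto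
        ultimately show ?thesis using W(2) S(2) by blast
      qed
      moreover have "ideal ?S R" using S(1) by (simp add: submodule_self_iff)
      ultimately show "\<exists>b'. ?ok b' \<and> (\<forall>z\<in>q. \<exists>r\<in>carrier R - b'. z \<otimes> r \<in> b')"
        using less(2)[of ?S] nr by blast
    qed blast
  qed
  have i0: "ideal (sat R (self_module R) q {\<zero>}) R"
    using self.submodule_sat(1)[OF q self.submodule_zero] by (simp add: submodule_self_iff)
  have ok0: "?ok (sat R (self_module R) q {\<zero>})"
    using sub[of "{\<zero>}"] near_regular.Nil[of R "self_module R" q] q.zero_closed by auto
  obtain b where b': "?ok b \<and> (\<forall>z\<in>q. \<exists>r\<in>carrier R - b. z \<otimes> r \<in> b)"
    using main[OF i0, THEN mp, OF ok0] by (rule exE)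
  then obtain zs where b: "b \<subseteq> q" "near_regular R (self_module R) q zs b" by blast
  note fb = self.near_regular_facts[OF q b(2)]
  then have ib: "ideal b R" by (simp add: submodule_self_iff)
  obtain r where r: "r \<in> carrier R - b" "\<forall>x\<in>q. x \<otimes> r \<in> b"
    using zero_divisors_annihilated[OF ib q.is_ideal] b' by blast
  have "colon R (self_module R) b r = q"
  proof
    show "colon R (self_module R) b r \<subseteq> q" using fb r by auto
    show "q \<subseteq> colon R (self_module R) b r" using r q.a_subset by auto
  qed
  then show ?thesis using b(1,2) r(1) 1 by blast
qed

text \<open>Induction over the factors of \<open>R / J\<close>. For a prime \<open>J\<close> there are three cases. If \<open>J\<close> is not contained
  in \<open>q\<close>, then \<open>R / J\<close> vanishes at \<open>q\<close>. If \<open>J = q\<close>, there is nothing to do. Otherwise some generator \<open>x\<close>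
  of \<open>q\<close> is a nonzerodivisor on \<open>R / J\<close>, and \<open>R / (J + R x)\<close> is covered by the induction hypothesis.\<close>

lemma kills_transfer_ideal:
  assumes q: "primeideal q R" and xs: "generating_list R q xs"
    and J: "ideal J R"
  shows "\<exists>s\<in>carrier R - q. \<exists>m. transfers R (self_module R) q (set xs) n J (carrier R) s m"
  using J
proof (induct J rule: ideal_factor_induct)
  case carrier
  have "kills (self_module R) P i (\<one> \<otimes> e [^] (0::nat)) (carrier R) (carrier R)"
    if "free_complex R P" "e \<in> carrier R" for P i e
    by (rule self.kills_annihilator[OF that(1)]) (auto simp: submodule_self_simps)
  then have "transfers R (self_module R) q (set xs) n (carrier R) (carrier R) \<one> 0" by (intro transfersI)
  then show ?case using prime_compl_one[OF q] by blast
next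
  case (prime J)
  interpret q: primeideal q R by fact
  interpret J: primeideal J R by fact
  have Js: "submodule J R (self_module R)" using J.is_ideal by (simp add: submodule_self_iff)
  consider "\<not> J \<subseteq> q" | "J = q" | "J \<subset> q" by blast
  then show ?case
  proof cases
    case 1
    then obtain s where s: "s \<in> J" "s \<notin> q" by blast
    have sR: "s \<in> carrier R" using s J.a_subset by blast
    have "kills (self_module R) P i (s \<otimes> e [^] (0::nat)) J (carrier R)"
      if "free_complex R P" "e \<in> carrier R" for P i e
      using s(1) sR J.I_r_closed J.a_subset
      by (intro self.kills_annihilator[OF that(1)]) (auto simp: Js submodule_self_simps)
    then have "transfers R (self_module R) q (set xs) n J (carrier R) s 0" by (intro transfersI)
    then show ?thesis using s sR by blast
  next
    case 2
    have "kills (self_module R) P i (\<one> \<otimes> e [^] (1::nat)) J (carrier R)"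
      if "e \<in> carrier R" "kills (self_module R) P i e q (carrier R)" for P i e
      using that 2 by simp
    then have "transfers R (self_module R) q (set xs) n J (carrier R) \<one> 1" by (intro transfersI) blast
    then show ?thesis using prime_compl_one[OF q] by blast
  next
    case 3
    then have "\<not> set xs \<subseteq> J" using xs J.is_ideal unfolding generating_list_def by blast
    then obtain x where x: "x \<in> set xs" "x \<notin> J" by blast
    have xR: "x \<in> carrier R" using x xs q.a_subset unfolding generating_list_def by blast
    let ?K = "plus_gen R (self_module R) J x"
    note K = ideal_plus_gen[OF J.is_ideal xR]
    obtain s m where s: "s \<in> carrier R - q"
    and tk: "transfers R (self_module R) q (set xs) n ?K (carrier R) s m"
      using prime(2)[OF K(1)] K x by blast
    note k = transfersD[OF tk]
    have "kills (self_module R) P i (s [^] n \<otimes> e [^] (m * n)) J (carrier R)"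
      if P: "free_complex R P" and null: "power_null R (self_module R) P (set xs) n"
        and e: "e \<in> carrier R" and ke: "\<forall>i<c. kills (self_module R) P i e q (carrier R)" and i: "i < c"
      for P c e i
    proof -
      have "kills (self_module R) P i (x [^] n) J (carrier R)"
        using null x Js submodule_self_simps(1) by (simp add: power_null_def)
      moreover have "kills (self_module R) P (i - 1) (s \<otimes> e [^] m) ?K (carrier R)"
        using k[OF P null e ke, of "i - 1"] i by simp
      moreover have "v \<in> J" if "v \<in> carrier R" "x \<otimes> v \<in> J" for v
        using J.I_prime[OF xR that(1)] that x(2) by blast
      ultimately have "kills (self_module R) P i ((s \<otimes> e [^] m) [^] n) J (carrier R)"
        using s e kills_ideal_nonzerodivisor[OF P J.is_ideal xR, of "s \<otimes> e [^] m" i n] by simp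
      moreover have "(s \<otimes> e [^] m) [^] n = s [^] n \<otimes> e [^] (m * n)"
        using s e by (simp add: nat_pow_distrib nat_pow_pow)
      ultimately show ?thesis by simp
    qed
    then have "transfers R (self_module R) q (set xs) n J (carrier R) (s [^] n) (m * n)"
      by (rule transfersI)
    moreover have "s [^] n \<in> carrier R - q" by (rule prime_compl_pow[OF q s])
    ultimately show ?thesis by blast
  qed
next
  case (factor J a)
  let ?K = "plus_gen R (self_module R) J a" and ?C = "colon R (self_module R) J a"
  have Js: "submodule J R (self_module R)" using factor(1) by (simp add: submodule_self_iff)
  have Ks: "submodule ?K R (self_module R)" "J \<subseteq> ?K" "?K \<subseteq> carrier R"
    using ideal_plus_gen[OF factor(1,2)] self.submoduleD(1)[of ?K] by (auto simp: submodule_self_iff)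
  obtain s m where s: "s \<in> carrier R - q"
    and tk: "transfers R (self_module R) q (set xs) n ?C (carrier R) s m"
    using factor(3) by blast
  note k = transfersD[OF tk]
  obtain s' m' where s': "s' \<in> carrier R - q"
    and tk': "transfers R (self_module R) q (set xs) n ?K (carrier R) s' m'"
    using factor(4) by blast
  note k' = transfersD[OF tk']
  have "kills (self_module R) P i ((s \<otimes> s') \<otimes> e [^] (m + m')) J (carrier R)"
    if P: "free_complex R P" and null: "power_null R (self_module R) P (set xs) n"
      and e: "e \<in> carrier R" and ke: "\<forall>i<c. kills (self_module R) P i e q (carrier R)" and i: "i < c"
    for P c e i
  proof -
    have "kills (self_module R) P i (s \<otimes> e [^] m) J ?K"
      using k[OF P null e ke i] self.kills_cyclic[OF P Js, of a "s \<otimes> e [^] m" i] factor(2) s e by simp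
    then have "kills (self_module R) P i ((s \<otimes> e [^] m) \<otimes> (s' \<otimes> e [^] m')) J (carrier R)"
      using k'[OF P null e ke i] s s' e Ks
      by (intro self.kills_extension[OF P Js Ks(1) submodule_self_simps(1)]) auto
    moreover have "(s \<otimes> e [^] m) \<otimes> (s' \<otimes> e [^] m') = (s \<otimes> s') \<otimes> e [^] (m + m')"
      using s s' e by (simp add: nat_pow_mult[symmetric] m_ac)
    ultimately show ?thesis by simp
  qed
  then have "transfers R (self_module R) q (set xs) n J (carrier R) (s \<otimes> s') (m + m')"
    by (rule transfersI)
  moreover have "s \<otimes> s' \<in> carrier R - q" by (rule prime_compl_mult[OF q s s'])
  ultimately show ?case by blast
qed

lemma kills_transfer_module:
  assumes q: "primeideal q R" and xs: "generating_list R q xs"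
    and M: "module R M" and U: "submodule U R M" and ms: "set ms \<subseteq> carrier M"
  shows "\<exists>s\<in>carrier R - q. \<exists>m. transfers R M q (set xs) n U (adjoin R M U ms) s m"
  using ms
proof (induct ms)
  case Nil
  interpret M: module R M by fact
  have "kills M P i (\<one> \<otimes> e [^] (0::nat)) U (adjoin R M U [])"
    if "free_complex R P" "e \<in> carrier R" for P i e
    using M.submoduleD[OF U] by (intro M.kills_annihilator[OF that(1) U]) auto
  then have "transfers R M q (set xs) n U (adjoin R M U []) \<one> 0" by (intro transfersI)
  then show ?case using prime_compl_one[OF q] by blast
next
  case (Cons x ms)
  interpret M: module R M by fact
  let ?V = "adjoin R M U ms"
  have x: "x \<in> carrier M" and ms: "set ms \<subseteq> carrier M" using Cons(2) by auto
  note V = M.submodule_adjoin[OF U ms] and W = M.submodule_plus_gen[OF M.submodule_adjoin(1)[OF U ms] x]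
  obtain s m where s: "s \<in> carrier R - q"
    and tk: "transfers R M q (set xs) n U ?V s m"
    using Cons(1)[OF ms] by blast
  note k = transfersD[OF tk]
  obtain s' m' where s': "s' \<in> carrier R - q"
    and tk': "transfers R (self_module R) q (set xs) n (colon R M ?V x) (carrier R) s' m'"
    using kills_transfer_ideal[OF q xs M.ideal_colon_module[OF V(1) x]] by blast
  note k' = transfersD[OF tk']
  have "kills M P i ((s \<otimes> s') \<otimes> e [^] (m + m')) U (adjoin R M U (x # ms))"
    if P: "free_complex R P" and null: "power_null R (self_module R) P (set xs) n"
      and e: "e \<in> carrier R" and ke: "\<forall>i<c. kills (self_module R) P i e q (carrier R)" and i: "i < c"
    for P c e i
  proof -
    have "kills M P i (s' \<otimes> e [^] m') ?V (plus_gen R M ?V x)"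
      using k'[OF P null e ke i] M.kills_cyclic[OF P V(1) x, of "s' \<otimes> e [^] m'" i] s' e by simp
    then have "kills M P i ((s \<otimes> e [^] m) \<otimes> (s' \<otimes> e [^] m')) U (plus_gen R M ?V x)"
      using k[OF P null e ke i] s s' e V W
      by (intro M.kills_extension[OF P U V(1) W(1)]) auto
    moreover have "(s \<otimes> e [^] m) \<otimes> (s' \<otimes> e [^] m') = (s \<otimes> s') \<otimes> e [^] (m + m')"
      using s s' e by (simp add: nat_pow_mult[symmetric] m_ac)
    ultimately show ?thesis by simp
  qed
  then have "transfers R M q (set xs) n U (adjoin R M U (x # ms)) (s \<otimes> s') (m + m')"
    by (rule transfersI)
  moreover have "s \<otimes> s' \<in> carrier R - q" by (rule prime_compl_mult[OF q s s'])
  ultimately show ?case by blast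
qed

text \<open>From \<open>0 \<rightarrow> R / q \<rightarrow> R / b \<rightarrow> R / (b + R r) \<rightarrow> 0\<close>: the middle term is killed in degree \<open>i\<close>, and the right
  term in degree \<open>i - 1\<close>, to which the annihilation of \<open>R / q\<close> in degrees below \<open>i\<close> transfers.\<close>

lemma kills_residue_step:
  assumes q: "primeideal q R" and xs: "generating_list R q xs"
    and zs: "near_regular R (self_module R) q zs b" and r: "r \<in> carrier R" "colon R (self_module R) b r = q"
  shows "\<exists>f\<in>carrier R - q. \<exists>m::nat. \<forall>P g e i. acyclic_below R P g \<longrightarrow>
    power_null R (self_module R) P (set xs) n \<longrightarrow> e \<in> carrier R \<longrightarrow> i + int (length zs) < g \<longrightarrow>
    (\<forall>j<i. kills (self_module R) P j e q (carrier R)) \<longrightarrow>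
    kills (self_module R) P i (f \<otimes> e [^] m) q (carrier R)"
proof -
  have b: "submodule b R (self_module R)" "ideal b R"
    using self.near_regular_facts[OF q zs] by (auto simp: submodule_self_iff)
  let ?K = "plus_gen R (self_module R) b r"
  have K: "submodule ?K R (self_module R)" "b \<subseteq> ?K" "?K \<subseteq> carrier R" "ideal ?K R"
    using ideal_plus_gen[OF b(2) r(1)] self.submoduleD(1)[of ?K] by (auto simp: submodule_self_iff)
  obtain f where f: "f \<in> carrier R - q" "\<And>P g i. acyclic_below R P g \<Longrightarrow> i + int (length zs) < g \<Longrightarrow>
     kills (self_module R) P i f b (carrier R)" using near_regular_kills[OF q zs] by blast
  obtain s m where s: "s \<in> carrier R - q"
    and tk: "transfers R (self_module R) q (set xs) n ?K (carrier R) s m"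
    using kills_transfer_ideal[OF q xs K(4)] by blast
  note k = transfersD[OF tk]
  have "kills (self_module R) P i ((s \<otimes> f) \<otimes> e [^] m) q (carrier R)"
    if P: "acyclic_below R P g" and null: "power_null R (self_module R) P (set xs) n" and e: "e \<in> carrier R"
      and i: "i + int (length zs) < g" and ke: "\<forall>j<i. kills (self_module R) P j e q (carrier R)" for P g e i
  proof -
    have PP: "free_complex R P" using P by (simp add: acyclic_below_def)
    have "kills (self_module R) P (i - 1) (s \<otimes> e [^] m) ?K (carrier R)"
      using k[OF PP null e ke, of "i - 1"] by simp
    then have "kills (self_module R) P i ((s \<otimes> e [^] m) \<otimes> f) b ?K"
      using f(2)[OF P i] s f(1) e K
      by (intro self.kills_submodule[OF PP b(1) K(1) submodule_self_simps(1)]) auto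
    then have "kills (self_module R) P i ((s \<otimes> e [^] m) \<otimes> f) q (carrier R)"
      using self.kills_cyclic[OF PP b(1), of r "(s \<otimes> e [^] m) \<otimes> f" i] r s f e by simp
    moreover have "(s \<otimes> e [^] m) \<otimes> f = (s \<otimes> f) \<otimes> e [^] m" using s f e by (simp add: m_ac)
    ultimately show ?thesis by simp
  qed
  moreover have "s \<otimes> f \<in> carrier R - q" by (rule prime_compl_mult[OF q s f(1)])
  ultimately show ?thesis by blast
qed

lemma power_null_cones:
  assumes M: "module R M" and P: "free_complex R P" and ys: "set ys \<subseteq> carrier R"
  shows "power_null R M (cones R ys P) (set ys) (2 ^ length ys)"
  unfolding power_null_def using module.kills_cones_mem[OF M P ys] by blast

lemma acyclic_below_cones:
  assumes P: "acyclic_below R P g" and ys: "set ys \<subseteq> carrier R"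
  shows "acyclic_below R (cones R ys P) g"
  using P free_complex_cones[of P ys, OF _ ys]
    self.kills_cones_one[of P ys "{\<zero>}" "carrier R" g, OF _ ys submodule_self_simps(2,1)]
  unfolding acyclic_below_def by blast

text \<open>The large restricted flat dimension of \<open>R / J\<close> over \<open>R\<close> is finite. For a prime \<open>q\<close> one may pass to an
  iterated cone, and then \<open>R / q\<close> is treated by induction on the degree. If the cohomology of \<open>R / q\<close>
  vanishes in all lower degrees, it is killed in the next degree by an element \<open>f \<notin> q\<close> that depends
  on nothing. As \<open>f\<close> is a nonzerodivisor on \<open>R / q\<close> and the cohomology of \<open>R / (q + R f)\<close> vanishes by
  noetherian induction, it vanishes in this degree too. There is no loss, so the induction may have
  any length.\<close>

lemma kills_bounded_slack:
  assumes J: "ideal J R"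
  shows "\<exists>k::nat. \<forall>P g i. acyclic_below R P g \<longrightarrow> i + int k < g \<longrightarrow> kills (self_module R) P i \<one> J (carrier R)"
  using J
proof (induct J rule: ideal_factor_induct)
  case carrier
  have "kills (self_module R) P i \<one> (carrier R) (carrier R)" if "acyclic_below R P g" for P g i
    using that by (intro self.kills_annihilator) (auto simp: acyclic_below_def submodule_self_simps)
  then show ?case by blast
next
  case (prime q)
  interpret q: primeideal q R by fact
  have qs: "submodule q R (self_module R)" using q.is_ideal by (simp add: submodule_self_iff)
  obtain xs where xs: "generating_list R q xs" using generating_list_exists[OF q.is_ideal] by blast
  have xsR: "set xs \<subseteq> carrier R" using xs q.a_subset unfolding generating_list_def by blast
  obtain zs b r where nr: "near_regular R (self_module R) q zs b" "r \<in> carrier R" "colon R (self_module R) b r = q"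
    using near_regular_maximal[OF prime(1)] by blast
  obtain f m where f: "f \<in> carrier R - q" and step: "\<And>P g e i. acyclic_below R P g \<Longrightarrow>
    power_null R (self_module R) P (set xs) (2 ^ length xs) \<Longrightarrow> e \<in> carrier R \<Longrightarrow> i + int (length zs) < g \<Longrightarrow>
    (\<forall>j<i. kills (self_module R) P j e q (carrier R)) \<Longrightarrow>
    kills (self_module R) P i (f \<otimes> e [^] (m::nat)) q (carrier R)"
    using kills_residue_step[OF prime(1) xs nr] by blast
  let ?K = "plus_gen R (self_module R) q f"
  have fR: "f \<in> carrier R" using f by blast
  note K = ideal_plus_gen[OF q.is_ideal fR]
  obtain k where k: "\<And>P g i. acyclic_below R P g \<Longrightarrow> i + int k < g \<Longrightarrow> kills (self_module R) P i \<one> ?K (carrier R)"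
    using prime(2)[OF K(1)] K f by blast
  have "kills (self_module R) P i \<one> q (carrier R)"
    if P: "acyclic_below R P g" and i: "i + int (length zs + k) < g" for P g i
  proof -
    let ?P = "cones R xs P"
    have PP: "free_complex R P" "free_complex R ?P"
      using P free_complex_cones[OF _ xsR] by (auto simp: acyclic_below_def)
    have C: "acyclic_below R ?P g" by (rule acyclic_below_cones[OF P xsR])
    have null: "power_null R (self_module R) ?P (set xs) (2 ^ length xs)"
      by (rule power_null_cones[OF self_module PP(1) xsR])
    have nonneg: "kills (self_module R) ?P (int j) \<one> q (carrier R)" if "int j + int (length zs + k) < g" for j
      using that
    proof (induct j rule: less_induct)
      case (less j)
      have lt: "kills (self_module R) ?P i \<one> q (carrier R)" if "i < int j" for i
      proof (cases "i < 0")
        case True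
        then show ?thesis using self.kills_neg[OF PP(2)] by blast
      next
        case False
        then show ?thesis using less(1)[of "nat i"] that less(2) by simp
      qed
      have "kills (self_module R) ?P (int j) (f \<otimes> \<one> [^] m) q (carrier R)"
        using lt less(2) by (intro step[OF C null]) auto
      then have "kills (self_module R) ?P (int j) (f [^] (1::nat)) q (carrier R)" using fR by simp
      moreover have "kills (self_module R) ?P (int j - 1) \<one> ?K (carrier R)" using k[OF C] less(2) by simp
      moreover have "v \<in> q" if "v \<in> carrier R" "f \<otimes> v \<in> q" for v
        using q.I_prime[OF fR that(1)] that f by blast
      ultimately have "kills (self_module R) ?P (int j) (\<one> [^] (1::nat)) q (carrier R)"
        using kills_ideal_nonzerodivisor[OF PP(2) q.is_ideal fR one_closed, of "int j" 1] by simp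
      then show ?case by simp
    qed
    have "kills (self_module R) ?P i \<one> q (carrier R)"
      using nonneg[of "nat i"] self.kills_neg[OF PP(2), of i] i by (cases "i < 0") simp_all
    then show ?thesis
      using xs q.I_r_closed unfolding generating_list_def
      by (intro self.kills_of_cones_annihilator[OF PP(1) xsR qs submodule_self_simps(1)]) auto
  qed
  then show ?case by blast
next
  case (factor J a)
  let ?K = "plus_gen R (self_module R) J a" and ?C = "colon R (self_module R) J a"
  have Js: "submodule J R (self_module R)" using factor(1) by (simp add: submodule_self_iff)
  have Ks: "submodule ?K R (self_module R)" "J \<subseteq> ?K" "?K \<subseteq> carrier R"
    using ideal_plus_gen[OF factor(1,2)] self.submoduleD(1)[of ?K] by (auto simp: submodule_self_iff)
  obtain k where k: "\<And>P g i. acyclic_below R P g \<Longrightarrow> i + int k < g \<Longrightarrow> kills (self_module R) P i \<one> ?C (carrier R)"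
    using factor(3) by blast
  obtain k' where k': "\<And>P g i. acyclic_below R P g \<Longrightarrow> i + int k' < g \<Longrightarrow> kills (self_module R) P i \<one> ?K (carrier R)"
    using factor(4) by blast
  have "kills (self_module R) P i \<one> J (carrier R)" if P: "acyclic_below R P g" and i: "i + int (k + k') < g" for P g i
  proof -
    have PP: "free_complex R P" using P by (simp add: acyclic_below_def)
    have "kills (self_module R) P i \<one> J ?K"
      using k[OF P] i self.kills_cyclic[OF PP Js, of a \<one> i] factor(2) by simp
    then have "kills (self_module R) P i (\<one> \<otimes> \<one>) J (carrier R)"
      using k'[OF P] i Ks
      by (intro self.kills_extension[OF PP Js Ks(1) submodule_self_simps(1)]) auto
    then show ?thesis by simp
  qed
  then show ?case by blast
qed

text \<open>The residue step is iterated only for the \<open>k\<close> degrees not covered by the vanishing result; \<open>l\<close> counts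
  the distance that remains to be covered.\<close>

lemma kills_residue_uniform:
  assumes q: "primeideal q R" and xs: "generating_list R q xs"
    and zs: "near_regular R (self_module R) q zs b" and r: "r \<in> carrier R" "colon R (self_module R) b r = q"
  shows "\<exists>s\<in>carrier R - q. \<forall>P g i. acyclic_below R P g \<longrightarrow> power_null R (self_module R) P (set xs) n \<longrightarrow>
    i + int (length zs) < g \<longrightarrow> kills (self_module R) P i s q (carrier R)"
proof -
  interpret q: primeideal q R by fact
  obtain f m where f: "f \<in> carrier R - q" and bound: "\<And>P g e i. acyclic_below R P g \<Longrightarrow>
    power_null R (self_module R) P (set xs) n \<Longrightarrow> e \<in> carrier R \<Longrightarrow> i + int (length zs) < g \<Longrightarrow>
    (\<forall>j<i. kills (self_module R) P j e q (carrier R)) \<Longrightarrow>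
    kills (self_module R) P i (f \<otimes> e [^] (m::nat)) q (carrier R)"
    using kills_residue_step[OF assms] by blast
  obtain k :: nat where k: "\<And>P g i. acyclic_below R P g \<Longrightarrow> i + int k < g \<Longrightarrow> kills (self_module R) P i \<one> q (carrier R)"
    using kills_bounded_slack[OF q.is_ideal] by blast
  have "\<exists>s\<in>carrier R - q. \<forall>P g i. acyclic_below R P g \<longrightarrow> power_null R (self_module R) P (set xs) n \<longrightarrow>
    i + int (length zs + l) < g \<longrightarrow> kills (self_module R) P i s q (carrier R)" if "l \<le> k" for l
    using that
  proof (induct l rule: inc_induct)
    case base
    then show ?case using prime_compl_one[OF q] k by (intro bexI[of _ \<one>]) auto
  next
    case (step l)
    then obtain s where s: "s \<in> carrier R - q" "\<And>P g i. acyclic_below R P g \<Longrightarrow> power_null R (self_module R) P (set xs) n \<Longrightarrow>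
      i + int (length zs + Suc l) < g \<Longrightarrow> kills (self_module R) P i s q (carrier R)" by blast
    have "kills (self_module R) P i (f \<otimes> s [^] m) q (carrier R)"
      if "acyclic_below R P g" "power_null R (self_module R) P (set xs) n" "i + int (length zs + l) < g" for P g i
      using that s by (intro bound) auto
    then show ?case using prime_compl_mult[OF q f prime_compl_pow[OF q s(1)]] by blast
  qed
  from this[of 0] show ?thesis by simp
qed

end

section \<open>A uniform annihilator for the cohomology of acyclic complexes\<close>

context noetherian_cring
begin

lemma power_null_map:
  assumes "set X \<subseteq> carrier R" "power_null R M P (set (map (\<lambda>x. x [^] (n::nat)) X)) k"
  shows "power_null R M P (set X) (n * k)"
  unfolding power_null_def
proof (intro ballI allI impI)
  fix x i U V assume x: "x \<in> set X" and UV: "submodule U R M" "submodule V R M"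
  have "kills M P i ((x [^] n) [^] k) U V"
    using assms(2) x UV unfolding power_null_def set_map by blast
  then show "kills M P i (x [^] (n * k)) U V" using assms(1) x by (simp add: nat_pow_pow subset_iff)
qed

lemma common_power_multiple:
  assumes q: "primeideal q R" and c: "ideal c R" and X: "set X \<subseteq> carrier R"
    and "\<And>x. x \<in> set X \<Longrightarrow> \<exists>s\<in>carrier R - q. \<exists>n::nat. s \<otimes> x [^] n \<in> c"
  shows "\<exists>s\<in>carrier R - q. \<exists>n::nat. \<forall>x\<in>set X. s \<otimes> x [^] n \<in> c"
  using assms(3,4)
proof (induct X)
  case Nil
  then show ?case using prime_compl_one[OF q] by auto
next
  case (Cons x X)
  interpret c: ideal c R by fact
  obtain s n where s: "s \<in> carrier R - q" "\<forall>x\<in>set X. s \<otimes> x [^] (n::nat) \<in> c" using Cons by auto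
  obtain t m where t: "t \<in> carrier R - q" "t \<otimes> x [^] (m::nat) \<in> c" using Cons(3)[of x] by auto
  have cl: "s \<in> carrier R" "t \<in> carrier R" using s t by auto
  have "(s \<otimes> t) \<otimes> y [^] (n + m) \<in> c" if y: "y \<in> set (x # X)" for y
  proof -
    have yR: "y \<in> carrier R" using y Cons(2) by auto
    have e: "(s \<otimes> t) \<otimes> y [^] (n + m) = (t \<otimes> y [^] m) \<otimes> (s \<otimes> y [^] n)"
      using yR cl by (simp add: nat_pow_mult[symmetric] m_ac)
    show ?thesis
    proof (cases "y = x")
      case True
      then have "(t \<otimes> y [^] m) \<otimes> (s \<otimes> y [^] n) \<in> c" using t(2) cl yR c.I_r_closed[of "t \<otimes> y [^] m" "s \<otimes> y [^] n"] by simp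
      then show ?thesis using e by simp
    next
      case False
      then have "(t \<otimes> y [^] m) \<otimes> (s \<otimes> y [^] n) \<in> c" using s(2) y cl yR c.I_l_closed[of "s \<otimes> y [^] n" "t \<otimes> y [^] m"] by simp
      then show ?thesis using e by simp
    qed
  qed
  then show ?case using prime_compl_mult[OF q s(1) t(1)] by blast
qed

text \<open>Along the sequence \<open>ws\<close>, the annihilation for \<open>M / U\<close> climbs up to \<open>M\<close>, one degree for each
  element. Saturations cost factors outside \<open>q\<close>.\<close>

lemma kills_near_regular_descent:
  assumes q: "primeideal q R" and M: "module R M" and gen: "generates R M ms"
    and "near_regular R M q ws U"
  shows "\<exists>f\<in>carrier R - q. \<exists>l::nat. \<forall>P i s. free_complex R P \<longrightarrow> power_null R M P (set ws) n \<longrightarrow>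
    s \<in> carrier R \<longrightarrow> kills M P (i - int (length ws)) s U (carrier M) \<longrightarrow>
    kills M P i (f \<otimes> s [^] l) {\<zero>\<^bsub>M\<^esub>} (carrier M)"
  using assms(4)
proof induct
  case Nil
  interpret M: module R M by fact
  let ?S = "sat R M q {\<zero>\<^bsub>M\<^esub>}"
  note S = M.submodule_sat[OF q M.submodule_zero]
  obtain f where f: "f \<in> carrier R - q" "\<forall>v\<in>?S. f \<odot>\<^bsub>M\<^esub> v \<in> {\<zero>\<^bsub>M\<^esub>}"
    using M.sat_annihilator[OF q noetherian_ring_axioms gen M.submodule_zero] by blast
  have "kills M P i (f \<otimes> s [^] (1::nat)) {\<zero>\<^bsub>M\<^esub>} (carrier M)"
    if P: "free_complex R P" and s: "s \<in> carrier R" and k: "kills M P (i - int (length [])) s ?S (carrier M)" for P i s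
  proof -
    have k': "kills M P i s ?S (carrier M)" using k by simp
    have "kills M P i f {\<zero>\<^bsub>M\<^esub>} ?S"
      using f S by (intro M.kills_annihilator[OF P M.submodule_zero]) auto
    from M.kills_extension[OF P M.submodule_zero S(1) M.carrier_is_submodule S(2,3) _ s this k'] f(1) s
    show ?thesis by simp
  qed
  then show ?case using f(1) by blast
next
  case (snoc ws U z)
  interpret M: module R M by fact
  have zR: "z \<in> carrier R" using q snoc(3) by (blast intro: ideal.Icarr primeideal.axioms(1))
  have U: "submodule U R M" using M.near_regular_facts[OF q snoc(1)] by blast
  have Uc: "U \<subseteq> carrier M" using M.submoduleD(1)[OF U] by blast
  let ?W = "plus_mult M U z (carrier M)"
  note W = M.submodule_plus_mult[OF U M.carrier_is_submodule zR]
  let ?S = "sat R M q ?W"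
  note S = M.submodule_sat[OF q W(1)]
  obtain f' where f': "f' \<in> carrier R - q" "\<forall>v\<in>?S. f' \<odot>\<^bsub>M\<^esub> v \<in> ?W"
    using M.sat_annihilator[OF q noetherian_ring_axioms gen W(1)] by blast
  obtain f and l :: nat where f: "f \<in> carrier R - q" and IH: "\<forall>P i s. free_complex R P \<longrightarrow> power_null R M P (set ws) n \<longrightarrow>
    s \<in> carrier R \<longrightarrow> kills M P (i - int (length ws)) s U (carrier M) \<longrightarrow>
    kills M P i (f \<otimes> s [^] l) {\<zero>\<^bsub>M\<^esub>} (carrier M)" using snoc(2) by blast
  have c: "f \<in> carrier R" "f' \<in> carrier R" using f f' by auto
  have "kills M P i ((f \<otimes> f' [^] (n * l)) \<otimes> s [^] (n * l)) {\<zero>\<^bsub>M\<^esub>} (carrier M)"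
    if P: "free_complex R P" and null: "power_null R M P (set (ws @ [z])) n" and s: "s \<in> carrier R"
      and k: "kills M P (i - int (length (ws @ [z]))) s ?S (carrier M)" for P i s
  proof -
    let ?j = "i - int (length ws)"
    have k': "kills M P (?j - 1) s ?S (carrier M)" using k by (simp add: algebra_simps)
    have "kills M P (?j - 1) f' ?W ?S" using f' S by (intro M.kills_annihilator[OF P W(1)]) auto
    from M.kills_extension[OF P W(1) S(1) M.carrier_is_submodule S(2,3) c(2) s this k']
    have k'': "kills M P (?j - 1) (f' \<otimes> s) ?W (carrier M)" .
    have "kills M P ?j (z [^] n) U (carrier M)"
      using null U M.carrier_is_submodule by (simp add: power_null_def)
    from M.kills_nonzerodivisor[OF P U M.carrier_is_submodule Uc _ zR snoc(4) k'' this] c s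
    have kj: "kills M P ?j ((f' \<otimes> s) [^] n) U (carrier M)" by simp
    have "power_null R M P (set ws) n" using null by (simp add: power_null_def)
    from IH[rule_format, OF P this _ kj] c s
    have "kills M P i (f \<otimes> ((f' \<otimes> s) [^] n) [^] l) {\<zero>\<^bsub>M\<^esub>} (carrier M)" by simp
    moreover have "f \<otimes> ((f' \<otimes> s) [^] n) [^] l = (f \<otimes> f' [^] (n * l)) \<otimes> s [^] (n * l)"
      using c s by (simp add: nat_pow_distrib nat_pow_pow m_assoc)
    ultimately show ?thesis by simp
  qed
  moreover have "f \<otimes> f' [^] (n * l) \<in> carrier R - q"
    by (rule prime_compl_mult[OF q f prime_compl_pow[OF q f'(1)]])
  ultimately show ?case by blast
qed

text \<open>For \<open>y s\<^sub>0\<close> known to kill the cohomology of all acyclic complexes, a cocycle times \<open>s\<^sub>0\<close> lifts to the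
  cone of \<open>y\<close>.\<close>

lemma kills_of_cones:
  assumes M: "module R M" and s0: "s0 \<in> carrier R" and P: "acyclic_below R P g" and ys: "set ys \<subseteq> carrier R"
    and k: "\<And>P y. y \<in> set ys \<Longrightarrow> acyclic_below R P g \<Longrightarrow> kills M P i (y \<otimes> s0) {\<zero>\<^bsub>M\<^esub>} (carrier M)"
    and "s \<in> carrier R" "kills M (cones R ys P) i s {\<zero>\<^bsub>M\<^esub>} (carrier M)"
  shows "kills M P i (s \<otimes> s0 [^] length ys) {\<zero>\<^bsub>M\<^esub>} (carrier M)"
  using ys k assms(6,7)
proof (induct ys arbitrary: s)
  case Nil
  then show ?case by simp
next
  case (Cons y ys)
  interpret M: module R M by fact
  have yR: "y \<in> carrier R" and ys: "set ys \<subseteq> carrier R" using Cons(2) by auto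
  have C: "acyclic_below R (cones R ys P) g" by (rule acyclic_below_cones[OF P ys])
  then have CC: "free_complex R (cones R ys P)" by (simp add: acyclic_below_def)
  have "kills M (cones R ys P) i (y \<otimes> s0) {\<zero>\<^bsub>M\<^esub>} (carrier M)" using Cons(3)[OF _ C] by simp
  moreover have "kills M (cone R y (cones R ys P)) i s {\<zero>\<^bsub>M\<^esub>} (carrier M)" using Cons(5) by simp
  ultimately have "kills M (cones R ys P) i (s \<otimes> s0) {\<zero>\<^bsub>M\<^esub>} (carrier M)"
    using M.kills_of_cone[OF CC yR M.submodule_zero M.carrier_is_submodule Cons(4) s0] by blast
  then have "kills M P i ((s \<otimes> s0) \<otimes> s0 [^] length ys) {\<zero>\<^bsub>M\<^esub>} (carrier M)"
    using Cons(1)[OF ys, of "s \<otimes> s0"] Cons(3,4) s0 by simp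
  moreover have "(s \<otimes> s0) \<otimes> s0 [^] length ys = s \<otimes> s0 [^] length (y # ys)"
    using Cons(4) s0 by (simp add: m_ac)
  ultimately show ?case by simp
qed

text \<open>The hypothesis \<open>depth\<close> says \<open>depth R\<^sub>q \<le> depth M\<^sub>q + r\<close> for \<open>q \<subseteq> p\<close>, in terms of near-regular
  sequences.\<close>

theorem uniform_annihilator:
  fixes r :: int
  assumes M: "module R M" and gen: "generates R M ms" and p: "primeideal p R"
    and depth: "\<And>q zs b. \<lbrakk>primeideal q R; q \<subseteq> p; near_regular R (self_module R) q zs b; b \<noteq> carrier R\<rbrakk> \<Longrightarrow>
      \<exists>ws U. near_regular R M q ws U \<and> int (length zs) \<le> int (length ws) + r"
  shows "\<exists>s\<in>carrier R - p. \<forall>P g i. acyclic_below R P g \<longrightarrow> i + r < g \<longrightarrow>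
    kills M P i s {\<zero>\<^bsub>M\<^esub>} (carrier M)"
proof -
  interpret M: module R M by fact
  define c where "c = {s \<in> carrier R. \<forall>P g i. acyclic_below R P g \<longrightarrow> i + r < g \<longrightarrow>
    kills M P i s {\<zero>\<^bsub>M\<^esub>} (carrier M)}"
  have cD: "kills M P i s {\<zero>\<^bsub>M\<^esub>} (carrier M)" if "s \<in> c" "acyclic_below R P g" "i + r < g" for s P g i
    using that unfolding c_def by blast
  have cR: "c \<subseteq> carrier R" by (auto simp: c_def)
  have cI: "s \<in> c" if "s \<in> carrier R"
    "\<And>P g i. free_complex R P \<Longrightarrow> acyclic_below R P g \<Longrightarrow> i + r < g \<Longrightarrow> kills M P i s {\<zero>\<^bsub>M\<^esub>} (carrier M)" for s
    using that unfolding c_def acyclic_below_def by blast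
  have c: "ideal c R"
    unfolding submodule_self_iff[symmetric]
  proof (rule self.submoduleI)
    show "c \<subseteq> carrier (self_module R)" using cR by simp
    have "\<zero> \<in> c"
      by (rule cI) (auto intro!: M.kills_annihilator M.submodule_zero)
    then show "\<zero>\<^bsub>self_module R\<^esub> \<in> c" by simp
    have mult: "a \<otimes> s \<in> c" if s: "s \<in> c" and a: "a \<in> carrier R" for a s
      using s a cR by (intro cI M.kills_mult[OF _ M.submodule_zero M.carrier_is_submodule] cD[OF s]) auto
    then show "a \<odot>\<^bsub>self_module R\<^esub> s \<in> c" if "a \<in> carrier R" "s \<in> c" for a s using that by simp
    show "\<ominus>\<^bsub>self_module R\<^esub> s \<in> c" if s: "s \<in> c" for s
      using mult[OF s, of "\<ominus> \<one>"] s cR by (auto simp: l_minus)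
    show "s \<oplus>\<^bsub>self_module R\<^esub> t \<in> c" if s: "s \<in> c" and t: "t \<in> c" for s t
    proof -
      have "s \<oplus> t \<in> c"
        using s t cR by (intro cI M.kills_add[OF _ M.submodule_zero M.carrier_is_submodule] cD[OF s] cD[OF t]) auto
      then show ?thesis by simp
    qed
  qed
  have "\<not> c \<subseteq> p"
  proof
    assume "c \<subseteq> p"
    then obtain q where q: "primeideal q R" "c \<subseteq> q" "q \<subseteq> p"
      and qc: "\<And>x. x \<in> q \<Longrightarrow> \<exists>s\<in>carrier R - q. \<exists>n::nat. s \<otimes> x [^] n \<in> c"
      using minimal_prime_over[OF c p] by metis
    \<comment> \<open>The sequences \<open>zs\<close> and \<open>ws\<close> represent \<open>depth R\<^sub>q\<close> and a lower bound for \<open>depth M\<^sub>q\<close>.\<close>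
    interpret q: primeideal q R by fact
    obtain xs where xs: "generating_list R q xs" using generating_list_exists[OF q.is_ideal] by blast
    obtain zs b a where zs: "near_regular R (self_module R) q zs b" "b \<noteq> carrier R" "a \<in> carrier R"
      "colon R (self_module R) b a = q" using near_regular_maximal[OF q(1)] by blast
    obtain ws U where ws: "near_regular R M q ws U" "int (length zs) \<le> int (length ws) + r"
      using depth[OF q(1,3) zs(1,2)] by blast
    have U: "submodule U R M" and wsq: "set ws \<subseteq> q" using M.near_regular_facts[OF q(1) ws(1)] by auto
    \<comment> \<open>The cone must make both the generators of \<open>q\<close> and the sequence \<open>ws\<close> nilpotent on cohomology.\<close>
    define X where "X = xs @ ws"
    have Xq: "set X \<subseteq> q" using xs wsq by (auto simp: X_def generating_list_def)
    then have XR: "set X \<subseteq> carrier R" using q.a_subset by blast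
    have "\<exists>s\<in>carrier R - q. \<exists>n::nat. \<forall>x\<in>set X. s \<otimes> x [^] n \<in> c"
      using qc Xq by (intro common_power_multiple[OF q(1) c XR]) blast
    then obtain s0 and n :: nat where s0: "s0 \<in> carrier R - q" "\<forall>x\<in>set X. s0 \<otimes> x [^] n \<in> c" by blast
    define ys where "ys = map (\<lambda>x. x [^] n) X"
    have ysR: "set ys \<subseteq> carrier R" using XR by (auto simp: ys_def)
    \<comment> \<open>Each cone squares the powers of the elements coned off before it.\<close>
    define N where "N = n * 2 ^ length ys"
    obtain s1 where s1: "s1 \<in> carrier R - q" "\<And>P g i. acyclic_below R P g \<Longrightarrow>
        power_null R (self_module R) P (set xs) N \<Longrightarrow>
        i + int (length zs) < g \<Longrightarrow> kills (self_module R) P i s1 q (carrier R)"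
      using kills_residue_uniform[OF q(1) xs zs(1,3,4), of N] by blast
    have "set ms \<subseteq> carrier M" using gen by (simp add: generates_def)
    then obtain s2 m where s2: "s2 \<in> carrier R - q" "transfers R M q (set xs) N U (carrier M) s2 m"
      using kills_transfer_module[OF q(1) xs M U, of ms N] M.adjoin_generates[OF U gen] by auto
    obtain f l where f: "f \<in> carrier R - q" and desc: "\<forall>P i s. free_complex R P \<longrightarrow> power_null R M P (set ws) N \<longrightarrow>
      s \<in> carrier R \<longrightarrow> kills M P (i - int (length ws)) s U (carrier M) \<longrightarrow>
      kills M P i (f \<otimes> s [^] (l::nat)) {\<zero>\<^bsub>M\<^esub>} (carrier M)"
      using kills_near_regular_descent[OF q(1) M gen ws(1), of N] by blast
    \<comment> \<open>From \<open>R / q\<close> by \<open>s1\<close>, to \<open>M / U\<close> by \<open>s2\<close> and \<open>m\<close>, to \<open>M\<close> by \<open>f\<close> and \<open>l\<close>.\<close>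
    define s where "s = f \<otimes> (s2 \<otimes> s1 [^] m) [^] l"
    have cl: "s0 \<in> carrier R" "s1 \<in> carrier R" "s2 \<in> carrier R" "f \<in> carrier R" using s0 s1 s2 f by auto
    have sq: "s \<in> carrier R - q"
      unfolding s_def
      by (intro prime_compl_mult[OF q(1) f] prime_compl_pow[OF q(1)] prime_compl_mult[OF q(1) s2(1)] s1(1))
    have "s \<otimes> s0 [^] length ys \<in> c"
    proof (rule cI)
      show "s \<otimes> s0 [^] length ys \<in> carrier R" using sq cl by simp
      fix P g i assume PP: "free_complex R P" and P: "acyclic_below R P g" and i: "i + r < g"
      let ?P = "cones R ys P"
      have C: "acyclic_below R ?P g" by (rule acyclic_below_cones[OF P ysR])
      then have CC: "free_complex R ?P" by (simp add: acyclic_below_def)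
      have null: "power_null R (self_module R) ?P (set X) N"
        unfolding N_def using power_null_map[OF XR] power_null_cones[OF self_module PP ysR] ys_def by blast
      have null': "power_null R M ?P (set X) N"
        unfolding N_def using power_null_map[OF XR] power_null_cones[OF M PP ysR] ys_def by blast
      have n1: "power_null R (self_module R) ?P (set xs) N" and n2: "power_null R M ?P (set ws) N"
        using null null' by (auto simp: power_null_def X_def)
      have "\<forall>j<g - int (length zs). kills (self_module R) ?P j s1 q (carrier R)"
        using s1(2)[OF C n1] by auto
      then have "kills M ?P (i - int (length ws)) (s2 \<otimes> s1 [^] m) U (carrier M)"
        using transfersD[OF s2(2) CC n1 cl(2), of "g - int (length zs)" "i - int (length ws)"] i ws(2) by auto
      then have "kills M ?P i s {\<zero>\<^bsub>M\<^esub>} (carrier M)"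
        using desc[rule_format, OF CC n2] cl unfolding s_def by simp
      moreover have "kills M Q i (y \<otimes> s0) {\<zero>\<^bsub>M\<^esub>} (carrier M)" if "y \<in> set ys" "acyclic_below R Q g" for Q y
      proof -
        have "y \<otimes> s0 \<in> c" using that(1) s0(2) XR cl by (auto simp: ys_def m_comm)
        then show ?thesis using cD that(2) i by blast
      qed
      ultimately show "kills M P i (s \<otimes> s0 [^] length ys) {\<zero>\<^bsub>M\<^esub>} (carrier M)"
        using sq by (intro kills_of_cones[OF M cl(1) P ysR]) auto
    qed
    moreover have "s \<otimes> s0 [^] length ys \<in> carrier R - q"
      by (rule prime_compl_mult[OF q(1) sq prime_compl_pow[OF q(1) s0(1)]])
    ultimately show False using q(2) by blast
  qed
  then obtain s where "s \<in> c" "s \<notin> p" by blast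
  then show ?thesis using cR cD by blast
qed

end

section \<open>Free resolutions of cyclic modules\<close>

text \<open>The free module on \<open>B\<close>. Vectors vanish outside \<open>B\<close>, which makes their addition and equality
  pointwise.\<close>

definition vectors :: "('r, 'x) ring_scheme \<Rightarrow> nat set \<Rightarrow> ('r, nat \<Rightarrow> 'r) module" where
  "vectors R B = \<lparr>carrier = {u. (\<forall>l. u l \<in> carrier R) \<and> (\<forall>l. l \<notin> B \<longrightarrow> u l = \<zero>\<^bsub>R\<^esub>)},
     monoid.mult = undefined, one = undefined, zero = (\<lambda>_. \<zero>\<^bsub>R\<^esub>),
     add = (\<lambda>u v l. u l \<oplus>\<^bsub>R\<^esub> v l), smult = (\<lambda>a u l. a \<otimes>\<^bsub>R\<^esub> u l)\<rparr>"

lemma vectors_simps [simp]: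
  "u \<in> carrier (vectors R B) \<longleftrightarrow> (\<forall>l. u l \<in> carrier R) \<and> (\<forall>l. l \<notin> B \<longrightarrow> u l = \<zero>\<^bsub>R\<^esub>)"
  "\<zero>\<^bsub>vectors R B\<^esub> = (\<lambda>_. \<zero>\<^bsub>R\<^esub>)"
  "u \<oplus>\<^bsub>vectors R B\<^esub> v = (\<lambda>l. u l \<oplus>\<^bsub>R\<^esub> v l)"
  "a \<odot>\<^bsub>vectors R B\<^esub> u = (\<lambda>l. a \<otimes>\<^bsub>R\<^esub> u l)"
  by (simp_all add: vectors_def)

definition combination ::
  "('r, 'x) ring_scheme \<Rightarrow> (nat \<Rightarrow> 'r) list \<Rightarrow> (nat \<Rightarrow> 'r) \<Rightarrow> nat \<Rightarrow> 'r" where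
  "combination R gs c = (\<lambda>l. \<Oplus>\<^bsub>R\<^esub> k\<in>{..<length gs}. c k \<otimes>\<^bsub>R\<^esub> (gs ! k) l)"

text \<open>The complex \<open>P\<close> is a free resolution of \<open>R / J\<close> with a single generator in degree \<open>0\<close>. The last two
  conditions are exactness in degree \<open>0\<close> and in positive degrees.\<close>

definition resolves ::
  "('r, 'x) ring_scheme \<Rightarrow> 'r based_complex \<Rightarrow> 'r set \<Rightarrow> bool" where
  "resolves R P J \<longleftrightarrow> free_complex R P \<and> bas P 0 = {0} \<and> (\<forall>k\<in>bas P 1. mat P 0 k 0 \<in> J) \<and>
     (\<forall>a\<in>J. \<exists>v. v \<in> bas P 1 \<rightarrow> carrier R \<and> a = (\<Oplus>\<^bsub>R\<^esub> k\<in>bas P 1. v k \<otimes>\<^bsub>R\<^esub> mat P 0 k 0)) \<and>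
     (\<forall>j\<ge>1. \<forall>u. u \<in> bas P j \<rightarrow> carrier R \<longrightarrow>
        (\<forall>m\<in>bas P (j - 1). (\<Oplus>\<^bsub>R\<^esub> l\<in>bas P j. u l \<otimes>\<^bsub>R\<^esub> mat P (j - 1) l m) = \<zero>\<^bsub>R\<^esub>) \<longrightarrow>
        (\<exists>v. v \<in> bas P (j + 1) \<rightarrow> carrier R \<and>
          (\<forall>l\<in>bas P j. u l = (\<Oplus>\<^bsub>R\<^esub> k\<in>bas P (j + 1). v k \<otimes>\<^bsub>R\<^esub> mat P j k l))))"

context cring
begin

lemma vectors_module: "module R (vectors R B)"
proof (rule moduleI[OF cring_axioms])
  show "abelian_group (vectors R B)"
  proof (rule abelian_groupI)
    show "\<exists>y\<in>carrier (vectors R B). y \<oplus>\<^bsub>vectors R B\<^esub> x = \<zero>\<^bsub>vectors R B\<^esub>"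
      if "x \<in> carrier (vectors R B)" for x
      using that by (intro bexI[of _ "\<lambda>l. \<ominus> x l"]) (auto simp: l_neg)
  qed (auto simp: a_ac)
qed (auto simp: l_distr r_distr m_assoc)

lemma combination_closed:
  assumes "set gs \<subseteq> carrier (vectors R B)" "c \<in> {..<length gs} \<rightarrow> carrier R"
  shows "combination R gs c \<in> carrier (vectors R B)"
proof -
  have g: "(gs ! k) l \<in> carrier R" "l \<notin> B \<Longrightarrow> (gs ! k) l = \<zero>" if "k < length gs" for k l
    using subsetD[OF assms(1) nth_mem[OF that]] by simp_all
  have "combination R gs c l \<in> carrier R" for l
    unfolding combination_def using assms(2) g by (intro finsum_closed) (auto simp: Pi_def)
  moreover have "combination R gs c l = \<zero>" if "l \<notin> B" for l
  proof -
    have "combination R gs c l = (\<Oplus>k\<in>{..<length gs}. \<zero>)"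
      unfolding combination_def using assms(2) g that by (intro finsum_cong') (auto simp: Pi_def)
    then show ?thesis by (simp add: finsum_zero)
  qed
  ultimately show ?thesis by auto
qed

lemma submodule_combinations:
  assumes gs: "set gs \<subseteq> carrier (vectors R B)"
  shows "submodule {combination R gs c | c. c \<in> {..<length gs} \<rightarrow> carrier R} R (vectors R B)" (is "submodule ?X _ _")
    "set gs \<subseteq> {combination R gs c | c. c \<in> {..<length gs} \<rightarrow> carrier R}"
proof -
  interpret V: module R "vectors R B" by (rule vectors_module)
  have g: "(gs ! k) l \<in> carrier R" if "k < length gs" for k l
    using subsetD[OF gs nth_mem[OF that]] by simp
  have smult: "a \<odot>\<^bsub>vectors R B\<^esub> x \<in> ?X" if a: "a \<in> carrier R" and x: "x \<in> ?X" for a x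
  proof -
    obtain c where c: "c \<in> {..<length gs} \<rightarrow> carrier R" "x = combination R gs c" using x by auto
    have "a \<otimes> combination R gs c l = combination R gs (\<lambda>k. a \<otimes> c k) l" for l
    proof -
      have "a \<otimes> combination R gs c l = (\<Oplus>k\<in>{..<length gs}. a \<otimes> (c k \<otimes> (gs ! k) l))"
        unfolding combination_def using a c g by (intro finsum_rdistr) (auto simp: Pi_def)
      also have "\<dots> = combination R gs (\<lambda>k. a \<otimes> c k) l"
        unfolding combination_def using a c g by (intro finsum_cong') (auto simp: m_assoc Pi_def)
      finally show ?thesis .
    qed
    then have "a \<odot>\<^bsub>vectors R B\<^esub> x = combination R gs (\<lambda>k. a \<otimes> c k)" using c by auto
    moreover have "(\<lambda>k. a \<otimes> c k) \<in> {..<length gs} \<rightarrow> carrier R" using a c by auto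
    ultimately show ?thesis by blast
  qed
  show "submodule ?X R (vectors R B)"
  proof (rule V.submoduleI)
    show sub: "?X \<subseteq> carrier (vectors R B)" using combination_closed[OF gs] by blast
    have "combination R gs (\<lambda>_. \<zero>) = (\<lambda>_. \<zero>)"
    proof
      fix l
      have "combination R gs (\<lambda>_. \<zero>) l = (\<Oplus>k\<in>{..<length gs}. \<zero>)"
        unfolding combination_def using g by (intro finsum_cong') (auto simp: Pi_def)
      then show "combination R gs (\<lambda>_. \<zero>) l = \<zero>" by (simp add: finsum_zero)
    qed
    then have "\<exists>c. (\<lambda>_. \<zero>) = combination R gs c \<and> c \<in> {..<length gs} \<rightarrow> carrier R"
      by (intro exI[of _ "\<lambda>_. \<zero>"]) auto
    then show "\<zero>\<^bsub>vectors R B\<^esub> \<in> ?X" by simp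
    show "\<ominus>\<^bsub>vectors R B\<^esub> x \<in> ?X" if x: "x \<in> ?X" for x
    proof -
      have "\<ominus>\<^bsub>vectors R B\<^esub> x = (\<ominus> \<one>) \<odot>\<^bsub>vectors R B\<^esub> x"
        using subsetD[OF sub x] V.smult_l_minus[of \<one> x] V.smult_one[of x] one_closed by metis
      then show ?thesis using smult[OF _ x, of "\<ominus> \<one>"] by simp
    qed
    show "x \<oplus>\<^bsub>vectors R B\<^esub> y \<in> ?X" if x: "x \<in> ?X" and y: "y \<in> ?X" for x y
    proof -
      obtain c where c: "c \<in> {..<length gs} \<rightarrow> carrier R" "x = combination R gs c" using x by auto
      obtain d where d: "d \<in> {..<length gs} \<rightarrow> carrier R" "y = combination R gs d" using y by auto
      have "combination R gs c l \<oplus> combination R gs d l = combination R gs (\<lambda>k. c k \<oplus> d k) l" for l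
      proof -
        have "combination R gs c l \<oplus> combination R gs d l
          = (\<Oplus>k\<in>{..<length gs}. c k \<otimes> (gs ! k) l \<oplus> d k \<otimes> (gs ! k) l)"
          unfolding combination_def using c d g by (intro finsum_addf[symmetric]) (auto simp: Pi_def)
        also have "\<dots> = combination R gs (\<lambda>k. c k \<oplus> d k) l"
          unfolding combination_def using c d g by (intro finsum_cong') (auto simp: l_distr Pi_def)
        finally show ?thesis .
      qed
      then have "x \<oplus>\<^bsub>vectors R B\<^esub> y = combination R gs (\<lambda>k. c k \<oplus> d k)" using c d by auto
      moreover have "(\<lambda>k. c k \<oplus> d k) \<in> {..<length gs} \<rightarrow> carrier R" using c d by auto
      ultimately show ?thesis by blast
    qed
  qed (use smult in blast)
  show "set gs \<subseteq> ?X"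
  proof
    fix x assume "x \<in> set gs"
    then obtain i where i: "i < length gs" "x = gs ! i" by (auto simp: in_set_conv_nth)
    have "combination R gs (\<lambda>k. if i = k then \<one> else \<zero>) l = x l" for l
    proof -
      have "combination R gs (\<lambda>k. if i = k then \<one> else \<zero>) l
        = (\<Oplus>k\<in>{..<length gs}. if i = k then (gs ! k) l else \<zero>)"
        unfolding combination_def using g by (intro finsum_cong') (auto simp: Pi_def)
      also have "\<dots> = (gs ! i) l" using i g by (intro finsum_singleton) (auto simp: Pi_def)
      finally show ?thesis using i by simp
    qed
    then have "x = combination R gs (\<lambda>k. if i = k then \<one> else \<zero>)" by auto
    moreover have "(\<lambda>k. if i = k then \<one> else \<zero>) \<in> {..<length gs} \<rightarrow> carrier R" by auto
    ultimately show "x \<in> ?X" by blast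
  qed
qed

lemma vectors_generates:
  assumes "finite B" shows "\<exists>es. generates R (vectors R B) es"
proof -
  interpret V: module R "vectors R B" by (rule vectors_module)
  define e where "e = (\<lambda>i l :: nat. if i = l then \<one> else \<zero>)"
  obtain bs where bs: "set bs = B" using finite_list[OF assms] by blast
  have "V = carrier (vectors R B)" if V: "submodule V R (vectors R B)" "set (map e bs) \<subseteq> V" for V
  proof
    note VD = V.submoduleD[OF V(1)]
    show "V \<subseteq> carrier (vectors R B)" using VD(1) by blast
    have "\<forall>u. u \<in> carrier (vectors R A) \<longrightarrow> u \<in> V" if "finite A" "A \<subseteq> B" for A
      using that
    proof (induct A)
      case empty
      have "u \<in> V" if "u \<in> carrier (vectors R {})" for u
      proof -
        have "u = (\<lambda>_. \<zero>)" using that by auto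
        then show ?thesis using VD(2) by simp
      qed
      then show ?case by blast
    next
      case (insert a A)
      show ?case
      proof (intro allI impI)
        fix u assume u: "u \<in> carrier (vectors R (insert a A))"
        have "u(a := \<zero>) \<in> carrier (vectors R A)" "u a \<in> carrier R" using u by auto
        moreover have "e a \<in> V" using V(2) bs insert(4) by auto
        ultimately have "u(a := \<zero>) \<oplus>\<^bsub>vectors R B\<^esub> (u a \<odot>\<^bsub>vectors R B\<^esub> e a) \<in> V"
          using insert(3,4) by (intro VD(3) VD(4)) blast+
        moreover have "u(a := \<zero>) \<oplus>\<^bsub>vectors R B\<^esub> (u a \<odot>\<^bsub>vectors R B\<^esub> e a) = u"
          using u by (auto simp: e_def)
        ultimately show "u \<in> V" by simp
      qed
    qed
    then show "carrier (vectors R B) \<subseteq> V" using assms by blast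
  qed
  then have "generates R (vectors R B) (map e bs)"
    unfolding generates_def using bs by (auto simp: e_def)
  then show ?thesis by blast
qed

end

lemma (in noetherian_cring) submodule_vectors_fin_gen:
  assumes "finite B" and K: "submodule K R (vectors R B)"
  shows "\<exists>gs. set gs \<subseteq> K \<and> (\<forall>u\<in>K. \<exists>c. c \<in> {..<length gs} \<rightarrow> carrier R \<and> u = combination R gs c)"
proof -
  interpret V: module R "vectors R B" by (rule vectors_module)
  obtain es where "generates R (vectors R B) es" using vectors_generates[OF assms(1)] by blast
  then obtain gs where gs: "set gs \<subseteq> K" "\<And>X. submodule X R (vectors R B) \<Longrightarrow> set gs \<subseteq> X \<Longrightarrow> K \<subseteq> X"
    using generates_submodule[OF vectors_module _ K] by blast
  have "set gs \<subseteq> carrier (vectors R B)" using gs(1) V.submoduleD(1)[OF K] by blast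
  then have "K \<subseteq> {combination R gs c | c. c \<in> {..<length gs} \<rightarrow> carrier R}"
    using gs(2) submodule_combinations by blast
  then show ?thesis using gs(1) by blast
qed

lemma (in cring) submodule_kernel:
  assumes B: "finite B" and gs: "set gs \<subseteq> carrier (vectors R B)"
  shows "submodule {c \<in> carrier (vectors R {..<length gs}). \<forall>l\<in>B. combination R gs c l = \<zero>} R
    (vectors R {..<length gs})" (is "submodule ?K _ ?V")
proof -
  interpret V: module R ?V by (rule vectors_module)
  have g: "(gs ! k) l \<in> carrier R" if "k < length gs" for k l
    using subsetD[OF gs nth_mem[OF that]] by simp
  have smult: "a \<odot>\<^bsub>?V\<^esub> c \<in> ?K" if a: "a \<in> carrier R" and c: "c \<in> ?K" for a c
  proof -
    have "combination R gs (\<lambda>k. a \<otimes> c k) l = \<zero>" if "l \<in> B" for l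
    proof -
      have "combination R gs (\<lambda>k. a \<otimes> c k) l = (\<Oplus>k\<in>{..<length gs}. a \<otimes> (c k \<otimes> (gs ! k) l))"
        unfolding combination_def using a c g by (intro finsum_cong') (auto simp: m_assoc)
      also have "\<dots> = a \<otimes> combination R gs c l"
        unfolding combination_def using a c g by (intro finsum_rdistr[symmetric]) (auto simp: Pi_def)
      finally show ?thesis using c a that by simp
    qed
    then show ?thesis using a c by auto
  qed
  show ?thesis
  proof (rule V.submoduleI)
    show sub: "?K \<subseteq> carrier ?V" by blast
    have "combination R gs (\<lambda>_. \<zero>) l = \<zero>" for l
    proof -
      have "combination R gs (\<lambda>_. \<zero>) l = (\<Oplus>k\<in>{..<length gs}. \<zero>)"
        unfolding combination_def using g by (intro finsum_cong') (auto simp: Pi_def)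
      then show ?thesis by (simp add: finsum_zero)
    qed
    then show "\<zero>\<^bsub>?V\<^esub> \<in> ?K" by simp
    show "\<ominus>\<^bsub>?V\<^esub> x \<in> ?K" if x: "x \<in> ?K" for x
    proof -
      have "\<ominus>\<^bsub>?V\<^esub> x = (\<ominus> \<one>) \<odot>\<^bsub>?V\<^esub> x"
        using subsetD[OF sub x] V.smult_l_minus[of \<one> x] V.smult_one[of x] one_closed by metis
      then show ?thesis using smult[OF _ x, of "\<ominus> \<one>"] by simp
    qed
    show "x \<oplus>\<^bsub>?V\<^esub> y \<in> ?K" if x: "x \<in> ?K" and y: "y \<in> ?K" for x y
    proof -
      have "combination R gs (\<lambda>k. x k \<oplus> y k) l = \<zero>" if "l \<in> B" for l
      proof -
        have "combination R gs (\<lambda>k. x k \<oplus> y k) l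
          = (\<Oplus>k\<in>{..<length gs}. x k \<otimes> (gs ! k) l \<oplus> y k \<otimes> (gs ! k) l)"
          unfolding combination_def using x y g by (intro finsum_cong') (auto simp: l_distr Pi_def)
        also have "\<dots> = combination R gs x l \<oplus> combination R gs y l"
          unfolding combination_def using x y g by (intro finsum_addf) (auto simp: Pi_def)
        finally show ?thesis using x y that by simp
      qed
      then show ?thesis using x y by auto
    qed
  qed (use smult in blast)
qed

text \<open>Syzygies are chosen degree by degree. A state of the recursion consists of the current basis and
  the submodule that the next differential has to cover.\<close>

lemma (in noetherian_cring) free_resolution_exists:
  assumes J: "ideal J R"
  shows "\<exists>P. resolves R P J"
proof -
  define pick where "pick = (\<lambda>(B :: nat set, K). SOME gs. set gs \<subseteq> K \<and>
    (\<forall>u\<in>K. \<exists>c. c \<in> {..<length gs} \<rightarrow> carrier R \<and> u = combination R gs c))"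
  define next_st where "next_st = (\<lambda>(B :: nat set, K). ({..<length (pick (B, K))},
    {c \<in> carrier (vectors R {..<length (pick (B, K))}). \<forall>l\<in>B. combination R (pick (B, K)) c l = \<zero>}))"
  define st where "st = rec_nat ({0 :: nat}, {u \<in> carrier (vectors R {0}). u 0 \<in> J}) (\<lambda>_. next_st)"
  have st0: "st 0 = ({0}, {u \<in> carrier (vectors R {0}). u 0 \<in> J})" and stS: "st (Suc n) = next_st (st n)" for n
    by (simp_all add: st_def)
  define B K G where "B = (\<lambda>n. fst (st n))" and "K = (\<lambda>n. snd (st n))" and "G = (\<lambda>n. pick (st n))"
  have stBK: "st n = (B n, K n)" for n by (simp add: B_def K_def)
  have BS: "B (Suc n) = {..<length (G n)}"
    and KS: "K (Suc n) = {c \<in> carrier (vectors R {..<length (G n)}). \<forall>l\<in>B n. combination R (G n) c l = \<zero>}" for n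
    by (simp_all add: B_def K_def G_def stS next_st_def case_prod_beta)
  have pickD: "set (pick (A, L)) \<subseteq> L \<and> (\<forall>u\<in>L. \<exists>c. c \<in> {..<length (pick (A, L))} \<rightarrow> carrier R \<and> u = combination R (pick (A, L)) c)"
    if "finite A" "submodule L R (vectors R A)" for A L
    unfolding pick_def prod.case using submodule_vectors_fin_gen[OF that] by (rule someI_ex)
  have good: "finite (B n) \<and> submodule (K n) R (vectors R (B n))" for n
  proof (induct n)
    case 0
    interpret V: module R "vectors R {0}" by (rule vectors_module)
    interpret J: ideal J R by fact
    have neg: "(\<ominus>\<^bsub>vectors R {0}\<^esub> u) = (\<lambda>l. \<ominus> u l)" if "u \<in> carrier (vectors R {0})" for u
    proof -
      have "\<ominus>\<^bsub>vectors R {0}\<^esub> u = (\<ominus> \<one>) \<odot>\<^bsub>vectors R {0}\<^esub> u"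
        using that V.smult_l_minus[of \<one> u] V.smult_one[of u] one_closed by metis
      then show ?thesis using that by (auto simp: l_minus)
    qed
    have "submodule {u \<in> carrier (vectors R {0}). u 0 \<in> J} R (vectors R {0})"
    proof (rule V.submoduleI)
      show "\<ominus>\<^bsub>vectors R {0}\<^esub> u \<in> {u \<in> carrier (vectors R {0}). u 0 \<in> J}"
        if "u \<in> {u \<in> carrier (vectors R {0}). u 0 \<in> J}" for u
        using that neg[of u] J.a_inv_closed by auto
    qed (auto intro: J.a_closed J.I_l_closed)
    then show ?case by (simp add: B_def K_def st0)
  next
    case (Suc n)
    interpret V: module R "vectors R (B n)" by (rule vectors_module)
    have "set (G n) \<subseteq> K n" using pickD[of "B n" "K n"] Suc by (simp add: G_def stBK)
    then have "set (G n) \<subseteq> carrier (vectors R (B n))" using V.submoduleD(1) Suc by blast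
    then show ?case using submodule_kernel Suc by (simp only: BS KS finite_lessThan simp_thms)
  qed
  have GK: "set (G n) \<subseteq> K n" and Gspan: "u \<in> K n \<Longrightarrow> \<exists>c. c \<in> {..<length (G n)} \<rightarrow> carrier R \<and> u = combination R (G n) c" for n u
    using pickD[of "B n" "K n"] good[of n] by (auto simp: G_def stBK)
  have Kc: "u l \<in> carrier R" "l \<notin> B n \<Longrightarrow> u l = \<zero>" if "u \<in> K n" for u l n
  proof -
    interpret V: module R "vectors R (B n)" by (rule vectors_module)
    have "u \<in> carrier (vectors R (B n))" using V.submoduleD(1) good that by blast
    then show "u l \<in> carrier R" "l \<notin> B n \<Longrightarrow> u l = \<zero>" by auto
  qed
  have Gc: "(G n ! k) l \<in> carrier R" if "k < length (G n)" for n k l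
    using Kc(1)[of "G n ! k" n l] GK nth_mem[OF that] by blast
  define P where "P = (\<lambda>j::int. if j < 0 then {} else B (nat j),
    \<lambda>j k l. if j < 0 \<or> length (G (nat j)) \<le> k then \<zero> else (G (nat j) ! k) l)"
  have basP: "bas P (int n) = B n" "j < 0 \<Longrightarrow> bas P j = {}" for n j by (simp_all add: P_def bas_def)
  have matP: "mat P (int n) k l = (if k < length (G n) then (G n ! k) l else \<zero>)" for n k l
    by (simp add: P_def mat_def)
  have comb: "(\<Oplus>k\<in>bas P (int n + 1). c k \<otimes> mat P (int n) k l) = combination R (G n) c l"
    if "c \<in> bas P (int n + 1) \<rightarrow> carrier R" for c l n
  proof -
    have e: "bas P (int n + 1) = {..<length (G n)}" using basP(1)[of "Suc n"] by (simp add: BS add.commute)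
    show ?thesis unfolding combination_def e
      using that e Gc by (intro finsum_cong') (auto simp: matP)
  qed
  have f1: "free_complex R P"
    unfolding free_complex_def
  proof (intro conjI allI ballI impI)
    show "finite (bas P j)" for j using good by (simp add: P_def bas_def)
    show "j < 0 \<Longrightarrow> bas P j = {}" for j by (rule basP(2))
    show "mat P j k l \<in> carrier R" for j k l using Gc by (simp add: P_def mat_def)
    fix j k m assume k: "k \<in> bas P (j + 1)" and m: "m \<in> bas P (j - 1)"
    have "j - 1 \<ge> 0" using m basP(2)[of "j - 1"] by fastforce
    then obtain n where n: "j - 1 = int n" using nonneg_int_cases by blast
    then have j: "j = int (Suc n)" by simp
    have "k < length (G (Suc n))" using k basP(1)[of "Suc (Suc n)"] by (simp add: j BS add.commute)
    then have gk: "G (Suc n) ! k \<in> K (Suc n)" "mat P j k = (\<lambda>l. (G (Suc n) ! k) l)"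
      using GK nth_mem by (blast, intro ext, simp only: j matP if_True)
    have mB: "m \<in> B n" using m n basP(1)[of n] by simp
    have "(\<Oplus>l\<in>bas P j. mat P j k l \<otimes> mat P (j - 1) l m) = combination R (G n) (G (Suc n) ! k) m"
      using comb[of "G (Suc n) ! k" n m] Kc(1)[OF gk(1)] gk(2) n j by (simp add: add.commute)
    then show "(\<Oplus>l\<in>bas P j. mat P j k l \<otimes> mat P (j - 1) l m) = \<zero>"
      using gk(1) mB unfolding KS by simp
  qed
  have f2: "bas P 0 = {0}" using basP(1)[of 0] by (simp add: B_def st0)
  have f3: "mat P 0 k 0 \<in> J" if k: "k \<in> bas P 1" for k
  proof -
    have "k < length (G 0)" using k basP(1)[of 1] by (simp add: BS)
    then have "G 0 ! k \<in> K 0" "mat P 0 k 0 = (G 0 ! k) 0"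
      using GK nth_mem matP[of 0] by (blast, simp)
    then show ?thesis by (simp add: K_def st0)
  qed
  have f4: "\<exists>v. v \<in> bas P 1 \<rightarrow> carrier R \<and> a = (\<Oplus>k\<in>bas P 1. v k \<otimes> mat P 0 k 0)" if a: "a \<in> J" for a
  proof -
    have "a \<in> carrier R" using a J by (blast intro: ideal.Icarr)
    then have "(\<lambda>l. if l = 0 then a else \<zero>) \<in> K 0" using a by (auto simp: K_def st0)
    then obtain c where c: "c \<in> {..<length (G 0)} \<rightarrow> carrier R" "(\<lambda>l. if l = 0 then a else \<zero>) = combination R (G 0) c"
      using Gspan by blast
    have "bas P 1 = {..<length (G 0)}" using basP(1)[of 1] by (simp add: BS)
    then have "c \<in> bas P 1 \<rightarrow> carrier R" "a = (\<Oplus>k\<in>bas P 1. c k \<otimes> mat P 0 k 0)"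
      using c(1) comb[of c 0 0] fun_cong[OF c(2), of 0] by auto
    then show ?thesis by blast
  qed
  have f5: "\<exists>v. v \<in> bas P (j + 1) \<rightarrow> carrier R \<and> (\<forall>l\<in>bas P j. u l = (\<Oplus>k\<in>bas P (j + 1). v k \<otimes> mat P j k l))"
    if j: "1 \<le> j" and u: "u \<in> bas P j \<rightarrow> carrier R"
      "\<forall>m\<in>bas P (j - 1). (\<Oplus>l\<in>bas P j. u l \<otimes> mat P (j - 1) l m) = \<zero>" for j u
  proof -
    obtain n where n: "j - 1 = int n" using nonneg_int_cases[of "j - 1"] j by auto
    then have jn: "j = int (Suc n)" by simp
    have bj: "bas P j = {..<length (G n)}" using basP(1)[of "Suc n"] by (simp only: jn BS)
    define u' where "u' = (\<lambda>l. if l \<in> bas P j then u l else \<zero>)"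
    have u'c: "u' \<in> bas P j \<rightarrow> carrier R" "u' \<in> carrier (vectors R {..<length (G n)})"
      using u(1) bj by (auto simp: u'_def)
    have "combination R (G n) u' m = \<zero>" if m: "m \<in> B n" for m
    proof -
      have "combination R (G n) u' m = (\<Oplus>l\<in>bas P j. u' l \<otimes> mat P (j - 1) l m)"
        using comb[of u' n m] u'c(1) n jn by (simp add: add.commute)
      also have "\<dots> = (\<Oplus>l\<in>bas P j. u l \<otimes> mat P (j - 1) l m)"
        using u(1) by (intro finsum_cong') (auto simp: u'_def P_def mat_def Gc)
      also have "\<dots> = \<zero>" using u(2) m n basP(1)[of n] by simp
      finally show ?thesis .
    qed
    then have "u' \<in> K (Suc n)" unfolding KS using u'c(2) by blast
    then obtain c where c: "c \<in> {..<length (G (Suc n))} \<rightarrow> carrier R" "u' = combination R (G (Suc n)) c"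
      using Gspan by blast
    have "bas P (j + 1) = {..<length (G (Suc n))}" using basP(1)[of "Suc (Suc n)"] by (simp add: jn BS add.commute)
    then have cc: "c \<in> bas P (int (Suc n) + 1) \<rightarrow> carrier R" using c(1) jn by simp
    have "u l = (\<Oplus>k\<in>bas P (j + 1). c k \<otimes> mat P j k l)" if "l \<in> bas P j" for l
      using comb[OF cc, of l] fun_cong[OF c(2), of l] that jn by (simp add: u'_def)
    then show ?thesis using cc jn by blast
  qed
  have "resolves R P J"
    unfolding resolves_def by (intro conjI ballI allI impI f1 f2; (erule f3 | erule f4 | erule (2) f5))
  then show ?thesis by blast
qed

lemma resolvesD:
  assumes "resolves R P J"
  shows "free_complex R P" "bas P 0 = {0}" "k \<in> bas P 1 \<Longrightarrow> mat P 0 k 0 \<in> J"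
    "a \<in> J \<Longrightarrow> \<exists>v. v \<in> bas P 1 \<rightarrow> carrier R \<and> a = (\<Oplus>\<^bsub>R\<^esub> k\<in>bas P 1. v k \<otimes>\<^bsub>R\<^esub> mat P 0 k 0)"
    "1 \<le> j \<Longrightarrow> u \<in> bas P j \<rightarrow> carrier R \<Longrightarrow>
       (\<And>m. m \<in> bas P (j - 1) \<Longrightarrow> (\<Oplus>\<^bsub>R\<^esub> l\<in>bas P j. u l \<otimes>\<^bsub>R\<^esub> mat P (j - 1) l m) = \<zero>\<^bsub>R\<^esub>) \<Longrightarrow>
       \<exists>v. v \<in> bas P (j + 1) \<rightarrow> carrier R \<and>
          (\<forall>l\<in>bas P j. u l = (\<Oplus>\<^bsub>R\<^esub> k\<in>bas P (j + 1). v k \<otimes>\<^bsub>R\<^esub> mat P j k l))"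
  using assms unfolding resolves_def by (blast, blast, blast, blast, blast)

text \<open>The obstruction to extending a homotopy \<open>h\<close> between multiplication by \<open>a\<close> and \<open>0\<close> by one degree is a
  family of cycles; \<open>e\<close> is the contribution of the previous stage.\<close>

lemma (in cring) homotopy_cycle:
  assumes P: "free_complex R P" and a: "a \<in> carrier R" and h: "\<And>l k. h l k \<in> carrier R"
    and l: "l \<in> bas P (j + 1)" and m': "m' \<in> bas P j"
    and e: "\<And>m. e m \<in> carrier R" "cob (self_module R) P j e l = \<zero>"
    and eq: "\<And>m. m \<in> bas P j \<Longrightarrow>
      (\<Oplus>k\<in>bas P (j + 1). h m k \<otimes> mat P j k m') = (if m = m' then a else \<zero>) \<ominus> e m"
  shows "(\<Oplus>k\<in>bas P (j + 1). ((if l = k then a else \<zero>) \<ominus> cob (self_module R) P j (\<lambda>m. h m k) l)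
     \<otimes> mat P j k m') = \<zero>"
proof -
  let ?D = "mat P j" and ?c = "cob (self_module R) P j"
  note [simp] = self.mat_closed[OF P] self.finite_bas[OF P]
  have hc [simp]: "?c (\<lambda>m. h m k) l \<in> carrier R" for k l
    using self.cob_closed[OF P, of "\<lambda>m. h m k" j l] h by simp
  have "(\<Oplus>k\<in>bas P (j + 1). ((if l = k then a else \<zero>) \<ominus> ?c (\<lambda>m. h m k) l) \<otimes> ?D k m')
     = (\<Oplus>k\<in>bas P (j + 1). (if l = k then a \<otimes> ?D k m' else \<zero>) \<oplus> (\<ominus> \<one>) \<otimes> (?c (\<lambda>m. h m k) l \<otimes> ?D k m'))"
    using a by (intro finsum_cong') (auto simp: a_minus_def l_distr l_minus)
  also have "\<dots> = (\<Oplus>k\<in>bas P (j + 1). (if l = k then a \<otimes> ?D k m' else \<zero>)) \<oplus>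
     (\<Oplus>k\<in>bas P (j + 1). (\<ominus> \<one>) \<otimes> (?c (\<lambda>m. h m k) l \<otimes> ?D k m'))"
    using a by (intro finsum_addf) auto
  also have "(\<Oplus>k\<in>bas P (j + 1). (if l = k then a \<otimes> ?D k m' else \<zero>)) = a \<otimes> ?D l m'"
    using a l by (intro finsum_singleton) auto
  also have "(\<Oplus>k\<in>bas P (j + 1). (\<ominus> \<one>) \<otimes> (?c (\<lambda>m. h m k) l \<otimes> ?D k m'))
     = (\<ominus> \<one>) \<otimes> (\<Oplus>k\<in>bas P (j + 1). ?c (\<lambda>m. h m k) l \<otimes> ?D k m')"
    by (intro finsum_rdistr[symmetric]) auto
  also have "(\<Oplus>k\<in>bas P (j + 1). ?c (\<lambda>m. h m k) l \<otimes> ?D k m')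
     = (\<Oplus>k\<in>bas P (j + 1). \<Oplus>m\<in>bas P j. ?D l m \<otimes> (h m k \<otimes> ?D k m'))"
  proof (intro finsum_cong')
    fix k
    have "?c (\<lambda>m. h m k) l \<otimes> ?D k m' = (\<Oplus>m\<in>bas P j. ?D l m \<otimes> h m k \<otimes> ?D k m')"
      unfolding cob_def using h by (simp, intro finsum_ldistr) auto
    also have "\<dots> = (\<Oplus>m\<in>bas P j. ?D l m \<otimes> (h m k \<otimes> ?D k m'))"
      using h by (intro finsum_cong') (auto simp: m_assoc)
    finally show "?c (\<lambda>m. h m k) l \<otimes> ?D k m' = (\<Oplus>m\<in>bas P j. ?D l m \<otimes> (h m k \<otimes> ?D k m'))" .
  qed (use h in \<open>auto intro!: finsum_closed\<close>)
  also have "\<dots> = (\<Oplus>m\<in>bas P j. \<Oplus>k\<in>bas P (j + 1). ?D l m \<otimes> (h m k \<otimes> ?D k m'))"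
    using self.finsum_swap[of "bas P (j + 1)" "bas P j" "\<lambda>k m. ?D l m \<otimes> (h m k \<otimes> ?D k m')"] h by simp
  also have "\<dots> = (\<Oplus>m\<in>bas P j. ?D l m \<otimes> ((if m = m' then a else \<zero>) \<ominus> e m))"
  proof (intro finsum_cong')
    fix m assume m: "m \<in> bas P j"
    have "(\<Oplus>k\<in>bas P (j + 1). ?D l m \<otimes> (h m k \<otimes> ?D k m')) = ?D l m \<otimes> (\<Oplus>k\<in>bas P (j + 1). h m k \<otimes> ?D k m')"
      using h by (intro finsum_rdistr[symmetric]) auto
    then show "(\<Oplus>k\<in>bas P (j + 1). ?D l m \<otimes> (h m k \<otimes> ?D k m'))
       = ?D l m \<otimes> ((if m = m' then a else \<zero>) \<ominus> e m)" using eq[OF m] by simp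
  qed (use a e(1) in \<open>auto simp: a_minus_def\<close>)
  also have "\<dots> = ?c (\<lambda>m. (if m = m' then a else \<zero>) \<ominus> e m) l" by (simp add: cob_def)
  also have "\<dots> = ?c (\<lambda>m. if m = m' then a else \<zero>) l \<ominus> ?c e l"
    using self.cob_diff[OF P, of "\<lambda>m. if m = m' then a else \<zero>" j e l] a e(1) by simp
  also have "?c (\<lambda>m. if m = m' then a else \<zero>) l = (\<Oplus>m\<in>bas P j. if m' = m then ?D l m \<otimes> a else \<zero>)"
    unfolding cob_def using a by (simp, intro finsum_cong') auto
  also have "\<dots> = ?D l m' \<otimes> a" using a m' by (intro finsum_singleton) auto
  finally show ?thesis using e(2) a by (simp add: a_minus_def l_minus r_neg m_comm)
qed

text \<open>Multiplication by an element of \<open>J\<close> is null-homotopic on a free resolution of \<open>R / J\<close>.\<close>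

lemma (in cring) resolution_homotopy:
  assumes res: "resolves R P J" and a: "a \<in> J" and J: "J \<subseteq> carrier R"
  shows "\<exists>h. (\<forall>n l k. h n l k \<in> carrier R) \<and>
    (\<forall>l\<in>bas P 0. \<forall>l'\<in>bas P 0. (\<Oplus>k\<in>bas P 1. h 0 l k \<otimes> mat P 0 k l') = (if l = l' then a else \<zero>)) \<and>
    (\<forall>n. \<forall>l\<in>bas P (int n + 1). \<forall>l'\<in>bas P (int n + 1).
      (\<Oplus>k\<in>bas P (int n + 2). h (Suc n) l k \<otimes> mat P (int n + 1) k l')
        = (if l = l' then a else \<zero>) \<ominus> cob (self_module R) P (int n) (\<lambda>m. h n m l') l)"
proof -
  note R = resolvesD[OF res]
  note [simp] = self.mat_closed[OF R(1)] self.finite_bas[OF R(1)]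
  have aR: "a \<in> carrier R" using a J by blast
  let ?c = "cob (self_module R) P"
  have hc: "?c j (\<lambda>m. h m k) l \<in> carrier R" if "\<And>l k. h l k \<in> carrier R" for h j k l
    using self.cob_closed[OF R(1), of "\<lambda>m. h m k" j l] that by simp
  define Pr where "Pr = (\<lambda>n (h :: nat \<Rightarrow> nat \<Rightarrow> 'a). (\<forall>l k. h l k \<in> carrier R) \<and>
    (\<forall>l\<in>bas P (int n + 1). \<forall>m'\<in>bas P (int n). (\<Oplus>k\<in>bas P (int n + 1).
      ((if l = k then a else \<zero>) \<ominus> ?c (int n) (\<lambda>m. h m k) l) \<otimes> mat P (int n) k m') = \<zero>))"
  define Q where "Q = (\<lambda>n (h :: nat \<Rightarrow> nat \<Rightarrow> 'a) h'. \<forall>l\<in>bas P (int n + 1). \<forall>l'\<in>bas P (int n + 1).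
      (\<Oplus>k\<in>bas P (int n + 2). h' l k \<otimes> mat P (int n + 1) k l')
        = (if l = l' then a else \<zero>) \<ominus> ?c (int n) (\<lambda>m. h m l') l)"
  obtain v where v: "v \<in> bas P 1 \<rightarrow> carrier R" "a = (\<Oplus>k\<in>bas P 1. v k \<otimes> mat P 0 k 0)"
    using R(4)[OF a] by blast
  define h0 where "h0 = (\<lambda>(l :: nat) k. if k \<in> bas P 1 then v k else \<zero>)"
  have h0c: "h0 l k \<in> carrier R" for l k using v(1) by (auto simp: h0_def)
  have h0: "(\<Oplus>k\<in>bas P 1. h0 l k \<otimes> mat P 0 k l') = (if l = l' then a else \<zero>)"
    if "l \<in> bas P 0" "l' \<in> bas P 0" for l l'
  proof -
    have "(\<Oplus>k\<in>bas P 1. h0 l k \<otimes> mat P 0 k 0) = a"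
      unfolding v(2) using v(1) by (intro finsum_cong') (auto simp: h0_def)
    then show ?thesis using that R(2) by simp
  qed
  have "Pr 0 h0"
    unfolding Pr_def
  proof (intro conjI allI ballI h0c)
    fix l m' assume l: "l \<in> bas P (int 0 + 1)" and m': "m' \<in> bas P (int 0)"
    have eq: "(\<Oplus>k\<in>bas P (0 + 1). h0 m k \<otimes> mat P 0 k m') = (if m = m' then a else \<zero>) \<ominus> \<zero>"
      if "m \<in> bas P 0" for m
      using h0[OF that, of m'] m' aR by (simp add: a_minus_def)
    have z: "?c 0 (\<lambda>m. \<zero>) l = \<zero>" using self.cob_zero[OF R(1)] by simp
    show "(\<Oplus>k\<in>bas P (int 0 + 1). ((if l = k then a else \<zero>) \<ominus> ?c (int 0) (\<lambda>m. h0 m k) l) \<otimes> mat P (int 0) k m') = \<zero>"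
      using homotopy_cycle[OF R(1) aR h0c _ _ _ z eq] l m' by simp
  qed
  moreover have "\<exists>h'. Pr (Suc n) h' \<and> Q n h h'" if h: "Pr n h" for n h
  proof -
    have hR: "h l k \<in> carrier R" for l k using h by (simp add: Pr_def)
    let ?u = "\<lambda>l k. (if l = k then a else \<zero>) \<ominus> ?c (int n) (\<lambda>m. h m k) l"
    have uc: "?u l k \<in> carrier R" for l k using aR hc[of h, OF hR] by simp
    have "\<forall>l\<in>bas P (int n + 1). \<exists>v. v \<in> bas P (int n + 2) \<rightarrow> carrier R \<and>
        (\<forall>l'\<in>bas P (int n + 1). ?u l l' = (\<Oplus>k\<in>bas P (int n + 2). v k \<otimes> mat P (int n + 1) k l'))"
    proof
      fix l assume l: "l \<in> bas P (int n + 1)"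
      have cyc: "(\<Oplus>k\<in>bas P (int n + 1). ?u l k \<otimes> mat P (int n + 1 - 1) k m) = \<zero>"
        if "m \<in> bas P (int n + 1 - 1)" for m
        using h l that by (simp add: Pr_def)
      show "\<exists>v. v \<in> bas P (int n + 2) \<rightarrow> carrier R \<and>
        (\<forall>l'\<in>bas P (int n + 1). ?u l l' = (\<Oplus>k\<in>bas P (int n + 2). v k \<otimes> mat P (int n + 1) k l'))"
        using R(5)[of "int n + 1" "?u l", OF _ _ cyc] uc by (simp add: add.assoc)
    qed
    then obtain w where w: "\<forall>l\<in>bas P (int n + 1). w l \<in> bas P (int n + 2) \<rightarrow> carrier R \<and>
        (\<forall>l'\<in>bas P (int n + 1). ?u l l' = (\<Oplus>k\<in>bas P (int n + 2). w l k \<otimes> mat P (int n + 1) k l'))"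
      by (rule bchoice[THEN exE])
    define h' where "h' = (\<lambda>l k. if l \<in> bas P (int n + 1) \<and> k \<in> bas P (int n + 2) then w l k else \<zero>)"
    have h'R: "h' l k \<in> carrier R" for l k using w by (auto simp: h'_def)
    have Q: "(\<Oplus>k\<in>bas P (int n + 2). h' l k \<otimes> mat P (int n + 1) k l') = ?u l l'"
      if "l \<in> bas P (int n + 1)" "l' \<in> bas P (int n + 1)" for l l'
    proof -
      have "(\<Oplus>k\<in>bas P (int n + 2). h' l k \<otimes> mat P (int n + 1) k l')
         = (\<Oplus>k\<in>bas P (int n + 2). w l k \<otimes> mat P (int n + 1) k l')"
        using w that by (intro finsum_cong') (auto simp: h'_def Pi_def)
      then show ?thesis using w that by simp
    qed
    then have "Q n h h'" by (simp add: Q_def)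
    moreover have "Pr (Suc n) h'"
      unfolding Pr_def
    proof (intro conjI allI ballI h'R)
      fix l m' assume l: "l \<in> bas P (int (Suc n) + 1)" and m': "m' \<in> bas P (int (Suc n))"
      let ?e = "\<lambda>m. ?c (int n) (\<lambda>p. h p m') m"
      have j: "int (Suc n) = int n + 1" "int n + 1 + 1 = int n + 2" by simp_all
      have ec: "?e m \<in> carrier R" for m by (rule hc[OF hR])
      have "(\<lambda>p. h p m') \<in> bas P (int n) \<rightarrow> carrier (self_module R)" using hR by simp
      then have z: "?c (int n + 1) ?e l = \<zero>"
        using self.cob_cob'[OF R(1), of "\<lambda>p. h p m'" "int n" l] l by (simp only: j self_module_simps)
      have eq: "(\<Oplus>k\<in>bas P (int n + 1 + 1). h' m k \<otimes> mat P (int n + 1) k m') = (if m = m' then a else \<zero>) \<ominus> ?e m"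
        if "m \<in> bas P (int n + 1)" for m
        using Q[OF that, of m'] m' by (simp only: j)
      show "(\<Oplus>k\<in>bas P (int (Suc n) + 1). ((if l = k then a else \<zero>) \<ominus> ?c (int (Suc n)) (\<lambda>m. h' m k) l)
          \<otimes> mat P (int (Suc n)) k m') = \<zero>"
        using homotopy_cycle[OF R(1) aR h'R _ _ ec z eq] l m' by (simp only: j)
    qed
    ultimately show ?thesis by blast
  qed
  ultimately obtain h where h: "\<And>n. Pr n (h n)" "\<And>n. Q n (h n) (h (Suc n))" "h 0 = h0"
    using dependent_nat_choice[of "\<lambda>n h. Pr n h \<and> (n = 0 \<longrightarrow> h = h0)" Q] by (metis nat.simps(3))
  then show ?thesis using h0 by (intro exI[of _ h]) (simp add: Pr_def Q_def)
qed

lemma (in module) add_minus_cancel: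
  "x \<in> carrier M \<Longrightarrow> y \<in> carrier M \<Longrightarrow> (x \<oplus>\<^bsub>M\<^esub> y) \<ominus>\<^bsub>M\<^esub> y = x"
  by (simp add: a_minus_def M.a_assoc M.r_neg)

lemma (in module) kills_resolution:
  assumes res: "resolves R P J" and a: "a \<in> J" and J: "J \<subseteq> carrier R"
    and U: "submodule U R M" and V: "submodule V R M"
  shows "kills M P i a U V"
proof (cases "i < 0")
  case True
  then show ?thesis using kills_neg[OF resolvesD(1)[OF res]] by blast
next
  case False
  then obtain n where n: "i = int n" using nonneg_int_cases[of i] by auto
  note R = resolvesD[OF res] and UD = submoduleD[OF U] and VD = submoduleD[OF V]
  note [simp] = mat_closed[OF R(1)] finite_bas[OF R(1)]
  have aR: "a \<in> carrier R" using a J by blast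
  obtain h where hR: "\<forall>n l k. h n l k \<in> carrier R" and
    h0: "\<forall>l\<in>bas P 0. \<forall>l'\<in>bas P 0. (\<Oplus>k\<in>bas P 1. h 0 l k \<otimes> mat P 0 k l') = (if l = l' then a else \<zero>)" and
    hS: "\<forall>n. \<forall>l\<in>bas P (int n + 1). \<forall>l'\<in>bas P (int n + 1).
      (\<Oplus>k\<in>bas P (int n + 2). h (Suc n) l k \<otimes> mat P (int n + 1) k l')
        = (if l = l' then a else \<zero>) \<ominus> cob (self_module R) P (int n) (\<lambda>m. h n m l') l"
    using resolution_homotopy[OF res a J] by blast
  note [simp] = hR[rule_format]
  show ?thesis
  proof (rule killsI)
    fix z assume z: "z \<in> bas P i \<rightarrow> V" "\<And>k. k \<in> bas P (i + 1) \<Longrightarrow> cob M P i z k \<in> U"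
    have zc: "z \<in> bas P i \<rightarrow> carrier M" using z(1) VD(1) by auto
    define e where "e = (\<lambda>l l'. if n = 0 then \<zero> else cob (self_module R) P (i - 1) (\<lambda>m. h (n - 1) m l') l)"
    have ec: "e l l' \<in> carrier R" for l l'
      using self.cob_closed[OF R(1), of "\<lambda>m. h (n - 1) m l'" "i - 1" l] by (simp add: e_def)
    have eq: "(\<Oplus>k\<in>bas P (i + 1). h n l k \<otimes> mat P i k l') \<oplus> e l l' = (if l = l' then a else \<zero>)"
      if "l \<in> bas P i" "l' \<in> bas P i" for l l'
    proof (cases n)
      case 0
      then show ?thesis using h0 that n aR by (simp add: e_def)
    next
      case (Suc m)
      then have i: "i = int m + 1" "i + 1 = int m + 2" "i - 1 = int m" using n by auto
      have e: "e l l' = cob (self_module R) P (int m) (\<lambda>p. h m p l') l" using Suc by (simp add: e_def i(3))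
      have "l \<in> bas P (int m + 1)" "l' \<in> bas P (int m + 1)" using that unfolding i(1) by auto
      from hS[rule_format, OF this]
      have "(\<Oplus>k\<in>bas P (i + 1). h n l k \<otimes> mat P i k l') = (if l = l' then a else \<zero>) \<ominus> e l l'"
        unfolding e i(2) unfolding i(1) Suc .
      then show ?thesis using aR by (simp add: ec a_minus_def R.a_assoc R.l_neg)
    qed
    define w where "w = (\<lambda>m. \<Oplus>\<^bsub>M\<^esub> l'\<in>bas P i. h (n - 1) m l' \<odot>\<^bsub>M\<^esub> z l')"
    have w: "w \<in> bas P (i - 1) \<rightarrow> V"
      unfolding w_def using z(1) by (auto intro!: submodule_finsum[OF V] VD(4))
    have cw: "cob M P (i - 1) w l = (\<Oplus>\<^bsub>M\<^esub> l'\<in>bas P i. e l l' \<odot>\<^bsub>M\<^esub> z l')" if l: "l \<in> bas P i" for l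
    proof (cases n)
      case 0
      then have "bas P (i - 1) = {}" using R(1) n by (simp add: free_complexD(2))
      then have "cob M P (i - 1) w l = \<zero>\<^bsub>M\<^esub>" by (simp add: cob_def)
      moreover have "(\<Oplus>\<^bsub>M\<^esub> l'\<in>bas P i. e l l' \<odot>\<^bsub>M\<^esub> z l') = (\<Oplus>\<^bsub>M\<^esub> l'\<in>bas P i. \<zero>\<^bsub>M\<^esub>)"
        using zc 0 by (intro M.finsum_cong') (auto simp: e_def Pi_def)
      ultimately show ?thesis by (simp add: M.finsum_zero)
    next
      case (Suc m)
      have "cob M P (i - 1) w l = (\<Oplus>\<^bsub>M\<^esub> p\<in>bas P (i - 1). \<Oplus>\<^bsub>M\<^esub> l'\<in>bas P i. (mat P (i - 1) l p \<otimes> h m p l') \<odot>\<^bsub>M\<^esub> z l')"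
        unfolding cob_def
      proof (intro M.finsum_cong')
        fix p
        have "mat P (i - 1) l p \<odot>\<^bsub>M\<^esub> w p = (\<Oplus>\<^bsub>M\<^esub> l'\<in>bas P i. mat P (i - 1) l p \<odot>\<^bsub>M\<^esub> (h m p l' \<odot>\<^bsub>M\<^esub> z l'))"
          unfolding w_def using zc Suc by (simp, intro finsum_smult_ldistr) (auto simp: Pi_def)
        also have "\<dots> = (\<Oplus>\<^bsub>M\<^esub> l'\<in>bas P i. (mat P (i - 1) l p \<otimes> h m p l') \<odot>\<^bsub>M\<^esub> z l')"
          using zc by (intro M.finsum_cong') (auto simp: smult_assoc1 Pi_def)
        finally show "mat P (i - 1) l p \<odot>\<^bsub>M\<^esub> w p
           = (\<Oplus>\<^bsub>M\<^esub> l'\<in>bas P i. (mat P (i - 1) l p \<otimes> h m p l') \<odot>\<^bsub>M\<^esub> z l')" .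
      qed (use zc in \<open>auto intro!: M.finsum_closed simp: Pi_def\<close>)
      also have "\<dots> = (\<Oplus>\<^bsub>M\<^esub> l'\<in>bas P i. \<Oplus>\<^bsub>M\<^esub> p\<in>bas P (i - 1). (mat P (i - 1) l p \<otimes> h m p l') \<odot>\<^bsub>M\<^esub> z l')"
        using zc by (intro finsum_swap) (auto simp: Pi_def)
      also have "\<dots> = (\<Oplus>\<^bsub>M\<^esub> l'\<in>bas P i. e l l' \<odot>\<^bsub>M\<^esub> z l')"
      proof (intro M.finsum_cong')
        fix l' assume l': "l' \<in> bas P i"
        have "(\<Oplus>\<^bsub>M\<^esub> p\<in>bas P (i - 1). (mat P (i - 1) l p \<otimes> h m p l') \<odot>\<^bsub>M\<^esub> z l')
          = (\<Oplus>p\<in>bas P (i - 1). mat P (i - 1) l p \<otimes> h m p l') \<odot>\<^bsub>M\<^esub> z l'"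
          using zc l' by (intro smult_finsum[symmetric]) (auto simp: Pi_def)
        then show "(\<Oplus>\<^bsub>M\<^esub> p\<in>bas P (i - 1). (mat P (i - 1) l p \<otimes> h m p l') \<odot>\<^bsub>M\<^esub> z l') = e l l' \<odot>\<^bsub>M\<^esub> z l'"
          using Suc by (simp add: e_def cob_def)
      qed (use zc ec in \<open>auto simp: Pi_def\<close>)
      finally show ?thesis .
    qed
    have ch: "(\<Oplus>\<^bsub>M\<^esub> k\<in>bas P (i + 1). h n l k \<odot>\<^bsub>M\<^esub> cob M P i z k)
       = (\<Oplus>\<^bsub>M\<^esub> l'\<in>bas P i. (\<Oplus>k\<in>bas P (i + 1). h n l k \<otimes> mat P i k l') \<odot>\<^bsub>M\<^esub> z l')" for l
    proof -
      have "(\<Oplus>\<^bsub>M\<^esub> k\<in>bas P (i + 1). h n l k \<odot>\<^bsub>M\<^esub> cob M P i z k)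
        = (\<Oplus>\<^bsub>M\<^esub> k\<in>bas P (i + 1). \<Oplus>\<^bsub>M\<^esub> l'\<in>bas P i. (h n l k \<otimes> mat P i k l') \<odot>\<^bsub>M\<^esub> z l')"
      proof (intro M.finsum_cong')
        fix k
        have "h n l k \<odot>\<^bsub>M\<^esub> cob M P i z k = (\<Oplus>\<^bsub>M\<^esub> l'\<in>bas P i. h n l k \<odot>\<^bsub>M\<^esub> (mat P i k l' \<odot>\<^bsub>M\<^esub> z l'))"
          unfolding cob_def using zc by (intro finsum_smult_ldistr) (auto simp: Pi_def)
        also have "\<dots> = (\<Oplus>\<^bsub>M\<^esub> l'\<in>bas P i. (h n l k \<otimes> mat P i k l') \<odot>\<^bsub>M\<^esub> z l')"
          using zc by (intro M.finsum_cong') (auto simp: smult_assoc1 Pi_def)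
        finally show "h n l k \<odot>\<^bsub>M\<^esub> cob M P i z k = (\<Oplus>\<^bsub>M\<^esub> l'\<in>bas P i. (h n l k \<otimes> mat P i k l') \<odot>\<^bsub>M\<^esub> z l')" .
      qed (use zc in \<open>auto intro!: M.finsum_closed simp: Pi_def\<close>)
      also have "\<dots> = (\<Oplus>\<^bsub>M\<^esub> l'\<in>bas P i. \<Oplus>\<^bsub>M\<^esub> k\<in>bas P (i + 1). (h n l k \<otimes> mat P i k l') \<odot>\<^bsub>M\<^esub> z l')"
        using zc by (intro finsum_swap) (auto simp: Pi_def)
      also have "\<dots> = (\<Oplus>\<^bsub>M\<^esub> l'\<in>bas P i. (\<Oplus>k\<in>bas P (i + 1). h n l k \<otimes> mat P i k l') \<odot>\<^bsub>M\<^esub> z l')"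
        using zc by (intro M.finsum_cong' smult_finsum[symmetric]) (auto simp: Pi_def intro!: R.finsum_closed)
      finally show ?thesis .
    qed
    have "a \<odot>\<^bsub>M\<^esub> z l \<ominus>\<^bsub>M\<^esub> cob M P (i - 1) w l \<in> U" if l: "l \<in> bas P i" for l
    proof -
      have zl: "z l \<in> carrier M" using zc l by auto
      have wc: "cob M P (i - 1) w l \<in> carrier M" using cob_closed[OF R(1)] w VD(1) by blast
      let ?s = "\<Oplus>\<^bsub>M\<^esub> k\<in>bas P (i + 1). h n l k \<odot>\<^bsub>M\<^esub> cob M P i z k"
      have sU: "?s \<in> U" using z(2) by (intro submodule_finsum[OF U] UD(4)) auto
      have hm: "(\<Oplus>k\<in>bas P (i + 1). h n l k \<otimes> mat P i k l') \<in> carrier R" for l'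
        by (intro R.finsum_closed) auto
      have "?s \<oplus>\<^bsub>M\<^esub> cob M P (i - 1) w l
         = (\<Oplus>\<^bsub>M\<^esub> l'\<in>bas P i. (\<Oplus>k\<in>bas P (i + 1). h n l k \<otimes> mat P i k l') \<odot>\<^bsub>M\<^esub> z l' \<oplus>\<^bsub>M\<^esub> e l l' \<odot>\<^bsub>M\<^esub> z l')"
        unfolding ch cw[OF l] using zc ec hm by (intro M.finsum_addf[symmetric]) (auto simp: Pi_def)
      also have "\<dots> = (\<Oplus>\<^bsub>M\<^esub> l'\<in>bas P i. if l = l' then a \<odot>\<^bsub>M\<^esub> z l' else \<zero>\<^bsub>M\<^esub>)"
      proof (intro M.finsum_cong')
        fix l' assume l': "l' \<in> bas P i"
        have zl': "z l' \<in> carrier M" using zc l' by auto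
        show "(\<Oplus>k\<in>bas P (i + 1). h n l k \<otimes> mat P i k l') \<odot>\<^bsub>M\<^esub> z l' \<oplus>\<^bsub>M\<^esub> e l l' \<odot>\<^bsub>M\<^esub> z l'
           = (if l = l' then a \<odot>\<^bsub>M\<^esub> z l' else \<zero>\<^bsub>M\<^esub>)"
          using eq[OF l l'] smult_l_distr[OF hm ec zl', of l' l l', symmetric] zl' by simp
      qed (use zc aR in \<open>auto simp: Pi_def\<close>)
      also have "\<dots> = a \<odot>\<^bsub>M\<^esub> z l" using zc aR l by (intro M.finsum_singleton) (auto simp: Pi_def)
      finally have "?s \<oplus>\<^bsub>M\<^esub> cob M P (i - 1) w l = a \<odot>\<^bsub>M\<^esub> z l" .
      then have "a \<odot>\<^bsub>M\<^esub> z l \<ominus>\<^bsub>M\<^esub> cob M P (i - 1) w l = ?s"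
        using add_minus_cancel[OF UD(1)[OF sU] wc] by (simp only:)
      then show ?thesis using sU by simp
    qed
    then show "\<exists>w. w \<in> bas P (i - 1) \<rightarrow> V \<and> (\<forall>k\<in>bas P i. a \<odot>\<^bsub>M\<^esub> z k \<ominus>\<^bsub>M\<^esub> cob M P (i - 1) w k \<in> U)"
      using w by blast
  qed
qed

context module
begin

lemma seq_smult_Nil: "seq_smult M [] = {\<zero>\<^bsub>M\<^esub>}"
  by (simp add: seq_smult_def)

text \<open>Together with the corresponding fact for the empty list, this makes \<open>seq_smult\<close> accessible to
  induction from the end of the sequence.\<close>

lemma seq_smult_snoc:
  assumes "set xs \<subseteq> carrier R" "x \<in> carrier R"
  shows "seq_smult M (xs @ [x]) = plus_mult M (seq_smult M xs) x (carrier M)"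
proof -
  let ?n = "length xs"
  have xs: "xs ! j \<in> carrier R" if "j < ?n" for j using assms(1) that nth_mem by blast
  have split: "(\<Oplus>\<^bsub>M\<^esub> j\<in>{..<length (xs @ [x])}. (xs @ [x]) ! j \<odot>\<^bsub>M\<^esub> m j)
     = (\<Oplus>\<^bsub>M\<^esub> j\<in>{..<?n}. xs ! j \<odot>\<^bsub>M\<^esub> m j) \<oplus>\<^bsub>M\<^esub> x \<odot>\<^bsub>M\<^esub> m ?n"
    if m: "m \<in> {..<Suc ?n} \<rightarrow> carrier M" for m
  proof -
    have "{..<length (xs @ [x])} = insert ?n {..<?n}" by auto
    then have "(\<Oplus>\<^bsub>M\<^esub> j\<in>{..<length (xs @ [x])}. (xs @ [x]) ! j \<odot>\<^bsub>M\<^esub> m j)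
      = x \<odot>\<^bsub>M\<^esub> m ?n \<oplus>\<^bsub>M\<^esub> (\<Oplus>\<^bsub>M\<^esub> j\<in>{..<?n}. (xs @ [x]) ! j \<odot>\<^bsub>M\<^esub> m j)"
      using m xs assms by (simp add: Pi_def nth_append)
    also have "(\<Oplus>\<^bsub>M\<^esub> j\<in>{..<?n}. (xs @ [x]) ! j \<odot>\<^bsub>M\<^esub> m j) = (\<Oplus>\<^bsub>M\<^esub> j\<in>{..<?n}. xs ! j \<odot>\<^bsub>M\<^esub> m j)"
      using m xs by (intro M.finsum_cong') (auto simp: nth_append Pi_def)
    finally show ?thesis using m xs assms by (simp add: M.a_comm Pi_def)
  qed
  show ?thesis
  proof (intro equalityI subsetI)
    fix y assume "y \<in> seq_smult M (xs @ [x])"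
    then obtain m where m: "m \<in> {..<Suc ?n} \<rightarrow> carrier M"
      "y = (\<Oplus>\<^bsub>M\<^esub> j\<in>{..<length (xs @ [x])}. (xs @ [x]) ! j \<odot>\<^bsub>M\<^esub> m j)" by (auto simp: seq_smult_def)
    then have "(\<Oplus>\<^bsub>M\<^esub> j\<in>{..<?n}. xs ! j \<odot>\<^bsub>M\<^esub> m j) \<in> seq_smult M xs" "m ?n \<in> carrier M"
      by (auto simp: seq_smult_def Pi_def)
    then show "y \<in> plus_mult M (seq_smult M xs) x (carrier M)"
      using m(2) split[OF m(1)] unfolding plus_mult_def by blast
  next
    fix y assume "y \<in> plus_mult M (seq_smult M xs) x (carrier M)"
    then obtain m v where m: "m \<in> {..<?n} \<rightarrow> carrier M" "v \<in> carrier M"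
      "y = (\<Oplus>\<^bsub>M\<^esub> j\<in>{..<?n}. xs ! j \<odot>\<^bsub>M\<^esub> m j) \<oplus>\<^bsub>M\<^esub> x \<odot>\<^bsub>M\<^esub> v" by (auto simp: seq_smult_def plus_mult_def)
    have m': "m(?n := v) \<in> {..<Suc ?n} \<rightarrow> carrier M" using m by (auto simp: Pi_def less_Suc_eq)
    have "(\<Oplus>\<^bsub>M\<^esub> j\<in>{..<?n}. xs ! j \<odot>\<^bsub>M\<^esub> (m(?n := v)) j) = (\<Oplus>\<^bsub>M\<^esub> j\<in>{..<?n}. xs ! j \<odot>\<^bsub>M\<^esub> m j)"
      using m xs by (intro M.finsum_cong') (auto simp: Pi_def)
    then have "y = (\<Oplus>\<^bsub>M\<^esub> j\<in>{..<length (xs @ [x])}. (xs @ [x]) ! j \<odot>\<^bsub>M\<^esub> (m(?n := v)) j)"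
      using split[OF m'] m(3) by simp
    then show "y \<in> seq_smult M (xs @ [x])"
      using m' unfolding seq_smult_def mem_Collect_eq by (intro exI[of _ "m(?n := v)"] conjI) simp_all
  qed
qed

lemma submodule_seq_smult:
  "set xs \<subseteq> carrier R \<Longrightarrow> submodule (seq_smult M xs) R M"
proof (induct xs rule: rev_induct)
  case Nil
  then show ?case using submodule_zero by (simp add: seq_smult_Nil)
next
  case (snoc x xs)
  then show ?case
    using submodule_plus_mult(1)[OF _ carrier_is_submodule, of "seq_smult M xs" x] by (simp add: seq_smult_snoc)
qed

end

text \<open>Powers of the elements of a regular sequence lie in \<open>J\<close> and thus kill the cohomology of \<open>P\<close>, while
  each element is a nonzerodivisor modulo its predecessors. Descending induction along the sequence
  gives vanishing in one more degree for each element.\<close>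

lemma (in noetherian_cring) acyclic_below_resolution:
  assumes res: "resolves R P J" and J: "J \<subseteq> carrier R"
    and reg: "regular_sequence R (self_module R) xs" and pow: "\<And>x. x \<in> set xs \<Longrightarrow> \<exists>n::nat. x [^] n \<in> J"
  shows "acyclic_below R P (int (length xs))"
proof -
  note P = resolvesD(1)[OF res]
  have xsR: "set xs \<subseteq> carrier R" using reg by (simp add: regular_sequence_def)
  let ?U = "\<lambda>k. seq_smult (self_module R) (take k xs)"
  have tk: "set (take k xs) \<subseteq> carrier R" for k by (rule subset_trans[OF set_take_subset xsR])
  have U: "ideal (?U k) R" for k
    using self.submodule_seq_smult[OF tk] by (simp add: submodule_self_iff)
  have "kills (self_module R) P i \<one> (?U k) (carrier R)" if "k \<le> length xs" "i < int (length xs - k)" for k i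
    using that
  proof (induct k arbitrary: i rule: inc_induct)
    case base
    then show ?case using self.kills_neg[OF P] by simp
  next
    case (step k)
    let ?x = "xs ! k"
    have x: "?x \<in> set xs" "?x \<in> carrier R" using step(2) xsR by auto
    obtain n :: nat where n: "?x [^] n \<in> J" using pow[OF x(1)] by blast
    have "?U (Suc k) = plus_mult (self_module R) (?U k) ?x (carrier R)"
      using self.seq_smult_snoc[OF tk x(2), of k] step(2) by (simp add: take_Suc_conv_app_nth)
    also have "\<dots> = plus_gen R (self_module R) (?U k) ?x"
      using U[of k] x(2) by (intro plus_mult_self) (auto dest: ideal.Icarr)
    finally have "kills (self_module R) P (i - 1) \<one> (plus_gen R (self_module R) (?U k) ?x) (carrier R)"
      using step(3)[of "i - 1"] step(2,4) by simp
    moreover have "kills (self_module R) P i (?x [^] n) (?U k) (carrier R)"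
      using self.kills_resolution[OF res n J] U[of k] by (simp add: submodule_self_iff oneideal)
    moreover have "v \<in> ?U k" if "v \<in> carrier R" "?x \<otimes> v \<in> ?U k" for v
      using reg step(2) that unfolding regular_sequence_def by simp
    ultimately have "kills (self_module R) P i (\<one> [^] n) (?U k) (carrier R)"
      using kills_ideal_nonzerodivisor[OF P U[of k] x(2) one_closed, of i n] by blast
    then show ?case by simp
  qed
  from this[of 0] show ?thesis using P by (simp add: acyclic_below_def self.seq_smult_Nil)
qed

section \<open>Injective modules and injective resolutions\<close>

lemma (in module) minus_eq_zeroD:
  assumes "x \<in> carrier M" "y \<in> carrier M" "x \<ominus>\<^bsub>M\<^esub> y = \<zero>\<^bsub>M\<^esub>"
  shows "x = y"
proof -
  have "(x \<ominus>\<^bsub>M\<^esub> y) \<oplus>\<^bsub>M\<^esub> y = x" using assms(1,2) by (simp add: a_minus_def M.a_assoc M.l_neg)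
  then show ?thesis using assms by simp
qed

lemma (in module) minus_eq_zero_iff:
  "x \<in> carrier M \<Longrightarrow> y \<in> carrier M \<Longrightarrow> x \<ominus>\<^bsub>M\<^esub> y = \<zero>\<^bsub>M\<^esub> \<longleftrightarrow> x = y"
  using minus_eq_zeroD[of x y] by (auto simp: a_minus_def M.r_neg)

lemma mod_homD:
  assumes "f \<in> mod_hom R M N"
  shows "x \<in> carrier M \<Longrightarrow> f x \<in> carrier N"
    "x \<in> carrier M \<Longrightarrow> y \<in> carrier M \<Longrightarrow> f (x \<oplus>\<^bsub>M\<^esub> y) = f x \<oplus>\<^bsub>N\<^esub> f y"
    "a \<in> carrier R \<Longrightarrow> x \<in> carrier M \<Longrightarrow> f (a \<odot>\<^bsub>M\<^esub> x) = a \<odot>\<^bsub>N\<^esub> f x"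
  using assms unfolding mod_hom_def by auto

lemma mod_hom_diff:
  assumes f: "f \<in> mod_hom R M N" and "module R M" "module R N" and x: "x \<in> carrier M" and y: "y \<in> carrier M"
  shows "f (x \<ominus>\<^bsub>M\<^esub> y) = f x \<ominus>\<^bsub>N\<^esub> f y" "f \<zero>\<^bsub>M\<^esub> = \<zero>\<^bsub>N\<^esub>"
proof -
  interpret M: module R M by fact
  interpret N: module R N by fact
  note F = mod_homD[OF f]
  have c: "f x \<in> carrier N" "f y \<in> carrier N" using F(1) x y by auto
  have "f (x \<ominus>\<^bsub>M\<^esub> y) = f (x \<oplus>\<^bsub>M\<^esub> (\<ominus>\<^bsub>R\<^esub> \<one>\<^bsub>R\<^esub>) \<odot>\<^bsub>M\<^esub> y)"
    using x y by (simp add: a_minus_def M.smult_l_minus)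
  also have "\<dots> = f x \<oplus>\<^bsub>N\<^esub> (\<ominus>\<^bsub>R\<^esub> \<one>\<^bsub>R\<^esub>) \<odot>\<^bsub>N\<^esub> f y" using x y F(2,3) by simp
  also have "\<dots> = f x \<ominus>\<^bsub>N\<^esub> f y" using c by (simp add: a_minus_def N.smult_l_minus)
  finally show "f (x \<ominus>\<^bsub>M\<^esub> y) = f x \<ominus>\<^bsub>N\<^esub> f y" .
  have "f (\<zero>\<^bsub>R\<^esub> \<odot>\<^bsub>M\<^esub> x) = \<zero>\<^bsub>R\<^esub> \<odot>\<^bsub>N\<^esub> f x" by (rule F(3)[OF M.R.zero_closed x])
  then show "f \<zero>\<^bsub>M\<^esub> = \<zero>\<^bsub>N\<^esub>" using x c by simp
qed

lemma (in module) weighted_sum: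
  assumes "finite A" "v \<in> A \<rightarrow> carrier M" and u: "\<And>m. u m \<in> carrier R" "\<And>m. u' m \<in> carrier R" and a: "a \<in> carrier R"
  shows "(\<Oplus>\<^bsub>M\<^esub> m\<in>A. u m \<odot>\<^bsub>M\<^esub> v m) \<in> carrier M"
    "(\<Oplus>\<^bsub>M\<^esub> m\<in>A. (u m \<oplus> u' m) \<odot>\<^bsub>M\<^esub> v m) = (\<Oplus>\<^bsub>M\<^esub> m\<in>A. u m \<odot>\<^bsub>M\<^esub> v m) \<oplus>\<^bsub>M\<^esub> (\<Oplus>\<^bsub>M\<^esub> m\<in>A. u' m \<odot>\<^bsub>M\<^esub> v m)"
    "(\<Oplus>\<^bsub>M\<^esub> m\<in>A. (a \<otimes> u m) \<odot>\<^bsub>M\<^esub> v m) = a \<odot>\<^bsub>M\<^esub> (\<Oplus>\<^bsub>M\<^esub> m\<in>A. u m \<odot>\<^bsub>M\<^esub> v m)"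
proof -
  show "(\<Oplus>\<^bsub>M\<^esub> m\<in>A. u m \<odot>\<^bsub>M\<^esub> v m) \<in> carrier M"
    using assms by (intro M.finsum_closed) (auto simp: Pi_def)
  have "(\<Oplus>\<^bsub>M\<^esub> m\<in>A. (u m \<oplus> u' m) \<odot>\<^bsub>M\<^esub> v m) = (\<Oplus>\<^bsub>M\<^esub> m\<in>A. u m \<odot>\<^bsub>M\<^esub> v m \<oplus>\<^bsub>M\<^esub> u' m \<odot>\<^bsub>M\<^esub> v m)"
    using assms by (intro M.finsum_cong') (auto simp: Pi_def smult_l_distr)
  also have "\<dots> = (\<Oplus>\<^bsub>M\<^esub> m\<in>A. u m \<odot>\<^bsub>M\<^esub> v m) \<oplus>\<^bsub>M\<^esub> (\<Oplus>\<^bsub>M\<^esub> m\<in>A. u' m \<odot>\<^bsub>M\<^esub> v m)"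
    using assms by (intro M.finsum_addf) (auto simp: Pi_def)
  finally show "(\<Oplus>\<^bsub>M\<^esub> m\<in>A. (u m \<oplus> u' m) \<odot>\<^bsub>M\<^esub> v m)
     = (\<Oplus>\<^bsub>M\<^esub> m\<in>A. u m \<odot>\<^bsub>M\<^esub> v m) \<oplus>\<^bsub>M\<^esub> (\<Oplus>\<^bsub>M\<^esub> m\<in>A. u' m \<odot>\<^bsub>M\<^esub> v m)" .
  have "a \<odot>\<^bsub>M\<^esub> (\<Oplus>\<^bsub>M\<^esub> m\<in>A. u m \<odot>\<^bsub>M\<^esub> v m) = (\<Oplus>\<^bsub>M\<^esub> m\<in>A. a \<odot>\<^bsub>M\<^esub> (u m \<odot>\<^bsub>M\<^esub> v m))"
    using assms by (intro finsum_smult_ldistr) (auto simp: Pi_def)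
  also have "\<dots> = (\<Oplus>\<^bsub>M\<^esub> m\<in>A. (a \<otimes> u m) \<odot>\<^bsub>M\<^esub> v m)"
    using assms by (intro M.finsum_cong') (auto simp: Pi_def smult_assoc1)
  finally show "(\<Oplus>\<^bsub>M\<^esub> m\<in>A. (a \<otimes> u m) \<odot>\<^bsub>M\<^esub> v m) = a \<odot>\<^bsub>M\<^esub> (\<Oplus>\<^bsub>M\<^esub> m\<in>A. u m \<odot>\<^bsub>M\<^esub> v m)" by simp
qed

text \<open>A system of linear equations with values in an injective module \<open>E\<close> has a solution as soon as it is
  consistent. The set \<open>T\<close> plays the role of a submodule of \<open>R\<^sup>A \<times> E\<close>, the graph of a homomorphism from a submodule of
  \<open>R\<^sup>A\<close> to \<open>E\<close>, and the family \<open>v\<close> extends it. The injectivity hypothesis covers only test modules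
  inside the type of \<open>R\<close>, so the extension is made one coordinate at a time, from an ideal of \<open>R\<close> to
  \<open>R\<close>. This is the finite part of Baer's criterion.\<close>

lemma (in cring) injective_extension:
  assumes inj: "injective_module R E" and A: "finite A"
    and "\<And>u e. (u, e) \<in> T \<Longrightarrow> (\<forall>m. u m \<in> carrier R) \<and> e \<in> carrier E"
    and "\<And>u e u' e'. (u, e) \<in> T \<Longrightarrow> (u', e') \<in> T \<Longrightarrow> (\<lambda>m. u m \<oplus> u' m, e \<oplus>\<^bsub>E\<^esub> e') \<in> T"
    and "\<And>a u e. a \<in> carrier R \<Longrightarrow> (u, e) \<in> T \<Longrightarrow> (\<lambda>m. a \<otimes> u m, a \<odot>\<^bsub>E\<^esub> e) \<in> T"
    and "\<And>u e. (u, e) \<in> T \<Longrightarrow> (\<And>m. m \<in> A \<Longrightarrow> u m = \<zero>) \<Longrightarrow> e = \<zero>\<^bsub>E\<^esub>"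
  shows "\<exists>v. v \<in> A \<rightarrow> carrier E \<and> (\<forall>u e. (u, e) \<in> T \<longrightarrow> e = (\<Oplus>\<^bsub>E\<^esub> m\<in>A. u m \<odot>\<^bsub>E\<^esub> v m))"
  using A assms(3-)
proof (induct A arbitrary: T)
  case empty
  interpret E: module R E using inj by (simp add: injective_module_def)
  show ?case using empty(4) by auto
next
  case (insert a A)
  interpret E: module R E using inj by (simp add: injective_module_def)
  note TD = insert(4) and Tadd = insert(5) and Tsmult = insert(6) and Tzero = insert(7)
  let ?T0 = "{(u, e). (u, e) \<in> T \<and> u a = \<zero>}"
  have "\<exists>v. v \<in> A \<rightarrow> carrier E \<and> (\<forall>u e. (u, e) \<in> ?T0 \<longrightarrow> e = (\<Oplus>\<^bsub>E\<^esub> m\<in>A. u m \<odot>\<^bsub>E\<^esub> v m))"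
  proof (rule insert(3))
    fix u e assume *: "(u, e) \<in> ?T0"
    then show "(\<forall>m. u m \<in> carrier R) \<and> e \<in> carrier E" using TD by blast
    show "e = \<zero>\<^bsub>E\<^esub>" if "\<And>m. m \<in> A \<Longrightarrow> u m = \<zero>" using Tzero[of u e] * that by auto
    show "(\<lambda>m. u m \<oplus> u' m, e \<oplus>\<^bsub>E\<^esub> e') \<in> ?T0" if "(u', e') \<in> ?T0" for u' e'
      using Tadd[of u e u' e'] * that by auto
    show "(\<lambda>m. b \<otimes> u m, b \<odot>\<^bsub>E\<^esub> e) \<in> ?T0" if "b \<in> carrier R" for b
      using Tsmult[OF that, of u e] * that by auto
  qed
  then obtain v where v: "v \<in> A \<rightarrow> carrier E" "\<And>u e. (u, e) \<in> T \<Longrightarrow> u a = \<zero> \<Longrightarrow> e = (\<Oplus>\<^bsub>E\<^esub> m\<in>A. u m \<odot>\<^bsub>E\<^esub> v m)"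
    by auto
  define L where "L = (\<lambda>u. \<Oplus>\<^bsub>E\<^esub> m\<in>A. u m \<odot>\<^bsub>E\<^esub> v m)"
  have Lc: "L u \<in> carrier E" if "\<And>m. u m \<in> carrier R" for u
    unfolding L_def using E.weighted_sum(1)[OF insert(1) v(1) that that zero_closed] by simp
  have Ladd: "L (\<lambda>m. u m \<oplus> u' m) = L u \<oplus>\<^bsub>E\<^esub> L u'" if "\<And>m. u m \<in> carrier R" "\<And>m. u' m \<in> carrier R" for u u'
    unfolding L_def using E.weighted_sum(2)[OF insert(1) v(1) that zero_closed] by simp
  have Lsmult: "L (\<lambda>m. b \<otimes> u m) = b \<odot>\<^bsub>E\<^esub> L u" if "\<And>m. u m \<in> carrier R" "b \<in> carrier R" for b u
    unfolding L_def using E.weighted_sum(3)[OF insert(1) v(1) that(1) that(1) that(2)] by simp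
  \<comment> \<open>What remains of \<open>e\<close> after the coordinates in \<open>A\<close> are accounted for depends only on \<open>u a\<close>.\<close>
  define \<rho> where "\<rho> = (\<lambda>u e. e \<ominus>\<^bsub>E\<^esub> L u)"
  have \<rho>c: "\<rho> u e \<in> carrier E" if "(u, e) \<in> T" for u e
    using TD[OF that] Lc[of u] by (simp add: \<rho>_def)
  have \<rho>add: "\<rho> (\<lambda>m. u m \<oplus> u' m) (e \<oplus>\<^bsub>E\<^esub> e') = \<rho> u e \<oplus>\<^bsub>E\<^esub> \<rho> u' e'" if "(u, e) \<in> T" "(u', e') \<in> T" for u e u' e'
    using TD[OF that(1)] TD[OF that(2)] Lc[of u] Lc[of u'] Ladd[of u u']
    by (simp add: \<rho>_def a_minus_def E.M.minus_add E.M.a_ac)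
  have \<rho>smult: "\<rho> (\<lambda>m. b \<otimes> u m) (b \<odot>\<^bsub>E\<^esub> e) = b \<odot>\<^bsub>E\<^esub> \<rho> u e" if "(u, e) \<in> T" "b \<in> carrier R" for u e b
    using TD[OF that(1)] Lc[of u] Lsmult[of u b] that(2)
    by (simp add: \<rho>_def E.smult_minus_distr)
  have \<rho>eq: "\<rho> u e = \<rho> u' e'" if t: "(u, e) \<in> T" "(u', e') \<in> T" and ua: "u a = u' a" for u e u' e'
  proof -
    let ?n = "\<ominus> \<one>"
    have n: "?n \<in> carrier R" by simp
    have d: "(\<lambda>m. u m \<oplus> ?n \<otimes> u' m, e \<oplus>\<^bsub>E\<^esub> ?n \<odot>\<^bsub>E\<^esub> e') \<in> T"
      using Tadd[OF t(1) Tsmult[OF n t(2)]] .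
    have ua0: "u a \<oplus> ?n \<otimes> u' a = \<zero>" using ua TD[OF t(2)] by (simp add: l_minus r_neg)
    have "\<rho> (\<lambda>m. u m \<oplus> ?n \<otimes> u' m) (e \<oplus>\<^bsub>E\<^esub> ?n \<odot>\<^bsub>E\<^esub> e') = \<zero>\<^bsub>E\<^esub>"
      using E.M.r_neg[of "e \<oplus>\<^bsub>E\<^esub> ?n \<odot>\<^bsub>E\<^esub> e'"] TD[OF d]
      unfolding \<rho>_def a_minus_def L_def v(2)[OF d ua0, symmetric] by simp
    then have "\<rho> u e \<oplus>\<^bsub>E\<^esub> ?n \<odot>\<^bsub>E\<^esub> \<rho> u' e' = \<zero>\<^bsub>E\<^esub>"
      using \<rho>add[OF t(1) Tsmult[OF n t(2)]] \<rho>smult[OF t(2) n] by simp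
    then have "\<rho> u e \<ominus>\<^bsub>E\<^esub> \<rho> u' e' = \<zero>\<^bsub>E\<^esub>"
      using \<rho>c[OF t(2)] by (simp add: E.smult_l_minus a_minus_def)
    then show ?thesis using E.minus_eq_zeroD \<rho>c[OF t(1)] \<rho>c[OF t(2)] by blast
  qed
  show ?case
  proof (cases "T = {}")
    case True
    then show ?thesis by (intro exI[of _ "\<lambda>_. \<zero>\<^bsub>E\<^esub>"]) auto
  next
    case False
    define I where "I = {u a | u e. (u, e) \<in> T}"
    define g where "g = (\<lambda>x. SOME y. \<exists>u e. (u, e) \<in> T \<and> u a = x \<and> y = \<rho> u e)"
    have g: "g (u a) = \<rho> u e" if "(u, e) \<in> T" for u e
    proof -
      have "\<exists>u' e'. (u', e') \<in> T \<and> u' a = u a \<and> g (u a) = \<rho> u' e'"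
        unfolding g_def by (rule someI_ex) (use that in blast)
      then show ?thesis using \<rho>eq that by metis
    qed
    have Imem: "u a \<in> I" if "(u, e) \<in> T" for u e using that unfolding I_def by blast
    have I: "submodule I R (self_module R)"
    proof (rule self.submoduleI)
      show "I \<subseteq> carrier (self_module R)" using TD by (auto simp: I_def)
      have sm: "b \<otimes> x \<in> I" if bx: "b \<in> carrier R" "x \<in> I" for b x
      proof -
        obtain u e where "(u, e) \<in> T" "x = u a" using bx by (auto simp: I_def)
        then show ?thesis using Imem[OF Tsmult[OF bx(1)]] by simp
      qed
      then show "b \<odot>\<^bsub>self_module R\<^esub> x \<in> I" if "b \<in> carrier R" "x \<in> I" for b x using that by simp
      obtain u e where "(u, e) \<in> T" using False by auto
      then have x: "u a \<in> I" "u a \<in> carrier R" using TD by (auto simp: I_def)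
      show "\<zero>\<^bsub>self_module R\<^esub> \<in> I" using sm[OF zero_closed x(1)] x(2) by simp
      show "\<ominus>\<^bsub>self_module R\<^esub> x \<in> I" if "x \<in> I" for x
      proof -
        have "x \<in> carrier R" using that TD by (auto simp: I_def)
        then show ?thesis using sm[of "\<ominus> \<one>" x] that by (simp add: l_minus)
      qed
      show "x \<oplus>\<^bsub>self_module R\<^esub> y \<in> I" if xy: "x \<in> I" "y \<in> I" for x y
      proof -
        obtain u e where ue: "(u, e) \<in> T" "x = u a" using xy by (auto simp: I_def)
        obtain u' e' where ue': "(u', e') \<in> T" "y = u' a" using xy by (auto simp: I_def)
        show ?thesis using Imem[OF Tadd[OF ue(1) ue'(1)]] ue ue' by simp
      qed
    qed
    have "g \<in> mod_hom R ((self_module R)\<lparr>carrier := I\<rparr>) E"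
      unfolding mod_hom_def
    proof (intro CollectI conjI ballI)
      show "g \<in> carrier ((self_module R)\<lparr>carrier := I\<rparr>) \<rightarrow> carrier E"
        using g \<rho>c by (auto simp: I_def)
      show "g (x \<oplus>\<^bsub>(self_module R)\<lparr>carrier := I\<rparr>\<^esub> y) = g x \<oplus>\<^bsub>E\<^esub> g y"
        if xy: "x \<in> carrier ((self_module R)\<lparr>carrier := I\<rparr>)" "y \<in> carrier ((self_module R)\<lparr>carrier := I\<rparr>)" for x y
      proof -
        obtain u e where ue: "(u, e) \<in> T" "x = u a" using xy by (auto simp: I_def)
        obtain u' e' where ue': "(u', e') \<in> T" "y = u' a" using xy by (auto simp: I_def)
        show ?thesis using g[OF ue(1)] g[OF ue'(1)] g[OF Tadd[OF ue(1) ue'(1)]] \<rho>add[OF ue(1) ue'(1)] ue ue' by simp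
      qed
      show "g (b \<odot>\<^bsub>(self_module R)\<lparr>carrier := I\<rparr>\<^esub> x) = b \<odot>\<^bsub>E\<^esub> g x"
        if b: "b \<in> carrier R" and x: "x \<in> carrier ((self_module R)\<lparr>carrier := I\<rparr>)" for b x
      proof -
        obtain u e where ue: "(u, e) \<in> T" "x = u a" using x by (auto simp: I_def)
        show ?thesis using g[OF ue(1)] g[OF Tsmult[OF b ue(1)]] \<rho>smult[OF ue(1) b] ue by simp
      qed
    qed
    then have "\<exists>G\<in>mod_hom R (self_module R) E. \<forall>x\<in>I. G x = g x"
      using inj I self_module unfolding injective_module_def by blast
    then obtain G where G: "G \<in> mod_hom R (self_module R) E" "\<And>x. x \<in> I \<Longrightarrow> G x = g x" by blast
    note GD = mod_homD[OF G(1)]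
    have G1: "G \<one> \<in> carrier E" using GD(1) by simp
    have Gx: "G x = x \<odot>\<^bsub>E\<^esub> G \<one>" if "x \<in> carrier R" for x using GD(3)[of x \<one>] that by simp
    let ?v = "v(a := G \<one>)"
    have vc: "?v \<in> insert a A \<rightarrow> carrier E" using v(1) G1 by auto
    have "e = (\<Oplus>\<^bsub>E\<^esub> m\<in>insert a A. u m \<odot>\<^bsub>E\<^esub> ?v m)" if t: "(u, e) \<in> T" for u e
    proof -
      have u: "u m \<in> carrier R" for m using TD[OF t] by blast
      have eL: "e \<in> carrier E" "L u \<in> carrier E" using TD[OF t] Lc[of u] by auto
      have "(\<Oplus>\<^bsub>E\<^esub> m\<in>A. u m \<odot>\<^bsub>E\<^esub> ?v m) = L u"
        unfolding L_def using v(1) u insert(2) by (intro E.M.finsum_cong') (auto simp: Pi_def)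
      moreover have "(\<lambda>m. u m \<odot>\<^bsub>E\<^esub> ?v m) \<in> A \<rightarrow> carrier E" using v(1) u insert(2) by (auto simp: Pi_def)
      ultimately have "(\<Oplus>\<^bsub>E\<^esub> m\<in>insert a A. u m \<odot>\<^bsub>E\<^esub> ?v m) = u a \<odot>\<^bsub>E\<^esub> G \<one> \<oplus>\<^bsub>E\<^esub> L u"
        using insert(1,2) u G1 by simp
      also have "u a \<odot>\<^bsub>E\<^esub> G \<one> = \<rho> u e"
        using Gx[OF u, of a] G(2)[of "u a"] g[OF t] t by (auto simp: I_def)
      also have "\<rho> u e \<oplus>\<^bsub>E\<^esub> L u = e" using eL by (simp add: \<rho>_def a_minus_def E.M.a_assoc E.M.l_neg)
      finally show ?thesis by simp
    qed
    then show ?thesis using vc by blast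
  qed
qed

text \<open>The functor \<open>Hom(-, E)\<close> is exact. A cocycle \<open>y\<close> defines a homomorphism on the image of the differential,
  whose extension to the whole free module is the cochain looked for.\<close>

lemma (in cring) injective_kills:
  assumes inj: "injective_module R E" and res: "resolves R P J" and j: "1 \<le> j"
  shows "kills E P j \<one> {\<zero>\<^bsub>E\<^esub>} (carrier E)"
proof (rule killsI)
  interpret E: module R E using inj by (simp add: injective_module_def)
  note P = resolvesD(1)[OF res]
  note [simp] = self.mat_closed[OF P] self.finite_bas[OF P]
  fix y assume y: "y \<in> bas P j \<rightarrow> carrier E" "\<And>k. k \<in> bas P (j + 1) \<Longrightarrow> cob E P j y k \<in> {\<zero>\<^bsub>E\<^esub>}"
  let ?B = "bas P j" and ?D = "mat P (j - 1)"
  define c where "c = (\<lambda>u m. \<Oplus>l\<in>?B. u l \<otimes> ?D l m)"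
  define f where "f = (\<lambda>u. \<Oplus>\<^bsub>E\<^esub> l\<in>?B. u l \<odot>\<^bsub>E\<^esub> y l)"
  define T where "T = {(c u, f u) | u. \<forall>l. u l \<in> carrier R}"
  have D: "(\<lambda>l. ?D l m) \<in> ?B \<rightarrow> carrier (self_module R)" for m by simp
  have cc: "c u m \<in> carrier R" "c (\<lambda>l. u l \<oplus> u' l) m = c u m \<oplus> c u' m" "c (\<lambda>l. a \<otimes> u l) m = a \<otimes> c u m"
    if "\<And>l. u l \<in> carrier R" "\<And>l. u' l \<in> carrier R" "a \<in> carrier R" for u u' a m
    using self.weighted_sum[OF _ D, of u u' a] that by (auto simp: c_def)
  have ff: "f u \<in> carrier E" "f (\<lambda>l. u l \<oplus> u' l) = f u \<oplus>\<^bsub>E\<^esub> f u'" "f (\<lambda>l. a \<otimes> u l) = a \<odot>\<^bsub>E\<^esub> f u"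
    if "\<And>l. u l \<in> carrier R" "\<And>l. u' l \<in> carrier R" "a \<in> carrier R" for u u' a
    using E.weighted_sum[OF _ y(1), of u u' a] that by (auto simp: f_def)
  have "\<exists>v. v \<in> bas P (j - 1) \<rightarrow> carrier E \<and>
      (\<forall>u e. (u, e) \<in> T \<longrightarrow> e = (\<Oplus>\<^bsub>E\<^esub> m\<in>bas P (j - 1). u m \<odot>\<^bsub>E\<^esub> v m))"
  proof (rule injective_extension[OF inj])
    show "finite (bas P (j - 1))" by simp
    show "(\<forall>m. w m \<in> carrier R) \<and> e \<in> carrier E" if we: "(w, e) \<in> T" for w e
    proof -
      obtain u where "\<forall>l. u l \<in> carrier R" "w = c u" "e = f u" using we by (auto simp: T_def)
      then show ?thesis using cc(1)[of u u \<zero>] ff(1)[of u u \<zero>] by simp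
    qed
    show "(\<lambda>m. w m \<oplus> w' m, e \<oplus>\<^bsub>E\<^esub> e') \<in> T" if we: "(w, e) \<in> T" "(w', e') \<in> T" for w e w' e'
    proof -
      obtain u where u: "\<forall>l. u l \<in> carrier R" "w = c u" "e = f u" using we by (auto simp: T_def)
      obtain u' where u': "\<forall>l. u' l \<in> carrier R" "w' = c u'" "e' = f u'" using we by (auto simp: T_def)
      have "(\<lambda>m. w m \<oplus> w' m) = c (\<lambda>l. u l \<oplus> u' l)" "e \<oplus>\<^bsub>E\<^esub> e' = f (\<lambda>l. u l \<oplus> u' l)"
        using cc(2)[of u u' \<zero>] ff(2)[of u u' \<zero>] u u' by auto
      moreover have "\<forall>l. u l \<oplus> u' l \<in> carrier R" using u u' by simp
      ultimately show ?thesis unfolding T_def by blast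
    qed
    show "(\<lambda>m. a \<otimes> w m, a \<odot>\<^bsub>E\<^esub> e) \<in> T" if a: "a \<in> carrier R" and we: "(w, e) \<in> T" for a w e
    proof -
      obtain u where u: "\<forall>l. u l \<in> carrier R" "w = c u" "e = f u" using we by (auto simp: T_def)
      have "(\<lambda>m. a \<otimes> w m) = c (\<lambda>l. a \<otimes> u l)" "a \<odot>\<^bsub>E\<^esub> e = f (\<lambda>l. a \<otimes> u l)"
        using cc(3)[of u u a] ff(3)[of u u a] u a by auto
      moreover have "\<forall>l. a \<otimes> u l \<in> carrier R" using u a by simp
      ultimately show ?thesis unfolding T_def by blast
    qed
    show "e = \<zero>\<^bsub>E\<^esub>" if we: "(w, e) \<in> T" and z: "\<And>m. m \<in> bas P (j - 1) \<Longrightarrow> w m = \<zero>" for w e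
    proof -
      obtain u where u: "\<forall>l. u l \<in> carrier R" "w = c u" "e = f u" using we by (auto simp: T_def)
      obtain t where t: "t \<in> bas P (j + 1) \<rightarrow> carrier R"
        "\<forall>l\<in>?B. u l = (\<Oplus>k\<in>bas P (j + 1). t k \<otimes> mat P j k l)"
        using resolvesD(5)[OF res j, of u] z u by (auto simp: c_def)
      have "f u = (\<Oplus>\<^bsub>E\<^esub> l\<in>?B. \<Oplus>\<^bsub>E\<^esub> k\<in>bas P (j + 1). t k \<odot>\<^bsub>E\<^esub> (mat P j k l \<odot>\<^bsub>E\<^esub> y l))"
        unfolding f_def
      proof (intro E.M.finsum_cong')
        fix l assume l: "l \<in> ?B"
        have yl: "y l \<in> carrier E" using y(1) l by auto
        have "u l \<odot>\<^bsub>E\<^esub> y l = (\<Oplus>k\<in>bas P (j + 1). t k \<otimes> mat P j k l) \<odot>\<^bsub>E\<^esub> y l" using t(2) l by simp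
        also have "\<dots> = (\<Oplus>\<^bsub>E\<^esub> k\<in>bas P (j + 1). (t k \<otimes> mat P j k l) \<odot>\<^bsub>E\<^esub> y l)"
          using t(1) yl by (intro E.smult_finsum) (auto simp: Pi_def)
        also have "\<dots> = (\<Oplus>\<^bsub>E\<^esub> k\<in>bas P (j + 1). t k \<odot>\<^bsub>E\<^esub> (mat P j k l \<odot>\<^bsub>E\<^esub> y l))"
          using t(1) yl by (intro E.M.finsum_cong') (auto simp: Pi_def E.smult_assoc1)
        finally show "u l \<odot>\<^bsub>E\<^esub> y l = (\<Oplus>\<^bsub>E\<^esub> k\<in>bas P (j + 1). t k \<odot>\<^bsub>E\<^esub> (mat P j k l \<odot>\<^bsub>E\<^esub> y l))" .
      qed (use t(1) y(1) in \<open>auto intro!: E.M.finsum_closed simp: Pi_def\<close>)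
      also have "\<dots> = (\<Oplus>\<^bsub>E\<^esub> k\<in>bas P (j + 1). \<Oplus>\<^bsub>E\<^esub> l\<in>?B. t k \<odot>\<^bsub>E\<^esub> (mat P j k l \<odot>\<^bsub>E\<^esub> y l))"
        using t(1) y(1) by (intro E.finsum_swap) (auto simp: Pi_def)
      also have "\<dots> = (\<Oplus>\<^bsub>E\<^esub> k\<in>bas P (j + 1). \<zero>\<^bsub>E\<^esub>)"
      proof (intro E.M.finsum_cong')
        fix k assume k: "k \<in> bas P (j + 1)"
        have "(\<Oplus>\<^bsub>E\<^esub> l\<in>?B. t k \<odot>\<^bsub>E\<^esub> (mat P j k l \<odot>\<^bsub>E\<^esub> y l)) = t k \<odot>\<^bsub>E\<^esub> cob E P j y k"
          unfolding cob_def using t(1) y(1) k by (intro E.finsum_smult_ldistr[symmetric]) (auto simp: Pi_def)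
        then show "(\<Oplus>\<^bsub>E\<^esub> l\<in>?B. t k \<odot>\<^bsub>E\<^esub> (mat P j k l \<odot>\<^bsub>E\<^esub> y l)) = \<zero>\<^bsub>E\<^esub>"
          using y(2)[OF k] t(1) k by (auto simp: Pi_def)
      qed auto
      finally show ?thesis using u(3) by (simp add: E.M.finsum_zero)
    qed
  qed
  then obtain v where v: "v \<in> bas P (j - 1) \<rightarrow> carrier E"
    "\<And>u e. (u, e) \<in> T \<Longrightarrow> e = (\<Oplus>\<^bsub>E\<^esub> m\<in>bas P (j - 1). u m \<odot>\<^bsub>E\<^esub> v m)" by blast
  have "\<one> \<odot>\<^bsub>E\<^esub> y l \<ominus>\<^bsub>E\<^esub> cob E P (j - 1) v l \<in> {\<zero>\<^bsub>E\<^esub>}" if l: "l \<in> ?B" for l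
  proof -
    let ?u = "\<lambda>l'. if l = l' then \<one> else \<zero>"
    have yl: "y l \<in> carrier E" using y(1) l by auto
    have "c ?u m = ?D l m" for m
    proof -
      have "c ?u m = (\<Oplus>l'\<in>?B. if l = l' then ?D l' m else \<zero>)"
        unfolding c_def by (intro finsum_cong') auto
      also have "\<dots> = ?D l m" using l by (intro finsum_singleton) auto
      finally show ?thesis .
    qed
    moreover have "f ?u = y l"
    proof -
      have "f ?u = (\<Oplus>\<^bsub>E\<^esub> l'\<in>?B. if l = l' then y l' else \<zero>\<^bsub>E\<^esub>)"
        unfolding f_def using y(1) by (intro E.M.finsum_cong') (auto simp: Pi_def)
      also have "\<dots> = y l" using l y(1) by (intro E.M.finsum_singleton) auto
      finally show ?thesis .
    qed
    moreover have "(c ?u, f ?u) \<in> T" unfolding T_def by auto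
    ultimately have "(\<lambda>m. ?D l m, y l) \<in> T" by (metis (no_types, lifting) ext)
    then have "y l = cob E P (j - 1) v l" using v(2) by (simp add: cob_def)
    then show ?thesis using yl by (simp add: a_minus_def E.M.r_neg)
  qed
  then show "\<exists>w. w \<in> bas P (j - 1) \<rightarrow> carrier E \<and> (\<forall>k\<in>bas P j. \<one> \<odot>\<^bsub>E\<^esub> y k \<ominus>\<^bsub>E\<^esub> cob E P (j - 1) w k \<in> {\<zero>\<^bsub>E\<^esub>})"
    using v(1) by blast
qed

lemma (in cring) submodule_hom_kernel:
  assumes "module R E" "module R E'" and f: "f \<in> mod_hom R E E'"
  shows "submodule {x \<in> carrier E. f x = \<zero>\<^bsub>E'\<^esub>} R E"
proof -
  interpret E: module R E by fact
  interpret E': module R E' by fact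
  note F = mod_homD[OF f]
  have F0: "f \<zero>\<^bsub>E\<^esub> = \<zero>\<^bsub>E'\<^esub>" by (rule mod_hom_diff(2)[OF f assms(1,2) E.M.zero_closed E.M.zero_closed])
  have neg: "f (\<ominus>\<^bsub>E\<^esub> x) = \<zero>\<^bsub>E'\<^esub>" if "x \<in> carrier E" "f x = \<zero>\<^bsub>E'\<^esub>" for x
    using mod_hom_diff(1)[OF f assms(1,2) E.M.zero_closed that(1)] that F0 by (simp add: a_minus_def)
  show ?thesis by (rule E.submoduleI) (use F F0 neg in auto)
qed

text \<open>Dimension shifting along \<open>0 \<rightarrow> ker f \<rightarrow> E \<rightarrow> f E \<rightarrow> 0\<close>. It needs \<open>H\<^sup>j(Hom(P, E)) = 0\<close> for the given
  \<open>j \<ge> 1\<close>.\<close>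

lemma (in cring) kills_shift:
  assumes inj: "injective_module R E" and E': "module R E'" and f: "f \<in> mod_hom R E E'"
    and res: "resolves R P J" and j: "1 \<le> j" and s: "s \<in> carrier R"
    and k: "kills E P (j + 1) s {\<zero>\<^bsub>E\<^esub>} {x \<in> carrier E. f x = \<zero>\<^bsub>E'\<^esub>}"
  shows "kills E' P j s {\<zero>\<^bsub>E'\<^esub>} (f ` carrier E)"
proof (rule killsI)
  interpret E: module R E using inj by (simp add: injective_module_def)
  interpret E': module R E' by fact
  note P = resolvesD(1)[OF res]
  note F = mod_homD[OF f] and Fd = mod_hom_diff(1)[OF f E.module_axioms E']
  have hom: "f (cob E P i z l) = cob E' P i (\<lambda>l. f (z l)) l" if "z \<in> bas P i \<rightarrow> carrier E" for i z l
    using that by (intro E.cob_hom[OF P E' E.carrier_is_submodule]) (simp_all add: F)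
  fix y assume y: "y \<in> bas P j \<rightarrow> f ` carrier E" "\<And>k. k \<in> bas P (j + 1) \<Longrightarrow> cob E' P j y k \<in> {\<zero>\<^bsub>E'\<^esub>}"
  have "\<forall>l\<in>bas P j. \<exists>x. x \<in> carrier E \<and> f x = y l" using y(1) by (auto simp: Pi_def image_iff) metis
  then obtain x where x: "\<forall>l\<in>bas P j. x l \<in> carrier E \<and> f (x l) = y l" by (rule bchoice[THEN exE])
  have xc: "x \<in> bas P j \<rightarrow> carrier E" using x by auto
  have yc: "y \<in> bas P j \<rightarrow> carrier E'"
  proof (rule Pi_I)
    fix l assume "l \<in> bas P j"
    then show "y l \<in> carrier E'" using x F(1)[of "x l"] by auto
  qed
  have fx: "f (cob E P j x k) = \<zero>\<^bsub>E'\<^esub>" if "k \<in> bas P (j + 1)" for k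
    using hom[OF xc, of k] E'.cob_cong[OF P yc, of "\<lambda>l. f (x l)" k] x y(2)[OF that] by simp
  have a1: "cob E P j x \<in> bas P (j + 1) \<rightarrow> {x \<in> carrier E. f x = \<zero>\<^bsub>E'\<^esub>}"
    using fx E.cob_closed[OF P xc] by auto
  have a2: "\<forall>k\<in>bas P (j + 1 + 1). cob E P (j + 1) (cob E P j x) k \<in> {\<zero>\<^bsub>E\<^esub>}"
    using E.cob_cob'[OF P xc] by (simp add: add.assoc)
  obtain w where w: "w \<in> bas P (j + 1 - 1) \<rightarrow> {x \<in> carrier E. f x = \<zero>\<^bsub>E'\<^esub>}"
    "\<forall>k\<in>bas P (j + 1). s \<odot>\<^bsub>E\<^esub> cob E P j x k \<ominus>\<^bsub>E\<^esub> cob E P (j + 1 - 1) w k \<in> {\<zero>\<^bsub>E\<^esub>}"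
    using kills_bounds[OF k a1 a2] by blast
  have w': "w \<in> bas P j \<rightarrow> carrier E" "\<And>l. l \<in> bas P j \<Longrightarrow> f (w l) = \<zero>\<^bsub>E'\<^esub>" using w(1) by auto
  have sx: "(\<lambda>l. s \<odot>\<^bsub>E\<^esub> x l) \<in> bas P j \<rightarrow> carrier E" using xc s by auto
  define u where "u = (\<lambda>l. s \<odot>\<^bsub>E\<^esub> x l \<ominus>\<^bsub>E\<^esub> w l)"
  have uc: "u \<in> bas P j \<rightarrow> carrier E" unfolding u_def using sx w'(1) by auto
  have a3: "\<forall>k\<in>bas P (j + 1). cob E P j u k \<in> {\<zero>\<^bsub>E\<^esub>}"
    unfolding u_def using w(2) E.cob_diff[OF P sx w'(1)] E.cob_smult[OF P xc s] by simp
  obtain v where v: "v \<in> bas P (j - 1) \<rightarrow> carrier E"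
    "\<forall>l\<in>bas P j. \<one> \<odot>\<^bsub>E\<^esub> u l \<ominus>\<^bsub>E\<^esub> cob E P (j - 1) v l \<in> {\<zero>\<^bsub>E\<^esub>}"
    using kills_bounds[OF injective_kills[OF inj res j] uc a3] by blast
  have "s \<odot>\<^bsub>E'\<^esub> y l \<ominus>\<^bsub>E'\<^esub> cob E' P (j - 1) (\<lambda>l. f (v l)) l \<in> {\<zero>\<^bsub>E'\<^esub>}" if l: "l \<in> bas P j" for l
  proof -
    have c: "x l \<in> carrier E" "w l \<in> carrier E" "u l \<in> carrier E" "cob E P (j - 1) v l \<in> carrier E" "f (x l) = y l"
      using xc w'(1) uc E.cob_closed[OF P v(1)] x l by auto
    have "u l = cob E P (j - 1) v l"
      using E.minus_eq_zeroD[OF c(3,4)] bspec[OF v(2) l] c by simp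
    then have "f (u l) = cob E' P (j - 1) (\<lambda>l. f (v l)) l" using hom[OF v(1)] by simp
    moreover have "f (u l) = s \<odot>\<^bsub>E'\<^esub> y l"
    proof -
      have "f (u l) = s \<odot>\<^bsub>E'\<^esub> f (x l) \<ominus>\<^bsub>E'\<^esub> f (w l)" unfolding u_def using c s by (simp only: Fd F E.smult_closed)
      then show ?thesis using c(5) w'(2)[OF l] F(1)[OF c(1)] s by (simp add: a_minus_def)
    qed
    ultimately have "s \<odot>\<^bsub>E'\<^esub> y l \<ominus>\<^bsub>E'\<^esub> cob E' P (j - 1) (\<lambda>l. f (v l)) l = f (u l) \<ominus>\<^bsub>E'\<^esub> f (u l)"
      by (simp only:)
    then show ?thesis using F(1)[OF c(3)] by (simp add: a_minus_def E'.M.r_neg)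
  qed
  moreover have "(\<lambda>l. f (v l)) \<in> bas P (j - 1) \<rightarrow> f ` carrier E" using v(1) by auto
  ultimately show "\<exists>w. w \<in> bas P (j - 1) \<rightarrow> f ` carrier E \<and>
      (\<forall>k\<in>bas P j. s \<odot>\<^bsub>E'\<^esub> y k \<ominus>\<^bsub>E'\<^esub> cob E' P (j - 1) w k \<in> {\<zero>\<^bsub>E'\<^esub>})" by blast
qed

lemma injective_resolutionD:
  assumes "injective_resolution R M E d \<epsilon>"
  shows "injective_module R (E i)" "module R (E i)" "i < 0 \<Longrightarrow> carrier (E i) = {\<zero>\<^bsub>E i\<^esub>}"
    "d i \<in> mod_hom R (E i) (E (i + 1))" "\<epsilon> \<in> mod_hom R M (E 0)" "inj_on \<epsilon> (carrier M)"
    "\<epsilon> ` carrier M = {x \<in> carrier (E 0). d 0 x = \<zero>\<^bsub>E 1\<^esub>}"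
    "0 \<le> i \<Longrightarrow> d i ` carrier (E i) = {x \<in> carrier (E (i + 1)). d (i + 1) x = \<zero>\<^bsub>E (i + 2)\<^esub>}"
  using assms unfolding injective_resolution_def injective_module_def a_kernel_def' by auto

text \<open>The kernel of \<open>d\<^sub>n\<close> is the \<open>n\<close>-th cosyzygy of \<open>M\<close>. The bound on \<open>n\<close> is what keeps the degree
  \<open>i - n\<close> positive in every shift; \<open>n = 0\<close> only transports the hypothesis along \<open>\<epsilon>\<close>.\<close>

lemma (in cring) kills_cocycles:
  assumes M: "module R M" and inj: "injective_resolution R M E d \<epsilon>" and res: "resolves R P J"
    and s: "s \<in> carrier R" and k: "kills M P i s {\<zero>\<^bsub>M\<^esub>} (carrier M)"
  shows "int n \<le> i - 1 \<or> n = 0 \<Longrightarrow>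
    kills (E (int n)) P (i - int n) s {\<zero>\<^bsub>E (int n)\<^esub>} {x \<in> carrier (E (int n)). d (int n) x = \<zero>\<^bsub>E (int n + 1)\<^esub>}"
proof (induct n)
  note P = resolvesD(1)[OF res]
  note I = injective_resolutionD[OF inj]
  case 0
  interpret M: module R M by fact
  interpret E: module R "E 0" by (rule I(2))
  note F = mod_homD[OF I(5)]
  have e0: "\<epsilon> \<zero>\<^bsub>M\<^esub> = \<zero>\<^bsub>E 0\<^esub>" by (rule mod_hom_diff(2)[OF I(5) M I(2) M.M.zero_closed M.M.zero_closed])
  have "kills (E 0) P i s {\<zero>\<^bsub>E 0\<^esub>} (\<epsilon> ` carrier M)"
  proof (rule M.kills_iso[OF P I(2)[of 0] M.carrier_is_submodule M.submodule_zero _ E.submodule_zero s _ F(2,3) _ _ k])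
    show "submodule (\<epsilon> ` carrier M) R (E 0)"
      using submodule_hom_kernel[OF I(2)[of 0] I(2)[of 1]] I(4)[of 0] I(7) by simp
    show "\<exists>v\<in>carrier M. y \<ominus>\<^bsub>E 0\<^esub> \<epsilon> v \<in> {\<zero>\<^bsub>E 0\<^esub>}" if y: "y \<in> \<epsilon> ` carrier M" for y
    proof -
      obtain v where v: "v \<in> carrier M" "y = \<epsilon> v" using y by auto
      then show ?thesis using F(1)[OF v(1)] by (intro bexI[of _ v]) (simp_all add: a_minus_def E.M.r_neg)
    qed
    show "(\<epsilon> v \<in> {\<zero>\<^bsub>E 0\<^esub>}) = (v \<in> {\<zero>\<^bsub>M\<^esub>})" if "v \<in> carrier M" for v
      using inj_onD[OF I(6), of v "\<zero>\<^bsub>M\<^esub>"] e0 that by auto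
  qed auto
  then show ?case using I(7) by simp
next
  note I = injective_resolutionD[OF inj]
  case (Suc n)
  have j: "1 \<le> i - (int n + 1)" using Suc(2) by simp
  have "kills (E (int n)) P ((i - (int n + 1)) + 1) s {\<zero>\<^bsub>E (int n)\<^esub>} {x \<in> carrier (E (int n)). d (int n) x = \<zero>\<^bsub>E (int n + 1)\<^esub>}"
    using Suc by simp
  from kills_shift[OF I(1) I(2) I(4) res j s this]
  have "kills (E (int n + 1)) P (i - (int n + 1)) s {\<zero>\<^bsub>E (int n + 1)\<^esub>} (d (int n) ` carrier (E (int n)))" .
  then show ?case using I(8)[of "int n"] by (simp add: add.assoc add.commute)
qed

lemma (in cring) resolution_annihilates:
  assumes "module R E" and res: "resolves R P J" and x: "x \<in> carrier E"
    and "\<And>k. k \<in> bas P 1 \<Longrightarrow> mat P 0 k 0 \<odot>\<^bsub>E\<^esub> x = \<zero>\<^bsub>E\<^esub>" and a: "a \<in> J"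
  shows "a \<odot>\<^bsub>E\<^esub> x = \<zero>\<^bsub>E\<^esub>"
proof -
  interpret E: module R E by fact
  note P = resolvesD(1)[OF res]
  note [simp] = self.mat_closed[OF P] self.finite_bas[OF P]
  obtain v where v: "v \<in> bas P 1 \<rightarrow> carrier R" "a = (\<Oplus>k\<in>bas P 1. v k \<otimes> mat P 0 k 0)"
    using resolvesD(4)[OF res a] by blast
  have "a \<odot>\<^bsub>E\<^esub> x = (\<Oplus>\<^bsub>E\<^esub> k\<in>bas P 1. (v k \<otimes> mat P 0 k 0) \<odot>\<^bsub>E\<^esub> x)"
    unfolding v(2) using v(1) x by (intro E.smult_finsum) (auto simp: Pi_def)
  also have "\<dots> = (\<Oplus>\<^bsub>E\<^esub> k\<in>bas P 1. \<zero>\<^bsub>E\<^esub>)"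
    using v(1) x assms(4) by (intro E.M.finsum_cong') (auto simp: Pi_def E.smult_assoc1)
  finally show ?thesis by (simp add: E.M.finsum_zero)
qed

lemma (in cring) resolution_cob:
  assumes "module R E" and res: "resolves R P J" and y: "y 0 \<in> carrier E"
  shows "cob E P 0 y k = mat P 0 k 0 \<odot>\<^bsub>E\<^esub> y 0"
proof -
  interpret E: module R E by fact
  show ?thesis using resolvesD(2)[OF res] y self.mat_closed[OF resolvesD(1)[OF res]] by (simp add: cob_def)
qed

text \<open>Write the cocycle as \<open>z = d x\<close>. The cochain of degree \<open>0\<close> given by \<open>x\<close> has a coboundary with values in
  \<open>ker d\<close>, since \<open>J z = 0\<close>. As \<open>s\<close> kills \<open>H\<^sup>1(Hom(P, ker d))\<close>, there is \<open>w\<^sub>0 \<in> ker d\<close> such that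
  \<open>J (s x - w\<^sub>0) = 0\<close>, and \<open>d (s x - w\<^sub>0) = s z\<close>.\<close>

lemma (in cring) torsion_cocycle_boundary:
  assumes M: "module R M" and inj: "injective_resolution R M E d \<epsilon>" and res: "resolves R P J"
    and J: "J \<subseteq> carrier R" and s: "s \<in> carrier R" and k: "kills M P i s {\<zero>\<^bsub>M\<^esub>} (carrier M)"
    and z: "z \<in> carrier (E i)" "d i z = \<zero>\<^bsub>E (i + 1)\<^esub>" "\<And>a. a \<in> J \<Longrightarrow> a \<odot>\<^bsub>E i\<^esub> z = \<zero>\<^bsub>E i\<^esub>"
  shows "\<exists>w\<in>carrier (E (i - 1)). d (i - 1) w = s \<odot>\<^bsub>E i\<^esub> z \<and> (\<forall>a\<in>J. a \<odot>\<^bsub>E (i - 1)\<^esub> w = \<zero>\<^bsub>E (i - 1)\<^esub>)"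
proof -
  note P = resolvesD(1)[OF res]
  note I = injective_resolutionD[OF inj]
  note Jc = subsetD[OF J]
  interpret Ei: module R "E i" by (rule I(2))
  interpret E1: module R "E (i - 1)" by (rule I(2))
  have d1: "d (i - 1) \<in> mod_hom R (E (i - 1)) (E i)" using I(4)[of "i - 1"] by simp
  have d0: "d (i - 1) \<zero>\<^bsub>E (i - 1)\<^esub> = \<zero>\<^bsub>E i\<^esub>"
    by (rule mod_hom_diff(2)[OF d1 I(2) I(2) E1.M.zero_closed E1.M.zero_closed])
  have trivial: ?thesis if "s \<odot>\<^bsub>E i\<^esub> z = \<zero>\<^bsub>E i\<^esub>"
    using that d0 Jc by (intro bexI[of _ "\<zero>\<^bsub>E (i - 1)\<^esub>"]) auto
  consider "i < 0" | "i = 0" | "1 \<le> i" by linarith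
  then show ?thesis
  proof cases
    case 1
    then show ?thesis using I(3) z(1) s by (intro trivial) simp
  next
    case 2
    have a0: "kills (E 0) P 0 s {\<zero>\<^bsub>E 0\<^esub>} {x \<in> carrier (E 0). d 0 x = \<zero>\<^bsub>E 1\<^esub>}"
      using kills_cocycles[OF M inj res s k, of 0] 2 by simp
    have a1: "(\<lambda>_. z) \<in> bas P 0 \<rightarrow> {x \<in> carrier (E 0). d 0 x = \<zero>\<^bsub>E 1\<^esub>}" using z 2 by auto
    have a2: "\<forall>k\<in>bas P (0 + 1). cob (E 0) P 0 (\<lambda>_. z) k \<in> {\<zero>\<^bsub>E 0\<^esub>}"
      using resolution_cob[OF I(2) res, of "\<lambda>_. z" 0] z resolvesD(3)[OF res] 2 by simp
    obtain w where w: "w \<in> bas P (0 - 1) \<rightarrow> {x \<in> carrier (E 0). d 0 x = \<zero>\<^bsub>E 1\<^esub>}"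
      "\<forall>k\<in>bas P 0. s \<odot>\<^bsub>E 0\<^esub> z \<ominus>\<^bsub>E 0\<^esub> cob (E 0) P (0 - 1) w k \<in> {\<zero>\<^bsub>E 0\<^esub>}"
      using kills_bounds[OF a0 a1 a2] by blast
    interpret E0: module R "E 0" by (rule I(2))
    have "cob (E 0) P (0 - 1) w 0 = \<zero>\<^bsub>E 0\<^esub>" using free_complexD(2)[OF P, of "- 1"] by (simp add: cob_def)
    then have "s \<odot>\<^bsub>E 0\<^esub> z \<ominus>\<^bsub>E 0\<^esub> \<zero>\<^bsub>E 0\<^esub> = \<zero>\<^bsub>E 0\<^esub>"
      using w(2) resolvesD(2)[OF res] by simp
    moreover have "s \<odot>\<^bsub>E 0\<^esub> z \<in> carrier (E 0)" using z(1) s 2 by simp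
    ultimately have "s \<odot>\<^bsub>E i\<^esub> z = \<zero>\<^bsub>E i\<^esub>" using E0.minus_eq_zeroD[OF _ E0.M.zero_closed] 2 by blast
    then show ?thesis by (rule trivial)
  next
    case 3
    define Z where "Z = {x \<in> carrier (E (i - 1)). d (i - 1) x = \<zero>\<^bsub>E i\<^esub>}"
    have Zs: "submodule Z R (E (i - 1))" unfolding Z_def by (rule submodule_hom_kernel[OF I(2) I(2) d1])
    have a0: "kills (E (i - 1)) P 1 s {\<zero>\<^bsub>E (i - 1)\<^esub>} Z"
      using kills_cocycles[OF M inj res s k, of "nat (i - 1)"] 3 by (simp add: Z_def)
    have e: "i - 1 + 1 = i" "i - 1 + 2 = i + 1" by simp_all
    have "z \<in> d (i - 1) ` carrier (E (i - 1))" using I(8)[of "i - 1", unfolded e] 3 z(1,2) by simp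
    then obtain x where x: "x \<in> carrier (E (i - 1))" "d (i - 1) x = z" by blast
    define y where "y = (\<lambda>_ :: nat. x)"
    have yc: "y \<in> bas P 0 \<rightarrow> carrier (E (i - 1))" "y 0 \<in> carrier (E (i - 1))" using x by (auto simp: y_def)
    have cy: "cob (E (i - 1)) P 0 y k = mat P 0 k 0 \<odot>\<^bsub>E (i - 1)\<^esub> x" for k
      using resolution_cob[of "E (i - 1)", OF I(2) res, of y k] yc(2) by (simp add: y_def)
    have a1: "cob (E (i - 1)) P 0 y \<in> bas P 1 \<rightarrow> Z"
      using cy x z(3) resolvesD(3)[OF res] Jc mod_homD(3)[OF d1] by (auto simp: Z_def)
    have a2: "\<forall>k\<in>bas P (1 + 1). cob (E (i - 1)) P 1 (cob (E (i - 1)) P 0 y) k \<in> {\<zero>\<^bsub>E (i - 1)\<^esub>}"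
      using E1.cob_cob'[OF P yc(1)] by simp
    obtain w where w: "w \<in> bas P (1 - 1) \<rightarrow> Z"
      "\<forall>k\<in>bas P 1. s \<odot>\<^bsub>E (i - 1)\<^esub> cob (E (i - 1)) P 0 y k \<ominus>\<^bsub>E (i - 1)\<^esub> cob (E (i - 1)) P (1 - 1) w k \<in> {\<zero>\<^bsub>E (i - 1)\<^esub>}"
      using kills_bounds[OF a0 a1 a2] by blast
    have w0: "w 0 \<in> carrier (E (i - 1))" "d (i - 1) (w 0) = \<zero>\<^bsub>E i\<^esub>"
      using w(1) resolvesD(2)[OF res] by (auto simp: Z_def)
    have cw: "cob (E (i - 1)) P 0 w k = mat P 0 k 0 \<odot>\<^bsub>E (i - 1)\<^esub> w 0" for k
      using resolution_cob[of "E (i - 1)", OF I(2) res, of w k] w0(1) by simp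
    let ?v = "s \<odot>\<^bsub>E (i - 1)\<^esub> x \<ominus>\<^bsub>E (i - 1)\<^esub> w 0"
    have vc: "?v \<in> carrier (E (i - 1))" using x w0 s by simp
    have "mat P 0 k 0 \<odot>\<^bsub>E (i - 1)\<^esub> ?v = \<zero>\<^bsub>E (i - 1)\<^esub>" if "k \<in> bas P 1" for k
      using bspec[OF w(2) that] cy cw x w0 s self.mat_closed[OF P] E1.smult_commute[of s "mat P 0 k 0" x]
      by (simp add: E1.smult_minus_distr)
    then have "a \<odot>\<^bsub>E (i - 1)\<^esub> ?v = \<zero>\<^bsub>E (i - 1)\<^esub>" if "a \<in> J" for a
      using resolution_annihilates[OF E1.module_axioms res vc] that by blast
    moreover have "d (i - 1) ?v = s \<odot>\<^bsub>E i\<^esub> z"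
    proof -
      have "d (i - 1) ?v = s \<odot>\<^bsub>E i\<^esub> z \<ominus>\<^bsub>E i\<^esub> \<zero>\<^bsub>E i\<^esub>"
        using mod_hom_diff(1)[OF d1 E1.module_axioms Ei.module_axioms, of "s \<odot>\<^bsub>E (i - 1)\<^esub> x" "w 0"] mod_homD(3)[OF d1 s x(1)] x w0 s by simp
      then show ?thesis using Ei.smult_closed[OF s z(1)] by (simp add: a_minus_def)
    qed
    ultimately show ?thesis using vc by blast
  qed
qed


section \<open>Torsion and local cohomology\<close>

lemma (in cring) ideal_ideal_power: "ideal I R \<Longrightarrow> ideal (ideal_power R I n) R"
  using oneideal ideal_prod_is_ideal by (induct n) auto

lemma (in cring) pow_mem_ideal_power:
  assumes I: "ideal I R" and x: "x \<in> I"
  shows "x [^] n \<in> ideal_power R I n"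
proof (induct n)
  case (Suc n)
  have "x \<in> carrier R" using I x by (rule ideal.Icarr)
  moreover have "x \<otimes> x [^] n \<in> ideal_prod R I (ideal_power R I n)" using x Suc by (rule ideal_prod.prod)
  ultimately show ?case using m_comm[of x "x [^] n"] by simp
qed simp

text \<open>A coset is annihilated once all its elements become boundaries. This is the form in which
  \<open>quot_module\<close> defines the scalar multiplication.\<close>

lemma (in cring) cohomology_annihilated:
  fixes C :: "int \<Rightarrow> ('a, 'e) module"
  assumes C: "\<And>j. module R (C j)" and d: "\<And>j. d j \<in> mod_hom R (C j) (C (j + 1))"
    and s: "s \<in> carrier R" and bnd: "\<And>z. \<lbrakk>z \<in> carrier (C i); d i z = \<zero>\<^bsub>C (i + 1)\<^esub>\<rbrakk> \<Longrightarrow>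
      s \<odot>\<^bsub>C i\<^esub> z \<in> d (i - 1) ` carrier (C (i - 1))"
    and cyc: "\<And>w. w \<in> carrier (C (i - 1)) \<Longrightarrow> d i (d (i - 1) w) = \<zero>\<^bsub>C (i + 1)\<^esub>"
    and x: "x \<in> carrier (cohomology C d i)"
  shows "s \<odot>\<^bsub>cohomology C d i\<^esub> x = \<zero>\<^bsub>cohomology C d i\<^esub>"
proof -
  interpret Ci: module R "C i" by (rule C)
  interpret C1: module R "C (i - 1)" by (rule C)
  let ?N = "d (i - 1) ` carrier (C (i - 1))"
  let ?Z = "(C i)\<lparr>carrier := a_kernel (C i) (C (i + 1)) (d i)\<rparr>"
  have d1: "d (i - 1) \<in> mod_hom R (C (i - 1)) (C i)" using d[of "i - 1"] by simp
  note D1 = mod_homD[OF d1] and Di = mod_homD[OF d[of i]]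
  have Nc: "n \<in> carrier (C i)" if "n \<in> ?N" for n using that D1(1) by auto
  have Nadd: "n \<oplus>\<^bsub>C i\<^esub> n' \<in> ?N" if nn: "n \<in> ?N" "n' \<in> ?N" for n n'
  proof -
    obtain v v' where v: "v \<in> carrier (C (i - 1))" "n = d (i - 1) v" "v' \<in> carrier (C (i - 1))" "n' = d (i - 1) v'"
      using nn by auto
    then show ?thesis using D1(2)[OF v(1,3)] by (intro image_eqI[of _ _ "v \<oplus>\<^bsub>C (i - 1)\<^esub> v'"]) simp_all
  qed
  have Nneg: "\<ominus>\<^bsub>C i\<^esub> n \<in> ?N" if nn: "n \<in> ?N" for n
  proof -
    obtain v where v: "v \<in> carrier (C (i - 1))" "n = d (i - 1) v" using nn by auto
    have "d (i - 1) ((\<ominus> \<one>) \<odot>\<^bsub>C (i - 1)\<^esub> v) = (\<ominus> \<one>) \<odot>\<^bsub>C i\<^esub> n" using D1(3)[of "\<ominus> \<one>" v] v by simp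
    then show ?thesis using v Nc[OF nn] by (intro image_eqI[of _ _ "(\<ominus> \<one>) \<odot>\<^bsub>C (i - 1)\<^esub> v"]) (simp_all add: Ci.smult_l_minus)
  qed
  have coset: "?N +>\<^bsub>?Z\<^esub> m = (\<lambda>n. n \<oplus>\<^bsub>C i\<^esub> m) ` ?N" for m
    by (auto simp: a_r_coset_def r_coset_def)
  have coset_N: "?N +>\<^bsub>?Z\<^esub> m = ?N" if m: "m \<in> ?N" for m
  proof
    show "?N +>\<^bsub>?Z\<^esub> m \<subseteq> ?N" unfolding coset using Nadd m by blast
    show "?N \<subseteq> ?N +>\<^bsub>?Z\<^esub> m"
    proof
      fix n assume n: "n \<in> ?N"
      have "n = (n \<oplus>\<^bsub>C i\<^esub> (\<ominus>\<^bsub>C i\<^esub> m)) \<oplus>\<^bsub>C i\<^esub> m"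
        using Nc[OF n] Nc[OF m] by (simp add: Ci.M.a_assoc Ci.M.l_neg)
      then show "n \<in> ?N +>\<^bsub>?Z\<^esub> m" unfolding coset using Nadd[OF n Nneg[OF m]] by (rule image_eqI)
    qed
  qed
  obtain z where z: "z \<in> carrier (C i)" "d i z = \<zero>\<^bsub>C (i + 1)\<^esub>" "x = ?N +>\<^bsub>?Z\<^esub> z"
    using x by (auto simp: cohomology_def quot_module_def A_RCOSETS_def RCOSETS_def a_kernel_def' a_r_coset_def)
  have sy: "s \<odot>\<^bsub>C i\<^esub> y \<in> ?N" if y: "y \<in> x" for y
  proof -
    obtain w where w: "w \<in> carrier (C (i - 1))" "y = d (i - 1) w \<oplus>\<^bsub>C i\<^esub> z"
      using y unfolding z(3) coset by auto
    interpret C2: module R "C (i + 1)" by (rule C)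
    have "y \<in> carrier (C i)" using w z(1) D1(1) by simp
    moreover have "d i y = \<zero>\<^bsub>C (i + 1)\<^esub>"
      using w z(1,2) D1(1) Di(2) cyc by simp
    ultimately show ?thesis by (rule bnd)
  qed
  have "d (i - 1) \<zero>\<^bsub>C (i - 1)\<^esub> \<oplus>\<^bsub>C i\<^esub> z \<in> x" unfolding z(3) coset by simp
  then have "(\<Union>y\<in>x. ?N +>\<^bsub>?Z\<^esub> (s \<odot>\<^bsub>C i\<^esub> y)) = ?N" using coset_N[OF sy] by blast
  then show ?thesis by (simp add: cohomology_def quot_module_def)
qed


lemma (in cring) ideal_power_antimono:
  assumes I: "ideal I R" and "n \<le> m"
  shows "ideal_power R I m \<subseteq> ideal_power R I n"
  using assms(2)
proof (induct m rule: dec_induct)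
  case (step m)
  have "ideal_power R I (Suc m) \<subseteq> ideal_power R I m"
    using ideal_prod_inter[OF I ideal_ideal_power[OF I]] by simp
  then show ?case using step(3) by blast
qed simp

lemma (in cring) module_torsion:
  fixes E :: "('a, 'e) module"
  assumes "module R E" and I: "ideal I R"
  shows "module R (torsion R I E)"
proof -
  interpret E: module R E by fact
  let ?T = "{x \<in> carrier E. \<exists>n. \<forall>a\<in>ideal_power R I n. a \<odot>\<^bsub>E\<^esub> x = \<zero>\<^bsub>E\<^esub>}"
  have c: "a \<in> carrier R" if "a \<in> ideal_power R I n" for a n
    using ideal_ideal_power[OF I] that by (rule ideal.Icarr)
  have "submodule ?T R E"
  proof (rule E.submoduleI)
    show "\<zero>\<^bsub>E\<^esub> \<in> ?T" using c by auto
    show "\<ominus>\<^bsub>E\<^esub> x \<in> ?T" if "x \<in> ?T" for x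
    proof -
      obtain n where n: "x \<in> carrier E" "\<forall>a\<in>ideal_power R I n. a \<odot>\<^bsub>E\<^esub> x = \<zero>\<^bsub>E\<^esub>" using \<open>x \<in> ?T\<close> by blast
      then have "\<forall>a\<in>ideal_power R I n. a \<odot>\<^bsub>E\<^esub> (\<ominus>\<^bsub>E\<^esub> x) = \<zero>\<^bsub>E\<^esub>"
        using c E.smult_r_minus[of _ x] by (simp add: E.M.minus_equality)
      then show ?thesis using n(1) by auto
    qed
    show "a \<odot>\<^bsub>E\<^esub> x \<in> ?T" if a: "a \<in> carrier R" and x: "x \<in> ?T" for a x
    proof -
      obtain n where n: "x \<in> carrier E" "\<forall>a\<in>ideal_power R I n. a \<odot>\<^bsub>E\<^esub> x = \<zero>\<^bsub>E\<^esub>" using x by blast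
      have "\<forall>b\<in>ideal_power R I n. b \<odot>\<^bsub>E\<^esub> (a \<odot>\<^bsub>E\<^esub> x) = \<zero>\<^bsub>E\<^esub>"
        using c n a E.smult_commute[OF _ a n(1)] by simp
      then show ?thesis using n(1) a by auto
    qed
    show "x \<oplus>\<^bsub>E\<^esub> y \<in> ?T" if x: "x \<in> ?T" and y: "y \<in> ?T" for x y
    proof -
      obtain n where n: "x \<in> carrier E" "\<forall>a\<in>ideal_power R I n. a \<odot>\<^bsub>E\<^esub> x = \<zero>\<^bsub>E\<^esub>" using x by blast
      obtain m where m: "y \<in> carrier E" "\<forall>a\<in>ideal_power R I m. a \<odot>\<^bsub>E\<^esub> y = \<zero>\<^bsub>E\<^esub>" using y by blast
      have "\<forall>a\<in>ideal_power R I (max n m). a \<odot>\<^bsub>E\<^esub> (x \<oplus>\<^bsub>E\<^esub> y) = \<zero>\<^bsub>E\<^esub>"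
      proof
        fix a assume a: "a \<in> ideal_power R I (max n m)"
        have "a \<in> ideal_power R I n" "a \<in> ideal_power R I m"
          using a ideal_power_antimono[OF I, of n "max n m"] ideal_power_antimono[OF I, of m "max n m"] by auto
        then show "a \<odot>\<^bsub>E\<^esub> (x \<oplus>\<^bsub>E\<^esub> y) = \<zero>\<^bsub>E\<^esub>" using n m c by (simp add: E.smult_r_distr)
      qed
      then show ?thesis using n(1) m(1) by auto
    qed
  qed auto
  then show ?thesis unfolding torsion_def by (rule submodule.submodule_is_module) fact
qed

lemma (in cring) local_cohomology_annihilated:
  fixes H :: "('a, 'e set) module"
  assumes M: "module R M" and I: "ideal I R" and s: "s \<in> carrier R"
    and k: "\<And>n. \<exists>P. resolves R P (ideal_power R I n) \<and> kills M P i s {\<zero>\<^bsub>M\<^esub>} (carrier M)"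
    and H: "is_local_cohomology R I i M H" and x: "x \<in> carrier H"
  shows "s \<odot>\<^bsub>H\<^esub> x = \<zero>\<^bsub>H\<^esub>"
proof -
  obtain E :: "int \<Rightarrow> ('a, 'e) module" and d \<epsilon> where inj: "injective_resolution R M E d \<epsilon>"
    and HE: "H = cohomology (\<lambda>j. torsion R I (E j)) d i"
    using H unfolding is_local_cohomology_def by blast
  note Er = injective_resolutionD[OF inj]
  have T [simp]: "carrier (torsion R I (E j)) = {x \<in> carrier (E j). \<exists>n. \<forall>a\<in>ideal_power R I n. a \<odot>\<^bsub>E j\<^esub> x = \<zero>\<^bsub>E j\<^esub>}"
    "\<zero>\<^bsub>torsion R I (E j)\<^esub> = \<zero>\<^bsub>E j\<^esub>" "add (torsion R I (E j)) = add (E j)"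
    "smult (torsion R I (E j)) = smult (E j)" for j by (simp_all add: torsion_def)
  have c: "a \<in> carrier R" if "a \<in> ideal_power R I n" for a n
    using ideal_ideal_power[OF I] that by (rule ideal.Icarr)
  have d0: "d j \<zero>\<^bsub>E j\<^esub> = \<zero>\<^bsub>E (j + 1)\<^esub>" for j
  proof -
    interpret Ej: module R "E j" by (rule Er(2))
    show ?thesis by (rule mod_hom_diff(2)[OF Er(4) Er(2) Er(2) Ej.M.zero_closed Ej.M.zero_closed])
  qed
  have "s \<odot>\<^bsub>cohomology (\<lambda>j. torsion R I (E j)) d i\<^esub> x = \<zero>\<^bsub>cohomology (\<lambda>j. torsion R I (E j)) d i\<^esub>"
  proof (rule cohomology_annihilated[where C = "\<lambda>j. torsion R I (E j)"])
    show "module R (torsion R I (E j))" for j by (rule module_torsion[OF Er(2) I])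
    show "d j \<in> mod_hom R (torsion R I (E j)) (torsion R I (E (j + 1)))" for j
    proof -
      note dj = mod_homD[OF Er(4)[of j]]
      have "d j y \<in> carrier (torsion R I (E (j + 1)))" if y: "y \<in> carrier (torsion R I (E j))" for y
      proof -
        obtain n where n: "y \<in> carrier (E j)" "\<forall>a\<in>ideal_power R I n. a \<odot>\<^bsub>E j\<^esub> y = \<zero>\<^bsub>E j\<^esub>" using y by auto
        have "\<forall>a\<in>ideal_power R I n. a \<odot>\<^bsub>E (j + 1)\<^esub> d j y = \<zero>\<^bsub>E (j + 1)\<^esub>"
          using n d0[of j] by (simp add: dj(3)[OF c, symmetric])
        then show ?thesis using dj(1)[OF n(1)] by auto
      qed
      moreover have "\<forall>x y. x \<in> carrier (torsion R I (E j)) \<longrightarrow> x \<in> carrier (E j)" by simp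
      ultimately show ?thesis using dj(2,3) unfolding mod_hom_def by (simp del: T(1) add: Pi_def)
    qed
    show "s \<odot>\<^bsub>torsion R I (E i)\<^esub> z \<in> d (i - 1) ` carrier (torsion R I (E (i - 1)))"
      if z: "z \<in> carrier (torsion R I (E i))" "d i z = \<zero>\<^bsub>torsion R I (E (i + 1))\<^esub>" for z
    proof -
      obtain n where n: "z \<in> carrier (E i)" "\<forall>a\<in>ideal_power R I n. a \<odot>\<^bsub>E i\<^esub> z = \<zero>\<^bsub>E i\<^esub>" using z(1) by auto
      obtain P where P: "resolves R P (ideal_power R I n)" "kills M P i s {\<zero>\<^bsub>M\<^esub>} (carrier M)" using k by blast
      have "\<exists>w\<in>carrier (E (i - 1)). d (i - 1) w = s \<odot>\<^bsub>E i\<^esub> z \<and>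
         (\<forall>a\<in>ideal_power R I n. a \<odot>\<^bsub>E (i - 1)\<^esub> w = \<zero>\<^bsub>E (i - 1)\<^esub>)"
        using n z(2) c by (intro torsion_cocycle_boundary[OF M inj P(1) _ s P(2)]) auto
      then show ?thesis by (auto simp: image_iff Bex_def) metis
    qed
    show "d i (d (i - 1) w) = \<zero>\<^bsub>torsion R I (E (i + 1))\<^esub>" if w: "w \<in> carrier (torsion R I (E (i - 1)))" for w
    proof (cases "0 \<le> i - 1")
      case True
      have e: "i - 1 + 1 = i" "i - 1 + 2 = i + 1" by simp_all
      show ?thesis using Er(8)[OF True, unfolded e] w by auto
    next
      case False
      then have "w = \<zero>\<^bsub>E (i - 1)\<^esub>" using Er(3)[of "i - 1"] w by simp
      then show ?thesis using d0[of "i - 1"] d0[of i] by simp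
    qed
  qed (use s x HE in auto)
  then show ?thesis by (simp add: HE)
qed

section \<open>Modules of fractions\<close>

locale fractions = module R M for R (structure) and M :: "('a, 'm, 'y) module_scheme" +
  fixes T :: "'a set"
  assumes T_carrier: "s \<in> T \<Longrightarrow> s \<in> carrier R" and T_one: "\<one> \<in> T"
    and T_mult: "s \<in> T \<Longrightarrow> t \<in> T \<Longrightarrow> s \<otimes> t \<in> T"
begin

lemmas T_facts [simp] = T_carrier T_one T_mult

lemma equiv_frac_rel: "equiv (carrier M \<times> T) (frac_rel M T)"
proof (rule equivI)
  show "frac_rel M T \<subseteq> (carrier M \<times> T) \<times> (carrier M \<times> T)" by (auto simp: frac_rel_def)
  show "refl_on (carrier M \<times> T) (frac_rel M T)"
    by (auto simp: refl_on_def frac_rel_def intro: T_one)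
  show "sym (frac_rel M T)" unfolding sym_def frac_rel_def by (auto intro: sym)
  show "trans (frac_rel M T)"
  proof (rule transI)
    fix x y z assume "(x, y) \<in> frac_rel M T" "(y, z) \<in> frac_rel M T"
    then obtain m s n t k r u v where *: "x = (m, s)" "y = (n, t)" "z = (k, r)"
      "m \<in> carrier M" "n \<in> carrier M" "k \<in> carrier M" "s \<in> T" "t \<in> T" "r \<in> T" "u \<in> T" "v \<in> T"
      "u \<odot>\<^bsub>M\<^esub> (t \<odot>\<^bsub>M\<^esub> m) = u \<odot>\<^bsub>M\<^esub> (s \<odot>\<^bsub>M\<^esub> n)" "v \<odot>\<^bsub>M\<^esub> (r \<odot>\<^bsub>M\<^esub> n) = v \<odot>\<^bsub>M\<^esub> (t \<odot>\<^bsub>M\<^esub> k)"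
      unfolding frac_rel_def by auto
    have "(u \<otimes> v \<otimes> t) \<odot>\<^bsub>M\<^esub> (r \<odot>\<^bsub>M\<^esub> m) = (v \<otimes> r) \<odot>\<^bsub>M\<^esub> (u \<odot>\<^bsub>M\<^esub> (t \<odot>\<^bsub>M\<^esub> m))"
      using *(4-11) by (simp add: smult_assoc1[symmetric] R.m_ac)
    also have "\<dots> = (u \<otimes> s) \<odot>\<^bsub>M\<^esub> (v \<odot>\<^bsub>M\<^esub> (r \<odot>\<^bsub>M\<^esub> n))"
      unfolding *(12) using *(4-11) by (simp add: smult_assoc1[symmetric] R.m_ac)
    also have "\<dots> = (u \<otimes> v \<otimes> t) \<odot>\<^bsub>M\<^esub> (s \<odot>\<^bsub>M\<^esub> k)"
      unfolding *(13) using *(4-11) by (simp add: smult_assoc1[symmetric] R.m_ac)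
    finally show "(x, z) \<in> frac_rel M T"
      using *(1-11) T_mult[OF T_mult[OF *(10,11)] *(8)] unfolding frac_rel_def by blast
  qed
qed

lemma frac_eq_iff:
  assumes "m \<in> carrier M" "n \<in> carrier M" "s \<in> T" "t \<in> T"
  shows "loc_frac M T m s = loc_frac M T n t \<longleftrightarrow> (\<exists>u\<in>T. u \<odot>\<^bsub>M\<^esub> (t \<odot>\<^bsub>M\<^esub> m) = u \<odot>\<^bsub>M\<^esub> (s \<odot>\<^bsub>M\<^esub> n))"
  unfolding loc_frac_def using assms
  by (subst eq_equiv_class_iff[OF equiv_frac_rel]) (auto simp: frac_rel_def)

lemma frac_closed [simp]: "m \<in> carrier M \<Longrightarrow> s \<in> T \<Longrightarrow> loc_frac M T m s \<in> carrier (loc_module R T M)"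
  by (simp add: loc_module_def loc_frac_def quotientI)

lemma frac_cases:
  assumes "X \<in> carrier (loc_module R T M)"
  obtains m s where "m \<in> carrier M" "s \<in> T" "X = loc_frac M T m s"
  using assms by (auto simp: loc_module_def loc_frac_def elim!: quotientE)

lemma frac_scale:
  assumes "m \<in> carrier M" "s \<in> T" "u \<in> T"
  shows "loc_frac M T (u \<odot>\<^bsub>M\<^esub> m) (u \<otimes> s) = loc_frac M T m s"
  using assms by (subst frac_eq_iff) (auto simp: smult_assoc1[symmetric] R.m_ac)

text \<open>With a common denominator, addition of fractions is addition of numerators; this reduces the module
  axioms below to those of \<open>M\<close>.\<close>

lemma frac_common:
  assumes "X \<in> carrier (loc_module R T M)" "Y \<in> carrier (loc_module R T M)"
  obtains m n s where "m \<in> carrier M" "n \<in> carrier M" "s \<in> T" "X = loc_frac M T m s" "Y = loc_frac M T n s"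
proof -
  obtain m s where m: "m \<in> carrier M" "s \<in> T" "X = loc_frac M T m s" using frac_cases[OF assms(1)] .
  obtain n t where n: "n \<in> carrier M" "t \<in> T" "Y = loc_frac M T n t" using frac_cases[OF assms(2)] .
  show thesis
  proof (rule that)
    show "X = loc_frac M T (t \<odot>\<^bsub>M\<^esub> m) (t \<otimes> s)" using m n frac_scale by simp
    show "Y = loc_frac M T (s \<odot>\<^bsub>M\<^esub> n) (t \<otimes> s)" using m n frac_scale[of n t s] R.m_comm[of s t] by simp
  qed (use m n in simp_all)
qed

lemma frac_common3:
  assumes "X \<in> carrier (loc_module R T M)" "Y \<in> carrier (loc_module R T M)" "Z \<in> carrier (loc_module R T M)"
  obtains m n k s where "m \<in> carrier M" "n \<in> carrier M" "k \<in> carrier M" "s \<in> T"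
    "X = loc_frac M T m s" "Y = loc_frac M T n s" "Z = loc_frac M T k s"
proof -
  obtain m n s where m: "m \<in> carrier M" "n \<in> carrier M" "s \<in> T" "X = loc_frac M T m s" "Y = loc_frac M T n s"
    using frac_common[OF assms(1,2)] .
  obtain k t where k: "k \<in> carrier M" "t \<in> T" "Z = loc_frac M T k t" using frac_cases[OF assms(3)] .
  show thesis
  proof (rule that)
    show "X = loc_frac M T (t \<odot>\<^bsub>M\<^esub> m) (t \<otimes> s)" "Y = loc_frac M T (t \<odot>\<^bsub>M\<^esub> n) (t \<otimes> s)" using m k frac_scale by simp_all
    show "Z = loc_frac M T (s \<odot>\<^bsub>M\<^esub> k) (t \<otimes> s)" using m k frac_scale[of k t s] R.m_comm[of s t] by simp
  qed (use m k in simp_all)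
qed

lemma frac_add:
  assumes "m \<in> carrier M" "n \<in> carrier M" "s \<in> T"
  shows "loc_frac M T m s \<oplus>\<^bsub>loc_module R T M\<^esub> loc_frac M T n s = loc_frac M T (m \<oplus>\<^bsub>M\<^esub> n) s"
proof -
  let ?f = "\<lambda>(m, s) (n, t). loc_frac M T (t \<odot>\<^bsub>M\<^esub> m \<oplus>\<^bsub>M\<^esub> s \<odot>\<^bsub>M\<^esub> n) (s \<otimes> t)"
  have "congruent2 (frac_rel M T) (frac_rel M T) ?f"
  proof (rule congruent2_commuteI[OF equiv_frac_rel])
    show "?f y z = ?f z y" if "y \<in> carrier M \<times> T" "z \<in> carrier M \<times> T" for y z
      using that by (auto simp: M.a_comm R.m_comm)
    show "?f w y = ?f w z" if yz: "(y, z) \<in> frac_rel M T" and w: "w \<in> carrier M \<times> T" for y z w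
    proof -
      obtain m s n t k r u where *: "y = (m, s)" "z = (n, t)" "w = (k, r)" "m \<in> carrier M" "n \<in> carrier M"
        "k \<in> carrier M" "s \<in> T" "t \<in> T" "r \<in> T" "u \<in> T" "u \<odot>\<^bsub>M\<^esub> (t \<odot>\<^bsub>M\<^esub> m) = u \<odot>\<^bsub>M\<^esub> (s \<odot>\<^bsub>M\<^esub> n)"
        using yz w unfolding frac_rel_def by auto
      have "u \<odot>\<^bsub>M\<^esub> ((r \<otimes> t) \<odot>\<^bsub>M\<^esub> (s \<odot>\<^bsub>M\<^esub> k \<oplus>\<^bsub>M\<^esub> r \<odot>\<^bsub>M\<^esub> m))
        = (u \<otimes> r \<otimes> t \<otimes> s) \<odot>\<^bsub>M\<^esub> k \<oplus>\<^bsub>M\<^esub> (r \<otimes> r) \<odot>\<^bsub>M\<^esub> (u \<odot>\<^bsub>M\<^esub> (t \<odot>\<^bsub>M\<^esub> m))"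
        using *(4-10) by (simp add: smult_r_distr smult_assoc1[symmetric] R.m_ac)
      also have "\<dots> = u \<odot>\<^bsub>M\<^esub> ((r \<otimes> s) \<odot>\<^bsub>M\<^esub> (t \<odot>\<^bsub>M\<^esub> k \<oplus>\<^bsub>M\<^esub> r \<odot>\<^bsub>M\<^esub> n))"
        unfolding *(11) using *(4-10) by (simp add: smult_r_distr smult_assoc1[symmetric] R.m_ac)
      finally show ?thesis
        unfolding *(1-3) prod.case using *(4-10) by (subst frac_eq_iff) auto
    qed
  qed
  then have "loc_frac M T m s \<oplus>\<^bsub>loc_module R T M\<^esub> loc_frac M T n s
      = loc_frac M T (s \<odot>\<^bsub>M\<^esub> m \<oplus>\<^bsub>M\<^esub> s \<odot>\<^bsub>M\<^esub> n) (s \<otimes> s)"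
    using UN_equiv_class2[OF equiv_frac_rel equiv_frac_rel, of ?f "(m, s)" "(n, s)"] assms
    by (simp add: loc_module_def loc_frac_def[of _ _ m s] loc_frac_def[of _ _ n s] case_prod_unfold)
  also have "\<dots> = loc_frac M T (s \<odot>\<^bsub>M\<^esub> (m \<oplus>\<^bsub>M\<^esub> n)) (s \<otimes> s)" using assms by (simp add: smult_r_distr)
  also have "\<dots> = loc_frac M T (m \<oplus>\<^bsub>M\<^esub> n) s" using assms by (intro frac_scale) auto
  finally show ?thesis .
qed

lemma self_fractions: "fractions R (self_module R) T"
  using R.self_module by (intro fractions.intro fractions_axioms.intro) auto

lemma frac_smult:
  assumes "a \<in> carrier R" "m \<in> carrier M" "s \<in> T" "t \<in> T"
  shows "loc_frac (self_module R) T a s \<odot>\<^bsub>loc_module R T M\<^esub> loc_frac M T m t = loc_frac M T (a \<odot>\<^bsub>M\<^esub> m) (s \<otimes> t)"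
proof -
  interpret self: fractions R "self_module R" T by (rule self_fractions)
  let ?f = "\<lambda>(a, s) (m, t). loc_frac M T (a \<odot>\<^bsub>M\<^esub> m) (s \<otimes> t)"
  have "congruent2 (frac_rel (self_module R) T) (frac_rel M T) ?f"
  proof (rule congruent2I[OF self.equiv_frac_rel equiv_frac_rel])
    show "?f y w = ?f z w" if yz: "(y, z) \<in> frac_rel (self_module R) T" and w: "w \<in> carrier M \<times> T" for y z w
    proof -
      obtain a s b t k r u where *: "y = (a, s)" "z = (b, t)" "w = (k, r)" "a \<in> carrier R" "b \<in> carrier R"
        "k \<in> carrier M" "s \<in> T" "t \<in> T" "r \<in> T" "u \<in> T" "u \<otimes> (t \<otimes> a) = u \<otimes> (s \<otimes> b)"
        using yz w unfolding frac_rel_def by auto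
      have "u \<odot>\<^bsub>M\<^esub> ((t \<otimes> r) \<odot>\<^bsub>M\<^esub> (a \<odot>\<^bsub>M\<^esub> k)) = (u \<otimes> (t \<otimes> a)) \<odot>\<^bsub>M\<^esub> (r \<odot>\<^bsub>M\<^esub> k)"
        using *(4-10) by (simp add: smult_assoc1[symmetric] R.m_ac)
      also have "\<dots> = u \<odot>\<^bsub>M\<^esub> ((s \<otimes> r) \<odot>\<^bsub>M\<^esub> (b \<odot>\<^bsub>M\<^esub> k))"
        unfolding *(11) using *(4-10) by (simp add: smult_assoc1[symmetric] R.m_ac)
      finally show ?thesis
        unfolding *(1-3) prod.case using *(4-10) by (subst frac_eq_iff) auto
    qed
    show "?f w y = ?f w z" if yz: "(y, z) \<in> frac_rel M T" and w: "w \<in> carrier (self_module R) \<times> T" for y z w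
    proof -
      obtain m s n t a r u where *: "y = (m, s)" "z = (n, t)" "w = (a, r)" "m \<in> carrier M" "n \<in> carrier M"
        "a \<in> carrier R" "s \<in> T" "t \<in> T" "r \<in> T" "u \<in> T" "u \<odot>\<^bsub>M\<^esub> (t \<odot>\<^bsub>M\<^esub> m) = u \<odot>\<^bsub>M\<^esub> (s \<odot>\<^bsub>M\<^esub> n)"
        using yz w unfolding frac_rel_def by auto
      have "u \<odot>\<^bsub>M\<^esub> ((r \<otimes> t) \<odot>\<^bsub>M\<^esub> (a \<odot>\<^bsub>M\<^esub> m)) = (r \<otimes> a) \<odot>\<^bsub>M\<^esub> (u \<odot>\<^bsub>M\<^esub> (t \<odot>\<^bsub>M\<^esub> m))"
        using *(4-10) by (simp add: smult_assoc1[symmetric] R.m_ac)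
      also have "\<dots> = u \<odot>\<^bsub>M\<^esub> ((r \<otimes> s) \<odot>\<^bsub>M\<^esub> (a \<odot>\<^bsub>M\<^esub> n))"
        unfolding *(11) using *(4-10) by (simp add: smult_assoc1[symmetric] R.m_ac)
      finally show ?thesis
        unfolding *(1-3) prod.case using *(4-10) by (subst frac_eq_iff) auto
    qed
  qed
  then show ?thesis
    using UN_equiv_class2[OF self.equiv_frac_rel equiv_frac_rel, of ?f "(a, s)" "(m, t)"] assms
    by (simp add: loc_module_def loc_frac_def[of _ _ a s] loc_frac_def[of _ _ m t] case_prod_unfold)
qed

lemma frac_zero: "s \<in> T \<Longrightarrow> loc_frac M T \<zero>\<^bsub>M\<^esub> s = \<zero>\<^bsub>loc_module R T M\<^esub>"
proof -
  assume s: "s \<in> T"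
  then have "loc_frac M T \<zero>\<^bsub>M\<^esub> s = loc_frac M T \<zero>\<^bsub>M\<^esub> \<one>" by (subst frac_eq_iff) auto
  then show ?thesis by (simp add: loc_module_def)
qed

lemma loc_module_abelian_group: "abelian_group (loc_module R T M)"
proof (rule abelian_groupI)
  let ?L = "loc_module R T M"
  show "X \<oplus>\<^bsub>?L\<^esub> Y \<in> carrier ?L" if XY: "X \<in> carrier ?L" "Y \<in> carrier ?L" for X Y
    by (rule frac_common[OF XY]) (simp add: frac_add)
  show "\<zero>\<^bsub>?L\<^esub> \<in> carrier ?L" using frac_closed[of "\<zero>\<^bsub>M\<^esub>" \<one>] by (simp add: frac_zero)
  show "X \<oplus>\<^bsub>?L\<^esub> Y \<oplus>\<^bsub>?L\<^esub> Z = X \<oplus>\<^bsub>?L\<^esub> (Y \<oplus>\<^bsub>?L\<^esub> Z)"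
    if XY: "X \<in> carrier ?L" "Y \<in> carrier ?L" "Z \<in> carrier ?L" for X Y Z
    by (rule frac_common3[OF XY]) (simp add: frac_add M.a_assoc)
  show "X \<oplus>\<^bsub>?L\<^esub> Y = Y \<oplus>\<^bsub>?L\<^esub> X" if XY: "X \<in> carrier ?L" "Y \<in> carrier ?L" for X Y
    by (rule frac_common[OF XY]) (simp add: frac_add M.a_comm)
  show "\<zero>\<^bsub>?L\<^esub> \<oplus>\<^bsub>?L\<^esub> X = X" if X: "X \<in> carrier ?L" for X
    by (rule frac_cases[OF X]) (simp add: frac_add frac_zero[symmetric])
  show "\<exists>Y\<in>carrier ?L. Y \<oplus>\<^bsub>?L\<^esub> X = \<zero>\<^bsub>?L\<^esub>" if X: "X \<in> carrier ?L" for X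
  proof -
    obtain m s where m: "m \<in> carrier M" "s \<in> T" "X = loc_frac M T m s" using frac_cases[OF X] .
    then show ?thesis
      by (intro bexI[of _ "loc_frac M T (\<ominus>\<^bsub>M\<^esub> m) s"]) (simp_all add: frac_add M.l_neg frac_zero)
  qed
qed

end

lemma loc_ring_simps [simp]:
  "carrier (loc_ring R T) = carrier (loc_module R T (self_module R))"
  "monoid.mult (loc_ring R T) = smult (loc_module R T (self_module R))"
  "add (loc_ring R T) = add (loc_module R T (self_module R))"
  "\<zero>\<^bsub>loc_ring R T\<^esub> = \<zero>\<^bsub>loc_module R T (self_module R)\<^esub>"
  "\<one>\<^bsub>loc_ring R T\<^esub> = loc_frac (self_module R) T \<one>\<^bsub>R\<^esub> \<one>\<^bsub>R\<^esub>"
  by (simp_all add: loc_ring_def Let_def)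

context fractions
begin

lemma loc_smult_closed:
  assumes "A \<in> carrier (loc_ring R T)" "X \<in> carrier (loc_module R T M)"
  shows "A \<odot>\<^bsub>loc_module R T M\<^esub> X \<in> carrier (loc_module R T M)"
proof -
  interpret self: fractions R "self_module R" T by (rule self_fractions)
  obtain a s where a: "a \<in> carrier R" "s \<in> T" "A = loc_frac (self_module R) T a s"
    using self.frac_cases[of A] assms(1) by auto
  obtain m t where m: "m \<in> carrier M" "t \<in> T" "X = loc_frac M T m t" using frac_cases[OF assms(2)] .
  show ?thesis using a m by (simp add: frac_smult)
qed

lemma loc_smult_one:
  assumes X: "X \<in> carrier (loc_module R T M)"
  shows "\<one>\<^bsub>loc_ring R T\<^esub> \<odot>\<^bsub>loc_module R T M\<^esub> X = X"
  by (rule frac_cases[OF X]) (simp add: frac_smult)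

lemma loc_smult_r_distr:
  assumes A: "A \<in> carrier (loc_ring R T)" and X: "X \<in> carrier (loc_module R T M)" "Y \<in> carrier (loc_module R T M)"
  shows "A \<odot>\<^bsub>loc_module R T M\<^esub> (X \<oplus>\<^bsub>loc_module R T M\<^esub> Y)
    = A \<odot>\<^bsub>loc_module R T M\<^esub> X \<oplus>\<^bsub>loc_module R T M\<^esub> A \<odot>\<^bsub>loc_module R T M\<^esub> Y"
proof -
  interpret self: fractions R "self_module R" T by (rule self_fractions)
  obtain a s where a: "a \<in> carrier R" "s \<in> T" "A = loc_frac (self_module R) T a s"
    using self.frac_cases[of A] assms(1) by auto
  show ?thesis by (rule frac_common[OF X]) (simp add: a frac_smult frac_add smult_r_distr)
qed

lemma loc_smult_l_distr:
  assumes A: "A \<in> carrier (loc_ring R T)" "B \<in> carrier (loc_ring R T)" and X: "X \<in> carrier (loc_module R T M)"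
  shows "(A \<oplus>\<^bsub>loc_ring R T\<^esub> B) \<odot>\<^bsub>loc_module R T M\<^esub> X
    = A \<odot>\<^bsub>loc_module R T M\<^esub> X \<oplus>\<^bsub>loc_module R T M\<^esub> B \<odot>\<^bsub>loc_module R T M\<^esub> X"
proof -
  interpret self: fractions R "self_module R" T by (rule self_fractions)
  obtain a b s where a: "a \<in> carrier R" "b \<in> carrier R" "s \<in> T"
    "A = loc_frac (self_module R) T a s" "B = loc_frac (self_module R) T b s"
    using self.frac_common[of A B] A by auto
  have "A \<oplus>\<^bsub>loc_ring R T\<^esub> B = loc_frac (self_module R) T (a \<oplus> b) s"
    using self.frac_add[of a b s] a by simp
  then show ?thesis by (rule_tac frac_cases[OF X]) (simp add: a frac_smult frac_add smult_l_distr)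
qed

lemma loc_smult_assoc:
  assumes A: "A \<in> carrier (loc_ring R T)" "B \<in> carrier (loc_ring R T)" and X: "X \<in> carrier (loc_module R T M)"
  shows "(A \<otimes>\<^bsub>loc_ring R T\<^esub> B) \<odot>\<^bsub>loc_module R T M\<^esub> X = A \<odot>\<^bsub>loc_module R T M\<^esub> (B \<odot>\<^bsub>loc_module R T M\<^esub> X)"
proof -
  interpret self: fractions R "self_module R" T by (rule self_fractions)
  obtain a s where a: "a \<in> carrier R" "s \<in> T" "A = loc_frac (self_module R) T a s"
    using self.frac_cases[of A] A by auto
  obtain b t where b: "b \<in> carrier R" "t \<in> T" "B = loc_frac (self_module R) T b t"
    using self.frac_cases[of B] A by auto
  have "A \<otimes>\<^bsub>loc_ring R T\<^esub> B = loc_frac (self_module R) T (a \<otimes> b) (s \<otimes> t)"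
    using self.frac_smult[of a b s t] a b by simp
  then show ?thesis by (rule_tac frac_cases[OF X]) (simp add: a b frac_smult smult_assoc1 R.m_assoc)
qed

lemma cring_loc_ring: "cring (loc_ring R T)"
proof -
  interpret self: fractions R "self_module R" T by (rule self_fractions)
  let ?S = "loc_ring R T"
  have comm: "A \<otimes>\<^bsub>?S\<^esub> B = B \<otimes>\<^bsub>?S\<^esub> A" if AB: "A \<in> carrier ?S" "B \<in> carrier ?S" for A B
  proof -
    obtain a b s where a: "a \<in> carrier R" "b \<in> carrier R" "s \<in> T"
      "A = loc_frac (self_module R) T a s" "B = loc_frac (self_module R) T b s"
      using self.frac_common[of A B] AB by auto
    then show ?thesis using self.frac_smult[of a b s s] self.frac_smult[of b a s s] R.m_comm[of a b] by simp
  qed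
  have ag: "abelian_group ?S"
  proof (rule abelian_groupI)
    interpret A: abelian_group "loc_module R T (self_module R)" by (rule self.loc_module_abelian_group)
    show "\<exists>Y\<in>carrier ?S. Y \<oplus>\<^bsub>?S\<^esub> X = \<zero>\<^bsub>?S\<^esub>" if "X \<in> carrier ?S" for X
      using that A.l_neg by auto
  qed (use abelian_groupE[OF self.loc_module_abelian_group] in auto)
  have cm: "comm_monoid ?S"
    by (rule comm_monoidI)
      (use comm self.loc_smult_closed self.loc_smult_one self.loc_smult_assoc self.frac_closed[of \<one> \<one>] in auto)
  show ?thesis by (rule cringI[OF ag cm]) (use self.loc_smult_l_distr in auto)
qed

lemma module_loc_module: "module (loc_ring R T) (loc_module R T M)"
  by (rule moduleI[OF cring_loc_ring loc_module_abelian_group loc_smult_closed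
      loc_smult_l_distr loc_smult_r_distr loc_smult_assoc loc_smult_one])

end

section \<open>Regular sequences over a localization\<close>

text \<open>The properties of the localization maps \<open>l : R \<rightarrow> S = R\<^sub>q\<close> and \<open>\<phi> : M \<rightarrow> N = M\<^sub>q\<close> that are used. They are
  stable under composition, so iterated localizations need no computation with fractions of fractions.\<close>

locale localization = module R M + N: module S N
  for R (structure) and M :: "('a, 'm, 'y) module_scheme"
    and S :: "('b, 'w) ring_scheme" and N :: "('b, 'n, 'v) module_scheme" +
  fixes q :: "'a set" and l :: "'a \<Rightarrow> 'b" and \<phi> :: "'m \<Rightarrow> 'n"
  assumes q: "primeideal q R"
    and l_closed [simp]: "a \<in> carrier R \<Longrightarrow> l a \<in> carrier S"
    and map_closed [simp]: "m \<in> carrier M \<Longrightarrow> \<phi> m \<in> carrier N"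
    and map_add: "m \<in> carrier M \<Longrightarrow> m' \<in> carrier M \<Longrightarrow> \<phi> (m \<oplus>\<^bsub>M\<^esub> m') = \<phi> m \<oplus>\<^bsub>N\<^esub> \<phi> m'"
    and map_smult: "a \<in> carrier R \<Longrightarrow> m \<in> carrier M \<Longrightarrow> \<phi> (a \<odot>\<^bsub>M\<^esub> m) = l a \<odot>\<^bsub>N\<^esub> \<phi> m"
    and map_surj: "n \<in> carrier N \<Longrightarrow> \<exists>m\<in>carrier M. \<exists>u\<in>carrier R - q. l u \<odot>\<^bsub>N\<^esub> n = \<phi> m"
    and map_zero_iff: "m \<in> carrier M \<Longrightarrow> \<phi> m = \<zero>\<^bsub>N\<^esub> \<longleftrightarrow> (\<exists>u\<in>carrier R - q. u \<odot>\<^bsub>M\<^esub> m = \<zero>\<^bsub>M\<^esub>)"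
    and l_unit: "u \<in> carrier R - q \<Longrightarrow> l u \<in> Units S"
begin

lemma qc [simp]: "z \<in> q \<Longrightarrow> z \<in> carrier R"
  using q by (blast intro: ideal.Icarr primeideal.axioms(1))

lemma map_zero: "\<phi> \<zero>\<^bsub>M\<^esub> = \<zero>\<^bsub>N\<^esub>"
  using R.prime_compl_one[OF q] by (subst map_zero_iff) (auto intro!: bexI[of _ \<one>])

lemma map_diff:
  assumes "m \<in> carrier M" "m' \<in> carrier M"
  shows "\<phi> (m \<ominus>\<^bsub>M\<^esub> m') = \<phi> m \<ominus>\<^bsub>N\<^esub> \<phi> m'"
proof -
  have "\<phi> m = \<phi> (m \<ominus>\<^bsub>M\<^esub> m') \<oplus>\<^bsub>N\<^esub> \<phi> m'"
    using assms map_add[of "m \<ominus>\<^bsub>M\<^esub> m'" m'] by (simp add: a_minus_def M.a_assoc M.l_neg)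
  then show ?thesis using assms N.add_minus_cancel[of "\<phi> (m \<ominus>\<^bsub>M\<^esub> m')" "\<phi> m'"] by simp
qed

lemma map_eq_iff:
  assumes "m \<in> carrier M" "m' \<in> carrier M"
  shows "\<phi> m = \<phi> m' \<longleftrightarrow> (\<exists>u\<in>carrier R - q. u \<odot>\<^bsub>M\<^esub> m = u \<odot>\<^bsub>M\<^esub> m')"
proof -
  have "\<phi> m = \<phi> m' \<longleftrightarrow> \<phi> (m \<ominus>\<^bsub>M\<^esub> m') = \<zero>\<^bsub>N\<^esub>"
    using assms by (simp add: map_diff N.minus_eq_zero_iff)
  also have "\<dots> \<longleftrightarrow> (\<exists>u\<in>carrier R - q. u \<odot>\<^bsub>M\<^esub> m \<ominus>\<^bsub>M\<^esub> u \<odot>\<^bsub>M\<^esub> m' = \<zero>\<^bsub>M\<^esub>)"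
    using assms by (simp add: map_zero_iff smult_minus_distr)
  also have "\<dots> \<longleftrightarrow> (\<exists>u\<in>carrier R - q. u \<odot>\<^bsub>M\<^esub> m = u \<odot>\<^bsub>M\<^esub> m')"
    using assms by (intro bex_cong refl) (simp add: minus_eq_zero_iff)
  finally show ?thesis .
qed

lemma unit_cancel:
  assumes W: "submodule W S N" and u: "u \<in> Units S" and n: "n \<in> carrier N" "u \<odot>\<^bsub>N\<^esub> n \<in> W"
  shows "n \<in> W"
proof -
  have "inv\<^bsub>S\<^esub> u \<odot>\<^bsub>N\<^esub> (u \<odot>\<^bsub>N\<^esub> n) = n"
    using N.smult_assoc1[of "inv\<^bsub>S\<^esub> u" u n] N.smult_one[OF n(1)] N.R.Units_closed[OF u]
      N.R.Units_inv_closed[OF u] N.R.Units_l_inv[OF u] n(1) by simp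
  then show ?thesis using N.submoduleD(4)[OF W N.R.Units_inv_closed[OF u] n(2)] by simp
qed

definition pullback :: "'m set \<Rightarrow> 'n set \<Rightarrow> bool" where
  "pullback U W \<longleftrightarrow> (\<forall>m\<in>carrier M. \<phi> m \<in> W \<longleftrightarrow> m \<in> U)"

lemma pullbackD: "pullback U W \<Longrightarrow> m \<in> carrier M \<Longrightarrow> \<phi> m \<in> W \<longleftrightarrow> m \<in> U"
  by (simp add: pullback_def)

lemma pullback_zero: "pullback (sat R M q {\<zero>\<^bsub>M\<^esub>}) {\<zero>\<^bsub>N\<^esub>}"
  unfolding pullback_def sat_def using map_zero_iff by auto

lemma pullback_plus_mult:
  assumes U: "submodule U R M" and W: "submodule W S N" and c: "pullback U W" and z: "z \<in> carrier R"
  shows "pullback (sat R M q (plus_mult M U z (carrier M))) (plus_mult N W (l z) (carrier N))"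
  unfolding pullback_def
proof (intro ballI iffI)
  let ?P = "plus_mult N W (l z) (carrier N)"
  have P: "submodule ?P S N" using N.submodule_plus_mult(1)[OF W N.carrier_is_submodule] z by simp
  fix m assume m: "m \<in> carrier M"
  note UD = submoduleD[OF U]
  show "\<phi> m \<in> ?P" if "m \<in> sat R M q (plus_mult M U z (carrier M))"
  proof -
    obtain f x m' where f: "f \<in> carrier R - q" "f \<odot>\<^bsub>M\<^esub> m = x \<oplus>\<^bsub>M\<^esub> z \<odot>\<^bsub>M\<^esub> m'" "x \<in> U" "m' \<in> carrier M"
      using \<open>m \<in> sat R M q (plus_mult M U z (carrier M))\<close> by (auto simp: sat_def plus_mult_def)
    have "l f \<odot>\<^bsub>N\<^esub> \<phi> m = \<phi> x \<oplus>\<^bsub>N\<^esub> l z \<odot>\<^bsub>N\<^esub> \<phi> m'"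
      using f m z UD(1) map_smult[of f m] by (simp add: map_add map_smult)
    moreover have "\<phi> x \<in> W" using pullbackD[OF c] f(3) UD(1) by simp
    ultimately have "l f \<odot>\<^bsub>N\<^esub> \<phi> m \<in> ?P" using map_closed[OF f(4)] unfolding plus_mult_def by blast
    then show ?thesis using unit_cancel[OF P l_unit[OF f(1)]] m by simp
  qed
  show "m \<in> sat R M q (plus_mult M U z (carrier M))" if "\<phi> m \<in> ?P"
  proof -
    obtain w n where w: "w \<in> W" "n \<in> carrier N" "\<phi> m = w \<oplus>\<^bsub>N\<^esub> l z \<odot>\<^bsub>N\<^esub> n"
      using \<open>\<phi> m \<in> ?P\<close> by (auto simp: plus_mult_def)
    have wc: "w \<in> carrier N" using N.submoduleD(1)[OF W w(1)] .
    obtain m1 u where m1: "m1 \<in> carrier M" "u \<in> carrier R - q" "l u \<odot>\<^bsub>N\<^esub> w = \<phi> m1" using map_surj[OF wc] by blast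
    obtain m2 v where m2: "m2 \<in> carrier M" "v \<in> carrier R - q" "l v \<odot>\<^bsub>N\<^esub> n = \<phi> m2" using map_surj[OF w(2)] by blast
    have cR: "u \<in> carrier R" "v \<in> carrier R" "l u \<in> carrier S" "l v \<in> carrier S" "l z \<in> carrier S" using m1 m2 z by auto
    have "\<phi> m1 \<in> W" using N.submoduleD(4)[OF W cR(3) w(1)] m1(3) by simp
    then have m1U: "m1 \<in> U" using pullbackD[OF c m1(1)] by simp
    have "\<phi> ((v \<otimes> u) \<odot>\<^bsub>M\<^esub> m) = l v \<odot>\<^bsub>N\<^esub> (l u \<odot>\<^bsub>N\<^esub> \<phi> m)"
      using m cR by (simp add: smult_assoc1 map_smult)
    also have "\<dots> = l v \<odot>\<^bsub>N\<^esub> (l u \<odot>\<^bsub>N\<^esub> w) \<oplus>\<^bsub>N\<^esub> l v \<odot>\<^bsub>N\<^esub> (l u \<odot>\<^bsub>N\<^esub> (l z \<odot>\<^bsub>N\<^esub> n))"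
      using w(2,3) wc cR by (simp add: N.smult_r_distr)
    also have "l v \<odot>\<^bsub>N\<^esub> (l u \<odot>\<^bsub>N\<^esub> (l z \<odot>\<^bsub>N\<^esub> n)) = l z \<odot>\<^bsub>N\<^esub> (l u \<odot>\<^bsub>N\<^esub> (l v \<odot>\<^bsub>N\<^esub> n))"
      using w(2) cR by (simp add: N.smult_assoc1[symmetric] N.R.m_ac)
    also have "l v \<odot>\<^bsub>N\<^esub> (l u \<odot>\<^bsub>N\<^esub> w) \<oplus>\<^bsub>N\<^esub> \<dots> = \<phi> (v \<odot>\<^bsub>M\<^esub> m1 \<oplus>\<^bsub>M\<^esub> z \<odot>\<^bsub>M\<^esub> (u \<odot>\<^bsub>M\<^esub> m2))"
      using m1 m2 cR z by (simp add: map_add map_smult)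
    finally obtain f where f: "f \<in> carrier R - q"
      "f \<odot>\<^bsub>M\<^esub> ((v \<otimes> u) \<odot>\<^bsub>M\<^esub> m) = f \<odot>\<^bsub>M\<^esub> (v \<odot>\<^bsub>M\<^esub> m1 \<oplus>\<^bsub>M\<^esub> z \<odot>\<^bsub>M\<^esub> (u \<odot>\<^bsub>M\<^esub> m2))"
      using m m1 m2 cR z by (subst (asm) map_eq_iff) auto
    have fR: "f \<in> carrier R" using f(1) by simp
    have "(f \<otimes> (v \<otimes> u)) \<odot>\<^bsub>M\<^esub> m = (f \<otimes> v) \<odot>\<^bsub>M\<^esub> m1 \<oplus>\<^bsub>M\<^esub> z \<odot>\<^bsub>M\<^esub> ((f \<otimes> u) \<odot>\<^bsub>M\<^esub> m2)"
      using f(2) fR cR m m1(1) m2(1) z by (simp add: smult_r_distr smult_assoc1 smult_commute[of f z])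
    moreover have "(f \<otimes> v) \<odot>\<^bsub>M\<^esub> m1 \<in> U" "(f \<otimes> u) \<odot>\<^bsub>M\<^esub> m2 \<in> carrier M" using UD(4)[OF _ m1U] fR cR m2(1) by auto
    ultimately have "(f \<otimes> (v \<otimes> u)) \<odot>\<^bsub>M\<^esub> m \<in> plus_mult M U z (carrier M)"
      unfolding plus_mult_def by blast
    moreover have "f \<otimes> (v \<otimes> u) \<in> carrier R - q"
      using R.prime_compl_mult[OF q f(1) R.prime_compl_mult[OF q m2(2) m1(2)]] .
    ultimately show ?thesis using m unfolding sat_def by blast
  qed
qed

lemma pullback_nonzerodivisor:
  assumes W: "submodule W S N" and c: "pullback U W" and z: "z \<in> carrier R"
  shows "(\<forall>v\<in>carrier M. z \<odot>\<^bsub>M\<^esub> v \<in> U \<longrightarrow> v \<in> U) \<longleftrightarrow> (\<forall>n\<in>carrier N. l z \<odot>\<^bsub>N\<^esub> n \<in> W \<longrightarrow> n \<in> W)"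
proof
  assume nzd: "\<forall>n\<in>carrier N. l z \<odot>\<^bsub>N\<^esub> n \<in> W \<longrightarrow> n \<in> W"
  show "\<forall>v\<in>carrier M. z \<odot>\<^bsub>M\<^esub> v \<in> U \<longrightarrow> v \<in> U"
  proof (intro ballI impI)
    fix v assume v: "v \<in> carrier M" "z \<odot>\<^bsub>M\<^esub> v \<in> U"
    then have "l z \<odot>\<^bsub>N\<^esub> \<phi> v \<in> W" using pullbackD[OF c, of "z \<odot>\<^bsub>M\<^esub> v"] z map_smult[OF z v(1)] by simp
    then show "v \<in> U" using nzd pullbackD[OF c v(1)] v(1) by simp
  qed
next
  assume nzd: "\<forall>v\<in>carrier M. z \<odot>\<^bsub>M\<^esub> v \<in> U \<longrightarrow> v \<in> U"
  show "\<forall>n\<in>carrier N. l z \<odot>\<^bsub>N\<^esub> n \<in> W \<longrightarrow> n \<in> W"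
  proof (intro ballI impI)
    fix n assume n: "n \<in> carrier N" "l z \<odot>\<^bsub>N\<^esub> n \<in> W"
    obtain m u where m: "m \<in> carrier M" "u \<in> carrier R - q" "l u \<odot>\<^bsub>N\<^esub> n = \<phi> m" using map_surj[OF n(1)] by blast
    have "l u \<odot>\<^bsub>N\<^esub> (l z \<odot>\<^bsub>N\<^esub> n) \<in> W" using N.submoduleD(4)[OF W _ n(2)] m(2) by simp
    moreover have "l u \<odot>\<^bsub>N\<^esub> (l z \<odot>\<^bsub>N\<^esub> n) = \<phi> (z \<odot>\<^bsub>M\<^esub> m)"
      using m z n(1) N.smult_commute[of "l u" "l z" n] by (simp add: map_smult)
    ultimately have "z \<odot>\<^bsub>M\<^esub> m \<in> U" using pullbackD[OF c] m(1) z by simp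
    then have "\<phi> m \<in> W" using nzd m(1) pullbackD[OF c m(1)] by simp
    then show "n \<in> W" using unit_cancel[OF W l_unit[OF m(2)] n(1)] m(3) by simp
  qed
qed

lemma near_regular_image:
  assumes "near_regular R M q zs U"
  shows "set zs \<subseteq> q \<and> pullback U (seq_smult N (map l zs)) \<and> (\<forall>k<length zs. \<forall>n\<in>carrier N.
     l (zs ! k) \<odot>\<^bsub>N\<^esub> n \<in> seq_smult N (take k (map l zs)) \<longrightarrow> n \<in> seq_smult N (take k (map l zs)))"
  using assms
proof induct
  case Nil
  then show ?case using pullback_zero by (simp add: N.seq_smult_Nil)
next
  case (snoc zs U z)
  have sub: "submodule U R M" using near_regular_facts[OF q snoc(1)] by simp
  have zs: "set (map l zs) \<subseteq> carrier S" "l z \<in> carrier S" "z \<in> carrier R" using snoc(2,3) by auto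
  note W = N.submodule_seq_smult[OF zs(1)]
  have c: "pullback U (seq_smult N (map l zs))" using snoc(2) by simp
  have nz: "\<forall>n\<in>carrier N. l z \<odot>\<^bsub>N\<^esub> n \<in> seq_smult N (map l zs) \<longrightarrow> n \<in> seq_smult N (map l zs)"
    using pullback_nonzerodivisor[OF W c zs(3)] snoc(4) by blast
  show ?case
  proof (intro conjI allI impI ballI)
    show "set (zs @ [z]) \<subseteq> q" using snoc by auto
    show "pullback (sat R M q (plus_mult M U z (carrier M))) (seq_smult N (map l (zs @ [z])))"
      using pullback_plus_mult[OF sub W c zs(3)] N.seq_smult_snoc[OF zs(1,2)] by simp
    fix k n assume k: "k < length (zs @ [z])" and n: "n \<in> carrier N"
      "l ((zs @ [z]) ! k) \<odot>\<^bsub>N\<^esub> n \<in> seq_smult N (take k (map l (zs @ [z])))"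
    show "n \<in> seq_smult N (take k (map l (zs @ [z])))"
    proof (cases "k < length zs")
      case True
      then show ?thesis using snoc(2) n by (simp add: nth_append)
    next
      case False
      then have "k = length zs" using k by simp
      then show ?thesis using nz n by simp
    qed
  qed
qed

text \<open>If \<open>M\<^sub>q = 0\<close>, then every submodule has saturation \<open>M\<close>, and \<open>\<zero>\<close> can be appended arbitrarily often. This
  corresponds to the convention that the zero module has infinite depth.\<close>

lemma near_regular_trivial:
  assumes "carrier N = {\<zero>\<^bsub>N\<^esub>}"
  shows "\<exists>ws U. near_regular R M q ws U \<and> length ws = k"
proof -
  have sat: "sat R M q V = carrier M" if "submodule V R M" for V
  proof -
    have z: "\<zero>\<^bsub>M\<^esub> \<in> V" using submoduleD(2)[OF that] .
    have "\<exists>f\<in>carrier R - q. f \<odot>\<^bsub>M\<^esub> v \<in> V" if v: "v \<in> carrier M" for v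
    proof -
      have "\<phi> v = \<zero>\<^bsub>N\<^esub>" using map_closed[OF v] assms by simp
      then obtain f where "f \<in> carrier R - q" "f \<odot>\<^bsub>M\<^esub> v = \<zero>\<^bsub>M\<^esub>" using map_zero_iff[OF v] by blast
      then show ?thesis using z by (intro bexI[of _ f]) simp_all
    qed
    then show ?thesis by (auto simp: sat_def)
  qed
  have zq: "\<zero> \<in> q" using q by (blast intro: primeideal.axioms(1) additive_subgroup.zero_closed ideal.axioms(1))
  have "\<exists>ws. near_regular R M q ws (carrier M) \<and> length ws = k"
  proof (induct k)
    case 0
    show ?case using near_regular.Nil[of R M q] sat[OF submodule_zero] by auto
  next
    case (Suc k)
    then obtain ws where ws: "near_regular R M q ws (carrier M)" "length ws = k" by blast
    have "submodule (plus_mult M (carrier M) \<zero> (carrier M)) R M"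
      using submodule_plus_mult(1) carrier_is_submodule by simp
    then have "near_regular R M q (ws @ [\<zero>]) (carrier M)"
      using near_regular.snoc[OF ws(1) zq] sat by simp
    then show ?case using ws(2) by (intro exI[of _ "ws @ [\<zero>]"]) simp
  qed
  then show ?thesis by blast
qed

lemmas Units_carrier [simp] = N.R.Units_closed

lemma plus_mult_unit:
  assumes "c \<in> Units S" "y \<in> carrier S" "W \<subseteq> carrier N"
  shows "plus_mult N W (c \<otimes>\<^bsub>S\<^esub> y) (carrier N) = plus_mult N W y (carrier N)"
proof (intro equalityI subsetI)
  fix x assume "x \<in> plus_mult N W (c \<otimes>\<^bsub>S\<^esub> y) (carrier N)"
  then obtain w n where w: "w \<in> W" "n \<in> carrier N" "x = w \<oplus>\<^bsub>N\<^esub> (c \<otimes>\<^bsub>S\<^esub> y) \<odot>\<^bsub>N\<^esub> n" by (auto simp: plus_mult_def)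
  then have "x = w \<oplus>\<^bsub>N\<^esub> y \<odot>\<^bsub>N\<^esub> (c \<odot>\<^bsub>N\<^esub> n)" using assms N.R.m_comm[of c y] by (simp add: N.smult_assoc1)
  moreover have "c \<odot>\<^bsub>N\<^esub> n \<in> carrier N" using w assms by simp
  ultimately show "x \<in> plus_mult N W y (carrier N)" using w unfolding plus_mult_def by blast
next
  fix x assume "x \<in> plus_mult N W y (carrier N)"
  then obtain w n where w: "w \<in> W" "n \<in> carrier N" "x = w \<oplus>\<^bsub>N\<^esub> y \<odot>\<^bsub>N\<^esub> n" by (auto simp: plus_mult_def)
  have c: "c \<in> carrier S" "inv\<^bsub>S\<^esub> c \<in> carrier S" using assms(1) by auto
  have "(c \<otimes>\<^bsub>S\<^esub> y) \<odot>\<^bsub>N\<^esub> (inv\<^bsub>S\<^esub> c \<odot>\<^bsub>N\<^esub> n) = (c \<otimes>\<^bsub>S\<^esub> inv\<^bsub>S\<^esub> c) \<odot>\<^bsub>N\<^esub> (y \<odot>\<^bsub>N\<^esub> n)"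
    using c assms(2) w(2) by (simp only: N.smult_assoc1[symmetric] N.R.m_closed N.R.m_ac)
  also have "\<dots> = y \<odot>\<^bsub>N\<^esub> n" using assms w by simp
  finally have "x = w \<oplus>\<^bsub>N\<^esub> (c \<otimes>\<^bsub>S\<^esub> y) \<odot>\<^bsub>N\<^esub> (inv\<^bsub>S\<^esub> c \<odot>\<^bsub>N\<^esub> n)" using w(3) by simp
  moreover have "inv\<^bsub>S\<^esub> c \<odot>\<^bsub>N\<^esub> n \<in> carrier N" using w assms by simp
  ultimately show "x \<in> plus_mult N W (c \<otimes>\<^bsub>S\<^esub> y) (carrier N)" using w(1) unfolding plus_mult_def by blast
qed

text \<open>Every non-unit \<open>y\<close> of \<open>S\<close> agrees with the image of an element of \<open>q\<close> up to a unit, and unit factors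
  affect neither the generated submodules nor the property of being a nonzerodivisor.\<close>

lemma near_regular_preimage:
  assumes "set ys \<subseteq> carrier S" and ys: "\<And>y. y \<in> set ys \<Longrightarrow> \<exists>z\<in>q. \<exists>u\<in>carrier R - q. l u \<otimes>\<^bsub>S\<^esub> y = l z"
    and "\<And>k n. k < length ys \<Longrightarrow> n \<in> carrier N \<Longrightarrow> (ys ! k) \<odot>\<^bsub>N\<^esub> n \<in> seq_smult N (take k ys) \<Longrightarrow>
      n \<in> seq_smult N (take k ys)"
  shows "\<exists>zs U. near_regular R M q zs U \<and> length zs = length ys \<and> pullback U (seq_smult N ys)"
  using assms
proof (induct ys rule: rev_induct)
  case Nil
  show ?case using near_regular.Nil[of R M q] pullback_zero by (intro exI[of _ "[]"] exI conjI) (auto simp: N.seq_smult_Nil)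
next
  case (snoc y ys)
  have "\<exists>zs U. near_regular R M q zs U \<and> length zs = length ys \<and> pullback U (seq_smult N ys)"
  proof (rule snoc(1))
    show "n \<in> seq_smult N (take k ys)"
      if "k < length ys" "n \<in> carrier N" "(ys ! k) \<odot>\<^bsub>N\<^esub> n \<in> seq_smult N (take k ys)" for k n
      using snoc(4)[of k n] that by (simp add: nth_append)
    show "\<exists>z\<in>q. \<exists>u\<in>carrier R - q. l u \<otimes>\<^bsub>S\<^esub> x = l z" if "x \<in> set ys" for x
      by (rule snoc(3)) (use that in simp)
  qed (use snoc(2) in simp)
  then obtain zs U where zs: "near_regular R M q zs U" "length zs = length ys" "pullback U (seq_smult N ys)" by blast
  obtain z u where z: "z \<in> q" "u \<in> carrier R - q" "l u \<otimes>\<^bsub>S\<^esub> y = l z" using snoc(3)[of y] by auto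
  have yc: "y \<in> carrier S" "set ys \<subseteq> carrier S" using snoc(2) by auto
  note W = N.submodule_seq_smult[OF yc(2)]
  have sub: "submodule U R M" using near_regular_facts[OF q zs(1)] by simp
  have nz: "n \<in> seq_smult N ys" if n: "n \<in> carrier N" "l z \<odot>\<^bsub>N\<^esub> n \<in> seq_smult N ys" for n
  proof -
    have "l u \<odot>\<^bsub>N\<^esub> (y \<odot>\<^bsub>N\<^esub> n) \<in> seq_smult N ys"
      using n yc z(2) unfolding z(3)[symmetric] by (simp add: N.smult_assoc1)
    then have "y \<odot>\<^bsub>N\<^esub> n \<in> seq_smult N ys" using unit_cancel[OF W l_unit[OF z(2)]] n(1) yc(1) by simp
    then show ?thesis using snoc(4)[of "length ys" n] n(1) by simp
  qed
  have nz': "\<forall>v\<in>carrier M. z \<odot>\<^bsub>M\<^esub> v \<in> U \<longrightarrow> v \<in> U"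
  proof (rule iffD2[OF pullback_nonzerodivisor[OF W zs(3) qc[OF z(1)]]], intro ballI impI)
    fix n assume n: "n \<in> carrier N" "l z \<odot>\<^bsub>N\<^esub> n \<in> seq_smult N ys"
    then show "n \<in> seq_smult N ys" by (rule nz)
  qed
  have "near_regular R M q (zs @ [z]) (sat R M q (plus_mult M U z (carrier M)))"
    by (rule near_regular.snoc[OF zs(1) z(1)]) (rule nz'[rule_format])
  moreover have "seq_smult N (ys @ [y]) = plus_mult N (seq_smult N ys) (l z) (carrier N)"
    using N.seq_smult_snoc[OF yc(2,1)] plus_mult_unit[OF l_unit[OF z(2)] yc(1), of "seq_smult N ys"]
      N.submoduleD(1)[OF W] z(3) by auto
  moreover have "pullback (sat R M q (plus_mult M U z (carrier M))) (plus_mult N (seq_smult N ys) (l z) (carrier N))"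
    using pullback_plus_mult[OF sub W zs(3)] z(1) by simp
  ultimately show ?case using zs(2) by (intro exI[of _ "zs @ [z]"] exI conjI) auto
qed

end


locale ring_localization = localization R "self_module R" S "self_module S" q l l
  for R (structure) and S :: "('b, 'w) ring_scheme" and q l
begin

lemma l_mult: "a \<in> carrier R \<Longrightarrow> b \<in> carrier R \<Longrightarrow> l (a \<otimes> b) = l a \<otimes>\<^bsub>S\<^esub> l b"
  using map_smult by simp

lemma l_not_unit: "z \<in> q \<Longrightarrow> l z \<notin> Units S"
proof
  assume z: "z \<in> q" "l z \<in> Units S"
  obtain a u where a: "a \<in> carrier R" "u \<in> carrier R - q" "l u \<otimes>\<^bsub>S\<^esub> inv\<^bsub>S\<^esub> (l z) = l a"
    using map_surj[of "inv\<^bsub>S\<^esub> (l z)"] z(2) by auto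
  have c: "u \<in> carrier R" "z \<in> carrier R" "l u \<in> carrier S" "l z \<in> carrier S" using a(2) z(1) l_closed by auto
  have "l (a \<otimes> z) = (l u \<otimes>\<^bsub>S\<^esub> inv\<^bsub>S\<^esub> (l z)) \<otimes>\<^bsub>S\<^esub> l z"
    unfolding a(3) using a(1) c(2) by (rule l_mult)
  also have "\<dots> = l u \<otimes>\<^bsub>S\<^esub> (inv\<^bsub>S\<^esub> (l z) \<otimes>\<^bsub>S\<^esub> l z)"
    using c z(2) by (intro N.R.m_assoc) auto
  finally have "l (a \<otimes> z) = l u" using z(2) c by simp
  then obtain v where v: "v \<in> carrier R - q" "v \<otimes> (a \<otimes> z) = v \<otimes> u"
    using map_eq_iff[of "a \<otimes> z" u] a c by auto
  have "v \<otimes> (a \<otimes> z) \<in> q" using z(1) a(1) v(1) primeideal.axioms(1)[OF q] by (auto intro!: ideal.I_l_closed)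
  then show False using v R.prime_compl_mult[OF q v(1) a(2)] by simp
qed

lemma non_unit_iff:
  assumes y: "y \<in> carrier S"
  shows "y \<notin> Units S \<longleftrightarrow> (\<exists>z\<in>q. \<exists>u\<in>carrier R - q. l u \<otimes>\<^bsub>S\<^esub> y = l z)"
proof
  assume n: "y \<notin> Units S"
  obtain a u where a: "a \<in> carrier R" "u \<in> carrier R - q" "l u \<otimes>\<^bsub>S\<^esub> y = l a"
    using map_surj[of y] y by auto
  have "a \<in> q"
  proof (rule ccontr)
    assume "a \<notin> q"
    then have u: "l a \<in> Units S" "l u \<in> Units S" using l_unit a by auto
    have "inv\<^bsub>S\<^esub> (l u) \<otimes>\<^bsub>S\<^esub> l a = (inv\<^bsub>S\<^esub> (l u) \<otimes>\<^bsub>S\<^esub> l u) \<otimes>\<^bsub>S\<^esub> y"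
      unfolding a(3)[symmetric] using u(2) y by (intro N.R.m_assoc[symmetric]) auto
    also have "\<dots> = y" using u(2) y by simp
    finally have "y = inv\<^bsub>S\<^esub> (l u) \<otimes>\<^bsub>S\<^esub> l a" by simp
    then show False using n u by simp
  qed
  then show "\<exists>z\<in>q. \<exists>u\<in>carrier R - q. l u \<otimes>\<^bsub>S\<^esub> y = l z" using a by blast
next
  assume "\<exists>z\<in>q. \<exists>u\<in>carrier R - q. l u \<otimes>\<^bsub>S\<^esub> y = l z"
  then obtain z u where z: "z \<in> q" "u \<in> carrier R - q" "l u \<otimes>\<^bsub>S\<^esub> y = l z" by blast
  show "y \<notin> Units S" using l_not_unit[OF z(1)] N.R.Units_m_closed[OF l_unit[OF z(2)], of y] z(3) by auto
qed

definition extension :: "'a set \<Rightarrow> 'b set" where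
  "extension J = {y \<in> carrier S. \<exists>z\<in>J. \<exists>u\<in>carrier R - q. l u \<otimes>\<^bsub>S\<^esub> y = l z}"

lemma ideal_extension:
  assumes J: "ideal J R"
  shows "ideal (extension J) S"
proof -
  interpret J: ideal J R by fact
  have mem: "y \<in> extension J" if "y \<in> carrier S" "z \<in> J" "u \<in> carrier R - q" "l u \<otimes>\<^bsub>S\<^esub> y = l z" for y z u
    unfolding extension_def using that by blast
  have smult: "c \<otimes>\<^bsub>S\<^esub> y \<in> extension J" if c: "c \<in> carrier S" and y: "y \<in> extension J" for c y
  proof -
    obtain z u where z: "y \<in> carrier S" "z \<in> J" "u \<in> carrier R - q" "l u \<otimes>\<^bsub>S\<^esub> y = l z"
      using y by (auto simp: extension_def)
    obtain a v where a: "a \<in> carrier R" "v \<in> carrier R - q" "l v \<otimes>\<^bsub>S\<^esub> c = l a" using map_surj[of c] c by auto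
    have cR: "u \<in> carrier R" "v \<in> carrier R" "z \<in> carrier R" using z a J.Icarr by auto
    have cS: "l u \<in> carrier S" "l v \<in> carrier S" using cR l_closed by auto
    have "l (v \<otimes> u) \<otimes>\<^bsub>S\<^esub> (c \<otimes>\<^bsub>S\<^esub> y) = (l v \<otimes>\<^bsub>S\<^esub> c) \<otimes>\<^bsub>S\<^esub> (l u \<otimes>\<^bsub>S\<^esub> y)"
      using cR cS c z(1) by (simp add: l_mult N.R.m_ac)
    also have "\<dots> = l (a \<otimes> z)" unfolding a(3) z(4) using a(1) cR(3) by (rule l_mult[symmetric])
    finally show ?thesis
      using mem[OF _ _ R.prime_compl_mult[OF q a(2) z(3)]] c z(1) J.I_l_closed[OF z(2) a(1)] by simp
  qed
  have "submodule (extension J) S (self_module S)"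
  proof (rule N.submoduleI)
    show "extension J \<subseteq> carrier (self_module S)" by (auto simp: extension_def)
    show "\<zero>\<^bsub>self_module S\<^esub> \<in> extension J"
      using mem[of "\<zero>\<^bsub>S\<^esub>" \<zero> \<one>] J.zero_closed R.prime_compl_one[OF q] map_zero by simp
    show "c \<odot>\<^bsub>self_module S\<^esub> y \<in> extension J" if "c \<in> carrier S" "y \<in> extension J" for c y using smult that by simp
    show "\<ominus>\<^bsub>self_module S\<^esub> y \<in> extension J" if y: "y \<in> extension J" for y
    proof -
      have "y \<in> carrier S" using y by (simp add: extension_def)
      then show ?thesis using smult[OF _ y, of "\<ominus>\<^bsub>S\<^esub> \<one>\<^bsub>S\<^esub>"] by (simp add: N.R.l_minus)
    qed
    show "x \<oplus>\<^bsub>self_module S\<^esub> y \<in> extension J" if xy: "x \<in> extension J" "y \<in> extension J" for x y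
    proof -
      obtain z u where z: "x \<in> carrier S" "z \<in> J" "u \<in> carrier R - q" "l u \<otimes>\<^bsub>S\<^esub> x = l z"
        using xy by (auto simp: extension_def)
      obtain w v where w: "y \<in> carrier S" "w \<in> J" "v \<in> carrier R - q" "l v \<otimes>\<^bsub>S\<^esub> y = l w"
        using xy by (auto simp: extension_def)
      have c: "u \<in> carrier R" "v \<in> carrier R" "z \<in> carrier R" "w \<in> carrier R"
        using z w J.Icarr by auto
      have c': "l u \<in> carrier S" "l v \<in> carrier S" using c l_closed by auto
      have "l (u \<otimes> v) \<otimes>\<^bsub>S\<^esub> (x \<oplus>\<^bsub>S\<^esub> y) = l v \<otimes>\<^bsub>S\<^esub> (l u \<otimes>\<^bsub>S\<^esub> x) \<oplus>\<^bsub>S\<^esub> l u \<otimes>\<^bsub>S\<^esub> (l v \<otimes>\<^bsub>S\<^esub> y)"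
        using c c' z(1) w(1) by (simp add: l_mult N.R.r_distr N.R.m_ac)
      also have "\<dots> = l (v \<otimes> z \<oplus> u \<otimes> w)" using c z(4) w(4) map_add[of "v \<otimes> z" "u \<otimes> w"] by (simp add: l_mult)
      finally have "l (u \<otimes> v) \<otimes>\<^bsub>S\<^esub> (x \<oplus>\<^bsub>S\<^esub> y) = l (v \<otimes> z \<oplus> u \<otimes> w)" .
      moreover have "v \<otimes> z \<oplus> u \<otimes> w \<in> J"
        using J.I_l_closed[OF z(2) c(2)] J.I_l_closed[OF w(2) c(1)] by (rule J.a_closed)
      ultimately show ?thesis
        using mem[of "x \<oplus>\<^bsub>S\<^esub> y" "v \<otimes> z \<oplus> u \<otimes> w" "u \<otimes> v"] R.prime_compl_mult[OF q z(3) w(3)] z(1) w(1) by simp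
    qed
  qed
  then show ?thesis using N.R.submodule_self_iff by simp
qed

lemma maximalideal_non_units: "maximalideal (carrier S - Units S) S"
proof (rule maximalidealI)
  let ?n = "carrier S - Units S"
  have "?n = extension q" unfolding extension_def using non_unit_iff by blast
  then show "ideal ?n S" using ideal_extension[OF primeideal.axioms(1)[OF q]] by simp
  show "carrier S \<noteq> ?n" using N.R.Units_one_closed by blast
  show "J = ?n \<or> J = carrier S" if J: "ideal J S" "?n \<subseteq> J" "J \<subseteq> carrier S" for J
  proof (cases "J \<inter> Units S = {}")
    case True
    then show ?thesis using J by blast
  next
    case False
    then obtain u where u: "u \<in> J" "u \<in> Units S" by blast
    have "inv\<^bsub>S\<^esub> u \<otimes>\<^bsub>S\<^esub> u \<in> J" using u by (intro ideal.I_l_closed[OF J(1)]) auto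
    then show ?thesis using ideal.one_imp_carrier[OF J(1)] u(2) by simp
  qed
qed

lemma maximalideal_unique: "(THE n. maximalideal n S) = carrier S - Units S"
proof (rule the_equality[of "\<lambda>n. maximalideal n S", OF maximalideal_non_units])
  fix n assume n: "maximalideal n S"
  interpret n: maximalideal n S by fact
  have "u \<notin> Units S" if u: "u \<in> n" for u
  proof
    assume U: "u \<in> Units S"
    have "inv\<^bsub>S\<^esub> u \<otimes>\<^bsub>S\<^esub> u \<in> n" using u U by (intro n.I_l_closed) auto
    then show False using n.one_imp_carrier n.I_notcarr U by simp
  qed
  then have "n \<subseteq> carrier S - Units S" using n.Icarr by blast
  then have "carrier S - Units S = n \<or> carrier S - Units S = carrier S"
    using maximalideal.axioms(1)[OF maximalideal_non_units] by (intro n.I_maximal) auto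
  then show "n = carrier S - Units S" using N.R.Units_one_closed by blast
qed

lemma primeideal_extension:
  assumes Q: "primeideal Q R" and Qq: "Q \<subseteq> q"
  shows "primeideal (extension Q) S" and "a \<in> carrier R \<Longrightarrow> l a \<in> extension Q \<longleftrightarrow> a \<in> Q"
proof -
  interpret Q: primeideal Q R by fact
  have cancel: "a \<in> Q" if a: "a \<in> carrier R" "u \<in> carrier R - q" "z \<in> Q" "l (u \<otimes> a) = l z" for a u z
  proof -
    obtain v where v: "v \<in> carrier R - q" "v \<otimes> (u \<otimes> a) = v \<otimes> z"
      using map_eq_iff[of "u \<otimes> a" z] a Q.Icarr by auto
    have "v \<otimes> (u \<otimes> a) \<in> Q" unfolding v(2) using v(1) a(3) by (intro Q.I_l_closed) auto
    then show ?thesis using Q.I_prime[of v "u \<otimes> a"] Q.I_prime[of u a] v(1) a Qq by auto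
  qed
  have one: "\<one> \<in> carrier R - q" by (rule R.prime_compl_one[OF q])
  show iff: "l a \<in> extension Q \<longleftrightarrow> a \<in> Q" if a: "a \<in> carrier R" for a
  proof
    assume "l a \<in> extension Q"
    then obtain z u where "z \<in> Q" "u \<in> carrier R - q" "l u \<otimes>\<^bsub>S\<^esub> l a = l z" by (auto simp: extension_def)
    then show "a \<in> Q" using cancel[OF a, of u z] l_mult[of u a] a by simp
  next
    assume "a \<in> Q"
    moreover have "l \<one> \<otimes>\<^bsub>S\<^esub> l a = l a" using l_mult[of \<one> a] a by simp
    ultimately show "l a \<in> extension Q" unfolding extension_def using one a l_closed by blast
  qed
  show "primeideal (extension Q) S"
  proof (rule primeidealI[OF ideal_extension N.R.is_cring])
    show "ideal Q R" by (rule Q.ideal_axioms)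
    show "carrier S \<noteq> extension Q"
    proof
      assume "carrier S = extension Q"
      then have "l \<one> \<in> extension Q" using l_closed[of \<one>] by simp
      then show False using iff[of \<one>] one Qq by auto
    qed
    fix x y assume xy: "x \<in> carrier S" "y \<in> carrier S" "x \<otimes>\<^bsub>S\<^esub> y \<in> extension Q"
    obtain a u where a: "a \<in> carrier R" "u \<in> carrier R - q" "l u \<otimes>\<^bsub>S\<^esub> x = l a" using map_surj[of x] xy by auto
    obtain b v where b: "b \<in> carrier R" "v \<in> carrier R - q" "l v \<otimes>\<^bsub>S\<^esub> y = l b" using map_surj[of y] xy by auto
    have c: "l u \<in> carrier S" "l v \<in> carrier S" using a b l_closed by auto
    have "l (a \<otimes> b) = (l u \<otimes>\<^bsub>S\<^esub> l v) \<otimes>\<^bsub>S\<^esub> (x \<otimes>\<^bsub>S\<^esub> y)"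
      unfolding l_mult[OF a(1) b(1)] a(3)[symmetric] b(3)[symmetric] using c xy by (simp add: N.R.m_ac)
    then have "l (a \<otimes> b) \<in> extension Q"
      using ideal.I_l_closed[OF ideal_extension[OF Q.ideal_axioms] xy(3), of "l u \<otimes>\<^bsub>S\<^esub> l v"] c by simp
    then have "a \<in> Q \<or> b \<in> Q" using iff[of "a \<otimes> b"] Q.I_prime[OF a(1) b(1)] a b by simp
    then show "x \<in> extension Q \<or> y \<in> extension Q" unfolding extension_def using a b xy by blast
  qed
qed

lemma length_le_depth:
  assumes nr: "near_regular R (self_module R) q zs b" and b: "b \<noteq> carrier R"
  shows "enat (length zs) \<le> depth S (self_module S)"
proof -
  note I = near_regular_image[OF nr]
  have zs: "set (map l zs) \<subseteq> carrier S - Units S" using I l_not_unit l_closed qc by auto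
  have bs: "submodule b R (self_module R)" using near_regular_facts[OF q nr] by simp
  then obtain m where m: "m \<in> carrier R" "m \<notin> b" using b submoduleD(1)[OF bs] by auto
  have pb: "pullback b (seq_smult (self_module S) (map l zs))" using I by blast
  have "l m \<notin> seq_smult (self_module S) (map l zs)" "l m \<in> carrier S"
    using pullbackD[OF pb, of m] m l_closed by auto
  then have "regular_sequence S (self_module S) (map l zs)"
    using I zs unfolding regular_sequence_def by auto
  then have "enat (length (map l zs)) \<le> regular_length (carrier S - Units S) S (self_module S)"
    unfolding regular_length_def using zs by (intro SUP_upper) simp
  then show ?thesis by (simp add: depth_def maximalideal_unique)
qed

end

text \<open>For \<open>N = 0\<close> the depth is infinite by convention and the sequences are made of zeros. Otherwise \<open>k\<close> is
  reached by a regular sequence, because the supremum runs over natural numbers.\<close>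

lemma near_regular_of_depth:
  assumes "ring_localization R S q l" and "localization R M S N q l \<phi>" and k: "enat k \<le> depth S N"
  shows "\<exists>ws U. near_regular R M q ws U \<and> k \<le> length ws"
proof -
  interpret A: ring_localization R S q l by fact
  interpret L: localization R M S N q l \<phi> by fact
  show ?thesis
  proof (cases "carrier N = {\<zero>\<^bsub>N\<^esub>}")
    case True
    then show ?thesis using L.near_regular_trivial[OF True, of k] by auto
  next
    case False
    let ?X = "{xs. regular_sequence S N xs \<and> set xs \<subseteq> carrier S - Units S}"
    have le: "enat k \<le> (SUP xs\<in>?X. enat (length xs))"
      using k False by (simp add: depth_def A.maximalideal_unique regular_length_def)
    have "k = 0 \<or> (\<exists>xs\<in>?X. k \<le> length xs)"
    proof (rule ccontr)
      assume "\<not> (k = 0 \<or> (\<exists>xs\<in>?X. k \<le> length xs))"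
      then have "(SUP xs\<in>?X. enat (length xs)) \<le> enat (k - 1)" and k0: "k \<noteq> 0"
        by (auto intro!: SUP_least)
      then have "enat k \<le> enat (k - 1)" using le by (rule_tac order_trans)
      then show False using k0 by simp
    qed
    then show ?thesis
    proof
      assume "k = 0"
      then show ?thesis using near_regular.Nil[of R M q] by blast
    next
      assume "\<exists>xs\<in>?X. k \<le> length xs"
      then obtain xs where xs: "regular_sequence S N xs" "set xs \<subseteq> carrier S - Units S" "k \<le> length xs" by auto
      have "\<exists>zs U. near_regular R M q zs U \<and> length zs = length xs \<and> L.pullback U (seq_smult N xs)"
      proof (rule L.near_regular_preimage)
        show "set xs \<subseteq> carrier S" using xs(2) by blast
        show "\<exists>z\<in>q. \<exists>u\<in>carrier R - q. l u \<otimes>\<^bsub>S\<^esub> y = l z" if "y \<in> set xs" for y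
          using A.non_unit_iff[of y] xs(2) that by auto
        show "n \<in> seq_smult N (take j xs)"
          if "j < length xs" "n \<in> carrier N" "(xs ! j) \<odot>\<^bsub>N\<^esub> n \<in> seq_smult N (take j xs)" for j n
          using xs(1) that unfolding regular_sequence_def by blast
      qed
      then show ?thesis using xs(3) by auto
    qed
  qed
qed

section \<open>Depth over an iterated localization\<close>

lemma (in cring) fractions_prime_compl:
  assumes "module R M" and q: "primeideal q R"
  shows "fractions R M (carrier R - q)"
  using assms prime_compl_one[OF q] prime_compl_mult[OF q]
  by (intro fractions.intro fractions_axioms.intro) auto

lemma (in cring) localization_axioms_loc_module:
  assumes M: "module R M" and q: "primeideal q R"
  shows "localization_axioms R M (ring_at R q) (module_at R q M) q
     (\<lambda>a. loc_frac (self_module R) (carrier R - q) a \<one>) (\<lambda>m. loc_frac M (carrier R - q) m \<one>)"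
proof -
  define T where "T = carrier R - q"
  interpret F: fractions R M T unfolding T_def by (rule fractions_prime_compl[OF M q])
  interpret A: fractions R "self_module R" T by (rule F.self_fractions)
  show ?thesis
  proof (rule localization_axioms.intro, unfold T_def[symmetric])
    show "primeideal q R" by fact
    show "loc_frac (self_module R) T a \<one> \<in> carrier (loc_ring R T)" if "a \<in> carrier R" for a using that by simp
    show "loc_frac M T m \<one> \<in> carrier (loc_module R T M)" if "m \<in> carrier M" for m using that by simp
    show "loc_frac M T (m \<oplus>\<^bsub>M\<^esub> m') \<one> = loc_frac M T m \<one> \<oplus>\<^bsub>loc_module R T M\<^esub> loc_frac M T m' \<one>"
      if "m \<in> carrier M" "m' \<in> carrier M" for m m' using that by (simp add: F.frac_add)
    show "loc_frac M T (a \<odot>\<^bsub>M\<^esub> m) \<one> = loc_frac (self_module R) T a \<one> \<odot>\<^bsub>loc_module R T M\<^esub> loc_frac M T m \<one>"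
      if "a \<in> carrier R" "m \<in> carrier M" for a m using that by (simp add: F.frac_smult)
    show "\<exists>m\<in>carrier M. \<exists>u\<in>T. loc_frac (self_module R) T u \<one> \<odot>\<^bsub>loc_module R T M\<^esub> X = loc_frac M T m \<one>"
      if X: "X \<in> carrier (loc_module R T M)" for X
    proof -
      obtain m s where m: "m \<in> carrier M" "s \<in> T" "X = loc_frac M T m s" using F.frac_cases[OF X] .
      then have "loc_frac (self_module R) T s \<one> \<odot>\<^bsub>loc_module R T M\<^esub> X = loc_frac M T m \<one>"
        using F.frac_scale[of m \<one> s] by (simp add: F.frac_smult)
      then show ?thesis using m by blast
    qed
    show "loc_frac M T m \<one> = \<zero>\<^bsub>loc_module R T M\<^esub> \<longleftrightarrow> (\<exists>u\<in>T. u \<odot>\<^bsub>M\<^esub> m = \<zero>\<^bsub>M\<^esub>)" if "m \<in> carrier M" for m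
      unfolding F.frac_zero[OF F.T_one, symmetric] using that by (subst F.frac_eq_iff) auto
    show "loc_frac (self_module R) T u \<one> \<in> Units (loc_ring R T)" if u: "u \<in> T" for u
    proof -
      have "loc_frac (self_module R) T (u \<otimes> \<one>) (u \<otimes> \<one>) = loc_frac (self_module R) T \<one> \<one>"
        using A.frac_scale[of \<one> \<one> u] u by simp
      then have "loc_frac (self_module R) T u u = loc_frac (self_module R) T \<one> \<one>" using u by simp
      then show ?thesis
        unfolding Units_def using u A.frac_smult[of u \<one> \<one> u] A.frac_smult[of \<one> u u \<one>]
        by (auto intro!: bexI[of _ "loc_frac (self_module R) T \<one> u"])
    qed
  qed
qed

lemma (in cring) localization_loc_module:
  assumes M: "module R M" and q: "primeideal q R"
  shows "localization R M (ring_at R q) (module_at R q M) q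
     (\<lambda>a. loc_frac (self_module R) (carrier R - q) a \<one>) (\<lambda>m. loc_frac M (carrier R - q) m \<one>)"
  using M fractions.module_loc_module[OF fractions_prime_compl[OF M q]] localization_axioms_loc_module[OF M q]
  by (rule localization.intro)

lemma (in cring) ring_localization_loc_ring:
  assumes q: "primeideal q R"
  shows "ring_localization R (ring_at R q) q (\<lambda>a. loc_frac (self_module R) (carrier R - q) a \<one>)"
proof -
  interpret S: cring "ring_at R q" by (rule fractions.cring_loc_ring[OF fractions_prime_compl[OF self_module q]])
  have "localization_axioms R (self_module R) (ring_at R q) (self_module (ring_at R q)) q
     (\<lambda>a. loc_frac (self_module R) (carrier R - q) a \<one>) (\<lambda>m. loc_frac (self_module R) (carrier R - q) m \<one>)"
    using localization_axioms_loc_module[OF self_module q] by (simp add: localization_axioms_def)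
  then show ?thesis
    by (intro ring_localization.intro localization.intro self_module S.self_module)
qed

text \<open>For primes \<open>q \<subseteq> p\<close>, the localization of \<open>R\<^sub>p\<close> at the extension of \<open>q\<close> is the localization of \<open>R\<close> at \<open>q\<close>.\<close>

lemma localization_comp:
  assumes "ring_localization R S p l" and "localization R M S N p l \<phi>"
    and q: "primeideal q R" and qp: "q \<subseteq> p" and e: "e = ring_localization.extension R S p l q"
    and "ring_localization S S' e l'" and "localization S N S' N' e l' \<phi>'"
  shows "localization R M S' N' q (l' \<circ> l) (\<phi>' \<circ> \<phi>)"
proof -
  interpret A: ring_localization R S p l by fact
  interpret L: localization R M S N p l \<phi> by fact
  interpret A': ring_localization S S' e l' by fact
  interpret L': localization S N S' N' e l' \<phi>' by fact
  note ext = A.primeideal_extension(2)[OF q qp, folded e]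
  have cR: "u \<in> carrier R \<and> u \<in> carrier R - q" if "u \<in> carrier R - p" for u using that qp by auto
  have lu: "l u \<in> carrier S - e" if "u \<in> carrier R - q" for u using that ext[of u] A.l_closed[of u] by auto
  show ?thesis
  proof (rule localization.intro[OF L.module_axioms L'.N.module_axioms], rule localization_axioms.intro)
    show "primeideal q R" by fact
    show "(l' \<circ> l) a \<in> carrier S'" if "a \<in> carrier R" for a using that by simp
    show "(\<phi>' \<circ> \<phi>) m \<in> carrier N'" if "m \<in> carrier M" for m using that by simp
    show "(\<phi>' \<circ> \<phi>) (m \<oplus>\<^bsub>M\<^esub> m') = (\<phi>' \<circ> \<phi>) m \<oplus>\<^bsub>N'\<^esub> (\<phi>' \<circ> \<phi>) m'" if "m \<in> carrier M" "m' \<in> carrier M" for m m'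
      using that by (simp add: L.map_add L'.map_add)
    show "(\<phi>' \<circ> \<phi>) (a \<odot>\<^bsub>M\<^esub> m) = (l' \<circ> l) a \<odot>\<^bsub>N'\<^esub> (\<phi>' \<circ> \<phi>) m" if "a \<in> carrier R" "m \<in> carrier M" for a m
      using that by (simp add: L.map_smult L'.map_smult)
    show "(l' \<circ> l) u \<in> Units S'" if "u \<in> carrier R - q" for u using L'.l_unit[OF lu[OF that]] by simp
    show "\<exists>m\<in>carrier M. \<exists>u\<in>carrier R - q. (l' \<circ> l) u \<odot>\<^bsub>N'\<^esub> n = (\<phi>' \<circ> \<phi>) m" if n: "n \<in> carrier N'" for n
    proof -
      obtain x v where x: "x \<in> carrier N" "v \<in> carrier S - e" "l' v \<odot>\<^bsub>N'\<^esub> n = \<phi>' x" using L'.map_surj[OF n] by blast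
      obtain m u where m: "m \<in> carrier M" "u \<in> carrier R - p" "l u \<odot>\<^bsub>N\<^esub> x = \<phi> m" using L.map_surj[OF x(1)] by blast
      obtain a w where a: "a \<in> carrier R" "w \<in> carrier R - p" "l w \<otimes>\<^bsub>S\<^esub> v = l a" using A.map_surj[of v] x(2) by auto
      have "a \<notin> q"
      proof
        assume "a \<in> q"
        then have "v \<in> e" unfolding e A.extension_def using a x(2) by blast
        then show False using x(2) by simp
      qed
      then have ua: "u \<otimes>\<^bsub>R\<^esub> a \<in> carrier R - q"
        using A.R.prime_compl_mult[OF q, of u a] cR[OF m(2)] a(1) by simp
      have c: "u \<in> carrier R" "w \<in> carrier R" "l u \<in> carrier S" "l w \<in> carrier S" "v \<in> carrier S"
        using m(2) a(2) x(2) A.l_closed by auto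
      have "(l' \<circ> l) (u \<otimes>\<^bsub>R\<^esub> a) = l' (l u \<otimes>\<^bsub>S\<^esub> (l w \<otimes>\<^bsub>S\<^esub> v))"
        using A.l_mult[OF c(1) a(1)] a(3) by simp
      moreover have "l' (l u \<otimes>\<^bsub>S\<^esub> (l w \<otimes>\<^bsub>S\<^esub> v)) \<odot>\<^bsub>N'\<^esub> n = \<phi>' ((l u \<otimes>\<^bsub>S\<^esub> l w) \<odot>\<^bsub>N\<^esub> x)"
        using c x(1) n A'.l_mult[of "l u \<otimes>\<^bsub>S\<^esub> l w" v]
        by (simp add: A.N.R.m_assoc[symmetric] L'.N.smult_assoc1 L'.map_smult x(3))
      moreover have "(l u \<otimes>\<^bsub>S\<^esub> l w) \<odot>\<^bsub>N\<^esub> x = \<phi> (w \<odot>\<^bsub>M\<^esub> m)"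
        using c x(1) m(1,3) L.N.smult_commute[of "l u" "l w" x] by (simp add: L.N.smult_assoc1 L.map_smult)
      ultimately have "(l' \<circ> l) (u \<otimes>\<^bsub>R\<^esub> a) \<odot>\<^bsub>N'\<^esub> n = (\<phi>' \<circ> \<phi>) (w \<odot>\<^bsub>M\<^esub> m)" by simp
      then show ?thesis using ua c m(1) by (intro bexI[of _ "w \<odot>\<^bsub>M\<^esub> m"] bexI[of _ "u \<otimes>\<^bsub>R\<^esub> a"]) auto
    qed
    show "(\<phi>' \<circ> \<phi>) m = \<zero>\<^bsub>N'\<^esub> \<longleftrightarrow> (\<exists>u\<in>carrier R - q. u \<odot>\<^bsub>M\<^esub> m = \<zero>\<^bsub>M\<^esub>)" if m: "m \<in> carrier M" for m
    proof
      assume "\<exists>u\<in>carrier R - q. u \<odot>\<^bsub>M\<^esub> m = \<zero>\<^bsub>M\<^esub>"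
      then obtain u where u: "u \<in> carrier R - q" "u \<odot>\<^bsub>M\<^esub> m = \<zero>\<^bsub>M\<^esub>" by blast
      then have "l u \<odot>\<^bsub>N\<^esub> \<phi> m = \<zero>\<^bsub>N\<^esub>" using L.map_smult[of u m] L.map_zero m by simp
      then show "(\<phi>' \<circ> \<phi>) m = \<zero>\<^bsub>N'\<^esub>" using L'.map_zero_iff[of "\<phi> m"] m lu[OF u(1)] by auto
    next
      assume "(\<phi>' \<circ> \<phi>) m = \<zero>\<^bsub>N'\<^esub>"
      then obtain v where v: "v \<in> carrier S - e" "v \<odot>\<^bsub>N\<^esub> \<phi> m = \<zero>\<^bsub>N\<^esub>" using L'.map_zero_iff[of "\<phi> m"] m by auto
      obtain a w where a: "a \<in> carrier R" "w \<in> carrier R - p" "l w \<otimes>\<^bsub>S\<^esub> v = l a" using A.map_surj[of v] v(1) by auto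
      have aq: "a \<notin> q"
      proof
        assume "a \<in> q"
        then have "v \<in> e" unfolding e A.extension_def using a v(1) by blast
        then show False using v(1) by simp
      qed
      have "\<phi> (a \<odot>\<^bsub>M\<^esub> m) = l w \<odot>\<^bsub>N\<^esub> (v \<odot>\<^bsub>N\<^esub> \<phi> m)"
        using a v m A.l_closed[of w] unfolding L.map_smult[OF a(1) m] a(3)[symmetric] by (simp add: L.N.smult_assoc1)
      also have "\<dots> = \<zero>\<^bsub>N\<^esub>" using v(2) a(2) A.l_closed[of w] by simp
      finally obtain t where t: "t \<in> carrier R - p" "t \<odot>\<^bsub>M\<^esub> (a \<odot>\<^bsub>M\<^esub> m) = \<zero>\<^bsub>M\<^esub>"
        using L.map_zero_iff[of "a \<odot>\<^bsub>M\<^esub> m"] a(1) m by auto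
      have "t \<otimes>\<^bsub>R\<^esub> a \<in> carrier R - q" using A.R.prime_compl_mult[OF q, of t a] cR[OF t(1)] a(1) aq by simp
      moreover have "(t \<otimes>\<^bsub>R\<^esub> a) \<odot>\<^bsub>M\<^esub> m = \<zero>\<^bsub>M\<^esub>" using t a(1) m by (simp add: L.smult_assoc1)
      ultimately show "\<exists>u\<in>carrier R - q. u \<odot>\<^bsub>M\<^esub> m = \<zero>\<^bsub>M\<^esub>" by blast
    qed
  qed
qed

text \<open>The extension of \<open>q\<close> to \<open>R\<^sub>p\<close> is one of the primes over which the supremum in \<open>Rfd\<close> is taken.\<close>

lemma (in cring) near_regular_depth_bound:
  assumes M: "module R M" and p: "primeideal p R" and q: "primeideal q R" and qp: "q \<subseteq> p"
    and r: "Rfd (ring_at R p) (module_at R p M) < ereal (real_of_int (r + 1))"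
    and zs: "near_regular R (self_module R) q zs b" and b: "b \<noteq> carrier R"
  shows "\<exists>ws U. near_regular R M q ws U \<and> int (length zs) \<le> int (length ws) + r"
proof -
  let ?S = "ring_at R p" and ?N = "module_at R p M"
  let ?l = "\<lambda>a. loc_frac (self_module R) (carrier R - p) a \<one>"
  interpret A: ring_localization R ?S p ?l by (rule ring_localization_loc_ring[OF p])
  define e where "e = A.extension q"
  have e: "primeideal e ?S" unfolding e_def by (rule A.primeideal_extension(1)[OF q qp])
  let ?S' = "ring_at ?S e" and ?N' = "module_at ?S e ?N"
  note L = localization_loc_module[OF M p]
  have N: "module ?S ?N" using L by (simp add: localization_def)
  note L' = A.N.R.localization_loc_module[OF N e]
  note A' = A.N.R.ring_localization_loc_ring[OF e]
  have LL: "localization R M ?S' ?N' q ((\<lambda>a. loc_frac (self_module ?S) (carrier ?S - e) a \<one>\<^bsub>?S\<^esub>) \<circ> ?l)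
     ((\<lambda>m. loc_frac ?N (carrier ?S - e) m \<one>\<^bsub>?S\<^esub>) \<circ> (\<lambda>m. loc_frac M (carrier R - p) m \<one>))"
    by (rule localization_comp[OF A.ring_localization_axioms L q qp e_def A' L'])
  have AA: "ring_localization R ?S' q ((\<lambda>a. loc_frac (self_module ?S) (carrier ?S - e) a \<one>\<^bsub>?S\<^esub>) \<circ> ?l)"
    using localization_comp[OF A.ring_localization_axioms A.localization_axioms q qp e_def A'
        ring_localization.axioms(1)[OF A']] by (rule ring_localization.intro)
  have "enat (length zs) \<le> depth ?S' (self_module ?S')"
    by (rule ring_localization.length_le_depth[OF AA zs b])
  then have le: "ereal (real (length zs)) \<le> ereal_of_enat (depth ?S' (self_module ?S'))"
    by (metis ereal_of_enat_le_iff ereal_of_enat_simps(1))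
  have diff: "ereal_of_enat (depth ?S' (self_module ?S')) - ereal_of_enat (depth ?S' ?N') < ereal (real_of_int (r + 1))"
    using r e unfolding Rfd_def by (auto simp: SUP_lessD dest!: SUP_lessD)
  show ?thesis
  proof (cases "depth ?S' ?N'")
    case (enat d)
    obtain ws U where ws: "near_regular R M q ws U" "d \<le> length ws"
      using near_regular_of_depth[OF AA LL, of d] enat by auto
    have "ereal (real (length zs)) - ereal (real d) < ereal (real_of_int (r + 1))"
      by (rule le_less_trans[OF ereal_minus_mono[OF le order_refl]])
        (use diff in \<open>simp only: enat ereal_of_enat_simps\<close>)
    then have "real (length zs) - real d < real_of_int (r + 1)" by simp
    then have "int (length zs) \<le> int d + r" by linarith
    then show ?thesis using ws by (intro exI[of _ ws] exI[of _ U]) auto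
  next
    case infinity
    then show ?thesis
      using near_regular_of_depth[OF AA LL, of "nat (int (length zs) - r)"] by fastforce
  qed
qed

section \<open>Annihilation of local cohomology\<close>

text \<open>For a regular sequence longer than \<open>k\<close>, the class of \<open>\<one>\<close> in \<open>H\<^sup>0(Hom(P, R / I)) = R / I\<close> would vanish.\<close>

lemma (in noetherian_cring) grade_finite:
  assumes I: "ideal I R" and nc: "I \<noteq> carrier R"
  shows "\<exists>k. grade I R \<le> enat k"
proof -
  have IR: "I \<subseteq> carrier R" using I by (blast intro: ideal.Icarr)
  obtain P where res: "resolves R P I" using free_resolution_exists[OF I] by blast
  note P = resolvesD(1)[OF res]
  obtain k where k: "\<forall>P g i. acyclic_below R P g \<longrightarrow> i + int k < g \<longrightarrow> kills (self_module R) P i \<one> I (carrier R)"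
    using kills_bounded_slack[OF I] by blast
  have "length xs \<le> k" if xs: "regular_sequence R (self_module R) xs" "set xs \<subseteq> I" for xs
  proof (rule ccontr)
    assume "\<not> length xs \<le> k"
    then have lt: "0 + int k < int (length xs)" by simp
    have ab: "acyclic_below R P (int (length xs))"
    proof (rule acyclic_below_resolution[OF res IR xs(1)])
      show "\<exists>n::nat. x [^] n \<in> I" if x: "x \<in> set xs" for x
      proof -
        have "x \<in> I" "x \<in> carrier R" using x xs(2) IR by auto
        then show ?thesis by (intro exI[of _ 1]) simp
      qed
    qed
    have "kills (self_module R) P 0 \<one> I (carrier R)" by (rule k[rule_format, OF ab lt])
    moreover have "(\<lambda>_. \<one>) \<in> bas P 0 \<rightarrow> carrier R" by simp
    moreover have "\<forall>k\<in>bas P (0 + 1). cob (self_module R) P 0 (\<lambda>_. \<one>) k \<in> I"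
      using resolution_cob[OF self_module res, of "\<lambda>_. \<one>"] resolvesD(3)[OF res] self.mat_closed[OF P] by simp
    ultimately obtain w where "\<forall>k\<in>bas P 0. \<one> \<odot>\<^bsub>self_module R\<^esub> \<one> \<ominus>\<^bsub>self_module R\<^esub> cob (self_module R) P (0 - 1) w k \<in> I"
      using kills_bounds[of "self_module R" P 0 \<one> I "carrier R" "\<lambda>_. \<one>"] by blast
    then have "\<one> \<ominus> cob (self_module R) P (- 1) w 0 \<in> I" using resolvesD(2)[OF res] by simp
    moreover have "cob (self_module R) P (- 1) w 0 = \<zero>" using free_complexD(2)[OF P, of "- 1"] by (simp add: cob_def)
    ultimately have "\<one> \<in> I" by (simp add: a_minus_def)
    then show False using ideal.one_imp_carrier[OF I] nc by simp
  qed
  then show ?thesis using nc by (intro exI[of _ k]) (auto simp: grade_def regular_length_def intro!: SUP_least)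
qed

text \<open>One regular sequence in \<open>I\<close> serves all powers of \<open>I\<close>, because powers of its elements lie in them. For
  negative \<open>j\<close> nothing is required, and \<open>g = 0\<close> is possible.\<close>

lemma (in noetherian_cring) acyclic_below_grade:
  assumes I: "ideal I R" and nc: "I \<noteq> carrier R" and j: "ereal (real_of_int j) < ereal_of_enat (grade I R)"
  shows "\<exists>g>j. \<forall>n P. resolves R P (ideal_power R I n) \<longrightarrow> acyclic_below R P g"
proof (cases "j < 0")
  case True
  have "acyclic_below R P 0" if "resolves R P (ideal_power R I n)" for P n
    using self.kills_neg[OF resolvesD(1)[OF that]] resolvesD(1)[OF that] by (simp add: acyclic_below_def)
  then show ?thesis using True by blast
next
  case False
  have "ereal_of_enat (enat (nat j)) < ereal_of_enat (grade I R)" using j False by simp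
  then have "enat (nat j) < regular_length I R (self_module R)"
    using nc by (simp only: ereal_of_enat_less_iff grade_def if_False)
  then obtain xs where xs: "regular_sequence R (self_module R) xs" "set xs \<subseteq> I" "nat j < length xs"
    unfolding regular_length_def by (auto simp: less_SUP_iff)
  have "acyclic_below R P (int (length xs))" if res: "resolves R P (ideal_power R I n)" for P n
  proof (rule acyclic_below_resolution[OF res _ xs(1)])
    show "ideal_power R I n \<subseteq> carrier R" using ideal_ideal_power[OF I] by (blast intro: ideal.Icarr)
    show "\<exists>n'::nat. x [^] n' \<in> ideal_power R I n" if "x \<in> set xs" for x
      using pow_mem_ideal_power[OF I, of x] xs(2) that by blast
  qed
  then show ?thesis using xs(3) False by (intro exI[of _ "int (length xs)"]) auto
qed

text \<open>The large restricted flat dimension is treated according to its three possible forms. A real value \<open>x\<close>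
  gives the integer bound \<open>r = \<lfloor>x\<rfloor>\<close>. The value \<open>\<infinity>\<close> makes the condition on \<open>i\<close> unsatisfiable for proper
  ideals, whose grade is finite. The value \<open>-\<infinity>\<close> means \<open>M\<^sub>p = 0\<close>; the uniform annihilator for \<open>r = -1\<close>,
  applied to the complex \<open>R\<close> in degree \<open>0\<close>, then kills \<open>H\<^sup>0(Hom(R, M)) = M\<close>.\<close>

lemma (in noetherian_cring) uniform_annihilator_ideal_powers:
  assumes M: "module R M" and gen: "generates R M ms" and p: "primeideal p R"
  shows "\<exists>s\<in>carrier R - p. \<forall>I i. ideal I R \<longrightarrow>
     ereal (real_of_int i) < ereal_of_enat (grade I R) - Rfd (ring_at R p) (module_at R p M) \<longrightarrow>
     (\<forall>n P. resolves R P (ideal_power R I n) \<longrightarrow> kills M P i s {\<zero>\<^bsub>M\<^esub>} (carrier M))"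
proof -
  interpret M: module R M by fact
  let ?rfd = "Rfd (ring_at R p) (module_at R p M)"
  have power_carrier: "ideal_power R (carrier R) n = carrier R" for n
    using ideal_prod_one[OF oneideal] by (induct n) simp_all
  have unit: "kills M P i s {\<zero>\<^bsub>M\<^esub>} (carrier M)"
    if res: "resolves R P (ideal_power R (carrier R) n)" and s: "s \<in> carrier R" for n P i s
    using M.kills_resolution[OF res[unfolded power_carrier] s subset_refl M.submodule_zero M.carrier_is_submodule] .
  have uniform: "\<exists>s\<in>carrier R - p. \<forall>P g i. acyclic_below R P g \<longrightarrow> i + r < g \<longrightarrow> kills M P i s {\<zero>\<^bsub>M\<^esub>} (carrier M)"
    if r: "?rfd < ereal (real_of_int (r + 1))" for r
  proof (rule uniform_annihilator[OF M gen p])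
    fix q zs b assume "primeideal q R" "q \<subseteq> p" "near_regular R (self_module R) q zs b" "b \<noteq> carrier R"
    then show "\<exists>ws U. near_regular R M q ws U \<and> int (length zs) \<le> int (length ws) + r"
      using near_regular_depth_bound[OF M p] r by blast
  qed
  show ?thesis
  proof (cases ?rfd)
    case (real x)
    define r where "r = \<lfloor>x\<rfloor>"
    have r: "real_of_int r \<le> x" "x < real_of_int (r + 1)" unfolding r_def by linarith+
    obtain s where s: "s \<in> carrier R - p" "\<forall>P g i. acyclic_below R P g \<longrightarrow> i + r < g \<longrightarrow> kills M P i s {\<zero>\<^bsub>M\<^esub>} (carrier M)"
      using uniform[of r] r(2) real by auto
    have "kills M P i s {\<zero>\<^bsub>M\<^esub>} (carrier M)"
      if I: "ideal I R" and i: "ereal (real_of_int i) < ereal_of_enat (grade I R) - ?rfd"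
        and res: "resolves R P (ideal_power R I n)" for I i n P
    proof (cases "I = carrier R")
      case True
      then show ?thesis using unit res s by blast
    next
      case False
      have "ereal (real_of_int (i + r)) < ereal_of_enat (grade I R)"
        using i r(1) unfolding real by (cases "ereal_of_enat (grade I R)") auto
      then obtain g where "i + r < g" "acyclic_below R P g" using acyclic_below_grade[OF I False] res by blast
      then show ?thesis using s(2) by blast
    qed
    then show ?thesis using s(1) by blast
  next
    case PInf
    have "kills M P i \<one> {\<zero>\<^bsub>M\<^esub>} (carrier M)"
      if I: "ideal I R" and i: "ereal (real_of_int i) < ereal_of_enat (grade I R) - ?rfd"
        and res: "resolves R P (ideal_power R I n)" for I i n P
    proof (cases "I = carrier R")
      case True
      then show ?thesis using unit res by blast
    next
      case False
      obtain k where "grade I R \<le> enat k" using grade_finite[OF I False] by blast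
      then obtain k' where "grade I R = enat k'" by (cases "grade I R") auto
      then show ?thesis using i PInf by simp
    qed
    then show ?thesis using prime_compl_one[OF p] by blast
  next
    case MInf
    obtain s where s: "s \<in> carrier R - p" "\<forall>P g i. acyclic_below R P g \<longrightarrow> i + - 1 < g \<longrightarrow> kills M P i s {\<zero>\<^bsub>M\<^esub>} (carrier M)"
      using uniform[of "- 1"] MInf by auto
    \<comment> \<open>The ring itself, concentrated in degree \<open>0\<close>; there are no cochains below degree \<open>0\<close>.\<close>
    define P0 :: "(int \<Rightarrow> nat set) \<times> (int \<Rightarrow> nat \<Rightarrow> nat \<Rightarrow> 'a)"
      where "P0 = (\<lambda>j. if j = 0 then {0} else {}, \<lambda>_ _ _. \<zero>)"
    have P0: "bas P0 j = (if j = 0 then {0} else {})" for j by (simp add: P0_def bas_def)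
    have free: "free_complex R P0" unfolding free_complex_def P0 by (auto simp: P0_def mat_def)
    then have ab: "acyclic_below R P0 0" using self.kills_neg[OF free] by (simp add: acyclic_below_def)
    have k: "kills M P0 0 s {\<zero>\<^bsub>M\<^esub>} (carrier M)" by (rule s(2)[rule_format, OF ab]) simp
    have ann: "s \<odot>\<^bsub>M\<^esub> m = \<zero>\<^bsub>M\<^esub>" if m: "m \<in> carrier M" for m
    proof -
      obtain w where "\<forall>k\<in>bas P0 0. s \<odot>\<^bsub>M\<^esub> m \<ominus>\<^bsub>M\<^esub> cob M P0 (0 - 1) w k \<in> {\<zero>\<^bsub>M\<^esub>}"
        using kills_bounds[OF k, of "\<lambda>_. m"] m by (auto simp: P0)
      then have "s \<odot>\<^bsub>M\<^esub> m \<ominus>\<^bsub>M\<^esub> \<zero>\<^bsub>M\<^esub> = \<zero>\<^bsub>M\<^esub>" by (simp add: P0 cob_def)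
      then show ?thesis using M.minus_eq_zeroD[OF _ M.M.zero_closed] m s(1) by simp
    qed
    have "kills M P i s {\<zero>\<^bsub>M\<^esub>} (carrier M)" if "resolves R P J" for P J i
      using s(1) ann by (intro M.kills_annihilator[OF resolvesD(1)[OF that] M.submodule_zero]) auto
    then show ?thesis using s(1) by blast
  qed
qed

theorem corollary1p4:
  fixes R :: "('r, 'x) ring_scheme"
    and M :: "('r, 'm, 'y) module_scheme"
    and p :: "'r set"
  assumes "cring R" and "noetherian_ring R"
    and "fin_gen_module R M"
    and "primeideal p R"
  shows "\<exists>s \<in> carrier R - p. \<forall>I (i :: int) (H :: ('r, 'e set) module).
    ideal I R \<longrightarrow>
    ereal (real_of_int i) < ereal_of_enat (grade I R) - Rfd (ring_at R p) (module_at R p M) \<longrightarrow>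
    is_local_cohomology R I i M H \<longrightarrow>
    (\<forall>x \<in> carrier H. s \<odot>\<^bsub>H\<^esub> x = \<zero>\<^bsub>H\<^esub>)"
proof -
  interpret noetherian_cring R using assms by (simp add: noetherian_cring_def)
  have M: "module R M" using assms(3) by (simp add: fin_gen_module_def)
  obtain ms where gen: "generates R M ms" using fin_gen_module_generates[OF assms(3)] by blast
  obtain s where s: "s \<in> carrier R - p" and kill: "\<forall>I i. ideal I R \<longrightarrow>
     ereal (real_of_int i) < ereal_of_enat (grade I R) - Rfd (ring_at R p) (module_at R p M) \<longrightarrow>
     (\<forall>n P. resolves R P (ideal_power R I n) \<longrightarrow> kills M P i s {\<zero>\<^bsub>M\<^esub>} (carrier M))"
    using uniform_annihilator_ideal_powers[OF M gen assms(4)] by blast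
  show ?thesis
  proof (rule bexI[OF _ s], intro allI impI ballI)
    fix I i x and H :: "('r, 'e set) module"
    assume I: "ideal I R"
      and i: "ereal (real_of_int i) < ereal_of_enat (grade I R) - Rfd (ring_at R p) (module_at R p M)"
      and H: "is_local_cohomology R I i M H" and x: "x \<in> carrier H"
    have "\<exists>P. resolves R P (ideal_power R I n) \<and> kills M P i s {\<zero>\<^bsub>M\<^esub>} (carrier M)" for n
      using free_resolution_exists[OF ideal_ideal_power[OF I]] kill I i by blast
    then show "s \<odot>\<^bsub>H\<^esub> x = \<zero>\<^bsub>H\<^esub>" using s by (intro local_cohomology_annihilated[OF M I _ _ H x]) auto
  qed
qed

end
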